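(* Let $\lambda=(\lambda_1\ge\dots\ge\lambda_n\ge 0)$ be a partition and let $\mu\in S_n(\lambda)$ be a composition (a rearrangement of $\lambda$). Then the interpolation ASEP polynomial $f^*_\mu(x_1,\dots,x_n;q,t)$ equals the weight-generating function $F^*_\mu=\sum_{Q^{\pm}\in\mathrm{SMLQ}(\mu)}\mathrm{wt}(Q^{\pm})$ of signed multiline queues of type $\mu$. Moreover, the interpolation Macdonald polynomial $P^*_\lambda(x_1,\dots,x_n;q,t)$ equals $Z^*_\lambda=\sum_{\mu\in S_n(\lambda)}F^*_\mu$.
   Context: All polynomials are in $x_1,\dots,x_n$ with coefficients in $\mathbb{Q}(q,t)$. For $\mu\in\mathbb{N}^n$ let $k_i(\mu)=\#\{j<i:\mu_j>\mu_i\}+\#\{j>i:\mu_j\ge\mu_i\}$ and $\widetilde\mu=(q^{\mu_1}t^{-k_1(\mu)},\dots,q^{\mu_n}t^{-k_n(\mu)})$. For $\mu\in\mathbb{N}^n$ with $|\mu|=d$, the nonsymmetric interpolation Macdonald polynomial $E^*_\mu$ is the unique polynomial of degree at most $d$ whose coefficient of $x^\mu=x_1^{\mu_1}\cdots x_n^{\mu_n}$ is $1$ and with $E^*_\mu(\widetilde\nu)=0$ for all $\nu\in\mathbb{N}^n$ with $|\nu|\le d$, $\nu\ne\mu$. $S_n$ acts on compositions by $\sigma\cdot\mu=(\mu_{\sigma^{-1}(1)},\dots,\mu_{\sigma^{-1}(n)})$ and on polynomials by permuting variables; $s_i=(i,i+1)$. The Hecke operator is $T_i=t-\frac{tx_i-x_{i+1}}{x_i-x_{i+1}}(1-s_i)$,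 and $T_\sigma=T_{i_1}\cdots T_{i_\ell}$ for any reduced word $\sigma=s_{i_1}\cdots s_{i_\ell}$. For a partition $\lambda$ and $\mu\in S_n(\lambda)$, $\sigma_\mu$ is the shortest permutation with $\sigma_\mu(\lambda)=\mu$, and $f^*_\mu:=T_{\sigma_\mu}E^*_\lambda$. The interpolation Macdonald polynomial $P^*_\lambda$ is the unique symmetric polynomial of degree at most $|\lambda|$ whose coefficient of the monomial symmetric polynomial $m_\lambda$ is $1$ and which vanishes at $\widetilde\nu$ for every partition $\nu\ne\lambda$ with $|\nu|\le|\lambda|$. Signed multiline queues. Let $L$ be the largest part of $\lambda$ and $m_i=\#\{j:\lambda_j=i\}$. Let $\lambda^{(r)}$ be the multiset consisting of $m_L$ copies of $L$, ..., $m_r$ copies of $r$, and $m_{r-1}+\dots+m_0$ zeros. An enhanced ball system of type $\lambda$ is a $2L\times n$ array with rows labeled bottom to top $1,1',2,2',\dots,L,L'$ and columns $1,\dots,n$ left to right; each position is empty (value $0$) or holds a ball. In row $r$ the balls ("regular balls") carry labels in $\{1,\dots,L\}$ and the row, read as a word, is a permutation of $\lambda^{(r)}$; in row $r'$ the balls ("signed balls") carry labels in $\{\pm1,\dots,\pm L\}$ and the word of absolute values is a permutation of $\lambda^{(r)}$ (positive/negative balls according to sign). A signed multiline queue of type $\mu$ is an enhanced ball system of type $\lambda$ whose row $1$ is $\mu$, together with a pairing of every ball in each row above row $1$ with a ball in the row directly below having the same absolute value of label (distinct balls paired to distinct balls), such that: (Classic layers, between row $r\ge2$ and row $(r-1)'$,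 using absolute values of labels:) each pairing connects two balls by a shortest strand going straight down or from left to right, wrapping around cyclically (columns mod $n$) if needed; a ball with label $a$ in row $r$ has either an empty spot directly below it or a ball with absolute label $a'\ge a$, and if $a'=a$ these two balls are paired to each other (trivially paired). (Signed layers, between row $r'$ and row $r$:) each pairing connects two balls by a shortest strand going straight down or from left to right, without wrapping around; a positive ball with label $a$ in row $r'$ always has a ball with label $a'\ge a$ directly below it, and if $a'=a$ they are trivially paired; a negative ball with label $-a$ in row $r'$ has either an empty spot below it or a ball with label $a'\le a$. $\mathrm{SMLQ}(\mu)$ denotes the set of these. For $\mu=(0,\dots,0)$ the only one is the empty queue, of weight $1$. Weights. Ball weight: each positive ball in row $r'$, column $i$, has weight $x_i$; each negative ball in row $r'$ has weight $-q^{r-1}/t^{n-1}$; regular balls have weight $1$; $\mathrm{wt}_{\mathrm{ball}}$ is the product. Pairing weights (only nontrivial pairings get weights; trivial pairings have weight $1$). Classic layer between row $r$ and row $(r-1)'$: read the balls of row $r$ in decreasing order of label, ties broken right to left, and place the strands in this order. Balls of row $(r-1)'$ not yet matched just before placing pairing $p$ are free for $p$, except that when pairing balls of label $a$, balls of label $a$ in row $(r-1)'$ that are trivially paired are not free. If $p$ joins a ball of label $a$ in column $j$ to a ball in column $j'$, $\mathrm{skipped}(p)$ is the number of free balls in columns $j+1,\dots,j'-1$ (mod $n$), and $\mathrm{wt}(p)=\frac{(1-t)t^{\mathrm{skipped}(p)}}{1-q^{a-r+1}t^{\mathrm{free}(p)}}\cdot q^{a-r+1}$ if $j'<j$, and $\frac{(1-t)t^{\mathrm{skipped}(p)}}{1-q^{a-r+1}t^{\mathrm{free}(p)}}$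 if $j'>j$, where $\mathrm{free}(p)$ is the number of free balls for $p$. Signed layer between row $r'$ and row $r$: read the balls of row $r'$ in decreasing order of absolute value, ties right to left, placing strands in this order; free balls are the unmatched balls of row $r$. If $p$ joins a ball labeled $\pm a$ in column $j$ to a ball in column $k>j$, $\mathrm{skipped}(p)$ is the number of free balls and $\mathrm{emp}(p)$ the number of empty positions of row $r$ in columns $j+1,\dots,k-1$, and $\mathrm{wt}(p)=(1-t)t^{\mathrm{skipped}(p)+\mathrm{emp}(p)}$ if the top ball is positive, $-(1-t)t^{\mathrm{skipped}(p)+\mathrm{emp}(p)}$ if it is negative. Then $\mathrm{wt}(Q^{\pm})=\mathrm{wt}_{\mathrm{ball}}(Q^{\pm})\prod_p\mathrm{wt}(p)$. *)

theory Defs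
  imports Main "HOL-Library.Poly_Mapping" "HOL-Computational_Algebra.Polynomial"
    "HOL-Computational_Algebra.Fraction_Field" "HOL-Combinatorics.Permutations"
begin

text \<open>Q(q,t) is the fraction field of Q[t][q]; q is the outer, t the inner indeterminate.\<close>
type_synonym qt = "rat poly poly fract"

definition qq :: qt where "qq = Fraction_Field.Fract (monom (1::rat poly) 1) 1"
definition tt :: qt where "tt = Fraction_Field.Fract [:[:0, 1:]:] 1"

text \<open>Multivariate polynomials: finitely supported maps from exponent vectors to coefficients.
  Variable x_(i+1) of the paper is index i here (0-based).\<close>
type_synonym mpoly = "(nat \<Rightarrow>\<^sub>0 nat) \<Rightarrow>\<^sub>0 qt"

definition Xv :: "nat \<Rightarrow> mpoly" where
  "Xv i = Poly_Mapping.single (Poly_Mapping.single i 1) 1"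

definition Cst :: "qt \<Rightarrow> mpoly" where
  "Cst c = Poly_Mapping.single 0 c"

definition mono :: "nat list \<Rightarrow> (nat \<Rightarrow>\<^sub>0 nat)" where
  "mono mu = Poly_Mapping.nth mu"

definition mdeg :: "(nat \<Rightarrow>\<^sub>0 nat) \<Rightarrow> nat" where
  "mdeg m = (\<Sum>i\<in>Poly_Mapping.keys m. Poly_Mapping.lookup m i)"

definition deg_le :: "mpoly \<Rightarrow> nat \<Rightarrow> bool" where
  "deg_le p d = (\<forall>m\<in>Poly_Mapping.keys p. mdeg m \<le> d)"

definition vars_in :: "nat \<Rightarrow> mpoly \<Rightarrow> bool" where
  "vars_in n p = (\<forall>m\<in>Poly_Mapping.keys p. Poly_Mapping.keys m \<subseteq> {..<n})"

definition peval :: "mpoly \<Rightarrow> (nat \<Rightarrow> qt) \<Rightarrow> qt" where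
  "peval p v = (\<Sum>m\<in>Poly_Mapping.keys p.
      Poly_Mapping.lookup p m * (\<Prod>i\<in>Poly_Mapping.keys m. v i ^ Poly_Mapping.lookup m i))"

definition rename :: "(nat \<Rightarrow> nat) \<Rightarrow> mpoly \<Rightarrow> mpoly" where
  "rename \<sigma> p = (\<Sum>m\<in>Poly_Mapping.keys p.
      Poly_Mapping.single (\<Sum>i\<in>Poly_Mapping.keys m. Poly_Mapping.single (\<sigma> i) (Poly_Mapping.lookup m i))
        (Poly_Mapping.lookup p m))"

definition symmetric_poly :: "nat \<Rightarrow> mpoly \<Rightarrow> bool" where
  "symmetric_poly n p = (\<forall>\<sigma>. \<sigma> permutes {..<n} \<longrightarrow> rename \<sigma> p = p)"

definition kstat :: "nat list \<Rightarrow> nat \<Rightarrow> nat" where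
  "kstat mu i = card {j. j < i \<and> mu ! j > mu ! i}
              + card {j. i < j \<and> j < length mu \<and> mu ! j \<ge> mu ! i}"

definition tilde :: "nat list \<Rightarrow> nat \<Rightarrow> qt" where
  "tilde mu i = (if i < length mu then qq ^ (mu ! i) * inverse (tt ^ kstat mu i) else 0)"

definition is_partition :: "nat \<Rightarrow> nat list \<Rightarrow> bool" where
  "is_partition n lam = (length lam = n \<and> sorted_wrt (\<ge>) lam)"

definition Estar :: "nat list \<Rightarrow> mpoly" where
  "Estar mu = (THE p. vars_in (length mu) p \<and> deg_le p (sum_list mu)
      \<and> Poly_Mapping.lookup p (mono mu) = 1
      \<and> (\<forall>nu. length nu = length mu \<and> sum_list nu \<le> sum_list mu \<and> nu \<noteq> mu
               \<longrightarrow> peval p (tilde nu) = 0))"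

definition Pstar :: "nat list \<Rightarrow> mpoly" where
  "Pstar lam = (THE p. vars_in (length lam) p \<and> symmetric_poly (length lam) p
      \<and> deg_le p (sum_list lam)
      \<and> Poly_Mapping.lookup p (mono lam) = 1
      \<and> (\<forall>nu. is_partition (length lam) nu \<and> sum_list nu \<le> sum_list lam \<and> nu \<noteq> lam
               \<longrightarrow> peval p (tilde nu) = 0))"

definition transp :: "nat \<Rightarrow> nat \<Rightarrow> nat" where
  "transp i = Transposition.transpose i (Suc i)"

definition Hecke :: "nat \<Rightarrow> mpoly \<Rightarrow> mpoly" where
  "Hecke i f = (THE g. (Xv i - Xv (Suc i)) * g =
       Cst tt * (Xv i - Xv (Suc i)) * f - (Cst tt * Xv i - Xv (Suc i)) * (f - rename (transp i) f))"

definition word_perm :: "nat list \<Rightarrow> nat \<Rightarrow> nat" where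
  "word_perm w = foldr (\<lambda>i \<sigma>. transp i \<circ> \<sigma>) w id"

definition cox_len :: "nat \<Rightarrow> (nat \<Rightarrow> nat) \<Rightarrow> nat" where
  "cox_len n \<sigma> = (LEAST l. \<exists>w. length w = l \<and> set w \<subseteq> {..<n - 1} \<and> word_perm w = \<sigma>)"

definition reduced_word :: "nat \<Rightarrow> (nat \<Rightarrow> nat) \<Rightarrow> nat list \<Rightarrow> bool" where
  "reduced_word n \<sigma> w = (set w \<subseteq> {..<n - 1} \<and> word_perm w = \<sigma> \<and> length w = cox_len n \<sigma>)"

definition act :: "(nat \<Rightarrow> nat) \<Rightarrow> nat list \<Rightarrow> nat list" where
  "act \<sigma> mu = map (\<lambda>j. mu ! inv \<sigma> j) [0..<length mu]"

definition sigma_of :: "nat list \<Rightarrow> nat list \<Rightarrow> nat \<Rightarrow> nat" where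
  "sigma_of lam mu = (THE \<sigma>. \<sigma> permutes {..<length lam} \<and> act \<sigma> lam = mu
      \<and> (\<forall>\<tau>. \<tau> permutes {..<length lam} \<and> act \<tau> lam = mu
              \<longrightarrow> cox_len (length lam) \<sigma> \<le> cox_len (length lam) \<tau>))"

definition Hecke_word :: "nat list \<Rightarrow> mpoly \<Rightarrow> mpoly" where
  "Hecke_word w f = foldr (\<lambda>i g. Hecke i \<circ> g) w id f"

definition Hecke_perm :: "nat \<Rightarrow> (nat \<Rightarrow> nat) \<Rightarrow> mpoly \<Rightarrow> mpoly" where
  "Hecke_perm n \<sigma> f = Hecke_word (SOME w. reduced_word n \<sigma> w) f"

definition fstar :: "nat list \<Rightarrow> nat list \<Rightarrow> mpoly" where
  "fstar lam mu = Hecke_perm (length lam) (sigma_of lam mu) (Estar lam)"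

text \<open>reg Q r j: regular row r (1..L), column j (0..n-1), 0 = empty, else label.
  sgn Q r j: signed row r', 0 = empty, else signed label.
  pc Q r j: for 2 <= r <= L, column in row (r-1)' paired with the ball of row r in column j.
  ps Q r j: for 1 <= r <= L, column in row r paired with the ball of row r' in column j.
  All fields are 0 outside their meaningful domain (canonical representation).\<close>
record smlq =
  reg :: "nat \<Rightarrow> nat \<Rightarrow> nat"
  sgn :: "nat \<Rightarrow> nat \<Rightarrow> int"
  pc  :: "nat \<Rightarrow> nat \<Rightarrow> nat"
  ps  :: "nat \<Rightarrow> nat \<Rightarrow> nat"

definition Lmax :: "nat list \<Rightarrow> nat" where
  "Lmax lam = Max (insert 0 (set lam))"

definition lam_r :: "nat list \<Rightarrow> nat \<Rightarrow> nat list" where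
  "lam_r lam r = map (\<lambda>x. if r \<le> x then x else 0) lam"

definition absl :: "int \<Rightarrow> nat" where "absl z = nat \<bar>z\<bar>"

definition is_smlq :: "nat list \<Rightarrow> nat list \<Rightarrow> smlq \<Rightarrow> bool" where
  "is_smlq lam mu Q = (let n = length lam; L = Lmax lam in
     (\<forall>r j. (r < 1 \<or> L < r \<or> n \<le> j) \<longrightarrow> reg Q r j = 0 \<and> sgn Q r j = 0)
   \<and> (\<forall>r j. \<not> (2 \<le> r \<and> r \<le> L \<and> j < n \<and> reg Q r j \<noteq> 0) \<longrightarrow> pc Q r j = 0)
   \<and> (\<forall>r j. \<not> (1 \<le> r \<and> r \<le> L \<and> j < n \<and> sgn Q r j \<noteq> 0) \<longrightarrow> ps Q r j = 0)
   \<and> (\<forall>r\<in>{1..L}. mset (map (reg Q r) [0..<n]) = mset (lam_r lam r))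
   \<and> (\<forall>r\<in>{1..L}. mset (map (\<lambda>j. absl (sgn Q r j)) [0..<n]) = mset (lam_r lam r))
   \<and> (\<forall>j<n. reg Q 1 j = mu ! j)
   \<comment> \<open>classic layers: row r (top) and row (r-1)' (bottom)\<close>
   \<and> (\<forall>r\<in>{2..L}.
        (\<forall>j<n. reg Q r j \<noteq> 0 \<longrightarrow>
            pc Q r j < n \<and> absl (sgn Q (r - 1) (pc Q r j)) = reg Q r j)
      \<and> inj_on (pc Q r) {j. j < n \<and> reg Q r j \<noteq> 0}
      \<and> (\<forall>j<n. reg Q r j \<noteq> 0 \<longrightarrow>
            (sgn Q (r - 1) j = 0 \<or> reg Q r j \<le> absl (sgn Q (r - 1) j))
          \<and> (absl (sgn Q (r - 1) j) = reg Q r j \<longrightarrow> pc Q r j = j)))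
   \<comment> \<open>signed layers: row r' (top) and row r (bottom)\<close>
   \<and> (\<forall>r\<in>{1..L}.
        (\<forall>j<n. sgn Q r j \<noteq> 0 \<longrightarrow>
            j \<le> ps Q r j \<and> ps Q r j < n \<and> reg Q r (ps Q r j) = absl (sgn Q r j))
      \<and> inj_on (ps Q r) {j. j < n \<and> sgn Q r j \<noteq> 0}
      \<and> (\<forall>j<n. 0 < sgn Q r j \<longrightarrow>
            absl (sgn Q r j) \<le> reg Q r j
          \<and> (reg Q r j = absl (sgn Q r j) \<longrightarrow> ps Q r j = j))
      \<and> (\<forall>j<n. sgn Q r j < 0 \<longrightarrow>
            reg Q r j = 0 \<or> reg Q r j \<le> absl (sgn Q r j))))"

text \<open>c is placed before j: larger label first, ties broken right to left\<close>
definition prec :: "(nat \<Rightarrow> nat) \<Rightarrow> nat \<Rightarrow> nat \<Rightarrow> bool" where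
  "prec lab c j = (lab j < lab c \<or> (lab c = lab j \<and> j < c))"

definition cyc_between :: "nat \<Rightarrow> nat \<Rightarrow> nat \<Rightarrow> nat set" where
  "cyc_between n j j' = {c. c < n \<and> (if j < j' then j < c \<and> c < j' else j < c \<or> c < j')}"

definition classic_free :: "nat \<Rightarrow> smlq \<Rightarrow> nat \<Rightarrow> nat \<Rightarrow> nat set" where
  "classic_free n Q r j = (let a = reg Q r j in
     {c. c < n \<and> sgn Q (r - 1) c \<noteq> 0
       \<and> c \<notin> pc Q r ` {c'. c' < n \<and> reg Q r c' \<noteq> 0 \<and> prec (reg Q r) c' j}
       \<and> \<not> (absl (sgn Q (r - 1) c) = a \<and> reg Q r c \<noteq> 0 \<and> pc Q r c = c)})"

definition classic_wt :: "nat \<Rightarrow> smlq \<Rightarrow> nat \<Rightarrow> nat \<Rightarrow> qt" where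
  "classic_wt n Q r j = (let a = reg Q r j; j' = pc Q r j; F = classic_free n Q r j;
       sk = card (F \<inter> cyc_between n j j') in
     if j' = j then 1
     else (1 - tt) * tt ^ sk / (1 - qq ^ (a + 1 - r) * tt ^ card F)
          * (if j' < j then qq ^ (a + 1 - r) else 1))"

definition signed_free :: "nat \<Rightarrow> smlq \<Rightarrow> nat \<Rightarrow> nat \<Rightarrow> nat set" where
  "signed_free n Q r j =
     {c. c < n \<and> reg Q r c \<noteq> 0
       \<and> c \<notin> ps Q r ` {c'. c' < n \<and> sgn Q r c' \<noteq> 0 \<and> prec (\<lambda>x. absl (sgn Q r x)) c' j}}"

definition signed_wt :: "nat \<Rightarrow> smlq \<Rightarrow> nat \<Rightarrow> nat \<Rightarrow> qt" where
  "signed_wt n Q r j = (let k = ps Q r j; B = {c. j < c \<and> c < k};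
       sk = card (signed_free n Q r j \<inter> B); emp = card {c\<in>B. reg Q r c = 0} in
     if k = j then 1
     else (if 0 < sgn Q r j then 1 else -1) * (1 - tt) * tt ^ (sk + emp))"

definition ball_wt :: "nat \<Rightarrow> nat \<Rightarrow> smlq \<Rightarrow> mpoly" where
  "ball_wt n L Q = (\<Prod>r\<in>{1..L}. \<Prod>j<n.
      if 0 < sgn Q r j then Xv j
      else if sgn Q r j < 0 then Cst (- (qq ^ (r - 1)) / tt ^ (n - 1))
      else 1)"

definition smlq_wt :: "nat list \<Rightarrow> smlq \<Rightarrow> mpoly" where
  "smlq_wt lam Q = (let n = length lam; L = Lmax lam in
     ball_wt n L Q
     * (\<Prod>r\<in>{2..L}. \<Prod>j\<in>{j. j < n \<and> reg Q r j \<noteq> 0}. Cst (classic_wt n Q r j))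
     * (\<Prod>r\<in>{1..L}. \<Prod>j\<in>{j. j < n \<and> sgn Q r j \<noteq> 0}. Cst (signed_wt n Q r j)))"

text \<open>F*_mu, with lambda the sorted rearrangement of mu\<close>
definition Fstar :: "nat list \<Rightarrow> nat list \<Rightarrow> mpoly" where
  "Fstar lam mu = (\<Sum>Q\<in>{Q. is_smlq lam mu Q}. smlq_wt lam Q)"

end

theory Submission
  imports Defs
begin

text \<open>
  Let \<open>G\<^sub>\<mu>\<close> be the generating function of the part of a signed multiline queue in the rows from \<open>r\<close> on,
  with row \<open>r\<close> equal to \<open>\<mu>\<close>. Going down one row, the pairing sum of a classic layer is a product of traces of
  words in operators of a \<open>q\<close>-oscillator algebra, and the pairing sum of a signed layer is a product of local
  column weights. By downward induction on \<open>r\<close> both are compatible with two systems of equations. First,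
  \<open>T\<^sub>i G\<^sub>\<mu>\<close> is \<open>G\<close> at \<open>s\<^sub>i \<mu>\<close> if \<open>\<mu>\<^sub>i > \<mu>\<^sub>i\<^sub>+\<^sub>1\<close>, and \<open>t G\<^sub>\<mu>\<close> if the two parts agree. Second, with
  \<open>\<rho> = q\<^sup>r\<^sup>-\<^sup>1\<close>, the operator \<open>(x\<^sub>1 - \<rho> t\<^sup>1\<^sup>-\<^sup>n) R + \<rho> T\<^sub>1\<^sup>-\<^sup>1 \<dots> T\<^sub>n\<^sub>-\<^sub>1\<^sup>-\<^sup>1\<close>, where \<open>R\<close> rotates the variables, sends
  \<open>G\<^sub>\<mu>\<close> to \<open>x\<^sub>1\<close> times a power of \<open>q\<close> times \<open>G\<close> at the rotation of \<open>\<mu>\<close>.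

  For \<open>r = 1\<close>, evaluate these equations at the points \<open>tilde \<nu>\<close> with \<open>|\<nu>| = d\<close>, where \<open>d\<close> is such that all the
  polynomials vanish at smaller \<open>\<nu>\<close>. The rotation term drops out, and what remains says that multiplication by
  \<open>x\<^sub>i\<close> acts on the values of \<open>F\<^sub>\<lambda>\<close> as the scalar \<open>tilde \<lambda> i\<close>. So \<open>F\<^sub>\<lambda>\<close> vanishes at \<open>tilde \<nu>\<close> for
  \<open>\<nu> \<noteq> \<lambda>\<close>, \<open>|\<nu>| \<le> |\<lambda>|\<close>; since the coefficient of \<open>x\<^sup>\<lambda>\<close> is 1, it is the interpolation polynomial. The Hecke
  relations then give all \<open>f\<^sub>\<mu>\<close>, and the symmetry of the sum.
\<close>

text \<open>The two layers of a row treat an empty spot in opposite ways. A classic layer produces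
  equations in which 0 behaves as the largest label; a signed layer turns them into equations in
  which 0 is the smallest, and at the same time replaces \<open>q^r\<close> by
  \<open>q^(r-1)\<close> in the rotation equation. The weight \<open>q^(r-1) / t^(n-1)\<close> of a
  negative ball is the value at which the error terms of this conversion cancel. In a signed layer
  only a nonzero label followed by an empty spot is compared locally; the other Hecke relations are
  derived from such moves and the braid relation.

  The denominators \<open>1 - q^k t^l\<close> are sums of geometric series: a strand behaves as if
  it could circle any number of times, each turn costing a power of \<open>q\<close> and one
  \<open>t\<close> per free ball.

  Inverse operators, division by \<open>q\<close> and cancellation of factors call for functions of
  generic points, whereas the interpolation points are special. Identities needed there are
  therefore proved generically, cleared of denominators, read as identities of polynomials and only
  then evaluated at \<open>tilde nu\<close>.\<close>

section \<open>Independence of the monomials in q and t; generic points\<close>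

lemma qq_power: "qq ^ k = Fraction_Field.Fract (monom (1::rat poly) k) 1"
  by (induction k) (simp_all add: One_fract_def qq_def mult_monom)

lemma tt_power: "tt ^ l = Fraction_Field.Fract [:monom (1::rat) l:] 1"
  by (induction l) (simp_all add: One_fract_def tt_def mult_monom monom_altdef one_pCons)

lemma qt_monomial:
  "of_nat c * qq ^ k * tt ^ l = Fraction_Field.Fract (monom (monom (of_nat c :: rat) l) k) 1"
proof -
  have "of_nat c * qq ^ k * tt ^ l
      = Fraction_Field.Fract (of_nat c * monom 1 k * [:monom (1::rat) l:]) 1"
    by (simp add: qq_power tt_power of_nat_fract)
  also have "of_nat c * monom 1 k * [:monom (1::rat) l:] = monom (monom (of_nat c :: rat) l) k"
    by (rule poly_eqI) (simp add: of_nat_poly smult_monom)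
  finally show ?thesis .
qed

text \<open>Monomials with integer coefficients already live in the polynomial ring, where exponents
  and coefficients can be read off. The nonvanishing facts about \<open>q\<close>, \<open>t\<close>
  and generic points reduce to this comparison.\<close>

lemma qt_monomial_eqD:
  assumes "of_nat c * qq ^ k * tt ^ l = of_nat c' * qq ^ k' * tt ^ l'" "c \<noteq> 0"
  shows "c = c'" "k = k'" "l = l'"
proof -
  have eq: "monom (monom (of_nat c :: rat) l) k = monom (monom (of_nat c') l') k'"
    using assms(1) unfolding qt_monomial by (simp add: eq_fract)
  have "monom (of_nat c :: rat) l = coeff (monom (monom (of_nat c') l') k') k"
    by (subst eq[symmetric]) simp
  then have *: "(if k' = k then monom (of_nat c' :: rat) l' else 0) = monom (of_nat c) l" by simp
  then have k: "k = k'" using assms(2) by (auto split: if_splits)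
  then have e2: "monom (of_nat c' :: rat) l' = monom (of_nat c) l" using * by simp
  have "(of_nat c :: rat) = coeff (monom (of_nat c' :: rat) l') l" by (subst e2) simp
  then have **: "(if l' = l then (of_nat c' :: rat) else 0) = of_nat c" by simp
  then show "k = k'" "c = c'" "l = l'" using k assms(2) by (auto split: if_splits)
qed

lemma qq_tt_power_eqD:
  assumes "qq ^ k * tt ^ l = qq ^ k' * tt ^ l'"
  shows "k = k'" "l = l'"
  using qt_monomial_eqD[of 1 k l 1 k' l'] assms by auto

lemma qq_nz [simp]: "qq \<noteq> 0" and tt_nz [simp]: "tt \<noteq> 0"
proof -
  have "\<not> qq = 0" using qq_tt_power_eqD(1)[of 1 0 2 0] by auto
  moreover have "\<not> tt = 0" using qq_tt_power_eqD(2)[of 0 1 0 2] by auto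
  ultimately show "qq \<noteq> 0" "tt \<noteq> 0" by auto
qed

lemma one_minus_qt_nz [simp]: "0 < a \<Longrightarrow> 1 - qq ^ a * tt ^ k \<noteq> 0"
  using qq_tt_power_eqD(1)[of a k 0 0] by auto

lemma tt_power_ne_1 [simp]: "0 < k \<Longrightarrow> tt ^ k \<noteq> 1"
  using qq_tt_power_eqD(2)[of 0 k 0 0] by auto

lemma tt_ne_1 [simp]: "tt \<noteq> 1" using tt_power_ne_1[of 1] by simp

text \<open>Generic points: Hecke operators, the \<open>q\<close>-rotation and cancellation of the factors
  \<open>x - q\<^sup>k t\<^sup>-\<^sup>l\<close> are all defined on arbitrary functions of such points.\<close>

typedef gpt = "{v :: nat \<Rightarrow> qt. (\<forall>i j k l. i \<noteq> j \<longrightarrow> qq ^ k * v i \<noteq> qq ^ l * v j)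
    \<and> (\<forall>i k l. v i * tt ^ k \<noteq> qq ^ l) \<and> (\<forall>i. v i \<noteq> 0)}"
  morphisms co Gpt
proof -
  \<comment> \<open>Integers are monomials of degree zero in \<open>q\<close> and \<open>t\<close>,
    so distinct ones stay distinct after multiplication by powers of \<open>q\<close>; starting at 2
    rather than 1 keeps them away from every \<open>q^l / t^k\<close>.\<close>
  define e :: "nat \<Rightarrow> qt" where "e i = of_nat (2 ^ (i + 1))" for i
  have 1: "qq ^ k * e i \<noteq> qq ^ l * e j" if "i \<noteq> j" for i j k l
  proof
    assume "qq ^ k * e i = qq ^ l * e j"
    then have "of_nat (2 ^ (i + 1)) * qq ^ k * tt ^ 0 = of_nat (2 ^ (j + 1)) * qq ^ l * tt ^ 0"
      by (simp only: e_def mult.commute power_0 mult_1_right)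
    from qt_monomial_eqD(1)[OF this] that show False by simp
  qed
  have 2: "e i * tt ^ k \<noteq> qq ^ l" for i k l
  proof
    assume "e i * tt ^ k = qq ^ l"
    then have "of_nat (2 ^ (i + 1)) * qq ^ 0 * tt ^ k = of_nat 1 * qq ^ l * tt ^ 0"
      by (simp only: e_def power_0 mult_1_right mult_1_left of_nat_1)
    from qt_monomial_eqD(1)[OF this] show False by simp
  qed
  have 3: "e i \<noteq> 0" for i by (simp only: e_def of_nat_eq_0_iff) simp
  show ?thesis using 1 2 3 by (intro exI[of _ e]) blast
qed

lemma co_sep: "i \<noteq> j \<Longrightarrow> qq ^ k * co v i \<noteq> qq ^ l * co v j"
  and co_mon: "co v i * tt ^ k \<noteq> qq ^ l"
  and co_nz [simp]: "co v i \<noteq> 0"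
  using co[of v] by auto

lemma co_neq: "i \<noteq> j \<Longrightarrow> co v i \<noteq> co v j"
  using co_sep[of i j 0 v 0] by simp

lemma co_neq_Suc [simp]: "co v i \<noteq> co v (Suc i)" "co v (Suc i) \<noteq> co v i"
  using co_neq[of i "Suc i" v] by auto

lemma gpt_eqI: "(\<And>i. co v i = co w i) \<Longrightarrow> v = w"
  by (metis co_inverse ext)

definition sw :: "nat \<Rightarrow> gpt \<Rightarrow> gpt" where
  "sw i v = Gpt (\<lambda>j. co v (transp i j))"

lemma transp_simps [simp]: "transp i i = Suc i" "transp i (Suc i) = i"
  "j \<noteq> i \<Longrightarrow> j \<noteq> Suc i \<Longrightarrow> transp i j = j" "transp i (transp i j) = j"
  by (auto simp: transp_def)

lemma transp_inj [simp]: "transp i j = transp i k \<longleftrightarrow> j = k"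
  by (metis transp_simps(4))

lemma co_sw [simp]: "co (sw i v) j = co v (transp i j)"
  unfolding sw_def by (subst Gpt_inverse) (auto simp: co_sep co_mon)

lemma sw_sw [simp]: "sw i (sw i v) = v"
  by (rule gpt_eqI) simp

text \<open>The rotation \<open>(x\<^sub>0, \<dots>, x\<^sub>n\<^sub>-\<^sub>1) \<mapsto> (x\<^sub>1, \<dots>, x\<^sub>n\<^sub>-\<^sub>1, x\<^sub>0 / q)\<close>; the other coordinates stay.\<close>

definition rotv :: "nat \<Rightarrow> (nat \<Rightarrow> qt) \<Rightarrow> nat \<Rightarrow> qt" where
  "rotv n v i = (if Suc i < n then v (Suc i) else if Suc i = n then v 0 / qq else v i)"

definition rt :: "nat \<Rightarrow> gpt \<Rightarrow> gpt" where
  "rt n v = Gpt (rotv n (co v))"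

text \<open>The conditions on generic points quantify over all powers of \<open>q\<close> precisely
  so that dividing one coordinate by \<open>q\<close> stays inside the type: the missing factor is
  absorbed by raising an exponent on the other side.\<close>

lemma co_rt [simp]: "co (rt n v) = rotv n (co v)"
proof -
  have div: "qq ^ k * (co v a / qq) \<noteq> qq ^ l * co v b" if "a \<noteq> b" for k l a b
    using co_sep[of a b k v "Suc l"] that by (auto simp: field_simps)
  have div2: "qq ^ l * co v b \<noteq> qq ^ k * (co v a / qq)" if "a \<noteq> b" for k l a b
    using div[OF that, of k l] by metis
  have div3: "co v a / qq * tt ^ k \<noteq> qq ^ l" for a k l
    using co_mon[of v a k "Suc l"] by (auto simp: field_simps)
  have sep: "qq ^ k * rotv n (co v) i \<noteq> qq ^ l * rotv n (co v) j" if "i \<noteq> j" for i j k l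
    unfolding rotv_def using that by (auto intro!: co_sep div div2 simp del: times_divide_eq_right)
  have mon: "rotv n (co v) i * tt ^ k \<noteq> qq ^ l" for i k l
    unfolding rotv_def using div3 co_mon by auto
  have nz: "rotv n (co v) i \<noteq> 0" for i
    unfolding rotv_def by auto
  show ?thesis unfolding rt_def by (subst Gpt_inverse) (use sep mon nz in auto)
qed

section \<open>Hecke operators on functions of generic points\<close>

type_synonym fn = "gpt \<Rightarrow> qt"

definition TT :: "nat \<Rightarrow> fn \<Rightarrow> fn" where
  "TT i f v = tt * f v - (tt * co v i - co v (Suc i)) / (co v i - co v (Suc i)) * (f v - f (sw i v))"

definition hc :: "nat \<Rightarrow> gpt \<Rightarrow> qt" where
  "hc i v = (tt * co v i - co v (Suc i)) / (co v i - co v (Suc i))"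

lemma TT_hc: "TT i f v = tt * f v - hc i v * (f v - f (sw i v))"
  by (simp add: TT_def hc_def)

text \<open>\<open>T_i^{-1}\<close>, read off from the quadratic relation
  \<open>(T_i - t)(T_i + 1) = 0\<close>.\<close>

definition TI :: "nat \<Rightarrow> fn \<Rightarrow> fn" where
  "TI i f v = (TT i f v - (tt - 1) * f v) / tt"

definition RR :: "nat \<Rightarrow> fn \<Rightarrow> fn" where
  "RR n f v = f (rt n v)"

lemma TT_add: "TT i (\<lambda>v. f v + g v) = (\<lambda>v. TT i f v + TT i g v)"
  and TT_diff: "TT i (\<lambda>v. f v - g v) = (\<lambda>v. TT i f v - TT i g v)"
  by (auto simp: TT_hc fun_eq_iff algebra_simps)

lemma TT_mult_sym: "(\<And>v. g (sw i v) = g v) \<Longrightarrow> TT i (\<lambda>v. g v * f v) = (\<lambda>v. g v * TT i f v)"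
  by (auto simp: TT_hc fun_eq_iff algebra_simps)

lemma TT_cmult: "TT i (\<lambda>v. c * f v) = (\<lambda>v. c * TT i f v)"
  by (rule TT_mult_sym) simp

lemma TT_const: "TT i (\<lambda>v. c) = (\<lambda>v. tt * c)"
  by (auto simp: TT_def)

lemma TT_sum: "finite S \<Longrightarrow> TT i (\<lambda>v. \<Sum>x\<in>S. f x v) = (\<lambda>v. \<Sum>x\<in>S. TT i (f x) v)"
proof (induction S rule: finite_induct)
  case empty
  then show ?case using TT_const[of i 0] by simp
next
  case (insert x F)
  then show ?case by (simp add: TT_add)
qed

lemma hc_sw: "hc i (sw i v) = tt + 1 - hc i v"
proof -
  have "co v i - co v (Suc i) \<noteq> 0" "co v (Suc i) - co v i \<noteq> 0" by auto
  then show ?thesis unfolding hc_def by (simp add: divide_simps) (simp add: algebra_simps)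
qed

lemma TT_quad: "TT i (TT i f) v = (tt - 1) * TT i f v + tt * f v"
  unfolding TT_hc by (simp add: hc_sw) (simp add: algebra_simps)

lemma TT_TI [simp]: "TT i (TI i f) = f" and TI_TT [simp]: "TI i (TT i f) = f"
proof -
  have *: "TT i (TI i f) v = f v" for v
  proof -
    have "TI i f = (\<lambda>v. (1 / tt) * (TT i f v - (tt - 1) * f v))"
      by (auto simp: TI_def fun_eq_iff)
    then have "TT i (TI i f) v = (1 / tt) * (TT i (TT i f) v - (tt - 1) * TT i f v)"
      by (simp only: TT_cmult TT_diff)
    then show ?thesis by (simp add: TT_quad)
  qed
  have "TI i (TT i f) v = f v" for v by (simp add: TI_def TT_quad)
  with * show "TT i (TI i f) = f" "TI i (TT i f) = f" by auto
qed

lemma TI_add: "TI i (\<lambda>v. f v + g v) = (\<lambda>v. TI i f v + TI i g v)"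
  by (auto simp: TI_def TT_add fun_eq_iff field_simps)

lemma TI_diff: "TI i (\<lambda>v. f v - g v) = (\<lambda>v. TI i f v - TI i g v)"
  by (auto simp: TI_def TT_diff fun_eq_iff field_simps)

lemma TI_mult_sym: "(\<And>v. g (sw i v) = g v) \<Longrightarrow> TI i (\<lambda>v. g v * f v) = (\<lambda>v. g v * TI i f v)"
  using TT_mult_sym[of g i f] by (auto simp: TI_def fun_eq_iff algebra_simps diff_divide_distrib)

lemma TI_cmult: "TI i (\<lambda>v. c * f v) = (\<lambda>v. c * TI i f v)"
  by (rule TI_mult_sym) simp

lemma TI_eqI: "TT i f = g \<Longrightarrow> TI i g = f" by auto

lemma TT_eq_TI: "TT i f v = tt * TI i f v + (tt - 1) * f v"
  by (simp add: TI_def)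

text \<open>The cross relation of the affine Hecke algebra. It lets a variable follow a label that
  moves one column to the right.\<close>

lemma TT_x: "TT i (\<lambda>v. co v i * f v) v = tt * co v (Suc i) * TI i f v"
proof -
  have ne: "co v i - co v (Suc i) \<noteq> 0" by simp
  show ?thesis unfolding TI_def TT_def using ne by (simp add: divide_simps) (simp add: algebra_simps)
qed

lemma TT_far:
  assumes "Suc i < j"
  shows "TT i (TT j f) = TT j (TT i f)"
proof
  fix v
  have s: "sw j (sw i v) = sw i (sw j v)"
    by (rule gpt_eqI) (use assms in \<open>auto simp: transp_def transpose_def\<close>)
  have t: "transp i j = j" "transp i (Suc j) = Suc j" "transp j i = i" "transp j (Suc i) = Suc i"
    using assms by auto
  define C where "C a b = (tt * a - b) / (a - b)" for a b :: qt
  have T: "TT j g w = tt * g w - C (co w j) (co w (Suc j)) * (g w - g (sw j w))" for j g w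
    by (simp add: TT_def C_def)
  show "TT i (TT j f) v = TT j (TT i f) v"
    unfolding T by (simp add: s t) (simp add: algebra_simps)
qed

text \<open>The second relation is the three-term identity of the Hecke coefficients; it is exactly
  the factor by which the two sides of the braid relation could differ.\<close>

lemma hecke_coeff_relations:
  fixes x y z t :: qt
  assumes "x \<noteq> y" "x \<noteq> z" "y \<noteq> z"
  defines "C \<equiv> \<lambda>a b. (t * a - b) / (a - b)"
  shows "C y x = t + 1 - C x y"
    and "C x y * C y z - C x z * C x y - C x z * C y z + (t + 1) * C x z - t = 0"
proof -
  have ne: "x - y \<noteq> 0" "y - x \<noteq> 0" "x - z \<noteq> 0" "y - z \<noteq> 0" using assms by auto
  show "C y x = t + 1 - C x y"
    unfolding C_def using ne by (simp add: divide_simps) (simp add: algebra_simps)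
  show "C x y * C y z - C x z * C x y - C x z * C y z + (t + 1) * C x z - t = 0"
    unfolding C_def using ne by (simp add: divide_simps) (simp add: algebra_simps)
qed

lemma TT_braid: "TT i (TT (Suc i) (TT i f)) = TT (Suc i) (TT i (TT (Suc i) f))"
proof
  fix v
  define x y z where "x = co v i" and "y = co v (Suc i)" and "z = co v (Suc (Suc i))"
  have ne: "x \<noteq> y" "x \<noteq> z" "y \<noteq> z"
    unfolding x_def y_def z_def using co_neq[of i "Suc (Suc i)" v] by auto
  define C where "C a b = (tt * a - b) / (a - b)" for a b :: qt
  have t: "transp i (Suc (Suc i)) = Suc (Suc i)" "transp (Suc i) i = i" by auto
  have s: "sw (Suc i) (sw i (sw (Suc i) v)) = sw i (sw (Suc i) (sw i v))"
    by (rule gpt_eqI) (auto simp: transp_def transpose_def)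
  define f0 f1 f2 f12 f21 f121 where "f0 = f v" and "f1 = f (sw i v)" and "f2 = f (sw (Suc i) v)"
    and "f12 = f (sw (Suc i) (sw i v))" and "f21 = f (sw i (sw (Suc i) v))"
    and "f121 = f (sw i (sw (Suc i) (sw i v)))"
  note fs = f0_def f1_def f2_def f12_def f21_def f121_def
  define a b c where "a = C x y" and "b = C y z" and "c = C x z"
  have yx: "C y x = tt + 1 - a" "C z y = tt + 1 - b"
    using hecke_coeff_relations(1)[OF ne, of tt]
      hecke_coeff_relations(1)[of y z x tt, OF ne(3) ne(1)[symmetric] ne(2)[symmetric]]
    by (simp_all only: a_def b_def C_def)
  have rel: "a * b - c * a - c * b + (tt + 1) * c - tt = 0"
    using hecke_coeff_relations(2)[OF ne, of tt] by (simp only: a_def b_def c_def C_def)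
  have T: "TT j g w = tt * g w - C (co w j) (co w (Suc j)) * (g w - g (sw j w))" for j g w
    by (simp add: TT_def C_def)
  \<comment> \<open>The values of \<open>f\<close> at points swapped more than once cancel; what
    remains is a multiple of the three-term identity.\<close>
  have "TT i (TT (Suc i) (TT i f)) v = TT (Suc i) (TT i (TT (Suc i) f)) v
      + (a * b - c * a - c * b + (tt + 1) * c - tt) * ((b - a) * f0 + a * f1 - b * f2)"
    unfolding T by (simp add: t s x_def[symmetric] y_def[symmetric] z_def[symmetric] fs[symmetric]
      a_def[symmetric] b_def[symmetric] c_def[symmetric] yx) (simp add: algebra_simps)
  then show "TT i (TT (Suc i) (TT i f)) v = TT (Suc i) (TT i (TT (Suc i) f)) v"
    by (simp add: rel)
qed

lemma RR_TT:
  assumes "Suc (Suc i) < n"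
  shows "RR n (TT i f) = TT (Suc i) (RR n f)"
proof
  fix v
  have s: "sw i (rt n v) = rt n (sw (Suc i) v)"
    by (rule gpt_eqI) (use assms in \<open>auto simp: rotv_def transp_def transpose_def\<close>)
  have c: "rotv n (co v) i = co v (Suc i)" "rotv n (co v) (Suc i) = co v (Suc (Suc i))"
    using assms by (auto simp: rotv_def)
  show "RR n (TT i f) v = TT (Suc i) (RR n f) v"
    unfolding RR_def TT_def by (simp add: s c)
qed

section \<open>Words in oscillator letters and their traces\<close>

text \<open>Operators on states n = 0, 1, 2, ...: \<open>LA\<close> raises n, \<open>LB\<close>
  lowers n with factor \<open>1 - t^n\<close>, and \<open>Lin p q\<close> is diagonal with
  eigenvalue \<open>p + q t^n\<close>, so that \<open>LO\<close> is the identity and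
  \<open>LD\<close> is \<open>t^n\<close>. A state counts the strands of one label that are in
  flight.\<close>

datatype ltr = LA | LB | Lin qt qt

abbreviation "LO \<equiv> Lin 1 0"
abbreviation "LD \<equiv> Lin 0 1"

definition lin :: "qt \<Rightarrow> qt \<Rightarrow> qt poly" where "lin a b = [:a, b:]"

lemma lin_simps [simp]: "lin 1 0 = 1" "poly (lin a b) x = a + b * x"
  "pcompose (lin a b) [:0, tt:] = lin a (tt * b)" "lin 0 (c * b) = smult c (lin 0 b)"
  by (simp_all add: lin_def one_pCons pcompose_pCons)

lemma lin_tt: "lin 1 (- (tt * s)) = smult tt (lin 1 (- s)) + smult (1 - tt) 1"
  by (simp add: lin_def one_pCons)

text \<open>The indeterminate stands for \<open>t\<close> to the initial state and \<open>s\<close>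
  for the change accumulated since, so \<open>s\<close> times the indeterminate is always
  \<open>t\<close> to the current state. Because the result is a polynomial, a trace over all states
  becomes a finite sum.\<close>

fun PP :: "qt \<Rightarrow> ltr list \<Rightarrow> qt poly" where
  "PP s [] = 1"
| "PP s (LA # w) = PP (tt * s) w"
| "PP s (LB # w) = lin 1 (- s) * PP (s / tt) w"
| "PP s (Lin p q # w) = lin p (q * s) * PP s w"

fun stt :: "qt \<Rightarrow> ltr list \<Rightarrow> qt" where
  "stt s [] = s"
| "stt s (LA # w) = stt (tt * s) w"
| "stt s (LB # w) = stt (s / tt) w"
| "stt s (Lin p q # w) = stt s w"

abbreviation na :: "ltr list \<Rightarrow> nat" where "na w \<equiv> count_list w LA"
abbreviation nb :: "ltr list \<Rightarrow> nat" where "nb w \<equiv> count_list w LB"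
abbreviation nd :: "ltr list \<Rightarrow> nat" where "nd w \<equiv> count_list w LD"

lemma PP_append: "PP s (u @ w) = PP s u * PP (stt s u) w"
  by (induction s u rule: PP.induct) (simp_all add: mult.assoc)

lemma stt_count: "stt s w * tt ^ nb w = s * tt ^ na w"
  by (induction s w rule: stt.induct) (simp_all add: field_simps)

lemma PP_LO [simp]: "PP s (LO # w) = PP s w"
  by simp

lemma PP_LO2 [simp]: "PP s (u @ LO # w) = PP s (u @ w)"
  by (simp add: PP_append)

lemma PP_dilate: "PP (tt * s) w = pcompose (PP s w) [:0, tt:]"
proof (induction s w rule: PP.induct)
  case (3 s w)
  then have "PP (tt * s / tt) w = pcompose (PP (s / tt) w) [:0, tt:]" by simp
  then show ?case by (simp add: pcompose_mult)
qed (simp_all add: pcompose_mult mult.left_commute pcompose_1)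

text \<open>A path with too many lowering steps meets state 0 at some letter \<open>LB\<close>,
  whose factor \<open>1 - t^0\<close> vanishes.\<close>

lemma PP_negative_net: "n + na w < nb w \<Longrightarrow> poly (PP (tt ^ n) w) 1 = 0"
proof (induction w arbitrary: n)
  case (Cons a w)
  show ?case
  proof (cases a)
    case LA
    then show ?thesis using Cons.prems Cons.IH[of "Suc n"] by simp
  next
    case LB
    show ?thesis
    proof (cases n)
      case (Suc m)
      then show ?thesis using Cons.prems Cons.IH[of m] LB by simp
    qed (use LB in simp)
  next
    case (Lin p q)
    then show ?thesis using Cons.prems Cons.IH[of n] by simp
  qed
qed simp

text \<open>With \<open>s = t\<^sup>n\<close> the polynomial \<open>PP\<close> is the weight of a path of oscillator states started at \<open>n\<close>;
  \<open>Lam Q\<close> is its trace \<open>\<Sum>n. Q\<^sup>n \<dots>\<close> summed as a geometric series.\<close>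

definition Lam :: "qt \<Rightarrow> qt poly \<Rightarrow> qt" where
  "Lam Q p = (\<Sum>k\<le>degree p. coeff p k / (1 - Q * tt ^ k))"

lemma Lam_eq: "degree p \<le> N \<Longrightarrow> Lam Q p = (\<Sum>k\<le>N. coeff p k / (1 - Q * tt ^ k))"
  unfolding Lam_def by (rule sum.mono_neutral_left) (auto simp: coeff_eq_0)

lemma Lam_add: "Lam Q (p + r) = Lam Q p + Lam Q r"
proof -
  let ?N = "max (degree p) (degree r)"
  have "Lam Q (p + r) = (\<Sum>k\<le>?N. coeff (p + r) k / (1 - Q * tt ^ k))"
    by (rule Lam_eq) (rule degree_add_le_max)
  then show ?thesis
    by (simp add: Lam_eq[of p ?N] Lam_eq[of r ?N] add_divide_distrib sum.distrib)
qed

lemma Lam_smult: "Lam Q (smult c p) = c * Lam Q p"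
  by (simp add: Lam_eq[of "smult c p" "degree p"] Lam_def sum_distrib_left)

lemma Lam_0 [simp]: "Lam Q 0 = 0" by (simp add: Lam_def)

lemma Lam_sum: "Lam Q (\<Sum>x\<in>S. f x) = (\<Sum>x\<in>S. Lam Q (f x))"
  by (induction S rule: infinite_finite_induct) (simp_all add: Lam_add)

text \<open>In the trace sum over n the substitution is the index shift from n to n + 1. Only the
  term n = 0 is left, and there the indeterminate is 1.\<close>

lemma Lam_dilate:
  assumes "\<And>k. 1 - Q * tt ^ k \<noteq> 0"
  shows "Lam Q p - Q * Lam Q (pcompose p [:0, tt:]) = poly p 1"
proof -
  have "degree (pcompose p [:0, tt:]) \<le> degree p" by (simp add: degree_pcompose)
  then have "Lam Q p - Q * Lam Q (pcompose p [:0, tt:])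
      = (\<Sum>k\<le>degree p. coeff p k / (1 - Q * tt ^ k) - Q * (tt ^ k * coeff p k / (1 - Q * tt ^ k)))"
    by (simp add: Lam_eq[of "pcompose p [:0, tt:]" "degree p"] Lam_def[of Q p] coeff_pcompose_linear
        sum_subtractf sum_distrib_left del: degree_pcompose)
  also have "\<dots> = (\<Sum>k\<le>degree p. coeff p k)"
  proof (rule sum.cong)
    fix k
    show "coeff p k / (1 - Q * tt ^ k) - Q * (tt ^ k * coeff p k / (1 - Q * tt ^ k)) = coeff p k"
      using assms[of k] by (simp add: divide_simps) (simp add: algebra_simps)
  qed simp
  finally show ?thesis by (simp add: poly_altdef)
qed

definition tr :: "qt \<Rightarrow> ltr list \<Rightarrow> qt" where
  "tr Q w = Lam Q (PP 1 w)"

text \<open>Normalised by the trace of the word from which all strands have been removed, so that a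
  layer without nontrivial strands of the label has weight 1.\<close>

definition cc :: "qt \<Rightarrow> ltr list \<Rightarrow> qt" where
  "cc Q w = (1 - Q * tt ^ nd w) * tr Q w"

text \<open>Twisted cyclicity: carrying a letter around the circle shifts the summation index by one
  and costs \<open>Q\<close>. The boundary term at state 0 vanishes because \<open>w\<close> has one
  lowering letter too many; for \<open>LB\<close> below it vanishes through the factor of
  \<open>LB\<close> itself.\<close>

lemma tr_rot_A:
  assumes "\<And>k. 1 - Q * tt ^ k \<noteq> 0" "nb w = Suc (na w)"
  shows "tr Q (w @ [LA]) = Q * tr Q (LA # w)"
proof -
  have "poly (PP 1 w) 1 = 0" using PP_negative_net[of 0 w] assms(2) by simp
  then show ?thesis
    using Lam_dilate[OF assms(1), where p = "PP 1 w"] PP_dilate[of 1 w] by (simp add: tr_def PP_append)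
qed

lemma tr_rot_B:
  assumes "\<And>k. 1 - Q * tt ^ k \<noteq> 0" "na w = Suc (nb w)"
  shows "tr Q (LB # w) = Q * tr Q (w @ [LB])"
proof -
  have "stt 1 w * tt ^ nb w = tt * tt ^ nb w" using stt_count[of 1 w] assms(2) by simp
  then have st: "stt 1 w = tt" by simp
  have d: "pcompose (PP (1 / tt) w) [:0, tt:] = PP 1 w" using PP_dilate[of "1 / tt" w] by simp
  have "pcompose (PP 1 (LB # w)) [:0, tt:] = PP 1 (w @ [LB])"
    by (simp only: PP.simps pcompose_mult d) (simp add: PP_append st mult.commute)
  moreover have "poly (PP 1 (LB # w)) 1 = 0" by simp
  ultimately show ?thesis
    using Lam_dilate[OF assms(1), where p = "PP 1 (LB # w)"] by (simp add: tr_def del: PP.simps)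
qed

lemma tr_rot_Lin:
  assumes "na w = nb w"
  shows "tr Q (Lin p q # w) = tr Q (w @ [Lin p q])"
proof -
  have "stt 1 w = 1" using stt_count[of 1 w] assms by simp
  then show ?thesis by (simp add: tr_def PP_append mult.commute)
qed

lemma tr_LO [simp]: "tr Q (u @ LO # w) = tr Q (u @ w)" "tr Q (LO # w) = tr Q w"
  by (simp_all add: tr_def)

text \<open>\<open>AD = t DA\<close>, and below \<open>DB = t BD\<close> and
  \<open>AB = t BA + (1 - t)\<close>, are the relations of the oscillator algebra. The exchange
  relations of a classic layer are derived from these three.\<close>

lemma tr_AD: "tr Q (u @ LA # LD # w) = tt * tr Q (u @ LD # LA # w)"
proof -
  have "PP 1 (u @ LA # LD # w) = smult tt (PP 1 (u @ LD # LA # w))"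
    by (simp add: PP_append)
  then show ?thesis by (simp add: tr_def Lam_smult)
qed

lemma tr_DB: "tr Q (u @ LD # LB # w) = tt * tr Q (u @ LB # LD # w)"
proof -
  define s where "s = stt 1 u"
  have "lin 0 s = smult tt (lin 0 (s / tt))"
    using lin_simps(4)[of tt "s / tt"] by simp
  then have "PP 1 (u @ LD # LB # w) = smult tt (PP 1 (u @ LB # LD # w))"
    by (simp only: PP_append PP.simps s_def[symmetric] mult_1_left) (simp add: mult.left_commute)
  then show ?thesis by (simp add: tr_def Lam_smult)
qed

lemma PP_AB: "PP s (LA # LB # w) = smult tt (PP s (LB # LA # w)) + smult (1 - tt) (PP s w)"
  by (simp add: lin_tt distrib_right)

lemma tr_AB: "tr Q (u @ LA # LB # w) = tt * tr Q (u @ LB # LA # w) + (1 - tt) * tr Q (u @ w)"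
  by (simp only: tr_def PP_append PP_AB distrib_left mult_smult_right Lam_add Lam_smult)

lemma cc_trivial:
  assumes "set w \<subseteq> {LD, LO}" "\<And>k. 1 - Q * tt ^ k \<noteq> 0"
  shows "cc Q w = 1"
proof -
  have "PP 1 w = [:0, 1:] ^ nd w"
    using assms(1) by (induction w) (auto simp: lin_def)
  then have "PP 1 w = monom 1 (nd w)" by (simp add: monom_altdef)
  then have "tr Q w = 1 / (1 - Q * tt ^ nd w)"
    by (simp add: tr_def Lam_def degree_monom_eq if_distribR if_distrib[of "\<lambda>x. x / _"] sum.delta cong: if_cong)
  then show ?thesis using assms(2) by (simp add: cc_def)
qed

lemma smult_sum_right: "smult c (\<Sum>x\<in>S. f x) = (\<Sum>x\<in>S. smult c (f x :: qt poly))"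
  by (induction S rule: infinite_finite_induct) (simp_all add: smult_add_right)

section \<open>Words built column by column; following a single strand\<close>

text \<open>Each column contributes the letter of its lower position before the letter of its upper
  one, so a strand can end in its own column only after a full turn.\<close>

definition WW :: "(nat \<Rightarrow> ltr) \<Rightarrow> (nat \<Rightarrow> ltr) \<Rightarrow> nat list \<Rightarrow> ltr list" where
  "WW f g cs = concat (map (\<lambda>c. [f c, g c]) cs)"

lemma WW_simps [simp]: "WW f g [] = []" "WW f g (c # cs) = f c # g c # WW f g cs"
  "WW f g (cs @ ds) = WW f g cs @ WW f g ds"
  by (simp_all add: WW_def)

lemma WW_cong: "(\<And>c. c \<in> set cs \<Longrightarrow> f c = f' c \<and> g c = g' c) \<Longrightarrow> WW f g cs = WW f' g' cs"
  by (induction cs) simp_all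

text \<open>Pushing a strand start to the right: it either ends at one of the ball positions it meets
  or crosses all of them.\<close>

lemma PP_push:
  assumes "a \<le> b" "\<And>c. a \<le> c \<Longrightarrow> c < b \<Longrightarrow> f c \<in> {LB, LD, LO} \<and> g c \<in> {LA, LO}"
  shows "PP s (LA # WW f g [a..<b] @ r)
    = (\<Sum>k\<in>{k\<in>{a..<b}. f k = LB}. smult ((1 - tt) * tt ^ card {c\<in>{a..<k}. f c \<noteq> LO})
         (PP s (WW (f(k := LO)) g [a..<b] @ r)))
      + smult (tt ^ card {c\<in>{a..<b}. f c \<noteq> LO}) (PP s (WW f g [a..<b] @ LA # r))"
  using assms
proof (induction a arbitrary: s rule: inc_induct)
  case base
  then show ?case by simp
next
  case (step a)
  let ?X = "WW f g [Suc a..<b]"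
  have up: "[a..<b] = a # [Suc a..<b]" using step.hyps by (simp add: upt_conv_Cons)
  have fa: "f a \<in> {LB, LD, LO}" and ga: "g a \<in> {LA, LO}" using step.prems[of a] step.hyps by auto
  have swap: "PP s' (LA # g a # Y) = PP s' (g a # LA # Y)" for s' Y
    using ga by auto
  define s2 where "s2 = stt s [f a, g a]"
  define c0 where "c0 = PP s [f a, g a]"
  have col: "PP s (f a # g a # Y) = c0 * PP s2 Y" for Y
    using PP_append[of s "[f a, g a]" Y] by (simp add: s2_def c0_def)
  define S where "S = (\<Sum>k\<in>{k\<in>{Suc a..<b}. f k = LB}. smult ((1 - tt) * tt ^ card {c\<in>{Suc a..<k}. f c \<noteq> LO})
         (PP s (WW (f(k := LO)) g [a..<b] @ r)))"
  have upd: "PP s (WW (f(k := LO)) g [a..<b] @ r) = c0 * PP s2 (WW (f(k := LO)) g [Suc a..<b] @ r)"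
    if "k \<in> {k\<in>{Suc a..<b}. f k = LB}" for k
    using that by (simp add: up col)
  have IH: "PP s2 (LA # ?X @ r) = (\<Sum>k\<in>{k\<in>{Suc a..<b}. f k = LB}. smult ((1 - tt) * tt ^ card {c\<in>{Suc a..<k}. f c \<noteq> LO})
         (PP s2 (WW (f(k := LO)) g [Suc a..<b] @ r)))
      + smult (tt ^ card {c\<in>{Suc a..<b}. f c \<noteq> LO}) (PP s2 (?X @ LA # r))"
    by (rule step.IH) (use step.prems in auto)
  have main: "PP s (f a # LA # g a # ?X @ r) = S + smult (tt ^ card {c\<in>{Suc a..<b}. f c \<noteq> LO}) (PP s (WW f g [a..<b] @ LA # r))"
  proof -
    have "PP s ([f a] @ LA # g a # ?X @ r) = PP s ([f a] @ g a # LA # ?X @ r)"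
      unfolding PP_append swap ..
    then have "PP s (f a # LA # g a # ?X @ r) = PP s (f a # g a # LA # ?X @ r)"
      by (simp only: append_Cons append_Nil)
    also have "\<dots> = c0 * PP s2 (LA # ?X @ r)" by (rule col)
    also have "\<dots> = S + smult (tt ^ card {c\<in>{Suc a..<b}. f c \<noteq> LO}) (c0 * PP s2 (?X @ LA # r))"
      unfolding IH S_def by (simp add: distrib_left sum_distrib_left upd del: PP.simps)
    finally show ?thesis by (simp add: up col del: PP.simps)
  qed
  have card: "card {c\<in>{a..<k}. f c \<noteq> LO} = (if f a = LO then 0 else 1) + card {c\<in>{Suc a..<k}. f c \<noteq> LO}"
    if "a < k" for k
  proof -
    have "{c\<in>{a..<k}. f c \<noteq> LO} = (if f a = LO then {} else {a}) \<union> {c\<in>{Suc a..<k}. f c \<noteq> LO}"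
      using that by (auto simp: le_less Suc_le_eq)
    then show ?thesis by (simp add: card_insert_if)
  qed
  have set: "{k\<in>{a..<b}. f k = LB} = (if f a = LB then {a} else {}) \<union> {k\<in>{Suc a..<b}. f k = LB}"
    using step.hyps by (auto simp: le_less Suc_le_eq)
  define e :: nat where "e = (if f a = LO then 0 else 1)"
  have S_e: "(\<Sum>k\<in>{k\<in>{Suc a..<b}. f k = LB}. smult ((1 - tt) * tt ^ card {c\<in>{a..<k}. f c \<noteq> LO})
         (PP s (WW (f(k := LO)) g [a..<b] @ r))) = smult (tt ^ e) S"
    unfolding S_def smult_sum_right
  proof (rule sum.cong)
    fix k assume "k \<in> {k\<in>{Suc a..<b}. f k = LB}"
    then have "a < k" by auto
    show "smult ((1 - tt) * tt ^ card {c\<in>{a..<k}. f c \<noteq> LO}) (PP s (WW (f(k := LO)) g [a..<b] @ r))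
      = smult (tt ^ e) (smult ((1 - tt) * tt ^ card {c\<in>{Suc a..<k}. f c \<noteq> LO})
          (PP s (WW (f(k := LO)) g [a..<b] @ r)))"
      unfolding card[OF \<open>a < k\<close>] e_def[symmetric] power_add smult_smult by (simp only: mult_ac)
  qed simp
  have c_e: "tt ^ card {c\<in>{a..<b}. f c \<noteq> LO} = tt ^ e * tt ^ card {c\<in>{Suc a..<b}. f c \<noteq> LO}"
    using step.hyps by (simp only: card[OF \<open>a < b\<close>] power_add e_def[symmetric])
  define T where "T k = smult ((1 - tt) * tt ^ card {c\<in>{a..<k}. f c \<noteq> LO})
         (PP s (WW (f(k := LO)) g [a..<b] @ r))" for k
  have sumT: "sum T {k\<in>{a..<b}. f k = LB} = (if f a = LB then T a else 0) + sum T {k\<in>{Suc a..<b}. f k = LB}"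
    unfolding set by simp
  have sumT': "sum T {k\<in>{Suc a..<b}. f k = LB} = smult (tt ^ e) S"
    using S_e unfolding T_def .
  have k: "PP s (WW (f(a := LO)) g [a..<b] @ r) = PP s (g a # ?X @ r)"
    using WW_cong[of "[Suc a..<b]" "f(a := LO)" f g g] unfolding up by simp
  have Ta: "T a = smult (1 - tt) (PP s (g a # ?X @ r))" unfolding T_def k by simp
  \<comment> \<open>One column: \<open>LA\<close> passes \<open>LO\<close> freely and
    \<open>LD\<close> at the cost of \<open>t\<close>; at \<open>LB\<close> the relation for
    \<open>AB\<close> splits off the term in which the strand ends here.\<close>
  have "PP s (LA # WW f g [a..<b] @ r)
      = smult (tt ^ e) (PP s (f a # LA # g a # ?X @ r)) + (if f a = LB then T a else 0)"
    using fa unfolding Ta up e_def WW_simps append_Cons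
    using PP_AB[of s "g a # ?X @ r"] by (auto simp del: PP.simps(3)) 
  then show ?case
    unfolding T_def[symmetric] sumT sumT' main c_e by (simp only: smult_add_right smult_smult add_ac)
qed

lemma count_WW:
  "na (WW f g cs) = count_list (map f cs) LA + count_list (map g cs) LA"
  "nb (WW f g cs) = count_list (map f cs) LB + count_list (map g cs) LB"
  "nd (WW f g cs) = count_list (map f cs) LD + count_list (map g cs) LD"
  by (induction cs) auto

lemma count_map_upt: "count_list (map f [0..<n]) a = card {c. c < n \<and> f c = a}"
proof (induction n)
  case (Suc n)
  have "{c. c < Suc n \<and> f c = a} = {c. c < n \<and> f c = a} \<union> (if f n = a then {n} else {})"
    by (auto simp: less_Suc_eq)
  moreover have "card \<dots> = card {c. c < n \<and> f c = a} + (if f n = a then 1 else 0)"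
    by (subst card_Un_disjoint) auto
  ultimately show ?case using Suc by simp
qed simp

text \<open>Summing over the end point of one fixed strand: moving its start once around the circle
  returns the same word, scaled by \<open>Q\<close> and one factor \<open>t\<close> per crossed ball.\<close>

lemma tr_strand_rec:
  assumes Q: "\<And>k. 1 - Q * tt ^ k \<noteq> 0"
    and fg: "\<And>c. c < n \<Longrightarrow> f c \<in> {LB, LD, LO} \<and> g c \<in> {LA, LO}"
    and j: "j < n" "g j = LA"
    and bal: "card {c. c < n \<and> f c = LB} = card {c. c < n \<and> g c = LA}"
  shows "(1 - Q * tt ^ card {c. c < n \<and> f c \<noteq> LO}) * tr Q (WW f g [0..<n])
    = (\<Sum>k\<in>{k. k < n \<and> f k = LB}.
        (1 - tt) * tt ^ card ({c. c < n \<and> f c \<noteq> LO} \<inter> cyc_between n j k)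
          * (if k \<le> j then Q else 1) * tr Q (WW (f(k := LO)) (g(j := LO)) [0..<n]))"
proof -
  define g' where "g' = g(j := LO)"
  define w0 w1 where "w0 = WW f g' [0..<Suc j]" and "w1 = WW f g' [Suc j..<n]"
  have split: "[0..<n] = [0..<Suc j] @ [Suc j..<n]"
    using j(1) upt_add_eq_append[of 0 "Suc j" "n - Suc j"] by simp
  have g'0: "WW f g [0..<j] = WW f g' [0..<j]" "WW f g [Suc j..<n] = WW f g' [Suc j..<n]"
    unfolding g'_def by (auto intro: WW_cong)
  have X: "tr Q (WW f g [0..<n]) = tr Q (w0 @ LA # w1)"
    unfolding split w0_def w1_def 
    using PP_LO2[of 1 "WW f g' [0..<j] @ [f j]" "LA # WW f g' [Suc j..<n]"]
    by (simp add: g'0 j(2) g'_def tr_def)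
  have fg': "f c \<in> {LB, LD, LO} \<and> g' c \<in> {LA, LO}" if "c < n" for c
    using fg[OF that] by (auto simp: g'_def)
  define e where "e a b = card {c\<in>{a..<b}. f c \<noteq> LO}" for a b
  have nosrc: "{c. c < n \<and> f c = LA} = {}" "{c. c < n \<and> g' c = LB} = {}"
    by (auto dest!: fg') 
  have ins: "{c. c < n \<and> g c = LA} = insert j {c. c < n \<and> g' c = LA}"
    using j by (auto simp: g'_def)
  have bal': "card {c. c < n \<and> f c = LB} = Suc (card {c. c < n \<and> g' c = LA})"
    unfolding bal ins by (subst card_insert_disjoint) (auto simp: g'_def)
  have "nb (w0 @ w1) = Suc (na (w0 @ w1))"
    unfolding w0_def w1_def WW_simps(3)[symmetric] split[symmetric] count_WW count_map_upt
    unfolding nosrc bal' by simp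
  note rotA = tr_rot_A[OF Q this]
  have exp1: "tr Q (w0 @ LA # w1) = (\<Sum>k\<in>{k\<in>{Suc j..<n}. f k = LB}.
        (1 - tt) * tt ^ e (Suc j) k * tr Q (WW (f(k := LO)) g' [0..<n]))
      + tt ^ e (Suc j) n * tr Q (w0 @ w1 @ [LA])"
  proof -
    have w0k: "w0 = WW (f(k := LO)) g' [0..<Suc j]" if "k \<in> {k\<in>{Suc j..<n}. f k = LB}" for k
      unfolding w0_def using that by (auto intro: WW_cong)
    have "PP 1 (w0 @ LA # w1) = PP 1 w0 * PP (stt 1 w0) (LA # WW f g' [Suc j..<n] @ [])"
      by (simp only: PP_append w1_def append_Nil2)
    also have "PP (stt 1 w0) (LA # WW f g' [Suc j..<n] @ [])
        = (\<Sum>k\<in>{k\<in>{Suc j..<n}. f k = LB}. smult ((1 - tt) * tt ^ e (Suc j) k)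
             (PP (stt 1 w0) (WW (f(k := LO)) g' [Suc j..<n] @ [])))
          + smult (tt ^ e (Suc j) n) (PP (stt 1 w0) (WW f g' [Suc j..<n] @ LA # []))"
      unfolding e_def by (rule PP_push) (use j fg' in auto)
    also have "PP 1 w0 * \<dots> = (\<Sum>k\<in>{k\<in>{Suc j..<n}. f k = LB}. smult ((1 - tt) * tt ^ e (Suc j) k)
             (PP 1 (w0 @ WW (f(k := LO)) g' [Suc j..<n])))
          + smult (tt ^ e (Suc j) n) (PP 1 (w0 @ w1 @ [LA]))"
      by (simp only: PP_append[of 1 w0] distrib_left sum_distrib_left mult_smult_right w1_def append_Nil2)
    finally have "tr Q (w0 @ LA # w1) = (\<Sum>k\<in>{k\<in>{Suc j..<n}. f k = LB}. ((1 - tt) * tt ^ e (Suc j) k)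
             * (tr Q (w0 @ WW (f(k := LO)) g' [Suc j..<n])))
          + (tt ^ e (Suc j) n) * (tr Q (w0 @ w1 @ [LA]))"
      by (simp only: tr_def Lam_add Lam_sum Lam_smult)
    moreover have "w0 @ WW (f(k := LO)) g' [Suc j..<n] = WW (f(k := LO)) g' [0..<n]"
      if "k \<in> {k\<in>{Suc j..<n}. f k = LB}" for k
      using w0k[OF that] unfolding split by simp
    ultimately show ?thesis by simp
  qed
  \<comment> \<open>The second half of the turn starts at column 0, after wrapping, and leads back
    to the original place behind column \<open>j\<close>.\<close>
  have exp2: "tr Q (LA # w0 @ w1) = (\<Sum>k\<in>{k\<in>{0..<Suc j}. f k = LB}.
        (1 - tt) * tt ^ e 0 k * tr Q (WW (f(k := LO)) g' [0..<n]))
      + tt ^ e 0 (Suc j) * tr Q (w0 @ LA # w1)"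
  proof -
    have "PP 1 (LA # WW f g' [0..<Suc j] @ w1)
        = (\<Sum>k\<in>{k\<in>{0..<Suc j}. f k = LB}. smult ((1 - tt) * tt ^ e 0 k)
             (PP 1 (WW (f(k := LO)) g' [0..<Suc j] @ w1)))
          + smult (tt ^ e 0 (Suc j)) (PP 1 (WW f g' [0..<Suc j] @ LA # w1))"
      unfolding e_def by (rule PP_push) (use j fg' in auto)
    then have "tr Q (LA # w0 @ w1) = (\<Sum>k\<in>{k\<in>{0..<Suc j}. f k = LB}. ((1 - tt) * tt ^ e 0 k)
             * (tr Q (WW (f(k := LO)) g' [0..<Suc j] @ w1)))
          + (tt ^ e 0 (Suc j)) * (tr Q (w0 @ LA # w1))"
      by (simp only: tr_def Lam_add Lam_sum Lam_smult w0_def)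
    moreover have "WW (f(k := LO)) g' [0..<Suc j] @ w1 = WW (f(k := LO)) g' [0..<n]"
      if "k \<in> {k\<in>{0..<Suc j}. f k = LB}" for k
    proof -
      have "w1 = WW (f(k := LO)) g' [Suc j..<n]" unfolding w1_def using that by (auto intro: WW_cong)
      then show ?thesis unfolding split by simp
    qed
    ultimately show ?thesis by simp
  qed
  let ?F = "{c. c < n \<and> f c \<noteq> LO}"
  have cardF: "card ?F = e (Suc j) n + e 0 (Suc j)"
  proof -
    have "?F = {c\<in>{Suc j..<n}. f c \<noteq> LO} \<union> {c\<in>{0..<Suc j}. f c \<noteq> LO}" using j by auto
    then have "card ?F = card ({c\<in>{Suc j..<n}. f c \<noteq> LO} \<union> {c\<in>{0..<Suc j}. f c \<noteq> LO})" by (rule arg_cong)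
    also have "\<dots> = e (Suc j) n + e 0 (Suc j)" unfolding e_def by (rule card_Un_disjoint) auto
    finally show ?thesis .
  qed
  have btw1: "card (?F \<inter> cyc_between n j k) = e (Suc j) k" if "j < k" "k < n" for k
    unfolding e_def cyc_between_def using that by (intro arg_cong[where f = card]) auto
  have btw2: "card (?F \<inter> cyc_between n j k) = e (Suc j) n + e 0 k" if "k \<le> j" for k
  proof -
    have "?F \<inter> cyc_between n j k = {c\<in>{Suc j..<n}. f c \<noteq> LO} \<union> {c\<in>{0..<k}. f c \<noteq> LO}"
      using that j by (auto simp: cyc_between_def)
    then have "card (?F \<inter> cyc_between n j k) = card ({c\<in>{Suc j..<n}. f c \<noteq> LO} \<union> {c\<in>{0..<k}. f c \<noteq> LO})"
      by (rule arg_cong)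
    also have "\<dots> = e (Suc j) n + e 0 k" unfolding e_def using that by (intro card_Un_disjoint) auto
    finally show ?thesis .
  qed
  let ?T = "\<lambda>k. tr Q (WW (f(k := LO)) g' [0..<n])"
  let ?t = "\<lambda>k. (1 - tt) * tt ^ card (?F \<inter> cyc_between n j k) * (if k \<le> j then Q else 1) * ?T k"
  have K: "{k. k < n \<and> f k = LB} = {k\<in>{Suc j..<n}. f k = LB} \<union> {k\<in>{0..<Suc j}. f k = LB}" using j by auto
  have "(\<Sum>k\<in>{k. k < n \<and> f k = LB}. ?t k)
      = (\<Sum>k\<in>{k\<in>{Suc j..<n}. f k = LB}. ?t k) + (\<Sum>k\<in>{k\<in>{0..<Suc j}. f k = LB}. ?t k)"
    unfolding K by (rule sum.union_disjoint) auto
  also have "(\<Sum>k\<in>{k\<in>{Suc j..<n}. f k = LB}. ?t k)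
      = (\<Sum>k\<in>{k\<in>{Suc j..<n}. f k = LB}. (1 - tt) * tt ^ e (Suc j) k * ?T k)"
    by (rule sum.cong) (auto simp: btw1)
  also have "(\<Sum>k\<in>{k\<in>{0..<Suc j}. f k = LB}. ?t k)
      = tt ^ e (Suc j) n * Q * (\<Sum>k\<in>{k\<in>{0..<Suc j}. f k = LB}. (1 - tt) * tt ^ e 0 k * ?T k)"
    unfolding sum_distrib_left by (rule sum.cong) (auto simp: btw2 power_add)
  finally have S: "(\<Sum>k\<in>{k. k < n \<and> f k = LB}. ?t k)
      = (\<Sum>k\<in>{k\<in>{Suc j..<n}. f k = LB}. (1 - tt) * tt ^ e (Suc j) k * ?T k)
        + tt ^ e (Suc j) n * Q * (\<Sum>k\<in>{k\<in>{0..<Suc j}. f k = LB}. (1 - tt) * tt ^ e 0 k * ?T k)" .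
  \<comment> \<open>The two half turns, joined by one use of twisted cyclicity, give a linear
    equation for the trace itself. Its coefficient is the source of the denominator in the weight of
    a strand.\<close>
  have "tr Q (w0 @ LA # w1) = (\<Sum>k\<in>{k. k < n \<and> f k = LB}. ?t k)
      + Q * tt ^ card ?F * tr Q (w0 @ LA # w1)"
  proof -
    have *: "x = s1 + a * y \<Longrightarrow> y = Q * z \<Longrightarrow> z = s2 + b * x \<Longrightarrow> x = s1 + a * Q * s2 + Q * (a * b) * x"
      for x y z s1 s2 a b :: qt by (metis (no_types, opaque_lifting) add.assoc distrib_left mult.assoc mult.left_commute)
    show ?thesis unfolding S cardF power_add
      by (rule *[OF exp1 _ exp2]) (use rotA in simp)
  qed
  then show ?thesis unfolding X g'_def[symmetric] by (simp add: algebra_simps)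
qed

section \<open>The weight of a classic layer and its exchange relation\<close>

definition "cA = [LO, LA]"
definition "cB = [LB, LO]"
definition "cD = [LD, LO]"
definition "cO = [LO, LO]"

text \<open>One column as seen by label \<open>a\<close>, with \<open>k\<close> above and
  \<open>b\<close> below: a strand starts (\<open>cA\<close>), a strand ends (\<open>cB\<close>), a
  ball still free when label \<open>a\<close> is placed gets crossed (\<open>cD\<close>), or nothing
  happens (\<open>cO\<close>). The last case covers a trivially paired column, an empty spot and a
  lower ball already matched by a larger label.\<close>

definition ccol :: "nat \<Rightarrow> nat \<Rightarrow> nat \<Rightarrow> ltr list" where
  "ccol a k b = (if k = a \<and> b \<noteq> a then cA else if b = a \<and> k \<noteq> a then cB
     else if b \<noteq> 0 \<and> b < a then cD else cO)"

fun cword :: "nat \<Rightarrow> nat list \<Rightarrow> nat list \<Rightarrow> ltr list" where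
  "cword a (k # ks) (b # bs) = ccol a k b @ cword a ks bs"
| "cword a _ _ = []"

definition ok :: "nat \<Rightarrow> nat \<Rightarrow> bool" where
  "ok k b \<longleftrightarrow> b = 0 \<or> k \<le> b"

text \<open>The layer between row \<open>r+1\<close> and row \<open>r'\<close>. The index is that of
  the lower row, so the exponent of \<open>q\<close> in a strand weight is \<open>a - r\<close>
  here. Label \<open>r\<close> occurs only below and carries no strand.\<close>

definition CC :: "nat \<Rightarrow> nat \<Rightarrow> nat list \<Rightarrow> nat list \<Rightarrow> qt" where
  "CC r L ks bs = (if list_all2 ok ks bs then \<Prod>a\<in>{r+1..L}. cc (qq ^ (a - r)) (cword a ks bs) else 0)"

lemma cword_append:
  "length k1 = length b1 \<Longrightarrow> cword a (k1 @ k2) (b1 @ b2) = cword a k1 b1 @ cword a k2 b2"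
  by (induction k1 b1 rule: list_induct2) simp_all

text \<open>An empty spot below counts as larger than every label.\<close>

definition gtz :: "nat \<Rightarrow> nat \<Rightarrow> bool" where
  "gtz b b' \<longleftrightarrow> b' \<noteq> 0 \<and> (b = 0 \<or> b' < b)"

definition eps :: "nat \<Rightarrow> qt" where "eps b = (if b = 0 then tt else 1)"

text \<open>\<open>T_i\<close> acts on a family indexed by rows with coefficient \<open>th1\<close>
  at the same row and \<open>th2\<close> at the row with two parts exchanged: (0, 1) at a descent,
  (t, 0) at equal parts, and at an ascent (t - 1, t), which the quadratic relation forces.\<close>

definition th1 :: "nat \<Rightarrow> nat \<Rightarrow> qt" where
  "th1 k k' = (if k' < k then 0 else if k = k' then tt else tt - 1)"

definition th2 :: "nat \<Rightarrow> nat \<Rightarrow> qt" where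
  "th2 k k' = (if k' < k then 1 else if k = k' then 0 else tt)"

text \<open>The analogous action on the lower row of a classic layer, with an empty spot as the
  largest label. Exchanging an empty spot with a ball to its right brings the extra factor
  \<open>eps\<close>.\<close>

definition tz1 :: "nat \<Rightarrow> nat \<Rightarrow> qt" where
  "tz1 b b' = (if gtz b b' then 0 else if b = b' then tt else tt - 1)"

definition tz2 :: "nat \<Rightarrow> nat \<Rightarrow> qt" where
  "tz2 b b' = (if gtz b b' then eps b else if b = b' then 0 else tt / eps b')"

lemma eps_nz [simp]: "eps b \<noteq> 0" by (simp add: eps_def)

lemma tr_LO_gaps: "tr Q (U @ x # LO # V) = tr Q (U @ x # V)"
  "tr Q (U @ x # y # LO # V) = tr Q (U @ x # y # V)"
  "tr Q (U @ x # y # z # LO # V) = tr Q (U @ x # y # z # V)"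
  using tr_LO(1)[of Q "U @ [x]" V] tr_LO(1)[of Q "U @ [x, y]" V] tr_LO(1)[of Q "U @ [x, y, z]" V]
  by simp_all

lemma cc_cO: "cc Q (U @ cO @ X @ V) = cc Q (U @ X @ cO @ V)"
  using tr_LO(1)[of Q U "LO # X @ V"] tr_LO(1)[of Q U "X @ V"]
    tr_LO(1)[of Q "U @ X" "LO # V"] tr_LO(1)[of Q "U @ X" V]
  by (simp add: cc_def cO_def)

lemmas cc_cO_simps = cc_cO[where X = cA] cc_cO[where X = cB] cc_cO[where X = cD]

lemma cc_AD: "cc Q (U @ cA @ cD @ V) = tt * cc Q (U @ cD @ cA @ V)"
  by (simp add: cc_def cA_def cD_def tr_LO_gaps tr_AD)

lemma cc_DB: "cc Q (U @ cD @ cB @ V) = tt * cc Q (U @ cB @ cD @ V)"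
  by (simp add: cc_def cB_def cD_def tr_LO_gaps tr_DB)

lemma cc_AB: "cc Q (U @ cA @ cB @ V)
    = tt * cc Q (U @ cB @ cA @ V) + (1 - tt) * cc Q (U @ cO @ cO @ V)"
  by (simp add: cc_def cA_def cB_def cO_def tr_LO_gaps tr_AB algebra_simps)

lemma ccolA: "b \<noteq> a \<Longrightarrow> ccol a a b = cA"
  and ccolB: "k \<noteq> a \<Longrightarrow> ccol a k a = cB"
  and ccolD: "k \<noteq> a \<Longrightarrow> b \<noteq> 0 \<Longrightarrow> b < a \<Longrightarrow> ccol a k b = cD"
  and ccolO: "k \<noteq> a \<Longrightarrow> b = 0 \<or> a < b \<Longrightarrow> 1 \<le> a \<Longrightarrow> ccol a k b = cO"
  and ccolO': "ccol a a a = cO"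
  by (auto simp: ccol_def)

text \<open>For a single label the two columns nearly always commute, because they are equal or one
  of them is \<open>cO\<close>. Only label \<open>b\<close> puts \<open>cD\<close> next to
  \<open>cB\<close> and yields \<open>t\<close>.\<close>

lemma ccol_swap:
  assumes "gtz b b'" "k' \<le> k" "k \<le> b'" "1 \<le> a"
  shows "cc Q (U @ ccol a k b' @ ccol a k' b @ V)
    = (if a = b then tt else 1) * cc Q (U @ ccol a k' b @ ccol a k b' @ V)"
proof -
  have b': "b' \<noteq> 0" "b \<noteq> 0 \<Longrightarrow> b' < b" using assms(1) by (auto simp: gtz_def)
  consider "a = b" | "b \<noteq> 0" "b < a" | "a \<noteq> b" "b = 0 \<or> a < b" "a = k'" | "a \<noteq> b" "b = 0 \<or> a < b" "a \<noteq> k'"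
    by linarith
  then show ?thesis
  proof cases
    case 1
    then have "ccol a k b' = cD" "ccol a k' b = cB" using assms b' by (auto intro!: ccolD ccolB)
    then show ?thesis using 1 cc_DB by simp
  next
    case 2
    then have "ccol a k b' = cD" "ccol a k' b = cD" using assms b' by (auto intro!: ccolD)
    then show ?thesis using 2 by simp
  next
    case 3
    have X: "ccol a k' b = cA" using 3 by (auto intro: ccolA)
    have "ccol a k b' = cA \<or> ccol a k b' = cO"
      using 3 assms by (cases "k = a"; cases "b' = a") (auto simp: ccolA ccolO' intro!: ccolO)
    then show ?thesis using 3(1) X cc_cO by auto
  next
    case 4
    have "ccol a k' b = cO" using 4 assms by (auto intro!: ccolO)
    then show ?thesis using 4(1) cc_cO by simp
  qed
qed

lemma ccol_swap_le:
  assumes "gtz b b'" "k' < k" "k \<le> b'" "1 \<le> a" "a \<noteq> k \<or> k < b'"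
  shows "cc Q (U @ ccol a k b @ ccol a k' b' @ V) = cc Q (U @ ccol a k' b @ ccol a k b' @ V)"
    and "cc Q (U @ ccol a k' b' @ ccol a k b @ V)
      = (if a = b then tt else 1) * cc Q (U @ ccol a k' b @ ccol a k b' @ V)"
proof -
  have b': "b' \<noteq> 0" "b \<noteq> 0 \<Longrightarrow> b' < b" using assms(1) by (auto simp: gtz_def)
  consider "a = b" | "b \<noteq> 0" "b < a" | "a \<noteq> b" "b = 0 \<or> a < b" "a = k'"
    | "a \<noteq> b" "b = 0 \<or> a < b" "a = k" | "a \<noteq> b" "b = 0 \<or> a < b" "a \<noteq> k'" "a \<noteq> k"
    by linarith
  then have "cc Q (U @ ccol a k b @ ccol a k' b' @ V) = cc Q (U @ ccol a k' b @ ccol a k b' @ V) \<and>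
    cc Q (U @ ccol a k' b' @ ccol a k b @ V)
      = (if a = b then tt else 1) * cc Q (U @ ccol a k' b @ ccol a k b' @ V)"
  proof cases
    case 1
    then have "ccol a k b = cB" "ccol a k' b = cB" "ccol a k b' = cD" "ccol a k' b' = cD"
      using assms b' by (auto intro!: ccolD ccolB)
    then show ?thesis using 1 cc_DB by simp
  next
    case 2
    then have "ccol a k b = cD" "ccol a k' b = cD" "ccol a k b' = cD" "ccol a k' b' = cD"
      using assms b' by (auto intro!: ccolD)
    then show ?thesis using 2 by simp
  next
    case 3
    have "ccol a k b = cO" "ccol a k b' = cO" using 3 assms by (auto intro!: ccolO)
    moreover have "ccol a k' b = cA" "ccol a k' b' = cA" using 3 assms by (auto intro!: ccolA)
    ultimately show ?thesis using 3(1) cc_cO by simp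
  next
    case 4
    have "ccol a k' b = cO" "ccol a k' b' = cO" using 4 assms by (auto intro!: ccolO)
    moreover have "ccol a k b = cA" "ccol a k b' = cA" using 4 assms by (auto intro!: ccolA)
    ultimately show ?thesis using 4(1) cc_cO by simp
  next
    case 5
    have "ccol a k b = cO" "ccol a k' b = cO" using 5 assms by (auto intro!: ccolO)
    moreover have "ccol a k b' = ccol a k' b'" using 5 by (simp add: ccol_def)
    ultimately show ?thesis using 5(1) cc_cO by simp
  qed
  then show "cc Q (U @ ccol a k b @ ccol a k' b' @ V) = cc Q (U @ ccol a k' b @ ccol a k b' @ V)"
    "cc Q (U @ ccol a k' b' @ ccol a k b @ V)
      = (if a = b then tt else 1) * cc Q (U @ ccol a k' b @ ccol a k b' @ V)" by auto
qed

text \<open>The one situation that needs the inhomogeneous relation for \<open>AB\<close>: strands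
  of label \<open>k\<close> start in one column and end in the next.\<close>

lemma ccol_swap_eq:
  assumes "gtz b k" "k' < k"
  shows "cc Q (U @ ccol k k b @ ccol k k' k @ V)
      = tt * cc Q (U @ ccol k k' k @ ccol k k b @ V)
        + (1 - tt) * cc Q (U @ ccol k k' b @ ccol k k k @ V)"
proof -
  have "ccol k k b = cA" "ccol k k' k = cB" "ccol k k' b = cO" "ccol k k k = cO"
    using assms by (auto simp: gtz_def intro!: ccolA ccolB ccolO ccolO')
  then show ?thesis by (simp add: cc_AB)
qed

text \<open>Since \<open>k\<close> exceeds \<open>b'\<close> and cannot stand above it, the columns
  are exchanged as a whole. Label \<open>k\<close> then sees \<open>cA\<close> against
  \<open>cD\<close>, label \<open>b\<close> sees \<open>cD\<close> against
  \<open>cB\<close>.\<close>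

lemma ccol_swap_gt:
  assumes "gtz b b'" "k' < k" "b' < k" "ok k b" "1 \<le> a"
  shows "(if a = b \<and> k \<noteq> b then tt else 1) * cc Q (U @ ccol a k b @ ccol a k' b' @ V)
    = (if a = k \<and> k \<noteq> b then tt else 1) * cc Q (U @ ccol a k' b' @ ccol a k b @ V)"
proof -
  have b': "b' \<noteq> 0" "b \<noteq> 0 \<Longrightarrow> b' < b" using assms(1) by (auto simp: gtz_def)
  have kb: "b \<noteq> 0 \<Longrightarrow> k \<le> b" using assms(4) by (auto simp: ok_def)
  consider "a = b" "k \<noteq> b" | "a = b" "k = b" | "b \<noteq> 0" "b < a" | "a \<noteq> b" "b = 0 \<or> a < b" "a = k"
    | "a \<noteq> b" "b = 0 \<or> a < b" "a \<noteq> k"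
    by linarith
  then show ?thesis
  proof cases
    case 1
    then have "ccol a k b = cB" "ccol a k' b' = cD" using assms b' kb by (auto intro!: ccolD ccolB)
    then show ?thesis using 1 cc_DB by simp
  next
    case 2
    then have "ccol a k b = cO" by (simp add: ccolO')
    then show ?thesis using 2 cc_cO by simp
  next
    case 3
    then have "ccol a k b = cD" "ccol a k' b' = cD" using assms b' kb by (auto intro!: ccolD)
    then show ?thesis using 3 kb by simp
  next
    case 4
    then have "ccol a k b = cA" "ccol a k' b' = cD" using assms b' kb by (auto intro!: ccolA ccolD)
    then show ?thesis using 4 cc_AD by simp
  next
    case 5
    then have "ccol a k b = cO" using assms by (auto intro!: ccolO)
    then show ?thesis using 5 cc_cO by simp
  qed
qed

lemma ccol_swap_same:
  assumes "k \<le> b \<or> b = 0" "k' \<le> b \<or> b = 0" "1 \<le> a"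
  shows "cc Q (U @ ccol a k' b @ ccol a k b @ V) = cc Q (U @ ccol a k b @ ccol a k' b @ V)"
proof -
  consider "a = b" | "b \<noteq> 0" "b < a" | "a \<noteq> b" "b = 0 \<or> a < b" by linarith
  then show ?thesis
  proof cases
    case 1
    have "ccol a x b = cB \<or> ccol a x b = cO" for x
      using 1 by (cases "x = a") (auto simp: ccolB ccolO')
    then show ?thesis using cc_cO by metis
  next
    case 2
    then have "ccol a k b = cD" "ccol a k' b = cD" using assms by (auto intro!: ccolD)
    then show ?thesis by simp
  next
    case 3
    have "ccol a x b = cA \<or> ccol a x b = cO" for x
      using 3 assms by (cases "x = a") (auto intro!: ccolA ccolO)
    then show ?thesis using cc_cO by metis
  qed
qed

text \<open>The layer weight intertwines the two Hecke actions: on the upper row labels compare as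
  usual, on the lower row an empty spot is the largest label.\<close>

lemma CC_exchange:
  assumes len: "length k1 = length b1" "length k2 = length b2"
    and rng: "k \<in> insert 0 {r+1..L}" "k' \<in> insert 0 {r+1..L}" "b \<in> insert 0 {r..L}" "b' \<in> insert 0 {r..L}"
    and r: "1 \<le> r" and ge: "gtz b b' \<or> b = b'"
  shows "CC r L (k1 @ [k, k'] @ k2) (b1 @ [b, b'] @ b2) * th1 k k'
      + CC r L (k1 @ [k', k] @ k2) (b1 @ [b, b'] @ b2) * th2 k' k
    = (if b = b' then tt else eps b) * CC r L (k1 @ [k, k'] @ k2) (b1 @ [b', b] @ b2)"
proof -
  define D where "D a x y z w = cc (qq ^ (a - r)) (cword a k1 b1 @ ccol a x z @ ccol a y w @ cword a k2 b2)"
    for a x y z w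
  define OK0 where "OK0 \<longleftrightarrow> list_all2 ok k1 b1 \<and> list_all2 ok k2 b2"
  define P where "P x y z w = (\<Prod>a\<in>{r+1..L}. D a x y z w)" for x y z w
  have CC: "CC r L (k1 @ [x, y] @ k2) (b1 @ [z, w] @ b2)
      = (if OK0 \<and> ok x z \<and> ok y w then P x y z w else 0)" for x y z w
    using len unfolding CC_def P_def D_def OK0_def
    by (simp add: cword_append list_all2_append)
  have pd: "(\<Prod>a\<in>{r+1..L}. if a = c then tt else 1) = (if c \<in> {r+1..L} then tt else 1)" for c
    by (simp add: prod.delta)
  have mh: "x = c * y \<Longrightarrow> c * e = d \<Longrightarrow> e * x = d * y" for x y c e d :: qt
    by (simp add: mult_ac)
  show ?thesis
  proof (cases "b = b'")
    case True
    have P: "P k' k b b = P k k' b b" if "ok k b" "ok k' b"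
      unfolding P_def D_def by (rule prod.cong) (use that r in \<open>auto simp: ok_def intro!: ccol_swap_same\<close>)
    show ?thesis unfolding CC using True P
      by (auto simp: th1_def th2_def algebra_simps)
  next
    case False
    then have g: "gtz b b'" using ge by simp
    have b1: "b \<noteq> 0 \<Longrightarrow> b \<in> {r+1..L}" using g rng(3,4) by (auto simp: gtz_def)
    \<comment> \<open>If \<open>b\<close> is an empty spot no label supplies the factor
      \<open>t\<close>, and \<open>eps b\<close> makes up for it.\<close>
    have pb: "(\<Prod>a\<in>{r+1..L}. if a = b then tt else 1) * eps b = tt"
      unfolding pd eps_def using b1 by auto
    have sw: "P x y b' b = (\<Prod>a\<in>{r+1..L}. if a = b then tt else 1) * P y x b b'"
      if "y \<le> x" "x \<le> b'" for x y
      unfolding P_def D_def prod.distrib[symmetric]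
      by (rule prod.cong) (use that r ccol_swap[OF g] in auto)
    have swE: "eps b * P x y b' b = tt * P y x b b'" if "y \<le> x" "x \<le> b'" for x y
      by (rule mh[OF sw[OF that] pb])
    have okb: "ok x b" if "ok x b'" for x using that g by (auto simp: ok_def gtz_def)
    have okb': "ok x b' \<longleftrightarrow> x \<le> b'" for x using g by (auto simp: ok_def gtz_def)
    consider "k' < k" | "k = k'" | "k < k'" by linarith
    then show ?thesis
    proof cases
      case 1
      then show ?thesis
        unfolding CC using False swE[of k' k] okb[of k] okb[of k'] okb'[of k] okb'[of k']
        by (auto simp: th1_def th2_def mult.commute)
    next
      case 2
      then show ?thesis
        unfolding CC using False swE[of k k] okb[of k] okb'[of k]
        by (auto simp: th1_def th2_def mult.commute)
    next
      case 3
      \<comment> \<open>The larger upper label \<open>k'\<close> is compared with \<open>b'\<close>.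
        If it is smaller, columns commute up to powers of \<open>t\<close> for every label; at
        equality this one label uses the relation for \<open>AB\<close>; if it is larger, one of the
        three terms is inadmissible and the other two are proportional.\<close>
      have main: "(tt - 1) * (if k' \<le> b' then P k k' b b' else 0) + P k' k b b' = eps b * P k k' b' b"
        if ok: "ok k' b" "k \<le> b'"
      proof -
        consider "k' < b'" | "k' = b'" | "b' < k'" by linarith
        then show ?thesis
        proof cases
          case 1
          have "P k' k b b' = P k k' b b'" unfolding P_def D_def
            by (rule prod.cong) (use r 1 ccol_swap_le(1)[OF g 3] in auto)
          moreover have "P k k' b' b = (\<Prod>a\<in>{r+1..L}. if a = b then tt else 1) * P k k' b b'"
            unfolding P_def D_def prod.distrib[symmetric]
            by (rule prod.cong) (use r 1 ccol_swap_le(2)[OF g 3] in auto)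
          from mh[OF this pb] have "eps b * P k k' b' b = tt * P k k' b b'" .
          ultimately show ?thesis using 1 by (simp add: algebra_simps)
        next
          case 2
          have k': "k' \<in> {r+1..L}" using rng 3 by auto
          have kb: "k' \<noteq> b" using 2 g by (auto simp: gtz_def)
          have rem: "P x y z w = D k' x y z w * (\<Prod>a\<in>{r+1..L}-{k'}. D a x y z w)" for x y z w
            unfolding P_def by (rule prod.remove) (use k' in auto)
          have pb': "(\<Prod>a\<in>{r+1..L}-{k'}. if a = b then tt else 1) * eps b = tt"
            using pb prod.remove[OF _ k', of "\<lambda>a. if a = b then tt else 1"] kb by simp
          define R where "R = (\<Prod>a\<in>{r+1..L}-{k'}. D a k k' b b')"
          have R1: "(\<Prod>a\<in>{r+1..L}-{k'}. D a k' k b b') = R"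
            unfolding R_def D_def by (rule prod.cong) (use r 2 ccol_swap_le(1)[OF g 3] in auto)
          have "(\<Prod>a\<in>{r+1..L}-{k'}. D a k k' b' b)
              = (\<Prod>a\<in>{r+1..L}-{k'}. if a = b then tt else 1) * R"
            unfolding R_def D_def prod.distrib[symmetric]
            by (rule prod.cong) (use r 2 ccol_swap_le(2)[OF g 3] in auto)
          from mh[OF this pb'] have R2: "eps b * (\<Prod>a\<in>{r+1..L}-{k'}. D a k k' b' b) = tt * R" .
          have "gtz b k'" using g 2 by simp
          from ccol_swap_eq[OF this 3]
          have d: "D k' k' k b b' = tt * D k' k k' b' b + (1 - tt) * D k' k k' b b'"
            unfolding D_def 2[symmetric] .
          have "eps b * P k k' b' b = D k' k k' b' b * (tt * R)"
            unfolding rem by (simp only: mult.left_commute[of "eps b"] R2)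
          moreover have "P k' k b b' = (tt * D k' k k' b' b + (1 - tt) * D k' k k' b b') * R"
            unfolding rem R1 d ..
          moreover have "P k k' b b' = D k' k k' b b' * R" unfolding rem R_def ..
          ultimately show ?thesis using 2 by (simp add: algebra_simps)
        next
          case b3: 3
          have "(\<Prod>a\<in>{r+1..L}. if a = b \<and> k' \<noteq> b then tt else 1) * P k' k b b'
            = (\<Prod>a\<in>{r+1..L}. if a = k' \<and> k' \<noteq> b then tt else 1) * P k k' b' b"
            unfolding P_def D_def prod.distrib[symmetric]
            by (rule prod.cong) (use r ccol_swap_gt[OF g 3 b3 ok(1)] in auto)
          moreover have "k' \<in> {r+1..L}" using rng 3 by auto
          ultimately have "P k' k b b' = eps b * P k k' b' b"
            using b1 by (cases "k' = b") (auto simp: eps_def pd)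
          then show ?thesis using b3 by simp
        qed
      qed
      have k0: "k \<le> b'" if "k' \<le> b'" using that 3 by simp
      show ?thesis
        unfolding CC using False 3 main okb[of k] okb[of k'] okb'[of k] okb'[of k'] k0
        by (auto simp: th1_def th2_def mult.commute)
    qed
  qed
qed

lemma count_list_mset: "count_list xs a = count (mset xs) a"
  by (induction xs) auto

lemma gtz_cases: "gtz b b' \<or> b = b' \<or> (gtz b' b \<and> \<not> gtz b b' \<and> b \<noteq> b')"
  by (cases "b = 0"; cases "b' = 0") (auto simp: gtz_def)

lemma cword_counts:
  assumes "length ks = length bs"
  shows "na (cword a ks bs) + count_list (zip ks bs) (a, a) = count_list ks a"
    and "nb (cword a ks bs) + count_list (zip ks bs) (a, a) = count_list bs a"
  using assms by (induction ks bs rule: list_induct2)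
    (auto simp: ccol_def cA_def cB_def cD_def cO_def)

text \<open>Only a column that starts or ends a strand alters the number of strands crossing the
  seam, and it pays \<open>Q\<close>. The balance of starts and ends is what twisted cyclicity
  requires of the remaining word.\<close>

lemma cc_rot:
  assumes Q: "\<And>k. 1 - Q * tt ^ k \<noteq> 0" and bal: "na (ccol a k b @ w) = nb (ccol a k b @ w)"
  shows "(if a = k \<and> k \<noteq> b then Q else 1) * cc Q (ccol a k b @ w)
    = (if a = b \<and> k \<noteq> b then Q else 1) * cc Q (w @ ccol a k b)"
proof -
  have o: "tr Q (x # LO # w) = tr Q (x # w)" "tr Q (w @ [LO, x]) = tr Q (w @ [x])"
    "tr Q (w @ [x, LO]) = tr Q (w @ [x])" "tr Q (w @ [LO]) = tr Q w" for x
    using tr_LO(1)[of Q "[x]" w] tr_LO(1)[of Q "w" "[x]"] tr_LO(1)[of Q "w @ [x]" "[]"] tr_LO(1)[of Q "w" "[]"]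
    by auto
  consider "a = k" "b \<noteq> a" | "a \<noteq> k" "b = a" | "a \<noteq> k" "b \<noteq> a" "b \<noteq> 0" "b < a" | "ccol a k b = cO" "a = k \<longleftrightarrow> a = b"
    by (cases "a = k"; cases "b = a"; cases "b \<noteq> 0 \<and> b < a") (auto simp: ccol_def)
  then show ?thesis
  proof cases
    case 1
    then have c: "ccol a k b = [LO, LA]" by (simp add: ccol_def cA_def)
    then have "nb w = Suc (na w)" using bal by simp
    from tr_rot_A[OF Q this] show ?thesis using 1 unfolding c by (simp add: cc_def o)
  next
    case 2
    then have c: "ccol a k b = [LB, LO]" by (simp add: ccol_def cB_def)
    then have "na w = Suc (nb w)" using bal by simp
    from tr_rot_B[OF Q this] show ?thesis using 2 unfolding c by (simp add: cc_def o)
  next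
    case 3
    then have c: "ccol a k b = [LD, LO]" by (simp add: ccol_def cD_def)
    then have "na w = nb w" using bal by simp
    from tr_rot_Lin[OF this, of Q 0 1] show ?thesis using 3 unfolding c by (simp add: cc_def o)
  next
    case 4
    then show ?thesis by (auto simp: cO_def cc_def o)
  qed
qed

lemma CC_rot:
  assumes len: "length ks = length bs" and r: "1 \<le> r"
    and rng: "k \<in> insert 0 {r+1..L}" "b \<in> insert 0 {r..L}"
    and cnt: "\<And>a. a \<in> {r+1..L} \<Longrightarrow> count_list (k # ks) a = count_list (b # bs) a"
  shows "qq ^ (k - r) * CC r L (k # ks) (b # bs) = qq ^ (b - r) * CC r L (ks @ [k]) (bs @ [b])"
proof (cases "list_all2 ok ks bs \<and> ok k b")
  case False
  then show ?thesis using len by (auto simp: CC_def list_all2_append)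
next
  case True
  let ?f = "\<lambda>c a. if a = c \<and> k \<noteq> b then qq ^ (a - r) else 1"
  have lab: "?f k a * cc (qq ^ (a - r)) (cword a (k # ks) (b # bs))
      = ?f b a * cc (qq ^ (a - r)) (cword a (ks @ [k]) (bs @ [b]))" if a: "a \<in> {r+1..L}" for a
  proof -
    have "na (cword a (k # ks) (b # bs)) = nb (cword a (k # ks) (b # bs))"
      using cword_counts[of "k # ks" "b # bs" a] len cnt[OF a] by simp
    then have "na (ccol a k b @ cword a ks bs) = nb (ccol a k b @ cword a ks bs)" by simp
    moreover have "1 - qq ^ (a - r) * tt ^ j \<noteq> 0" for j using a by (intro one_minus_qt_nz) auto
    ultimately show ?thesis
      using cc_rot[of "qq ^ (a - r)" a k b "cword a ks bs"] len by (simp add: cword_append)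
  qed
  \<comment> \<open>For \<open>k = b\<close> the column is trivially paired and the two factors
    cancel. Labels 0 and \<open>r\<close> have exponent 0 by truncated subtraction, in agreement
    with their carrying no strand.\<close>
  have pf: "prod (?f c) {r+1..L} = (if k \<noteq> b then qq ^ (c - r) else 1)"
    if "c \<in> insert 0 {r..L}" for c
  proof (cases "c \<in> {r+1..L}")
    case True
    then show ?thesis by (cases "k = b") (auto simp: prod.delta)
  next
    case False
    then have "c - r = 0" using that by auto
    moreover have "prod (?f c) {r+1..L} = 1" by (rule prod.neutral) (use False in auto)
    ultimately show ?thesis by simp
  qed
  have "prod (?f k) {r+1..L} * CC r L (k # ks) (b # bs) = prod (?f b) {r+1..L} * CC r L (ks @ [k]) (bs @ [b])"
    using True len lab
    by (simp only: CC_def list_all2_append list_all2_Cons list_all2_Nil if_True prod.distrib[symmetric]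
        simp_thms list.rel_inject) (auto intro!: prod.cong)
  then show ?thesis using pf[of k] pf[of b] rng by (cases "k = b") auto
qed

section \<open>Families indexed by rows: Hecke and rotation equations through a classic
  layer\<close>

definition sp :: "nat \<Rightarrow> 'a list \<Rightarrow> 'a list" where
  "sp i xs = xs[i := xs ! Suc i, Suc i := xs ! i]"

lemma sp_append [simp]: "sp (length u) (u @ a # b # v) = u @ b # a # v"
  by (simp add: sp_def nth_append list_update_append)

lemma split_pair:
  assumes "Suc i < length xs"
  obtains u a b v where "xs = u @ a # b # v" "length u = i"
proof
  show "xs = take i xs @ xs ! i # xs ! Suc i # drop (Suc (Suc i)) xs"
    using assms by (metis Cons_nth_drop_Suc Suc_lessD append_take_drop_id)
  show "length (take i xs) = i" using assms by simp
qed

lemma mset_sp: "Suc i < length xs \<Longrightarrow> mset (sp i xs) = mset xs"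
  by (erule split_pair) (use sp_append in auto)

lemma length_sp [simp]: "length (sp i xs) = length xs" by (simp add: sp_def)

lemma sp_sp: "Suc i < length xs \<Longrightarrow> sp i (sp i xs) = xs"
  by (erule split_pair) (use sp_append in auto)

lemma nth_sp: "Suc i < length xs \<Longrightarrow> sp i xs ! i = xs ! Suc i" "Suc i < length xs \<Longrightarrow> sp i xs ! Suc i = xs ! i"
  by (simp_all add: sp_def)

definition arr :: "'a multiset \<Rightarrow> 'a list set" where
  "arr M = {xs. mset xs = M}"

lemma finite_arr: "finite (arr M)"
proof -
  have "arr M \<subseteq> {xs. set xs \<subseteq> set_mset M \<and> length xs = size M}"
    by (auto simp: arr_def)
  then show ?thesis by (rule finite_subset) (simp add: finite_lists_length_eq)
qed

lemma arr_length: "xs \<in> arr M \<Longrightarrow> length xs = size M"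
  by (auto simp: arr_def)

lemma sp_arr: "xs \<in> arr M \<Longrightarrow> Suc i < size M \<Longrightarrow> sp i xs \<in> arr M"
  by (auto simp: arr_def mset_sp)

definition hecke_fam :: "nat \<Rightarrow> nat list set \<Rightarrow> (nat \<Rightarrow> nat \<Rightarrow> qt) \<Rightarrow> (nat \<Rightarrow> nat \<Rightarrow> qt) \<Rightarrow> (nat list \<Rightarrow> fn) \<Rightarrow> bool" where
  "hecke_fam n S t1 t2 G \<longleftrightarrow> (\<forall>xs\<in>S. \<forall>i. Suc i < n \<longrightarrow>
     TT i (G xs) = (\<lambda>v. t1 (xs ! i) (xs ! Suc i) * G xs v + t2 (xs ! i) (xs ! Suc i) * G (sp i xs) v))"

lemma sum_sp: "Suc i < size M \<Longrightarrow> (\<Sum>x\<in>arr M. f (sp i x)) = (\<Sum>x\<in>arr M. f x)"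
  by (rule sum.reindex_bij_witness[of _ "sp i" "sp i"]) (auto simp: sp_arr sp_sp arr_length)

text \<open>Summation by parts: reindexing by \<open>sp i\<close> moves the action of
  \<open>T_i\<close> from the family to the coefficients.\<close>

lemma hecke_sum:
  assumes G: "hecke_fam n (arr M) t1 t2 G" and n: "size M = n" "Suc i < n"
  shows "TT i (\<lambda>v. \<Sum>x\<in>arr M. c x * G x v)
    = (\<lambda>v. \<Sum>x\<in>arr M. (c x * t1 (x ! i) (x ! Suc i) + c (sp i x) * t2 (x ! Suc i) (x ! i)) * G x v)"
proof -
  have "TT i (\<lambda>v. \<Sum>x\<in>arr M. c x * G x v) = (\<lambda>v. \<Sum>x\<in>arr M. c x * TT i (G x) v)"
    by (simp add: TT_sum finite_arr TT_cmult)
  also have "\<dots> = (\<lambda>v. (\<Sum>x\<in>arr M. c x * t1 (x ! i) (x ! Suc i) * G x v)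
      + (\<Sum>x\<in>arr M. c x * t2 (x ! i) (x ! Suc i) * G (sp i x) v))"
    using G n unfolding hecke_fam_def by (auto simp: fun_eq_iff sum.distrib[symmetric] algebra_simps intro!: sum.cong)
  also have "\<dots> = (\<lambda>v. (\<Sum>x\<in>arr M. c x * t1 (x ! i) (x ! Suc i) * G x v)
      + (\<Sum>x\<in>arr M. c (sp i x) * t2 (x ! Suc i) (x ! i) * G x v))"
  proof
    fix v
    have "(\<Sum>x\<in>arr M. c x * t2 (x ! i) (x ! Suc i) * G (sp i x) v)
      = (\<Sum>x\<in>arr M. c (sp i (sp i x)) * t2 (sp i x ! Suc i) (sp i x ! i) * G (sp i x) v)"
      by (rule sum.cong) (use n in \<open>auto simp: arr_length sp_sp nth_sp\<close>)
    also have "\<dots> = (\<Sum>x\<in>arr M. c (sp i x) * t2 (x ! Suc i) (x ! i) * G x v)"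
      by (rule sum_sp) (use n in simp)
    finally show "(\<Sum>x\<in>arr M. c x * t1 (x ! i) (x ! Suc i) * G x v)
      + (\<Sum>x\<in>arr M. c x * t2 (x ! i) (x ! Suc i) * G (sp i x) v) =
      (\<Sum>x\<in>arr M. c x * t1 (x ! i) (x ! Suc i) * G x v)
      + (\<Sum>x\<in>arr M. c (sp i x) * t2 (x ! Suc i) (x ! i) * G x v)" by simp
  qed
  finally show ?thesis by (simp add: sum.distrib distrib_right)
qed

lemma TT_flip:
  assumes "TT i f = (\<lambda>v. e * g v)" "e \<noteq> 0"
  shows "TT i g = (\<lambda>v. (tt - 1) * g v + tt / e * f v)"
proof
  fix v
  have "e * TT i g v = (tt - 1) * (e * g v) + tt * f v"
    using TT_quad[of i f v] unfolding assms(1) TT_cmult .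
  then show "TT i g v = (tt - 1) * g v + tt / e * f v" using assms(2) by (simp add: field_simps)
qed

definition hh :: "nat \<Rightarrow> nat \<Rightarrow> nat multiset \<Rightarrow> (nat list \<Rightarrow> fn) \<Rightarrow> nat list \<Rightarrow> fn" where
  "hh r L M G bs = (\<lambda>v. \<Sum>ks\<in>arr M. CC r L ks bs * G ks v)"

text \<open>The exchange relation carries the action from the upper row to the lower one. It covers
  descents and equal entries in the order with 0 on top; ascents follow by the quadratic
  relation.\<close>

lemma hh_hecke:
  assumes G: "hecke_fam n (arr M1) th1 th2 G"
    and n: "size M1 = n" "size M0 = n" and r: "1 \<le> r"
    and M1: "set_mset M1 \<subseteq> insert 0 {r+1..L}" and M0: "set_mset M0 \<subseteq> insert 0 {r..L}"
  shows "hecke_fam n (arr M0) tz1 tz2 (hh r L M1 G)"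
proof -
  have main: "TT i (hh r L M1 G bs) = (\<lambda>v. (if bs ! i = bs ! Suc i then tt else eps (bs ! i)) * hh r L M1 G (sp i bs) v)"
    if bs: "bs \<in> arr M0" and i: "Suc i < n" and ge: "gtz (bs ! i) (bs ! Suc i) \<or> bs ! i = bs ! Suc i" for bs i
  proof -
    have "Suc i < length bs" using bs i n arr_length by metis
    then obtain b1 b b' b2 where B: "bs = b1 @ b # b' # b2" "length b1 = i" by (rule split_pair)
    have bb: "bs ! i = b" "bs ! Suc i = b'" "sp i bs = b1 @ b' # b # b2" using B by (auto simp: nth_append)
    have rb: "b \<in> insert 0 {r..L}" "b' \<in> insert 0 {r..L}"
      using M0 bs B by (auto simp: arr_def)
    have ex: "CC r L ks bs * th1 (ks ! i) (ks ! Suc i) + CC r L (sp i ks) bs * th2 (ks ! Suc i) (ks ! i)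
      = (if b = b' then tt else eps b) * CC r L ks (sp i bs)" if ks: "ks \<in> arr M1" for ks
    proof -
      have "Suc i < length ks" using ks i n arr_length by metis
      then obtain k1 k k' k2 where K: "ks = k1 @ k # k' # k2" "length k1 = i" by (rule split_pair)
      have kk: "ks ! i = k" "ks ! Suc i = k'" "sp i ks = k1 @ k' # k # k2" using K by (auto simp: nth_append)
      have rk: "k \<in> insert 0 {r+1..L}" "k' \<in> insert 0 {r+1..L}"
        using M1 ks K by (auto simp: arr_def)
      have "length ks = length bs" using ks bs n arr_length by metis
      then have "length k1 = length b1" "length k2 = length b2" using K B by auto
      from CC_exchange[OF this rk rb r] ge show ?thesis
        unfolding bb(1,2) kk(1,2) unfolding kk(3) bb(3) unfolding K(1) B(1) by simp
    qed
    have "TT i (hh r L M1 G bs) = (\<lambda>v. \<Sum>ks\<in>arr M1. (CC r L ks bs * th1 (ks ! i) (ks ! Suc i)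
        + CC r L (sp i ks) bs * th2 (ks ! Suc i) (ks ! i)) * G ks v)"
      unfolding hh_def by (rule hecke_sum[OF G n(1) i])
    also have "\<dots> = (\<lambda>v. (if b = b' then tt else eps b) * hh r L M1 G (sp i bs) v)"
      unfolding hh_def by (simp add: fun_eq_iff ex sum_distrib_left mult.assoc cong: sum.cong)
    finally show ?thesis unfolding bb(1,2) .
  qed
  show ?thesis unfolding hecke_fam_def
  proof (intro ballI allI impI)
    fix bs i assume bs: "bs \<in> arr M0" and i: "Suc i < n"
    let ?H = "hh r L M1 G"
    have len: "Suc i < length bs" using bs i n arr_length by metis
    consider "gtz (bs ! i) (bs ! Suc i)" | "bs ! i = bs ! Suc i" | "gtz (bs ! Suc i) (bs ! i)" "\<not> gtz (bs ! i) (bs ! Suc i)" "bs ! i \<noteq> bs ! Suc i"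
      using gtz_cases[of "bs ! i" "bs ! Suc i"] by blast
    then show "TT i (?H bs) = (\<lambda>v. tz1 (bs ! i) (bs ! Suc i) * ?H bs v + tz2 (bs ! i) (bs ! Suc i) * ?H (sp i bs) v)"
    proof cases
      case 1
      then have "bs ! i \<noteq> bs ! Suc i" by (auto simp: gtz_def)
      then show ?thesis using main[OF bs i] 1 by (simp add: tz1_def tz2_def)
    next
      case 2
      then have "sp i bs = bs" by (simp add: sp_def) (metis list_update_id)
      then show ?thesis using main[OF bs i] 2 by (auto simp: tz1_def tz2_def gtz_def)
    next
      case 3
      have "TT i (?H (sp i bs)) = (\<lambda>v. eps (bs ! Suc i) * ?H bs v)"
        using main[of "sp i bs" i] sp_arr[OF bs] i n 3 len by (simp add: nth_sp sp_sp)
      from TT_flip[OF this] show ?thesis using 3 by (simp add: tz1_def tz2_def)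
    qed
  qed
qed

text \<open>\<open>JJ 0 (n - 1)\<close> is the product of inverse operators in the rotation
  equation; the factor with the largest index acts first.\<close>

definition JJ :: "nat \<Rightarrow> nat \<Rightarrow> fn \<Rightarrow> fn" where
  "JJ a b f = foldr TI [a..<b] f"

lemma JJ_same [simp]: "JJ a a f = f" by (simp add: JJ_def)

lemma JJ_Cons: "a < b \<Longrightarrow> JJ a b f = TI a (JJ (Suc a) b f)"
  by (simp add: JJ_def upt_conv_Cons)

lemma JJ_Suc: "a \<le> b \<Longrightarrow> JJ a (Suc b) f = JJ a b (TI b f)"
  by (simp add: JJ_def)

lemma JJ_split: "a \<le> b \<Longrightarrow> b \<le> c \<Longrightarrow> JJ a c f = JJ a b (JJ b c f)"
  using upt_add_eq_append[of a b "c - b"] by (simp add: JJ_def)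

lemma foldr_TI_linear:
  "foldr TI is (\<lambda>v. f v + g v) = (\<lambda>v. foldr TI is f v + foldr TI is g v)"
  "foldr TI is (\<lambda>v. f v - g v) = (\<lambda>v. foldr TI is f v - foldr TI is g v)"
  "foldr TI is (\<lambda>v. c * f v) = (\<lambda>v. c * foldr TI is f v)"
  by (induction "is") (simp_all add: TI_add TI_diff TI_cmult)

lemma JJ_add: "JJ a b (\<lambda>v. f v + g v) = (\<lambda>v. JJ a b f v + JJ a b g v)"
  and JJ_diff: "JJ a b (\<lambda>v. f v - g v) = (\<lambda>v. JJ a b f v - JJ a b g v)"
  and JJ_cmult: "JJ a b (\<lambda>v. c * f v) = (\<lambda>v. c * JJ a b f v)"
  by (simp_all add: JJ_def foldr_TI_linear)

lemma JJ_sum: "finite S \<Longrightarrow> JJ a b (\<lambda>v. \<Sum>x\<in>S. f x v) = (\<lambda>v. \<Sum>x\<in>S. JJ a b (f x) v)"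
proof (induction S rule: finite_induct)
  case empty
  then show ?case using JJ_cmult[of a b 0 "\<lambda>_. 0"] by simp
next
  case (insert x F)
  then show ?case by (simp add: JJ_add)
qed

lemma JJ_mult_sym:
  assumes "\<And>i v. a \<le> i \<Longrightarrow> i < b \<Longrightarrow> g (sw i v) = g v"
  shows "JJ a b (\<lambda>v. g v * f v) = (\<lambda>v. g v * JJ a b f v)"
proof -
  have "foldr TI is (\<lambda>v. g v * f v) = (\<lambda>v. g v * foldr TI is f v)" if "set is \<subseteq> {a..<b}" for "is"
    using that by (induction "is") (auto simp: TI_mult_sym assms)
  then show ?thesis by (simp add: JJ_def)
qed

lemma TI_far: "Suc i < j \<or> Suc j < i \<Longrightarrow> TI j (TT i f) = TT i (TI j f)"
  using TT_far[of i j "TI j f"] TT_far[of j i "TI j f"] by (metis TI_TT TT_TI)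

lemma TI_braid: "TI i (TI (Suc i) (TT i f)) = TT (Suc i) (TI i (TI (Suc i) f))"
  by (metis TI_TT TT_TI TT_braid)

lemma foldr_TI_far:
  "(\<And>j. j \<in> set js \<Longrightarrow> Suc i < j \<or> Suc j < i) \<Longrightarrow> foldr TI js (TT i f) = TT i (foldr TI js f)"
  by (induction js) (auto simp: TI_far)

text \<open>Only two factors fail to commute with \<open>T_i\<close>, and there the braid relation
  turns it into \<open>T_{i+1}\<close>. The rotation shifts the index in the same way, so Hecke
  operators pass through both terms of the rotation equation at once.\<close>

lemma JJ_TT:
  assumes "a \<le> i" "Suc i < b"
  shows "JJ a b (TT i f) = TT (Suc i) (JJ a b f)"
proof -
  have "[a..<b] = [a..<i] @ [i, Suc i] @ [Suc (Suc i)..<b]"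
    using assms upt_add_eq_append[of a i "b - i"] by (simp add: upt_conv_Cons)
  moreover have "foldr TI [Suc (Suc i)..<b] (TT i f) = TT i (foldr TI [Suc (Suc i)..<b] f)"
    by (rule foldr_TI_far) auto
  moreover have "foldr TI [a..<i] (TT (Suc i) g) = TT (Suc i) (foldr TI [a..<i] g)" for g
    by (rule foldr_TI_far) auto
  ultimately show ?thesis unfolding JJ_def by (simp add: TI_braid)
qed

lemma RR_add: "RR n (\<lambda>v. f v + g v) = (\<lambda>v. RR n f v + RR n g v)"
  and RR_diff: "RR n (\<lambda>v. f v - g v) = (\<lambda>v. RR n f v - RR n g v)"
  and RR_mult: "RR n (\<lambda>v. f v * g v) = (\<lambda>v. RR n f v * RR n g v)"
  and RR_sum: "RR n (\<lambda>v. \<Sum>x\<in>S. h x v) = (\<lambda>v. \<Sum>x\<in>S. RR n (h x) v)"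
  and RR_const: "RR n (\<lambda>v. c) = (\<lambda>v. c)"
  by (auto simp: RR_def)

text \<open>The interpolation analogue of the rotation equation of ASEP polynomials.\<close>

definition rot_fam :: "nat \<Rightarrow> qt \<Rightarrow> (nat \<Rightarrow> nat) \<Rightarrow> nat list set \<Rightarrow> (nat list \<Rightarrow> fn) \<Rightarrow> bool" where
  "rot_fam n \<rho> e S G \<longleftrightarrow> (\<forall>ys a. ys @ [a] \<in> S \<longrightarrow> (\<forall>v. co v 0 * G (a # ys) v
     = qq ^ e a * ((co v 0 - \<rho> / tt ^ (n - 1)) * RR n (G (ys @ [a])) v + \<rho> * JJ 0 (n - 1) (G (ys @ [a])) v)))"

text \<open>The rotation operator is linear and can be applied under the sum. Rotating upper and
  lower row together changes the layer weight by powers of \<open>q\<close> only, and these exchange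
  the exponent of the upper part for that of the lower part.\<close>

lemma hh_rot:
  assumes G: "rot_fam n \<rho> (\<lambda>a. a - r) (arr M1) G"
    and n: "size M1 = n" "size M0 = n" "1 \<le> n" and r: "1 \<le> r"
    and M1: "set_mset M1 \<subseteq> insert 0 {r+1..L}" and M0: "set_mset M0 \<subseteq> insert 0 {r..L}"
    and cnt: "\<And>a. a \<in> {r+1..L} \<Longrightarrow> count M1 a = count M0 a"
  shows "rot_fam n \<rho> (\<lambda>a. a - r) (arr M0) (hh r L M1 G)"
  unfolding rot_fam_def
proof (intro allI impI)
  fix bs b v assume bs: "bs @ [b] \<in> arr M0"
  define op where "op f = (co v 0 - \<rho> / tt ^ (n - 1)) * RR n f v + \<rho> * JJ 0 (n - 1) f v" for f
  have op_sum: "op (\<lambda>w. \<Sum>x\<in>arr M1. c x * G x w) = (\<Sum>x\<in>arr M1. c x * op (G x))" for c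
    unfolding op_def
    by (simp add: JJ_sum finite_arr JJ_cmult RR_sum RR_mult RR_const sum_distrib_left sum.distrib[symmetric] algebra_simps)
  have rb: "b \<in> insert 0 {r..L}" using bs M0 by (auto simp: arr_def)
  have tm: "CC r L (last ks # butlast ks) (b # bs) * (co v 0 * G (last ks # butlast ks) v)
      = qq ^ (b - r) * (CC r L ks (bs @ [b]) * op (G ks))" if ks: "ks \<in> arr M1" for ks
  proof -
    have "ks \<noteq> []" using ks n by (auto simp: arr_def)
    then obtain ys k where K: "ks = ys @ [k]" by (metis append_butlast_last_id)
    have rk: "k \<in> insert 0 {r+1..L}" using ks M1 K by (auto simp: arr_def)
    have "length ks = length (bs @ [b])" using ks bs n arr_length by metis
    then have len: "length ys = length bs" using K by simp
    have c: "count_list (k # ys) a = count_list (b # bs) a" if "a \<in> {r+1..L}" for a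
    proof -
      have "count (mset (k # ys)) a = count (mset (b # bs)) a"
        using ks bs K cnt[OF that] by (auto simp: arr_def)
      then show ?thesis by (simp only: count_list_mset)
    qed
    have g: "co v 0 * G (k # ys) v = qq ^ (k - r) * op (G ks)"
      using G ks unfolding rot_fam_def op_def K by blast
    have "CC r L (k # ys) (b # bs) * (co v 0 * G (k # ys) v) = (qq ^ (k - r) * CC r L (k # ys) (b # bs)) * op (G ks)"
      unfolding g by simp
    also have "\<dots> = qq ^ (b - r) * (CC r L ks (bs @ [b]) * op (G ks))"
      using CC_rot[OF len r rk rb c] unfolding K by simp
    finally show ?thesis unfolding K by simp
  qed
  have "co v 0 * hh r L M1 G (b # bs) v = (\<Sum>ks\<in>arr M1. CC r L ks (b # bs) * (co v 0 * G ks v))"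
    unfolding hh_def sum_distrib_left by (simp add: mult.left_commute)
  also have "\<dots> = (\<Sum>ks\<in>arr M1. CC r L (last ks # butlast ks) (b # bs) * (co v 0 * G (last ks # butlast ks) v))"
  proof (rule sum.reindex_bij_witness[of _ "\<lambda>ks. last ks # butlast ks" rotate1])
    fix ks assume ks: "ks \<in> arr M1"
    then have ne: "ks \<noteq> []" using n by (auto simp: arr_def)
    then obtain x xs where X: "ks = x # xs" by (cases ks) auto
    obtain ys y where Y: "ks = ys @ [y]" using ne by (metis append_butlast_last_id)
    show "last (rotate1 ks) # butlast (rotate1 ks) = ks" using X by simp
    show "rotate1 ks \<in> arr M1" using ks X by (simp add: arr_def)
    show "rotate1 (last ks # butlast ks) = ks" using ne by simp
    show "last ks # butlast ks \<in> arr M1" using ks Y by (simp add: arr_def)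
    show "CC r L (last (rotate1 ks) # butlast (rotate1 ks)) (b # bs) *
         (co v 0 * G (last (rotate1 ks) # butlast (rotate1 ks)) v) =
         CC r L ks (b # bs) * (co v 0 * G ks v)" using X by simp
  qed
  also have "\<dots> = (\<Sum>ks\<in>arr M1. qq ^ (b - r) * (CC r L ks (bs @ [b]) * op (G ks)))"
    by (rule sum.cong) (auto simp: tm)
  also have "\<dots> = qq ^ (b - r) * op (hh r L M1 G (bs @ [b]))"
    unfolding hh_def op_sum by (simp add: sum_distrib_left)
  finally show "co v 0 * hh r L M1 G (b # bs) v
     = qq ^ (b - r) * ((co v 0 - \<rho> / tt ^ (n - 1)) * RR n (hh r L M1 G (bs @ [b])) v
        + \<rho> * JJ 0 (n - 1) (hh r L M1 G (bs @ [b])) v)" unfolding op_def .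
qed

section \<open>Column weights of a signed layer\<close>

text \<open>In a column with lower label \<open>m\<close> every passing strand of larger label pays
  \<open>t\<close>: it skips a ball that is still free or, for \<open>m = 0\<close>, an empty
  position.\<close>

definition MP :: "nat \<Rightarrow> nat \<Rightarrow> (nat \<Rightarrow> qt) \<Rightarrow> qt" where
  "MP L m z = (\<Prod>a\<in>{m<..L}. z a)"

text \<open>\<open>z a = t\<^sup>j\<close> when \<open>j\<close> strands of label \<open>a\<close> pass the current column; the weight sums over
  the sign of the upper ball and over the choices of the strand ending in this column.\<close>

definition cwp :: "nat \<Rightarrow> (nat \<Rightarrow> qt) \<Rightarrow> nat \<Rightarrow> nat \<Rightarrow> qt" where
  "cwp L z b m = (if m \<noteq> 0 \<and> b = m then MP L m z else if b \<noteq> 0 \<and> b < m then (1 - z m) * MP L m z else 0)"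

text \<open>For \<open>b = m\<close> a negative ball contributes \<open>-y\<close> if it drops
  straight down, and \<open>y (1 - z m)\<close> if its strand leaves and another strand ends here;
  together this is \<open>- y z m\<close>.\<close>

definition cwq :: "nat \<Rightarrow> qt \<Rightarrow> (nat \<Rightarrow> qt) \<Rightarrow> nat \<Rightarrow> nat \<Rightarrow> qt" where
  "cwq L y z b m = (if m \<noteq> 0 \<and> b = m then - (y * z m) * MP L m z
     else if b \<noteq> 0 \<and> b < m then 0
     else (if b = 0 then 1 else y) * (if m = 0 then 1 else 1 - z m) * MP L m z)"

definition cw :: "nat \<Rightarrow> qt \<Rightarrow> qt \<Rightarrow> (nat \<Rightarrow> qt) \<Rightarrow> nat \<Rightarrow> nat \<Rightarrow> qt" where
  "cw L y x z b m = cwp L z b m * x + cwq L y z b m"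

text \<open>Behind the column one more strand of label \<open>b\<close> and one fewer of label
  \<open>m\<close> is in flight.\<close>

definition cz :: "(nat \<Rightarrow> qt) \<Rightarrow> nat \<Rightarrow> nat \<Rightarrow> nat \<Rightarrow> qt" where
  "cz z b m = (\<lambda>a. z a * (if a = b then tt else 1) / (if a = m then tt else 1))"

fun wl :: "nat \<Rightarrow> qt \<Rightarrow> nat \<Rightarrow> (nat \<Rightarrow> qt) \<Rightarrow> nat list \<Rightarrow> nat list \<Rightarrow> fn" where
  "wl L y i z (b # bs) (m # ms) v = cw L y (co v i) z b m * wl L y (Suc i) (cz z b m) bs ms v"
| "wl L y i z _ _ v = 1"

fun zl :: "(nat \<Rightarrow> qt) \<Rightarrow> nat list \<Rightarrow> nat list \<Rightarrow> nat \<Rightarrow> qt" where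
  "zl z (b # bs) (m # ms) = zl (cz z b m) bs ms"
| "zl z _ _ = z"

lemma wl_append:
  "length b1 = length m1 \<Longrightarrow>
    wl L y i z (b1 @ b2) (m1 @ m2) v = wl L y i z b1 m1 v * wl L y (i + length b1) (zl z b1 m1) b2 m2 v"
  by (induction b1 m1 arbitrary: i z rule: list_induct2) (simp_all add: mult.assoc)

lemma wl_sw:
  assumes "j + length bs \<le> i \<or> Suc i < j"
  shows "wl L y j z bs ms (sw i v) = wl L y j z bs ms v"
  using assms
proof (induction L y j z bs ms v rule: wl.induct)
  case (1 L y j z b bs m ms v)
  have "transp i j = j" using 1(2) by auto
  moreover have "Suc j + length bs \<le> i \<or> Suc i < Suc j" using 1(2) by auto
  ultimately show ?case using 1(1) by simp
qed auto

lemma cz_id [simp]: "cz z a a = z"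
  by (auto simp: cz_def fun_eq_iff)

lemma cz_commute: "cz (cz z b m) b' m' = cz (cz z b' m) b m'"
  by (auto simp: cz_def fun_eq_iff)

lemma cz_swap_cols: "cz (cz z b m) b' m' = cz (cz z b m') b' m"
  by (auto simp: cz_def fun_eq_iff)

lemma MP_cz:
  assumes "b \<le> L" "m \<le> L"
  shows "MP L k (cz z b m) = MP L k z * (if k < b then tt else 1) / (if k < m then tt else 1)"
proof -
  have "MP L k (cz z b m) = MP L k z * (\<Prod>a\<in>{k<..L}. if a = b then tt else 1) / (\<Prod>a\<in>{k<..L}. if a = m then tt else 1)"
    by (simp add: MP_def cz_def prod.distrib prod_dividef)
  also have "(\<Prod>a\<in>{k<..L}. if a = b then tt else 1) = (if k < b then tt else 1)"
    using assms by (simp add: prod.delta)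
  also have "(\<Prod>a\<in>{k<..L}. if a = m then tt else 1) = (if k < m then tt else 1)"
    using assms by (simp add: prod.delta)
  finally show ?thesis .
qed

text \<open>The two-column identity for exchanging lower labels \<open>m\<close> and 0, comparing
  coefficients of one upper row. The factor \<open>tz1 b b' - (t - 1)\<close> is the diagonal part
  of \<open>t T_i^{-1}\<close>, which appears when the variable of the left column is pulled through
  \<open>T_i\<close>. What remains is a finite check over the relative order of \<open>b\<close>,
  \<open>b'\<close> and \<open>m\<close>.\<close>

lemma local_exchange:
  assumes "b \<le> L" "b' \<le> L" "m \<le> L" "m \<noteq> 0"
  shows "cwq L y (cz z b m) b' 0 * (cwp L z b m * (tz1 b b' - (tt - 1)) * x + cwq L y z b m * tz1 b b')
      + cwq L y (cz z b' m) b 0 * (cwp L z b' m * x + cwq L y z b' m) * tz2 b' b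
    = cwq L y z b 0 * (cwp L (cz z b 0) b' m * x + cwq L y (cz z b 0) b' m)"
proof -
  define A D s where "A = MP L 0 z" and "D = MP L m z" and "s = z m"
  have M: "MP L 0 (cz z c m) = A * (if c = 0 then 1 else tt) / tt" "MP L m (cz z c 0) = D * (if m < c then tt else 1)"
    if "c \<le> L" for c
    using that assms by (auto simp: MP_cz A_def D_def)
  have zz: "cz z c 0 m = s * (if m = c then tt else 1)" for c
    using assms by (simp add: cz_def s_def)
  have P: "cwp L z c m = (if c = m then D else if c \<noteq> 0 \<and> c < m then (1 - s) * D else 0)"
    "cwq L y z c m = (if c = m then - (y * s) * D else if c \<noteq> 0 \<and> c < m then 0 else (if c = 0 then 1 else y) * (1 - s) * D)"
    for c using assms by (auto simp: cwp_def cwq_def D_def s_def)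
  have P0: "cwq L y z c 0 = (if c = 0 then 1 else y) * A" for c
    by (simp add: cwq_def A_def)
  have P1: "cwq L y (cz z c m) c' 0 = (if c' = 0 then 1 else y) * (A * (if c = 0 then 1 else tt) / tt)" if "c \<le> L" for c c'
    using that by (simp add: cwq_def M)
  have P2: "cwp L (cz z c 0) c' m = (if c' = m then D * (if m < c then tt else 1)
      else if c' \<noteq> 0 \<and> c' < m then (1 - s * (if m = c then tt else 1)) * (D * (if m < c then tt else 1)) else 0)"
    "cwq L y (cz z c 0) c' m = (if c' = m then - (y * (s * (if m = c then tt else 1))) * (D * (if m < c then tt else 1))
      else if c' \<noteq> 0 \<and> c' < m then 0 else (if c' = 0 then 1 else y) * (1 - s * (if m = c then tt else 1)) * (D * (if m < c then tt else 1)))"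
    if "c \<le> L" for c c'
    using that assms by (auto simp: cwp_def cwq_def M zz)
  note defs = P P0 P1[OF assms(1)] P1[OF assms(2)] P2[OF assms(1)]
  consider (z) "b = 0" | (l) "b \<noteq> 0" "b < m" | (e) "b = m" | (g) "m < b" by linarith
  then show ?thesis
  proof cases
    case z
    consider "b' = 0" | "b' \<noteq> 0" "b' < m" | "b' = m" | "m < b'" by linarith
    then show ?thesis using z assms(4) unfolding defs
      by cases (simp_all add: tz1_def tz2_def gtz_def eps_def field_simps)
  next
    case l
    consider "b' = 0" | "b' \<noteq> 0" "b' < b" | "b' = b" | "b < b'" "b' < m" | "b' = m" | "m < b'" by linarith
    then show ?thesis using l assms(4) unfolding defs
      by cases (simp_all add: tz1_def tz2_def gtz_def eps_def field_simps)
  next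
    case e
    consider "b' = 0" | "b' \<noteq> 0" "b' < m" | "b' = m" | "m < b'" by linarith
    then show ?thesis using e assms(4) unfolding defs
      by cases (simp_all add: tz1_def tz2_def gtz_def eps_def field_simps)
  next
    case g
    consider "b' = 0" | "b' \<noteq> 0" "b' < m" | "b' = m" | "m < b'" "b' < b" | "b' = b" | "b < b'" by linarith
    then show ?thesis using g assms(4) unfolding defs
      by cases (simp_all add: tz1_def tz2_def gtz_def eps_def field_simps)
  qed
qed

lemma TT_cdiv: "TT i (\<lambda>v. f v / c) = (\<lambda>v. TT i f v / c)"
  using TT_cmult[of i "1 / c" f] by simp

lemma TI_cdiv: "TI i (\<lambda>v. f v / c) = (\<lambda>v. TI i f v / c)"
  using TI_cmult[of i "1 / c" f] by simp

lemma JJ_cdiv: "JJ a b (\<lambda>v. f v / c) = (\<lambda>v. JJ a b f v / c)"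
  using JJ_cmult[of a b "1 / c" f] by simp

lemma adjacent_swap_induct:
  assumes sw: "\<And>u a b v. P (u @ a # b # v) \<Longrightarrow> P (u @ b # a # v)"
    and "mset xs = mset ys" "P xs"
  shows "P ys"
proof -
  have mv: "P (u @ y # x1 @ x2)" if "P (u @ x1 @ y # x2)" for u y x1 x2
    using that
  proof (induction x1 arbitrary: x2 rule: rev_induct)
    case (snoc x xs)
    then have "P ((u @ xs) @ x # y # x2)" by simp
    from sw[OF this] have "P (u @ xs @ y # x # x2)" by simp
    from snoc.IH[OF this] show ?case by simp
  qed simp
  have "P (u @ ys)" if "P (u @ xs)" "mset xs = mset ys" for u
    using that
  proof (induction ys arbitrary: xs u)
    case (Cons y ys)
    then have "y \<in> set xs" by (metis list.set_intros(1) set_mset_mset)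
    then obtain x1 x2 where X: "xs = x1 @ y # x2" by (meson split_list)
    have "P ((u @ [y]) @ x1 @ x2)" using mv[of u x1 y x2] Cons.prems(1) X by simp
    moreover have "mset (x1 @ x2) = mset ys" using Cons.prems(2) X by simp
    ultimately have "P ((u @ [y]) @ ys)" by (rule Cons.IH)
    then show ?case by simp
  qed simp
  from this[of "[]"] assms show ?thesis by simp
qed

lemma packed_or_zero_step:
  "(\<exists>u c v. xs = u @ 0 # c # v \<and> c \<noteq> (0::nat)) \<or> (\<exists>g m. xs = g @ replicate m 0 \<and> 0 \<notin> set g)"
proof (induction xs)
  case (Cons x xs)
  then consider u c v where "xs = u @ 0 # c # v" "c \<noteq> 0" | g m where "xs = g @ replicate m 0" "0 \<notin> set g" by blast
  then show ?case
  proof cases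
    case 1
    then have "x # xs = (x # u) @ 0 # c # v" by simp
    then show ?thesis using 1 by blast
  next
    case 2
    show ?thesis
    proof (cases "x = 0")
      case False
      then have "x # xs = (x # g) @ replicate m 0" "0 \<notin> set (x # g)" using 2 by auto
      then show ?thesis by blast
    next
      case True
      show ?thesis
      proof (cases g)
        case Nil
        then have "x # xs = [] @ replicate (Suc m) 0" using 2 True by simp
        then show ?thesis by (metis empty_iff list.set(1))
      next
        case (Cons c g')
        then have "x # xs = [] @ 0 # c # (g' @ replicate m 0)" "c \<noteq> 0" using 2 True by auto
        then show ?thesis by blast
      qed
    qed
  qed
qed (auto intro: exI[of _ "[]"])

text \<open>The sum of the positions of nonzero parts, a measure that drops when a zero is moved
  right past a nonzero part.\<close>

fun pz :: "nat \<Rightarrow> nat list \<Rightarrow> nat" where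
  "pz k [] = 0"
| "pz k (x # xs) = (if x = 0 then 0 else k) + pz (Suc k) xs"

lemma pz_append: "pz k (u @ v) = pz k u + pz (k + length u) v"
  by (induction u arbitrary: k) auto

lemma sp_append1: "Suc i < length g \<Longrightarrow> sp i (g @ z) = sp i g @ z"
  by (simp add: sp_def nth_append list_update_append)

lemma sp_append2: "sp (length u + i) (u @ w) = u @ sp i w"
  by (simp add: sp_def nth_append list_update_append)

lemma sp_eq: "xs ! i = xs ! Suc i \<Longrightarrow> sp i xs = xs"
  by (simp add: sp_def) (metis list_update_id)

lemma foldr_TI_eigen:
  "(\<And>j. j \<in> set js \<Longrightarrow> TT j f = (\<lambda>v. tt * f v)) \<Longrightarrow> foldr TI js f = (\<lambda>v. 1 / tt ^ length js * f v)"
proof (induction js)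
  case (Cons j js)
  have j: "TI j f = (\<lambda>v. f v / tt)"
    by (rule TI_eqI) (simp add: TT_cdiv Cons.prems)
  have "foldr TI js f = (\<lambda>v. f v / tt ^ length js)" using Cons by simp
  then show ?case by (simp add: TI_cdiv j)
qed simp

text \<open>The inverse of \<open>JJ a b\<close>; here \<open>T_a\<close> acts first.\<close>

definition TU :: "nat \<Rightarrow> nat \<Rightarrow> fn \<Rightarrow> fn" where
  "TU a b f = foldr TT (rev [a..<b]) f"

lemma TU_simps [simp]: "TU a a f = f" "a \<le> b \<Longrightarrow> TU a (Suc b) f = TT b (TU a b f)"
  by (simp_all add: TU_def)

lemma JJ_TU: "a \<le> b \<Longrightarrow> JJ a b (TU a b f) = f"
  by (induction b rule: dec_induct) (simp_all add: JJ_Suc)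

lemma TU_linear:
  assumes "a \<le> b"
  shows "TU a b (\<lambda>v. f v - g v) = (\<lambda>v. TU a b f v - TU a b g v)"
    "TU a b (\<lambda>v. c * f v) = (\<lambda>v. c * TU a b f v)"
  using assms by (induction b rule: dec_induct) (simp_all add: TT_diff TT_cmult)

lemma TU_mult_sym:
  assumes "a \<le> b" "\<And>i v. a \<le> i \<Longrightarrow> i < b \<Longrightarrow> g (sw i v) = g v"
  shows "TU a b (\<lambda>v. g v * f v) = (\<lambda>v. g v * TU a b f v)"
  using assms by (induction b rule: dec_induct) (auto simp: TT_mult_sym)

section \<open>Hecke and rotation equations through a signed layer\<close>

locale signed_layer =
  fixes n L r :: nat and M0 :: "nat multiset" and h :: "nat list \<Rightarrow> fn" and y :: qt
  assumes size: "size M0 = n" and n1: "1 \<le> n" and r1: "1 \<le> r"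
    and labels: "set_mset M0 \<subseteq> insert 0 {r..L}"
    and hH: "hecke_fam n (arr M0) tz1 tz2 h"
    and hR: "rot_fam n (qq ^ r) (\<lambda>a. a - r) (arr M0) h"
    and y: "y = qq ^ (r - 1) / tt ^ (n - 1)"
begin

definition F :: "nat list \<Rightarrow> fn" where
  "F mu = (\<lambda>v. \<Sum>bs\<in>arr M0. wl L y 0 (\<lambda>_. 1) bs mu v * h bs v)"

lemma label_le: "xs \<in> arr M0 \<Longrightarrow> a \<in> set xs \<Longrightarrow> a \<le> L"
  using labels by (auto simp: arr_def)

text \<open>The local exchange, summed over all upper rows. Columns outside the pair do not involve
  its two variables, and the strands in flight behind the pair do not depend on the order of the two
  lower labels.\<close>

lemma F_move_zero:
  assumes mu: "m1 @ m # 0 # m2 \<in> arr M0" and m: "m \<noteq> 0"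
  shows "TT (length m1) (F (m1 @ m # 0 # m2)) = F (m1 @ 0 # m # m2)"
proof
  fix v
  define i where "i = length m1"
  let ?mu = "m1 @ m # 0 # m2" and ?nu = "m1 @ 0 # m # m2"
  have i: "Suc i < n" using arr_length[OF mu] size by (simp add: i_def)
  define A where "A bs w = wl L y 0 (\<lambda>_. 1) (take i bs) m1 w" for bs w
  define z where "z bs = zl (\<lambda>_. 1) (take i bs) m1" for bs
  define B where "B bs w = wl L y (Suc (Suc i)) (cz (cz (z bs) (bs ! i) m) (bs ! Suc i) 0) (drop (Suc (Suc i)) bs) m2 w"
    for bs w
  define p where "p bs = cwp L (z bs) (bs ! i) m" for bs
  define q where "q bs = cwq L y (z bs) (bs ! i) m" for bs
  define k where "k bs = cwq L y (cz (z bs) (bs ! i) m) (bs ! Suc i) 0" for bs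
  have dec: "bs = take i bs @ bs ! i # bs ! Suc i # drop (Suc (Suc i)) bs" if "bs \<in> arr M0" for bs
    using arr_length[OF that] i size by (metis Cons_nth_drop_Suc Suc_lessD append_take_drop_id)
  have len: "length (take i bs) = length m1" if "bs \<in> arr M0" for bs
    using arr_length[OF that] i size by (simp add: i_def)
  have mn: "min (length bs) i = i" if "bs \<in> arr M0" for bs
    using arr_length[OF that] i size by simp
  have cw0: "cw L y x zz b 0 = cwq L y zz b 0" for x zz b by (simp add: cw_def cwp_def)
  have W: "wl L y 0 (\<lambda>_. 1) bs ?mu w = A bs w * ((p bs * co w i + q bs) * (k bs * B bs w))"
    if bs: "bs \<in> arr M0" for bs w
    by (subst dec[OF bs], subst wl_append[OF len[OF bs]])
      (simp add: A_def B_def z_def p_def q_def k_def cw0 cw_def[of _ _ _ _ _ m] mn[OF bs] i_def[symmetric])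
  have W': "wl L y 0 (\<lambda>_. 1) bs ?nu w
      = A bs w * (cwq L y (z bs) (bs ! i) 0 * (cwp L (cz (z bs) (bs ! i) 0) (bs ! Suc i) m * co w (Suc i)
          + cwq L y (cz (z bs) (bs ! i) 0) (bs ! Suc i) m)) * B bs w"
    if bs: "bs \<in> arr M0" for bs w
    by (subst dec[OF bs], subst wl_append[OF len[OF bs]])
      (simp add: A_def B_def z_def cw0 cw_def[of _ _ _ _ _ m] mn[OF bs] i_def[symmetric] cz_swap_cols[of _ _ m])
  have AB: "A bs (sw i w) * B bs (sw i w) = A bs w * B bs w" for bs w
    unfolding A_def B_def by (simp add: wl_sw)
  have tm: "TT i (\<lambda>w. wl L y 0 (\<lambda>_. 1) bs ?mu w * h bs w) v
      = A bs v * B bs v * (k bs * (p bs * (tz1 (bs ! i) (bs ! Suc i) - (tt - 1)) * co v (Suc i) + q bs * tz1 (bs ! i) (bs ! Suc i))) * h bs v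
       + A bs v * B bs v * (k bs * (p bs * co v (Suc i) + q bs) * tz2 (bs ! i) (bs ! Suc i)) * h (sp i bs) v"
    if bs: "bs \<in> arr M0" for bs
  proof -
    have "TT i (\<lambda>w. wl L y 0 (\<lambda>_. 1) bs ?mu w * h bs w) = TT i (\<lambda>w. (A bs w * B bs w) * (k bs * (p bs * (co w i * h bs w) + q bs * h bs w)))"
      unfolding W[OF bs] by (intro arg_cong[where f = "TT i"]) (simp add: fun_eq_iff algebra_simps)
    also have "\<dots> = (\<lambda>w. A bs w * B bs w * (k bs * (p bs * TT i (\<lambda>w. co w i * h bs w) w + q bs * TT i (h bs) w)))"
      by (subst TT_mult_sym) (auto simp: AB TT_cmult TT_add)
    finally have 1: "TT i (\<lambda>w. wl L y 0 (\<lambda>_. 1) bs ?mu w * h bs w) v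
      = A bs v * B bs v * (k bs * (p bs * (tt * co v (Suc i) * TI i (h bs) v) + q bs * TT i (h bs) v))"
      by (simp add: TT_x)
    have 2: "TT i (h bs) v = tz1 (bs ! i) (bs ! Suc i) * h bs v + tz2 (bs ! i) (bs ! Suc i) * h (sp i bs) v"
      using hH bs i by (simp add: hecke_fam_def)
    have 3: "tt * TI i (h bs) v = TT i (h bs) v - (tt - 1) * h bs v" by (simp add: TI_def)
    have 4: "tt * co v (Suc i) * TI i (h bs) v = co v (Suc i) * (TT i (h bs) v - (tt - 1) * h bs v)"
      using 3 by (metis mult.assoc mult.commute)
    show ?thesis unfolding 1 4 unfolding 2 by (simp add: algebra_simps)
  qed
  have spAB: "A (sp i bs) v * B (sp i bs) v = A bs v * B bs v" "z (sp i bs) = z bs" "sp i bs ! i = bs ! Suc i" "sp i bs ! Suc i = bs ! i"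
    if bs: "bs \<in> arr M0" for bs
  proof -
    have l: "Suc i < length bs" using arr_length[OF bs] i size by simp
    have t: "take i (sp i bs) = take i bs" "drop (Suc (Suc i)) (sp i bs) = drop (Suc (Suc i)) bs"
      by (simp_all add: sp_def)
    show zz: "z (sp i bs) = z bs" by (simp add: z_def t)
    show nn: "sp i bs ! i = bs ! Suc i" "sp i bs ! Suc i = bs ! i" using l by (simp_all add: nth_sp)
    show "A (sp i bs) v * B (sp i bs) v = A bs v * B bs v"
      unfolding A_def B_def t nn zz cz_commute[of _ "bs ! Suc i" _ "bs ! i"] ..
  qed
  have "TT i (F ?mu) v = (\<Sum>bs\<in>arr M0. TT i (\<lambda>w. wl L y 0 (\<lambda>_. 1) bs ?mu w * h bs w) v)"
    unfolding F_def by (simp add: TT_sum finite_arr)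
  also have "\<dots> = (\<Sum>bs\<in>arr M0. A bs v * B bs v * (k bs * (p bs * (tz1 (bs ! i) (bs ! Suc i) - (tt - 1)) * co v (Suc i) + q bs * tz1 (bs ! i) (bs ! Suc i))) * h bs v)
     + (\<Sum>bs\<in>arr M0. A bs v * B bs v * (k bs * (p bs * co v (Suc i) + q bs) * tz2 (bs ! i) (bs ! Suc i)) * h (sp i bs) v)"
    by (simp add: tm sum.distrib cong: sum.cong)
  \<comment> \<open>Reindexing brings both contributions of \<open>T_i\<close> to the same
    \<open>h bs\<close>, so that the local identity applies term by term.\<close>
  also have "(\<Sum>bs\<in>arr M0. A bs v * B bs v * (k bs * (p bs * co v (Suc i) + q bs) * tz2 (bs ! i) (bs ! Suc i)) * h (sp i bs) v)
    = (\<Sum>bs\<in>arr M0. A bs v * B bs v * (k (sp i bs) * (p (sp i bs) * co v (Suc i) + q (sp i bs)) * tz2 (bs ! Suc i) (bs ! i)) * h bs v)"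
  proof -
    have "(\<Sum>bs\<in>arr M0. A bs v * B bs v * (k (sp i bs) * (p (sp i bs) * co v (Suc i) + q (sp i bs)) * tz2 (bs ! Suc i) (bs ! i)) * h bs v)
      = (\<Sum>bs\<in>arr M0. A (sp i bs) v * B (sp i bs) v * (k (sp i (sp i bs)) * (p (sp i (sp i bs)) * co v (Suc i) + q (sp i (sp i bs))) * tz2 (sp i bs ! Suc i) (sp i bs ! i)) * h (sp i bs) v)"
      by (rule sum_sp[symmetric]) (use i size in simp)
    also have "\<dots> = (\<Sum>bs\<in>arr M0. A bs v * B bs v * (k bs * (p bs * co v (Suc i) + q bs) * tz2 (bs ! i) (bs ! Suc i)) * h (sp i bs) v)"
    proof (rule sum.cong)
      fix bs assume bs: "bs \<in> arr M0"
      have "sp i (sp i bs) = bs" by (rule sp_sp) (use arr_length[OF bs] i size in simp)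
      then show "A (sp i bs) v * B (sp i bs) v * (k (sp i (sp i bs)) * (p (sp i (sp i bs)) * co v (Suc i) + q (sp i (sp i bs))) * tz2 (sp i bs ! Suc i) (sp i bs ! i)) * h (sp i bs) v
        = A bs v * B bs v * (k bs * (p bs * co v (Suc i) + q bs) * tz2 (bs ! i) (bs ! Suc i)) * h (sp i bs) v"
        by (simp only: spAB[OF bs])
    qed simp
    finally show ?thesis by simp
  qed
  also have "(\<Sum>bs\<in>arr M0. A bs v * B bs v * (k bs * (p bs * (tz1 (bs ! i) (bs ! Suc i) - (tt - 1)) * co v (Suc i) + q bs * tz1 (bs ! i) (bs ! Suc i))) * h bs v) + \<dots>
     = (\<Sum>bs\<in>arr M0. wl L y 0 (\<lambda>_. 1) bs ?nu v * h bs v)"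
    unfolding sum.distrib[symmetric]
  proof (rule sum.cong)
    fix bs assume bs: "bs \<in> arr M0"
    have l: "Suc i < length bs" using arr_length[OF bs] i size by simp
    have "bs ! i \<le> L" "bs ! Suc i \<le> L" using label_le[OF bs] l by auto
    moreover have "m \<le> L" using label_le[OF mu] by simp
    ultimately have loc: "k bs * (p bs * (tz1 (bs ! i) (bs ! Suc i) - (tt - 1)) * co v (Suc i) + q bs * tz1 (bs ! i) (bs ! Suc i))
      + k (sp i bs) * (p (sp i bs) * co v (Suc i) + q (sp i bs)) * tz2 (bs ! Suc i) (bs ! i)
      = cwq L y (z bs) (bs ! i) 0 * (cwp L (cz (z bs) (bs ! i) 0) (bs ! Suc i) m * co v (Suc i)
          + cwq L y (cz (z bs) (bs ! i) 0) (bs ! Suc i) m)"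
      unfolding p_def q_def k_def spAB[OF bs] by (rule local_exchange[OF _ _ _ m])
    have fac: "ab * x * hh + ab * x' * hh = ab * (x + x') * hh" for ab x x' hh :: qt by (simp add: algebra_simps)
    show "A bs v * B bs v * (k bs * (p bs * (tz1 (bs ! i) (bs ! Suc i) - (tt - 1)) * co v (Suc i) + q bs * tz1 (bs ! i) (bs ! Suc i))) * h bs v
      + A bs v * B bs v * (k (sp i bs) * (p (sp i bs) * co v (Suc i) + q (sp i bs)) * tz2 (bs ! Suc i) (bs ! i)) * h bs v
      = wl L y 0 (\<lambda>_. 1) bs ?nu v * h bs v"
      unfolding fac loc W'[OF bs] by simp
  qed simp
  finally show "TT (length m1) (F ?mu) v = F ?nu v" unfolding i_def F_def .
qed

text \<open>The weight of \<open>k\<close> balls dropping straight down in the first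
  \<open>k\<close> columns, summed over both signs of each.\<close>

definition PX :: "nat \<Rightarrow> fn" where
  "PX k v = (\<Prod>i<k. co v i - y)"

lemma PX_Suc: "PX (Suc k) v = PX k v * (co v k - y)" by (simp add: PX_def)

lemma PX_sw: "Suc i \<noteq> k \<Longrightarrow> PX k (sw i v) = PX k v"
proof -
  assume "Suc i \<noteq> k"
  then have "bij_betw (transp i) {..<k} {..<k}"
    by (intro bij_betwI[where g = "transp i"]) (auto simp: transp_def transpose_def)
  from prod.reindex_bij_betw[OF this, of "\<lambda>j. co v j - y"] show ?thesis by (simp add: PX_def)
qed

text \<open>While no strand is in flight the factor \<open>1 - z m\<close> is 0, so the first lower
  ball must have its own label above it. This leaves \<open>z\<close> unchanged, and the argument
  repeats up to the empty spots.\<close>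

lemma wl_packed:
  assumes "0 \<notin> set g" "mset bs = mset (g @ replicate m 0)"
  shows "wl L y j (\<lambda>_. 1) bs (g @ replicate m 0) v
    = (if bs = g @ replicate m 0 then \<Prod>i<length g. co v (j + i) - y else 0)"
  using assms
proof (induction g arbitrary: bs j)
  case Nil
  have "set bs \<subseteq> {0}" "length bs = m"
    using Nil(2) by (metis append_Nil set_mset_mset set_replicate_conv_if subset_insertI empty_subsetI order_refl,
       metis Nil(2) append_Nil size_mset length_replicate)
  then have bs: "bs = replicate m 0" by (metis replicate_eqI subset_singletonD singletonD empty_iff subsetD)
  have "wl L y j (\<lambda>_. 1) (replicate m 0) (replicate m 0) v = 1"
    by (induction m arbitrary: j) (simp_all add: cw_def cwp_def cwq_def MP_def)
  then show ?case using bs by simp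
next
  case (Cons a g)
  have a: "a \<noteq> 0" using Cons.prems by auto
  obtain b bs' where B: "bs = b # bs'" using Cons.prems(2) by (cases bs) auto
  show ?case
  proof (cases "b = a")
    case True
    have "wl L y (Suc j) (\<lambda>_. 1) bs' (g @ replicate m 0) v
      = (if bs' = g @ replicate m 0 then \<Prod>i<length g. co v (Suc j + i) - y else 0)"
      by (rule Cons.IH) (use Cons.prems B True in auto)
    moreover have "(\<Prod>i<Suc (length g). co v (j + i) - y) = (co v j - y) * (\<Prod>i<length g. co v (Suc j + i) - y)"
      by (simp add: prod.lessThan_Suc_shift del: prod.lessThan_Suc)
    ultimately show ?thesis using B True a by (simp add: cw_def cwp_def cwq_def MP_def del: prod.lessThan_Suc)
  next
    case False
    then show ?thesis using B a by (simp add: cw_def cwp_def cwq_def)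
  qed
qed

lemma F_packed:
  assumes "g @ replicate m 0 \<in> arr M0" "0 \<notin> set g"
  shows "F (g @ replicate m 0) = (\<lambda>v. PX (length g) v * h (g @ replicate m 0) v)"
proof
  fix v
  have M0: "M0 = mset (g @ replicate m 0)" using assms(1) by (simp add: arr_def add_mset_commute)
  have "F (g @ replicate m 0) v = (\<Sum>bs\<in>arr M0. if bs = g @ replicate m 0 then PX (length g) v * h bs v else 0)"
    unfolding F_def PX_def
    by (rule sum.cong) (use wl_packed[OF assms(2), of _ m 0] M0 in \<open>auto simp: arr_def\<close>)
  also have "\<dots> = PX (length g) v * h (g @ replicate m 0) v"
    using assms(1) by (simp add: finite_arr)
  finally show "F (g @ replicate m 0) v = PX (length g) v * h (g @ replicate m 0) v" .
qed

text \<open>On a packed row the equation is inherited from \<open>h\<close>. Otherwise some 0 stands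
  directly before a nonzero part, \<open>F\<close> is \<open>T_j\<close> of the row with this 0
  moved one step to the right, and commutation or the braid relation reduces the claim to rows of
  smaller measure.\<close>

lemma F_desc:
  assumes "xs \<in> arr M0" "Suc i < n" "xs ! Suc i \<le> xs ! i"
  shows "TT i (F xs) = (\<lambda>v. (if xs ! i = xs ! Suc i then tt else 1) * F (sp i xs) v)"
  using assms
proof (induction "pz 0 xs" arbitrary: xs i rule: less_induct)
  case less
  note xs = less.prems(1) and i = less.prems(2) and ge = less.prems(3)
  have len: "length xs = n" using arr_length[OF xs] size by simp
  show ?case
  proof (cases "xs ! Suc i = 0 \<and> xs ! i \<noteq> 0")
    case True
    obtain u a b v where X: "xs = u @ a # b # v" "length u = i" using i len by (metis split_pair)
    then have "b = 0" "a \<noteq> 0" using True by (auto simp: nth_append)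
    then have "TT i (F xs) = F (sp i xs)" using F_move_zero[of u a v] xs X by auto
    then show ?thesis using True by simp
  next
    case nZ: False
    consider u c w where "xs = u @ 0 # c # w" "c \<noteq> 0" | g m where "xs = g @ replicate m 0" "0 \<notin> set g"
      using packed_or_zero_step by blast
    then show ?thesis
    proof cases
      case 2
      \<comment> \<open>The pair does not straddle the border between nonzero parts and zeros, which
        is what makes \<open>PX\<close> symmetric in its two variables.\<close>
      have ik: "Suc i \<noteq> length g"
      proof
        assume e: "Suc i = length g"
        then have "xs ! i \<noteq> 0" using 2 by (metis lessI nth_append nth_mem)
        moreover have "xs ! Suc i = 0" using 2 e i len by (simp add: nth_append)
        ultimately show False using nZ by simp
      qed
      have T: "TT i (F xs) = (\<lambda>v. PX (length g) v * TT i (h xs) v)"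
        using F_packed[of g m] 2 xs by (simp add: TT_mult_sym PX_sw ik)
      have Th: "TT i (h xs) = (\<lambda>v. tz1 (xs ! i) (xs ! Suc i) * h xs v + tz2 (xs ! i) (xs ! Suc i) * h (sp i xs) v)"
        using hH xs i by (simp add: hecke_fam_def)
      show ?thesis
      proof (cases "xs ! i = xs ! Suc i")
        case True
        then show ?thesis unfolding T Th using F_packed[of g m] 2 xs sp_eq[OF True]
          by (simp add: tz1_def tz2_def gtz_def fun_eq_iff)
      next
        case False
        then have nz: "xs ! Suc i \<noteq> 0" "xs ! Suc i < xs ! i" using ge nZ by auto
        then have "gtz (xs ! i) (xs ! Suc i)" "xs ! i \<noteq> 0" by (auto simp: gtz_def)
        then have Th': "TT i (h xs) = h (sp i xs)" unfolding Th by (simp add: tz1_def tz2_def eps_def)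
        have ig: "Suc i < length g"
        proof (rule ccontr)
          assume "\<not> ?thesis"
          then have "xs ! Suc i = 0" using 2 i len by (simp add: nth_append)
          then show False using nz by simp
        qed
        have s: "sp i xs = sp i g @ replicate m 0" using 2 ig by (simp add: sp_append1)
        have "set (sp i g) = set g" using mset_sp[OF ig] by (metis set_mset_mset)
        then have "F (sp i xs) = (\<lambda>v. PX (length g) v * h (sp i xs) v)"
          using F_packed[of "sp i g" m] sp_arr[OF xs, of i] i size 2(2) unfolding s by simp
        then show ?thesis unfolding T Th' using False by simp
      qed
    next
      case 1
      define j where "j = length u"
      let ?nu = "u @ c # 0 # w"
      have nu: "?nu \<in> arr M0" using xs 1 by (simp add: arr_def add_mset_commute)
      have Fx: "F xs = TT j (F ?nu)" using F_move_zero[OF nu 1(2)] 1 by (simp add: j_def)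
      have pzn: "pz 0 ?nu < pz 0 xs" using 1 by (simp add: pz_append)
      have jn: "Suc j < n" using len 1 by (simp add: j_def)
      consider "i = j" | "i = Suc j" | "Suc i = j" | "Suc j < i" | "Suc i < j" by linarith
      then show ?thesis
      proof cases
        case 1
        then show ?thesis using ge \<open>xs = _\<close> \<open>c \<noteq> 0\<close> by (simp add: j_def nth_append)
      next
        \<comment> \<open>The entries are 0, c, d. The row comes from c, d, 0 by two zero moves, and
          the braid relation lets \<open>T_j\<close> exchange c and d first.\<close>
        case i2: 2
        then have "w \<noteq> []" using len i 1 by (auto simp: j_def)
        then obtain d w' where w: "w = d # w'" by (cases w) auto
        have xd: "xs ! i = c" "xs ! Suc i = d" using 1 w i2 by (auto simp: j_def nth_append)
        have d: "d \<noteq> 0" "d \<le> c" using nZ xd 1 ge by auto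
        let ?n2 = "u @ c # d # 0 # w'"
        have n2: "?n2 \<in> arr M0" using xs 1 w by (simp add: arr_def add_mset_commute)
        have F1: "F ?nu = TT (Suc j) (F ?n2)" using F_move_zero[of "u @ [c]" d w'] n2 w d by (simp add: j_def)
        have IH: "TT j (F ?n2) = (\<lambda>v. (if c = d then tt else 1) * F (u @ d # c # 0 # w') v)"
          using less.hyps[of ?n2 j] n2 jn d 1 w by (simp add: pz_append j_def nth_append)
        have Z1: "TT (Suc j) (F (u @ d # c # 0 # w')) = F (u @ d # 0 # c # w')"
          using F_move_zero[of "u @ [d]" c w'] n2 1 by (simp add: arr_def j_def add_mset_commute)
        have Z2: "TT j (F (u @ d # 0 # c # w')) = F (u @ 0 # d # c # w')"
          using F_move_zero[of u d "c # w'"] n2 d by (simp add: arr_def j_def add_mset_commute)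
        have "TT i (F xs) = TT j (TT (Suc j) (TT j (F ?n2)))"
          unfolding Fx F1 i2 by (rule TT_braid[symmetric])
        also have "\<dots> = (\<lambda>v. (if c = d then tt else 1) * F (u @ 0 # d # c # w') v)"
          by (simp only: IH TT_cmult Z1 Z2)
        also have "u @ 0 # d # c # w' = sp i xs"
          using sp_append[of "u @ [0]" c d w'] 1 w i2 by (simp add: j_def)
        finally show ?thesis unfolding xd .
      next
        case i3: 3
        then have "u \<noteq> []" by (auto simp: j_def)
        then obtain u' d where u: "u = u' @ [d]" by (metis append_butlast_last_id)
        have iu: "length u' = i" using u i3 by (simp add: j_def)
        have xd: "xs ! i = d" "xs ! Suc i = 0" using 1 u iu by (auto simp: nth_append)
        \<comment> \<open>Otherwise the pair would be a nonzero part followed by a zero, a case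
          already settled.\<close>
        then have d: "d = 0" using nZ by simp
        let ?n2 = "u' @ c # 0 # 0 # w"
        have n2: "?n2 \<in> arr M0" using xs 1 u d by (simp add: arr_def add_mset_commute)
        have F1: "F ?nu = TT i (F ?n2)" using F_move_zero[of u' c "0 # w"] n2 u d 1 iu by simp
        have IH: "TT (Suc i) (F ?n2) = (\<lambda>v. tt * F ?n2 v)"
          using less.hyps[of ?n2 "Suc i"] n2 jn d 1 u iu i3 sp_append[of "u' @ [c]" 0 0 w]
          by (simp add: pz_append nth_append)
        have Fx2: "F xs = TT (Suc i) (TT i (F ?n2))" using Fx F1 i3 by simp
        have "TT i (F xs) = TT (Suc i) (TT i (TT (Suc i) (F ?n2)))"
          unfolding Fx2 by (rule TT_braid)
        also have "\<dots> = (\<lambda>v. tt * F xs v)"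
          unfolding IH TT_cmult Fx2 ..
        finally show ?thesis using xd d sp_eq[of xs i] by simp
      next
        case i4: 4
        define k where "k = i - Suc (Suc j)"
        have ik: "i = length (u @ [c, 0]) + k" "i = length (u @ [0, c]) + k" using i4 by (auto simp: k_def j_def)
        have xn: "?nu ! i = xs ! i" "?nu ! Suc i = xs ! Suc i" using 1 i4 by (auto simp: nth_append j_def nth_Cons')
        have sn: "sp i ?nu = u @ c # 0 # sp k w" using sp_append2[of "u @ [c, 0]" k w] ik by simp
        have sx: "sp i xs = u @ 0 # c # sp k w" using sp_append2[of "u @ [0, c]" k w] ik 1 by simp
        have IH: "TT i (F ?nu) = (\<lambda>v. (if xs ! i = xs ! Suc i then tt else 1) * F (sp i ?nu) v)"
          using less.hyps[of ?nu i] pzn nu i ge xn by simp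
        have "TT i (F xs) = TT j (TT i (F ?nu))" unfolding Fx using TT_far[of j i] i4 by simp
        also have "\<dots> = (\<lambda>v. (if xs ! i = xs ! Suc i then tt else 1) * F (sp i xs) v)"
          unfolding IH TT_cmult sn sx
          using F_move_zero[of u c "sp k w"] sp_arr[OF nu, of i] i size sn 1 by (simp add: j_def)
        finally show ?thesis .
      next
        case i5: 5
        have xn: "?nu ! i = xs ! i" "?nu ! Suc i = xs ! Suc i" using 1 i5 by (auto simp: nth_append j_def)
        have sn: "sp i ?nu = sp i u @ c # 0 # w" using sp_append1[of i u] i5 by (simp add: j_def)
        have sx: "sp i xs = sp i u @ 0 # c # w" using sp_append1[of i u] i5 1 by (simp add: j_def)
        have IH: "TT i (F ?nu) = (\<lambda>v. (if xs ! i = xs ! Suc i then tt else 1) * F (sp i ?nu) v)"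
          using less.hyps[of ?nu i] pzn nu i ge xn by simp
        have "TT i (F xs) = TT j (TT i (F ?nu))" unfolding Fx using TT_far[of i j] i5 by simp
        also have "\<dots> = (\<lambda>v. (if xs ! i = xs ! Suc i then tt else 1) * F (sp i xs) v)"
          unfolding IH TT_cmult sn sx
          using F_move_zero[of "sp i u" c w] sp_arr[OF nu, of i] i size sn 1 by (simp add: j_def)
        finally show ?thesis .
      qed
    qed
  qed
qed

lemma F_hecke: "hecke_fam n (arr M0) th1 th2 F"
  unfolding hecke_fam_def
proof (intro ballI allI impI)
  fix xs i assume xs: "xs \<in> arr M0" and i: "Suc i < n"
  have len: "Suc i < length xs" using arr_length[OF xs] i size by simp
  show "TT i (F xs) = (\<lambda>v. th1 (xs ! i) (xs ! Suc i) * F xs v + th2 (xs ! i) (xs ! Suc i) * F (sp i xs) v)"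
  proof (cases "xs ! Suc i \<le> xs ! i")
    case True
    then show ?thesis using F_desc[OF xs i True] sp_eq[of xs i] by (auto simp: th1_def th2_def)
  next
    case False
    have "TT i (F (sp i xs)) = (\<lambda>v. 1 * F xs v)"
      using F_desc[of "sp i xs" i] sp_arr[OF xs] i size False len by (simp add: nth_sp sp_sp)
    from TT_flip[OF this] show ?thesis using False by (simp add: th1_def th2_def)
  qed
qed

lemma TT_h_zero:
  assumes "u @ 0 # b # v \<in> arr M0"
  shows "TT (length u) (h (u @ 0 # b # v)) = (\<lambda>w. tt * h (u @ b # 0 # v) w)"
proof -
  have "Suc (length u) < n" using arr_length[OF assms] size by simp
  then have "TT (length u) (h (u @ 0 # b # v)) = (\<lambda>w. tz1 0 b * h (u @ 0 # b # v) w + tz2 0 b * h (u @ b # 0 # v) w)"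
    using hH assms unfolding hecke_fam_def by (fastforce simp: nth_append)
  then show ?thesis by (cases "b = 0") (simp_all add: tz1_def tz2_def gtz_def eps_def)
qed

lemma TI_h_zero:
  assumes "u @ b # 0 # v \<in> arr M0"
  shows "TI (length u) (h (u @ b # 0 # v)) = (\<lambda>w. 1 / tt * h (u @ 0 # b # v) w)"
proof (rule TI_eqI)
  have "u @ 0 # b # v \<in> arr M0" using assms by (simp add: arr_def add_mset_commute)
  from TT_h_zero[OF this] show "TT (length u) (\<lambda>w. 1 / tt * h (u @ 0 # b # v) w) = h (u @ b # 0 # v)"
    unfolding TT_cmult by simp
qed

lemma JJ_h_zero:
  "bs @ 0 # v \<in> arr M0 \<Longrightarrow> JJ 0 (length bs) (h (bs @ 0 # v)) = (\<lambda>w. 1 / tt ^ length bs * h (0 # bs @ v) w)"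
proof (induction bs arbitrary: v rule: rev_induct)
  case (snoc b bs)
  have "bs @ 0 # b # v \<in> arr M0" using snoc.prems by (simp add: arr_def add_mset_commute)
  note IH = snoc.IH[OF this]
  have "JJ 0 (length (bs @ [b])) (h ((bs @ [b]) @ 0 # v)) = JJ 0 (length bs) (TI (length bs) (h (bs @ b # 0 # v)))"
    by (simp add: JJ_Suc)
  also have "\<dots> = (\<lambda>w. 1 / tt * JJ 0 (length bs) (h (bs @ 0 # b # v)) w)"
    using TI_h_zero[of bs b v] snoc.prems by (simp add: JJ_cdiv)
  finally show ?case unfolding IH by (simp add: fun_eq_iff)
qed simp

text \<open>The inverse operators merely carry the final 0 to the front. The rotation equation then
  factors, and the factor \<open>x_0 - q^r t^(1-n)\<close> is nonzero at generic points.\<close>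

lemma h_last_zero:
  assumes "bs @ [0] \<in> arr M0"
  shows "JJ 0 (n - 1) (h (bs @ [0])) = (\<lambda>w. 1 / tt ^ (n - 1) * h (0 # bs) w)"
    and "RR n (h (bs @ [0])) = h (0 # bs)"
proof -
  have l: "length bs = n - 1" using arr_length[OF assms] size by simp
  show J: "JJ 0 (n - 1) (h (bs @ [0])) = (\<lambda>w. 1 / tt ^ (n - 1) * h (0 # bs) w)"
    using JJ_h_zero[of bs "[]"] assms l by simp
  show "RR n (h (bs @ [0])) = h (0 # bs)"
  proof
    fix v
    have "co v 0 * h (0 # bs) v = qq ^ (0 - r) * ((co v 0 - qq ^ r / tt ^ (n - 1)) * RR n (h (bs @ [0])) v
        + qq ^ r * JJ 0 (n - 1) (h (bs @ [0])) v)"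
      using hR assms unfolding rot_fam_def by blast
    then have "(co v 0 - qq ^ r / tt ^ (n - 1)) * (RR n (h (bs @ [0])) v - h (0 # bs) v) = 0"
      unfolding J by (simp add: algebra_simps)
    moreover have "co v 0 - qq ^ r / tt ^ (n - 1) \<noteq> 0"
      using co_mon[of v 0 "n - 1" r] by (auto simp: field_simps)
    ultimately show "RR n (h (bs @ [0])) v = h (0 # bs) v" by simp
  qed
qed

lemma raise_F_zero:
  "g @ 0 # w \<in> arr M0 \<Longrightarrow> 0 \<notin> set g \<Longrightarrow> foldr TT [0..<length g] (F (g @ 0 # w)) = F (0 # g @ w)"
proof (induction g arbitrary: w rule: rev_induct)
  case (snoc b g)
  have "g @ 0 # b # w \<in> arr M0" using snoc.prems by (simp add: arr_def add_mset_commute)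
  with snoc.IH[of "b # w"] snoc.prems have IH: "foldr TT [0..<length g] (F (g @ 0 # b # w)) = F (0 # g @ b # w)"
    by simp
  have "TT (length g) (F (g @ b # 0 # w)) = F (g @ 0 # b # w)"
    by (rule F_move_zero) (use snoc.prems in auto)
  then show ?case using IH by simp
qed simp

text \<open>A pure Hecke identity. In the induction the factor \<open>x_k - y\<close> is pulled
  through \<open>T_k\<close> by the cross relation, which gives \<open>x_{k+1} - y\<close> and a
  correction proportional to \<open>f\<close>.\<close>

lemma raise_PX:
  "co v 0 * foldr TT [0..<k] (\<lambda>w. PX k w * f w) v
    = tt ^ k * (PX (Suc k) v * JJ 0 k f v + y * JJ 0 k (\<lambda>w. PX k w * f w) v)"
proof (induction k arbitrary: f)
  case 0
  then show ?case by (simp add: PX_def algebra_simps)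
next
  case (Suc k)
  define g where "g = TT k (\<lambda>w. (co w k - y) * f w)"
  have g: "g = (\<lambda>w. tt * ((co w (Suc k) - y) * TI k f w) - y * (tt - 1) * f w)"
  proof
    fix w
    have "g = (\<lambda>w. TT k (\<lambda>w. co w k * f w) w - TT k (\<lambda>w. y * f w) w)"
      unfolding g_def by (simp add: left_diff_distrib TT_diff)
    then have "g w = tt * co w (Suc k) * TI k f w - y * TT k f w" by (simp add: TT_x TT_cmult)
    also have "\<dots> = tt * ((co w (Suc k) - y) * TI k f w) - y * (tt - 1) * f w"
      unfolding TT_eq_TI[of k f w] by (simp add: algebra_simps)
    finally show "g w = \<dots>" .
  qed
  have Pg: "(\<lambda>w. PX k w * g w) = TT k (\<lambda>w. PX (Suc k) w * f w)"
    unfolding g_def PX_Suc mult.assoc by (rule TT_mult_sym[symmetric]) (simp add: PX_sw)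
  have Jg: "JJ 0 k g = (\<lambda>w. tt * ((co w (Suc k) - y) * JJ 0 (Suc k) f w) - y * (tt - 1) * JJ 0 k f w)"
    unfolding g JJ_diff JJ_cmult
    by (subst JJ_mult_sym) (auto simp: JJ_Suc)
  have "(\<lambda>w. PX k w * g w) = (\<lambda>w. tt * TI k (\<lambda>w. PX (Suc k) w * f w) w + (tt - 1) * (PX (Suc k) w * f w))"
    unfolding Pg by (rule ext, rule TT_eq_TI)
  then have JPg: "JJ 0 k (\<lambda>w. PX k w * g w) = (\<lambda>w. tt * JJ 0 (Suc k) (\<lambda>w. PX (Suc k) w * f w) w
      + (tt - 1) * (PX (Suc k) w * JJ 0 k f w))"
    by (simp only: JJ_add JJ_cmult JJ_Suc le0) (subst JJ_mult_sym, auto simp: PX_sw)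
  have "foldr TT [0..<Suc k] (\<lambda>w. PX (Suc k) w * f w) = foldr TT [0..<k] (\<lambda>w. PX k w * g w)"
    by (simp add: Pg)
  then have "co v 0 * foldr TT [0..<Suc k] (\<lambda>w. PX (Suc k) w * f w) v
    = tt ^ k * (PX (Suc k) v * JJ 0 k g v + y * JJ 0 k (\<lambda>w. PX k w * g w) v)"
    using Suc.IH[of g] by simp
  also have "\<dots> = tt ^ Suc k * (PX (Suc (Suc k)) v * JJ 0 (Suc k) f v + y * JJ 0 (Suc k) (\<lambda>w. PX (Suc k) w * f w) v)"
    unfolding Jg JPg PX_Suc[of "Suc k"] by (simp add: algebra_simps)
  finally show ?case .
qed

lemma RR_PX:
  assumes "k < n"
  shows "(co v 0 - y) * RR n (PX k) v = PX (Suc k) v"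
proof -
  have "RR n (PX k) v = (\<Prod>i<k. co v (Suc i) - y)"
    unfolding RR_def PX_def by (rule prod.cong) (use assms in \<open>auto simp: rotv_def\<close>)
  then show ?thesis by (simp add: PX_def prod.lessThan_Suc_shift del: prod.lessThan_Suc)
qed

text \<open>Hecke operators raise a zero from behind \<open>g\<close> to the front. The two terms
  into which \<open>raise_PX\<close> splits the result are the rotation term and the term with
  inverse operators.\<close>

lemma F_rot_zero:
  assumes k: "g @ replicate (Suc m) 0 \<in> arr M0" and g: "0 \<notin> set g"
  shows "co v 0 * F (0 # g @ replicate m 0) v = (co v 0 - y) * RR n (F (g @ replicate (Suc m) 0)) v
    + qq ^ (r - 1) * JJ 0 (n - 1) (F (g @ replicate (Suc m) 0)) v"
proof -
  let ?ka = "g @ replicate (Suc m) 0" and ?k = "length g"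
  have n: "n = ?k + Suc m" using arr_length[OF k] size by simp
  have ka: "?ka = g @ 0 # replicate m 0" "?ka = (g @ replicate m 0) @ [0]"
    by (simp_all add: replicate_append_same)
  have Fk: "F ?ka = (\<lambda>v. PX ?k v * h ?ka v)" by (rule F_packed[OF k g])
  have up: "F (0 # g @ replicate m 0) = foldr TT [0..<?k] (\<lambda>v. PX ?k v * h ?ka v)"
    using raise_F_zero[of g "replicate m 0"] k g unfolding Fk[symmetric] by simp
  have Jh: "JJ 0 ?k (h ?ka) = (\<lambda>w. 1 / tt ^ ?k * h (0 # g @ replicate m 0) w)"
    using JJ_h_zero[of g "replicate m 0"] k by simp
  have Rh: "RR n (h ?ka) = h (0 # g @ replicate m 0)"
    using h_last_zero(2)[of "g @ replicate m 0"] k unfolding ka(2) by simp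
  have JF: "JJ 0 (n - 1) (F ?ka) = (\<lambda>v. 1 / tt ^ m * JJ 0 ?k (F ?ka) v)"
  proof -
    have z: "?ka ! j = 0" if "?k \<le> j" "j < n" for j using that n by (auto simp: nth_append nth_Cons')
    have "TT j (F ?ka) = (\<lambda>v. tt * F ?ka v)" if "?k \<le> j" "j < n - 1" for j
      using F_desc[OF k, of j] z[of j] z[of "Suc j"] sp_eq[of ?ka j] that by simp
    then have "JJ ?k (n - 1) (F ?ka) = (\<lambda>v. 1 / tt ^ (n - 1 - ?k) * F ?ka v)"
      unfolding JJ_def by (subst foldr_TI_eigen) auto
    then show ?thesis using JJ_split[of 0 ?k "n - 1"] n by (simp add: JJ_cdiv)
  qed
  \<comment> \<open>This matches the weight of a negative ball with the coefficient of the inverse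
    operators: \<open>n - 1\<close> is the number of nonzero parts plus \<open>m\<close>.\<close>
  have yy: "qq ^ (r - 1) * (1 / tt ^ m) = tt ^ ?k * y" unfolding y n by (simp add: power_add)
  have "co v 0 * F (0 # g @ replicate m 0) v
      = tt ^ ?k * (PX (Suc ?k) v * JJ 0 ?k (h ?ka) v + y * JJ 0 ?k (F ?ka) v)"
    unfolding up Fk by (rule raise_PX)
  also have "\<dots> = PX (Suc ?k) v * h (0 # g @ replicate m 0) v + tt ^ ?k * y * JJ 0 ?k (F ?ka) v"
    unfolding Jh by (simp add: algebra_simps)
  also have "PX (Suc ?k) v * h (0 # g @ replicate m 0) v = (co v 0 - y) * RR n (F ?ka) v"
    using RR_PX[of ?k v] n unfolding Fk RR_mult Rh by (metis less_add_same_cancel1 mult.assoc zero_less_Suc)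
  also have "tt ^ ?k * y * JJ 0 ?k (F ?ka) v = qq ^ (r - 1) * JJ 0 (n - 1) (F ?ka) v"
    unfolding JF yy[symmetric] by simp
  finally show ?thesis .
qed

text \<open>The part \<open>a\<close> is carried by \<open>TU\<close> from its packed position
  behind \<open>g\<close> to the end. On \<open>F\<close> these moves are clean; on \<open>h\<close>
  they leave extra rows ending in 0, collected in \<open>e\<close>. For such rows \<open>JJ\<close>
  is \<open>RR\<close> divided by \<open>t^(n-1)\<close>, so the two contributions of
  \<open>e\<close> cancel because \<open>y = q^(r-1) / t^(n-1)\<close>.\<close>

lemma F_rot_pos:
  assumes ka: "g @ replicate m 0 @ [a] \<in> arr M0" and g: "0 \<notin> set g" and a: "a \<noteq> 0"
  shows "co v 0 * F (a # g @ replicate m 0) v = qq ^ (a - (r - 1)) * ((co v 0 - y) * RR n (F (g @ replicate m 0 @ [a])) v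
    + qq ^ (r - 1) * JJ 0 (n - 1) (F (g @ replicate m 0 @ [a])) v)"
proof -
  define k where "k = length g"
  have n: "n = k + m + 1" using arr_length[OF ka] size by (simp add: k_def)
  define zz where "zz j = h (g @ replicate j 0 @ a # replicate (m - j) 0)" for j
  have mem: "g @ replicate j 0 @ a # replicate (m - j) 0 \<in> arr M0" if "j \<le> m" for j
  proof -
    have "mset (replicate j 0 @ replicate (m - j) (0::nat)) = mset (replicate m 0)"
      using that by (simp add: replicate_add[symmetric])
    then show ?thesis using ka by (simp add: arr_def add_mset_commute)
  qed
  have split: "g @ replicate j 0 @ a # replicate (m - j) 0 = (g @ replicate j 0) @ a # 0 # replicate (m - Suc j) 0"
    "g @ replicate (Suc j) 0 @ a # replicate (m - Suc j) 0 = (g @ replicate j 0) @ 0 # a # replicate (m - Suc j) 0"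
    if "j < m" for j
    using that by (simp_all add: Suc_diff_Suc[symmetric] replicate_append_same[symmetric])
  have len: "length (g @ replicate j 0) = k + j" for j by (simp add: k_def)
  have TUx: "TU k (k + j) (\<lambda>v. co v k * zz 0 v) = (\<lambda>v. co v (k + j) * zz j v)" if "j \<le> m" for j
    using that
  proof (induction j)
    case (Suc j)
    have "TI (k + j) (zz j) = (\<lambda>w. 1 / tt * zz (Suc j) w)"
      using TI_h_zero[of "g @ replicate j 0" a "replicate (m - Suc j) 0"] mem[of j] Suc.prems
      unfolding zz_def by (simp only: split len Suc_le_lessD less_imp_le simp_thms True_implies_equals)
    moreover have "TU k (k + j) (\<lambda>v. co v k * zz 0 v) = (\<lambda>v. co v (k + j) * zz j v)" using Suc by simp
    ultimately show ?case by (intro ext) (simp add: TT_x)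
  qed simp
  have TUF: "TU k (k + j) (F (g @ a # replicate m 0)) = F (g @ replicate j 0 @ a # replicate (m - j) 0)" if "j \<le> m" for j
    using that
  proof (induction j)
    case (Suc j)
    have "TT (k + j) (F (g @ replicate j 0 @ a # replicate (m - j) 0)) = F (g @ replicate (Suc j) 0 @ a # replicate (m - Suc j) 0)"
      using F_move_zero[of "g @ replicate j 0" a "replicate (m - Suc j) 0"] mem[of j] Suc.prems a
      by (simp only: split len Suc_le_lessD less_imp_le simp_thms True_implies_equals)
    then show ?case using Suc by simp
  qed simp
  have TUz: "\<exists>c. TU k (k + j) (zz 0) = (\<lambda>v. zz j v + (\<Sum>l<j. c l * zz l v))" if "j \<le> m" for j
    using that
  proof (induction j)
    case (Suc j)
    then obtain c where c: "TU k (k + j) (zz 0) = (\<lambda>v. zz j v + (\<Sum>l<j. c l * zz l v))" by auto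
    have "TT (k + j) (zz (Suc j)) = (\<lambda>w. tt * zz j w)"
      using TT_h_zero[of "g @ replicate j 0" a "replicate (m - Suc j) 0"] mem[of "Suc j"] Suc.prems
      unfolding zz_def by (simp only: split len Suc_le_lessD simp_thms True_implies_equals)
    from TT_flip[OF this tt_nz] have 1: "TT (k + j) (zz j) = (\<lambda>v. (tt - 1) * zz j v + zz (Suc j) v)" by simp
    have 2: "TT (k + j) (zz l) = (\<lambda>v. tt * zz l v)" if l: "l < j" for l
    proof -
      let ?x = "g @ replicate l 0 @ a # replicate (m - l) 0"
      have "?x ! (k + j) = 0" "?x ! Suc (k + j) = 0"
        using l Suc.prems by (auto simp: nth_append k_def nth_Cons')
      moreover have "TT (k + j) (h ?x) = (\<lambda>v. tz1 (?x ! (k + j)) (?x ! Suc (k + j)) * h ?x v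
          + tz2 (?x ! (k + j)) (?x ! Suc (k + j)) * h (sp (k + j) ?x) v)"
        using hH mem[of l] l Suc.prems n unfolding hecke_fam_def by auto
      ultimately show ?thesis unfolding zz_def by (simp add: tz1_def tz2_def gtz_def)
    qed
    have "TU k (k + Suc j) (zz 0) = TT (k + j) (\<lambda>v. zz j v + (\<Sum>l<j. c l * zz l v))" using c by simp
    also have "\<dots> = (\<lambda>v. zz (Suc j) v + ((tt - 1) * zz j v + (\<Sum>l<j. tt * c l * zz l v)))"
      by (simp add: TT_add TT_sum TT_cmult 1 2 fun_eq_iff mult_ac cong: sum.cong_simp)
    also have "\<dots> = (\<lambda>v. zz (Suc j) v + (\<Sum>l<Suc j. (if l = j then tt - 1 else tt * c l) * zz l v))"
      by (simp add: fun_eq_iff)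
    finally show ?case by (intro exI[of _ "\<lambda>l. if l = j then tt - 1 else tt * c l"])
  qed simp
  obtain c where c: "TU k (k + m) (zz 0) = (\<lambda>v. zz m v + (\<Sum>l<m. c l * zz l v))" using TUz[of m] by auto
  define e where "e v = (\<Sum>l<m. c l * zz l v)" for v
  have zl: "JJ 0 (n - 1) (zz l) = (\<lambda>v. RR n (zz l) v / tt ^ (n - 1))" if "l < m" for l
  proof -
    have "replicate (m - l) (0::nat) = 0 # replicate (m - Suc l) 0"
      using that by (metis Suc_diff_Suc replicate_Suc)
    then have "g @ replicate l 0 @ a # replicate (m - l) 0 = (g @ replicate l 0 @ a # replicate (m - Suc l) 0) @ [0]"
      by (simp add: replicate_append_same)
    with mem[of l] that h_last_zero[of "g @ replicate l 0 @ a # replicate (m - Suc l) 0"]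
    show ?thesis unfolding zz_def by (simp only: less_imp_le) simp
  qed
  have good: "JJ 0 (n - 1) e = (\<lambda>v. RR n e v / tt ^ (n - 1))"
  proof
    fix v
    have "JJ 0 (n - 1) e v = (\<Sum>l<m. c l * JJ 0 (n - 1) (zz l) v)" unfolding e_def by (simp add: JJ_sum JJ_cmult)
    also have "\<dots> = (\<Sum>l<m. c l * RR n (zz l) v / tt ^ (n - 1))" by (rule sum.cong) (simp_all add: zl del: One_nat_def)
    finally show "JJ 0 (n - 1) e v = RR n e v / tt ^ (n - 1)" by (simp add: e_def RR_def sum_divide_distrib)
  qed
  let ?w = "zz m" and ?z = "zz 0"
  have nk: "n - 1 = k + m" "k \<le> k + m" using n by auto
  have w: "?w = h (g @ replicate m 0 @ [a])" and z: "?z = h (g @ a # replicate m 0)"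
    by (simp_all add: zz_def)
  have F0: "F (g @ a # replicate m 0) = (\<lambda>v. PX (Suc k) v * ?z v)"
    using F_packed[of "g @ [a]" m] mem[of 0] g a unfolding z by (simp add: k_def)
  have Fk: "F (g @ replicate m 0 @ [a]) = TU k (k + m) (F (g @ a # replicate m 0))"
    using TUF[of m] by simp
  have Fk': "F (g @ replicate m 0 @ [a]) = (\<lambda>v. PX k v * (co v (k + m) * ?w v - y * TU k (k + m) ?z v))"
  proof -
    have "(\<lambda>v. PX (Suc k) v * ?z v) = (\<lambda>v. PX k v * (co v k * ?z v - y * ?z v))"
      by (simp add: PX_Suc fun_eq_iff algebra_simps)
    then have "F (g @ replicate m 0 @ [a]) = TU k (k + m) (\<lambda>v. PX k v * (co v k * ?z v - y * ?z v))"
      unfolding Fk F0 by simp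
    also have "\<dots> = (\<lambda>v. PX k v * TU k (k + m) (\<lambda>v. co v k * ?z v - y * ?z v) v)"
      by (rule TU_mult_sym) (auto simp: PX_sw)
    finally show ?thesis using TUx[of m] by (simp add: TU_linear)
  qed
  have J: "JJ 0 (n - 1) (F (g @ replicate m 0 @ [a])) = (\<lambda>v. PX (Suc k) v * JJ 0 k ?z v)"
  proof -
    have "JJ 0 (n - 1) (F (g @ replicate m 0 @ [a])) = JJ 0 k (F (g @ a # replicate m 0))"
      unfolding Fk nk(1) using JJ_split[of 0 k "k + m"] JJ_TU[of k "k + m"] by simp
    also have "\<dots> = (\<lambda>v. PX (Suc k) v * JJ 0 k ?z v)"
      unfolding F0 by (rule JJ_mult_sym) (auto simp: PX_sw)
    finally show ?thesis .
  qed
  have Jz: "JJ 0 k ?z v = JJ 0 (n - 1) ?w v + RR n e v / tt ^ (n - 1)"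
  proof -
    have "JJ 0 k ?z = JJ 0 (n - 1) (TU k (k + m) ?z)"
      unfolding nk(1) using JJ_split[of 0 k "k + m"] JJ_TU[of k "k + m"] by simp
    then show ?thesis unfolding c e_def[symmetric] JJ_add good by simp
  qed
  have RT: "RR n (TU k (k + m) ?z) v = RR n ?w v + RR n e v"
    unfolding c e_def[symmetric] RR_add by simp
  \<comment> \<open>The \<open>1/q\<close> on the wrapped variable accounts for the passage from
    \<open>a - r\<close> to \<open>a - (r - 1)\<close> and from \<open>q^r\<close> to
    \<open>q^(r-1)\<close>.\<close>
  have xk: "RR n (\<lambda>v. co v (k + m)) v = co v 0 / qq"
    using n by (simp add: RR_def rotv_def)
  have R: "(co v 0 - y) * RR n (F (g @ replicate m 0 @ [a])) v
      = PX (Suc k) v * (co v 0 / qq * RR n ?w v - y * (RR n ?w v + RR n e v))"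
    using RR_PX[of k v] n RT xk unfolding Fk' RR_mult RR_diff RR_const mult.assoc[symmetric] by simp
  have hr: "co v 0 * h (a # g @ replicate m 0) v = qq ^ (a - r) * ((co v 0 - qq ^ r / tt ^ (n - 1)) * RR n ?w v
      + qq ^ r * JJ 0 (n - 1) ?w v)"
    using hR ka unfolding rot_fam_def w by (metis append_assoc)
  have ar: "r \<le> a" using labels ka a by (auto simp: arr_def)
  have q1: "qq ^ (a - (r - 1)) = qq * qq ^ (a - r)" using ar r1 by (simp flip: power_Suc add: Suc_diff_le)
  have q2: "qq ^ r = qq * qq ^ (r - 1)" using r1 by (simp flip: power_Suc)
  have Fa: "F (a # g @ replicate m 0) v = PX (Suc k) v * h (a # g @ replicate m 0) v"
    using F_packed[of "a # g" m] ka g a by (simp add: k_def arr_def add_mset_commute)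
  define X Rw Re Jw P hv where "X = co v 0" and "Rw = RR n ?w v" and "Re = RR n e v" and "Jw = JJ 0 (n - 1) ?w v"
    and "P = PX (Suc k) v" and "hv = h (a # g @ replicate m 0) v"
  note ds = X_def[symmetric] Rw_def[symmetric] Re_def[symmetric] Jw_def[symmetric] P_def[symmetric] hv_def[symmetric]
  have "X * (P * hv) = P * (X * hv)" by simp
  also have "\<dots> = P * (qq ^ (a - r) * ((X - qq * y) * Rw + qq * qq ^ (r - 1) * Jw))"
    using hr unfolding ds q2 y by simp
  also have "\<dots> = qq * qq ^ (a - r) * (P * (X / qq * Rw - y * (Rw + Re)) + qq ^ (r - 1) * (P * (Jw + Re / tt ^ (n - 1))))"
    unfolding y by (simp add: field_simps)
  finally show ?thesis unfolding Fa R J q1 Jz unfolding ds .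
qed

text \<open>Hecke operators intertwine both sides of the equation, with the index raised by one on
  the side where \<open>a\<close> stands in front. Hence the equation survives exchanging two
  entries of \<open>ys\<close>, and packed \<open>ys\<close> are enough.\<close>

lemma F_rot: "rot_fam n (qq ^ (r - 1)) (\<lambda>a. a - (r - 1)) (arr M0) F"
  unfolding rot_fam_def
proof (intro allI impI)
  fix ys a v assume ya: "ys @ [a] \<in> arr M0"
  define E where "E ys \<longleftrightarrow> (ys @ [a] \<in> arr M0 \<longrightarrow> (\<forall>v. co v 0 * F (a # ys) v
     = qq ^ (a - (r - 1)) * ((co v 0 - y) * RR n (F (ys @ [a])) v + qq ^ (r - 1) * JJ 0 (n - 1) (F (ys @ [a])) v)))" for ys
  have step: "E (u @ d # c # w)" if E: "E (u @ c # d # w)" for u c d w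
    unfolding E_def
  proof (intro impI allI)
    fix v assume mem': "(u @ d # c # w) @ [a] \<in> arr M0"
    define i where "i = length u"
    have mem: "u @ c # d # w @ [a] \<in> arr M0" and mem2: "a # u @ c # d # w \<in> arr M0"
      using mem' by (simp_all add: arr_def add_mset_commute)
    have i: "Suc (Suc i) < n" using arr_length[OF mem] size by (simp add: i_def)
    let ?op = "\<lambda>f v. qq ^ (a - (r - 1)) * ((co v 0 - y) * RR n f v + qq ^ (r - 1) * JJ 0 (n - 1) f v)"
    have eq: "(\<lambda>v. co v 0 * F (a # u @ c # d # w) v) = ?op (F (u @ c # d # w @ [a]))"
      using E mem unfolding E_def by auto
    show "co v 0 * F (a # u @ d # c # w) v = ?op (F ((u @ d # c # w) @ [a])) v"
    proof (cases "c = d")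
      case True
      then show ?thesis using fun_cong[OF eq, of v] by simp
    next
      case False
      \<comment> \<open>The coefficient of the exchanged row vanishes only for equal parts, so its
        equation can be solved for.\<close>
      then have t2: "th2 c d \<noteq> 0" by (auto simp: th2_def)
      have T1: "TT (Suc i) (F (a # u @ c # d # w)) = (\<lambda>v. th1 c d * F (a # u @ c # d # w) v + th2 c d * F (a # u @ d # c # w) v)"
        using F_hecke mem2 i sp_append[of "a # u" c d w] unfolding hecke_fam_def by (auto simp: i_def nth_append)
      have T2: "TT i (F (u @ c # d # w @ [a])) = (\<lambda>v. th1 c d * F (u @ c # d # w @ [a]) v + th2 c d * F (u @ d # c # w @ [a]) v)"
        using F_hecke mem i sp_append[of u c d "w @ [a]"] unfolding hecke_fam_def by (auto simp: i_def nth_append)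
      have opT: "TT (Suc i) (?op f) = ?op (TT i f)" for f
      proof -
        have "TT (Suc i) (?op f) = (\<lambda>v. qq ^ (a - (r - 1)) * ((co v 0 - y) * TT (Suc i) (RR n f) v
            + qq ^ (r - 1) * TT (Suc i) (JJ 0 (n - 1) f) v))"
          unfolding TT_cmult TT_add by (subst TT_mult_sym) auto
        then show ?thesis using RR_TT[OF i] JJ_TT[of 0 i "n - 1" f] i by simp
      qed
      have oplin: "?op (\<lambda>v. s * f v + s' * f' v) v = s * ?op f v + s' * ?op f' v" for s s' f f' v
        unfolding RR_add RR_mult RR_const JJ_add JJ_cmult by (simp add: algebra_simps)
      have "TT (Suc i) (\<lambda>v. co v 0 * F (a # u @ c # d # w) v) v = TT (Suc i) (?op (F (u @ c # d # w @ [a]))) v"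
        unfolding eq ..
      then have "co v 0 * (th1 c d * F (a # u @ c # d # w) v + th2 c d * F (a # u @ d # c # w) v)
          = th1 c d * ?op (F (u @ c # d # w @ [a])) v + th2 c d * ?op (F (u @ d # c # w @ [a])) v"
        unfolding opT T2 oplin by (subst (asm) TT_mult_sym) (auto simp: T1)
      then have "th2 c d * (co v 0 * F (a # u @ d # c # w) v) = th2 c d * ?op (F (u @ d # c # w @ [a])) v"
        unfolding fun_cong[OF eq, symmetric, of v] by (simp add: algebra_simps)
      then show ?thesis using t2 by simp
    qed
  qed
  define g where "g = filter (\<lambda>x. x \<noteq> 0) ys"
  define m where "m = count_list ys 0"
  have ms: "mset (g @ replicate m 0) = mset ys"
    unfolding g_def m_def by (induction ys) (auto simp: add_mset_commute)
  have g0: "0 \<notin> set g" by (simp add: g_def)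
  have Eg: "E (g @ replicate m 0)"
  proof (cases "a = 0")
    case True
    show ?thesis unfolding E_def
    proof (intro impI allI)
      fix v assume "(g @ replicate m 0) @ [a] \<in> arr M0"
      then have "g @ replicate (Suc m) 0 \<in> arr M0" using True by (simp add: replicate_append_same)
      from F_rot_zero[OF this g0, of v] show "co v 0 * F (a # g @ replicate m 0) v =
         qq ^ (a - (r - 1)) * ((co v 0 - y) * RR n (F ((g @ replicate m 0) @ [a])) v +
          qq ^ (r - 1) * JJ 0 (n - 1) (F ((g @ replicate m 0) @ [a])) v)"
        using True by (simp add: replicate_append_same)
    qed
  next
    case False
    then show ?thesis unfolding E_def using F_rot_pos[OF _ g0 False, of m] by simp
  qed
  have "E ys" by (rule adjacent_swap_induct[of E, OF _ ms Eg]) (rule step)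
  then show "co v 0 * F (a # ys) v = qq ^ (a - (r - 1)) * ((co v 0 - qq ^ (r - 1) / tt ^ (n - 1)) * RR n (F (ys @ [a])) v
      + qq ^ (r - 1) * JJ 0 (n - 1) (F (ys @ [a])) v)"
    using ya unfolding E_def y by blast
qed

end

section \<open>Sums over pairings, one strand at a time\<close>

text \<open>Sums over all ways to place strands one after another; \<open>ky c\<close> is the position used up by the
  choice \<open>c\<close>, and \<open>U\<close> collects the positions already used.\<close>

fun asum :: "('j \<Rightarrow> 'c set) \<Rightarrow> ('j \<Rightarrow> 'c \<Rightarrow> 'k set \<Rightarrow> qt) \<Rightarrow> ('c \<Rightarrow> 'k) \<Rightarrow> 'j list \<Rightarrow> 'k set \<Rightarrow> qt" where
  "asum Al w ky [] U = 1"
| "asum Al w ky (j # js) U = (\<Sum>c\<in>{c\<in>Al j. ky c \<notin> U}. w j c U * asum Al w ky js (insert (ky c) U))"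

text \<open>The default \<open>d\<close> outside \<open>js\<close> makes every assignment a unique
  total function, matching the canonical zeros of the record fields.\<close>

definition asg :: "('j \<Rightarrow> 'c set) \<Rightarrow> ('c \<Rightarrow> 'k) \<Rightarrow> 'c \<Rightarrow> 'j list \<Rightarrow> 'k set \<Rightarrow> ('j \<Rightarrow> 'c) set" where
  "asg Al ky d js U = {p. (\<forall>j. j \<notin> set js \<longrightarrow> p j = d) \<and> (\<forall>j\<in>set js. p j \<in> Al j \<and> ky (p j) \<notin> U)
     \<and> inj_on (\<lambda>j. ky (p j)) (set js)}"

lemma finite_asg:
  assumes "\<And>j. j \<in> set js \<Longrightarrow> finite (Al j)"
  shows "finite (asg Al ky d js U)"
proof -
  have "finite {p. \<forall>x. (x \<in> set js \<longrightarrow> p x \<in> (\<Union>j\<in>set js. Al j)) \<and> (x \<notin> set js \<longrightarrow> p x = d)}"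
    using assms by (intro finite_set_of_finite_funs) auto
  then show ?thesis by (rule rev_finite_subset) (auto simp: asg_def)
qed

text \<open>\<open>bef\<close> is the placing order. The weight of a strand depends on earlier
  strands only through the set of positions they occupy, and this is what allows the sum to be
  unfolded strand by strand.\<close>

lemma asum_eq:
  assumes "distinct js" "sorted_wrt bef js" "\<And>x y. bef x y \<Longrightarrow> \<not> bef y x"
    and "\<And>j. j \<in> set js \<Longrightarrow> finite (Al j)"
  shows "(\<Sum>p\<in>asg Al ky d js U. \<Prod>j\<in>set js. w j (p j) (U \<union> (\<lambda>j. ky (p j)) ` {c\<in>set js. bef c j}))
    = asum Al w ky js U"
  using assms
proof (induction js arbitrary: U)
  case Nil
  have "asg Al ky d [] U = {\<lambda>_. d}" by (auto simp: asg_def)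
  then show ?case by simp
next
  case (Cons j js)
  have j: "j \<notin> set js" and dj: "distinct js" and bj: "\<And>x. x \<in> set js \<Longrightarrow> bef j x" and sj: "sorted_wrt bef js"
    using Cons.prems(1,2) by auto
  let ?S = "\<lambda>c. asg Al ky d js (insert (ky c) U)"
  let ?C = "{c\<in>Al j. ky c \<notin> U}"
  define W where "W U js p = (\<Prod>j\<in>set js. w j (p j) (U \<union> (\<lambda>j. ky (p j)) ` {c\<in>set js. bef c j}))" for U js p
  have IH: "(\<Sum>p\<in>asg Al ky d js V. W V js p) = asum Al w ky js V" for V
    unfolding W_def by (rule Cons.IH[OF dj sj Cons.prems(3)]) (use Cons.prems(4) in auto)
  have fin: "finite ?C" "\<And>c. finite (?S c)" using Cons.prems(4) by (auto intro: finite_asg)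
  have W: "W U (j # js) (p(j := c)) = w j c U * W (insert (ky c) U) js p" for c p
  proof -
    have e: "{x\<in>set (j # js). bef x j} = {}" using Cons.prems(3) bj by auto
    have "(\<Prod>i\<in>set js. w i ((p(j := c)) i) (U \<union> (\<lambda>i. ky ((p(j := c)) i)) ` {x\<in>set (j # js). bef x i}))
        = W (insert (ky c) U) js p" unfolding W_def
    proof (rule prod.cong)
      fix i assume i: "i \<in> set js"
      have "{x\<in>set (j # js). bef x i} = insert j {x\<in>set js. bef x i}" using bj[OF i] by auto
      then have "U \<union> (\<lambda>i. ky ((p(j := c)) i)) ` {x\<in>set (j # js). bef x i}
          = insert (ky c) U \<union> (\<lambda>i. ky (p i)) ` {x\<in>set js. bef x i}"
        using j by (auto simp: image_iff)
      then show "w i ((p(j := c)) i) (U \<union> (\<lambda>i. ky ((p(j := c)) i)) ` {x\<in>set (j # js). bef x i})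
        = w i (p i) (insert (ky c) U \<union> (\<lambda>j. ky (p j)) ` {c\<in>set js. bef c i})"
        using i j by auto
    qed simp
    moreover have "W U (j # js) (p(j := c)) = w j ((p(j := c)) j) (U \<union> (\<lambda>i. ky ((p(j := c)) i)) ` {x\<in>set (j # js). bef x j})
        * (\<Prod>i\<in>set js. w i ((p(j := c)) i) (U \<union> (\<lambda>i. ky ((p(j := c)) i)) ` {x\<in>set (j # js). bef x i}))"
      unfolding W_def list.set(2) by (rule prod.insert) (use j in auto)
    ultimately show ?thesis unfolding e by simp
  qed
  have "(\<Sum>p\<in>asg Al ky d (j # js) U. W U (j # js) p)
      = (\<Sum>(c, p)\<in>Sigma ?C ?S. W U (j # js) (p(j := c)))"
  proof (rule sum.reindex_bij_witness[of _ "\<lambda>(c, p). p(j := c)" "\<lambda>p. (p j, p(j := d))"])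
    fix p assume p: "p \<in> asg Al ky d (j # js) U"
    show "(case (p j, p(j := d)) of (c, p) \<Rightarrow> p(j := c)) = p" by simp
    show "(p j, p(j := d)) \<in> Sigma ?C ?S"
      using p j unfolding asg_def by (auto simp: inj_on_def)
    show "(case (p j, p(j := d)) of (c, p) \<Rightarrow> W U (j # js) (p(j := c))) = W U (j # js) p" by simp
  next
    fix x assume "x \<in> Sigma ?C ?S"
    then obtain c p where x: "x = (c, p)" "c \<in> ?C" "p \<in> ?S c" by auto
    have "p j = d" using x j by (auto simp: asg_def)
    then show "((case x of (c, p) \<Rightarrow> p(j := c)) j, (case x of (c, p) \<Rightarrow> p(j := c))(j := d)) = x" using x by auto
    show "(case x of (c, p) \<Rightarrow> p(j := c)) \<in> asg Al ky d (j # js) U"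
      using x j unfolding asg_def by (auto simp: inj_on_def)
  qed
  also have "\<dots> = (\<Sum>c\<in>?C. \<Sum>p\<in>?S c. W U (j # js) (p(j := c)))"
    using fin by (subst sum.Sigma) auto
  also have "\<dots> = (\<Sum>c\<in>?C. w j c U * (\<Sum>p\<in>?S c. W (insert (ky c) U) js p))"
    by (simp add: W sum_distrib_left)
  also have "\<dots> = (\<Sum>c\<in>?C. w j c U * asum Al w ky js (insert (ky c) U))"
    unfolding IH ..
  finally show ?case unfolding W_def by simp
qed

text \<open>The placing order of the strands: decreasing label, and within one label from right to
  left.\<close>

fun jl :: "(nat \<Rightarrow> nat) \<Rightarrow> nat \<Rightarrow> nat \<Rightarrow> nat list" where
  "jl K n 0 = []"
| "jl K n (Suc a) = rev (filter (\<lambda>j. K j = Suc a) [0..<n]) @ jl K n a"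

lemma set_jl: "set (jl K n a) = {j. j < n \<and> 0 < K j \<and> K j \<le> a}"
proof (induction a)
  case (Suc a)
  have "set (jl K n (Suc a)) = {j. j < n \<and> K j = Suc a} \<union> set (jl K n a)" by auto
  also have "\<dots> = {j. j < n \<and> 0 < K j \<and> K j \<le> Suc a}"
    unfolding Suc by (rule set_eqI) (simp, linarith)
  finally show ?case .
qed auto

lemma distinct_jl: "distinct (jl K n a)"
  by (induction a) (auto simp: set_jl)

lemma sorted_desc_filter: "sorted_wrt (\<lambda>x y. y < x) (rev (filter P [0..<n]))"
  by (induction n) (auto simp: sorted_wrt_append)

lemma sorted_jl: "sorted_wrt (prec K) (jl K n a)"
proof (induction a)
  case (Suc a)
  have "sorted_wrt (prec K) (rev (filter (\<lambda>j. K j = Suc a) [0..<n]))"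
    by (rule sorted_wrt_mono_rel[OF _ sorted_desc_filter]) (auto simp: prec_def)
  moreover have "\<forall>x\<in>set (rev (filter (\<lambda>j. K j = Suc a) [0..<n])). \<forall>y\<in>set (jl K n a). prec K x y"
    by (auto simp: set_jl prec_def)
  ultimately show ?case using Suc unfolding jl.simps sorted_wrt_append by blast
qed simp

lemma prec_asym: "prec K x y \<Longrightarrow> \<not> prec K y x"
  by (auto simp: prec_def)

section \<open>Pairings of a classic layer\<close>

text \<open>One classic layer detached from the record: \<open>K\<close> holds the labels above,
  \<open>B\<close> the absolute values below.\<close>

definition cl_pair :: "nat \<Rightarrow> (nat \<Rightarrow> nat) \<Rightarrow> (nat \<Rightarrow> nat) \<Rightarrow> (nat \<Rightarrow> nat) set" where
  "cl_pair n K B = {p. (\<forall>j. \<not> (j < n \<and> K j \<noteq> 0) \<longrightarrow> p j = 0)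
     \<and> (\<forall>j<n. K j \<noteq> 0 \<longrightarrow> p j < n \<and> B (p j) = K j) \<and> inj_on p {j. j < n \<and> K j \<noteq> 0}
     \<and> (\<forall>j<n. K j \<noteq> 0 \<longrightarrow> (B j = 0 \<or> K j \<le> B j) \<and> (B j = K j \<longrightarrow> p j = j))}"

definition cl_free :: "nat \<Rightarrow> (nat \<Rightarrow> nat) \<Rightarrow> (nat \<Rightarrow> nat) \<Rightarrow> (nat \<Rightarrow> nat) \<Rightarrow> nat \<Rightarrow> nat set" where
  "cl_free n K B p j = {c. c < n \<and> B c \<noteq> 0 \<and> c \<notin> p ` {c'. c' < n \<and> K c' \<noteq> 0 \<and> prec K c' j}
     \<and> \<not> (B c = K j \<and> K c \<noteq> 0 \<and> p c = c)}"

definition cl_wt :: "nat \<Rightarrow> nat \<Rightarrow> (nat \<Rightarrow> nat) \<Rightarrow> (nat \<Rightarrow> nat) \<Rightarrow> (nat \<Rightarrow> nat) \<Rightarrow> nat \<Rightarrow> qt" where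
  "cl_wt n r K B p j = (if p j = j then 1
     else (1 - tt) * tt ^ card (cl_free n K B p j \<inter> cyc_between n j (p j))
        / (1 - qq ^ (K j - r) * tt ^ card (cl_free n K B p j)) * (if p j < j then qq ^ (K j - r) else 1))"

lemma cword_map: "cword a (map K cs) (map B cs) = concat (map (\<lambda>c. ccol a (K c) (B c)) cs)"
  by (induction cs) simp_all

context
  fixes n r L :: nat and K B :: "nat \<Rightarrow> nat"
  assumes K: "\<And>j. j < n \<Longrightarrow> K j \<in> insert 0 {r+1..L}" and B: "\<And>j. j < n \<Longrightarrow> B j \<in> insert 0 {r..L}"
    and cnt: "\<And>a. a \<in> {r+1..L} \<Longrightarrow> card {j. j < n \<and> K j = a} = card {j. j < n \<and> B j = a}"
    and ok: "\<And>j. j < n \<Longrightarrow> ok (K j) (B j)"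
begin

text \<open>A lower ball that is going to be trivially paired is excluded from the outset as the
  target of other strands of its label.\<close>

definition "cAl j = (if B j = K j then {j} else {k. k < n \<and> B k = K j \<and> K k \<noteq> K j})"
definition "cF j U = {c. c < n \<and> B c \<noteq> 0 \<and> c \<notin> U \<and> \<not> (B c = K j \<and> K c = K j)}"
definition "cW j k U = (if k = j then 1 else (1 - tt) * tt ^ card (cF j U \<inter> cyc_between n j k)
   / (1 - qq ^ (K j - r) * tt ^ card (cF j U)) * (if k < j then qq ^ (K j - r) else 1))"

text \<open>An invariant for placing the strands of one label: \<open>B'\<close> contains the lower
  balls of that label which nontrivial strands still have to match. Each such strand is one use of
  \<open>tr_strand_rec\<close>, whose left factor is the denominator of the strand weight; when no
  strand is left the normalised trace is 1.\<close>

lemma cl_block: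
  assumes a: "a \<in> {r+1..L}" and "distinct js" "\<And>j. j \<in> set js \<Longrightarrow> j < n \<and> K j = a"
    and "B' \<subseteq> {c. c < n \<and> B c = a \<and> K c \<noteq> a}" "card {j\<in>set js. B j \<noteq> a} = card B'"
  shows "asum cAl cW id (js @ rest) ({c. c < n \<and> a \<le> B c} - B' - {c\<in>set js. B c = a})
    = cc (qq ^ (a - r)) (WW (\<lambda>c. if c \<in> B' then LB else if 0 < B c \<and> B c < a then LD else LO)
        (\<lambda>c. if c \<in> set js \<and> B c \<noteq> a then LA else LO) [0..<n])
      * asum cAl cW id rest {c. c < n \<and> a \<le> B c}"
  using assms(2-)
proof (induction js arbitrary: B')
  case Nil
  have "finite B'" using Nil(3) by (rule finite_subset) simp
  then have B': "B' = {}" using Nil by simp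
  have Q: "1 - qq ^ (a - r) * tt ^ k \<noteq> 0" for k using a by (intro one_minus_qt_nz) auto
  have "cc (qq ^ (a - r)) (WW (\<lambda>c. if c \<in> B' then LB else if 0 < B c \<and> B c < a then LD else LO)
        (\<lambda>c. if c \<in> set [] \<and> B c \<noteq> a then LA else LO) [0..<n]) = 1"
    by (rule cc_trivial[OF _ Q]) (auto simp: WW_def B')
  then show ?case by (simp only: append_Nil B') simp
next
  case (Cons j js)
  define Q where "Q = qq ^ (a - r)"
  have Q: "1 - Q * tt ^ k \<noteq> 0" for k unfolding Q_def using a by (intro one_minus_qt_nz) auto
  have a1: "1 \<le> a" using a by auto
  have j: "j < n" "K j = a" "j \<notin> set js" using Cons.prems by auto
  let ?R = "asum cAl cW id rest {c. c < n \<and> a \<le> B c}"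
  let ?U = "{c. c < n \<and> a \<le> B c} - B' - {c\<in>set (j # js). B c = a}"
  define f where "f B' = (\<lambda>c. if c \<in> B' then LB else if 0 < B c \<and> B c < a then LD else LO)" for B'
  define g where "g js = (\<lambda>c. if c \<in> set js \<and> B c \<noteq> a then LA else LO)" for js
  have fin: "finite B'" using Cons.prems(3) by (rule finite_subset) simp
  show ?case
  proof (cases "B j = a")
    case True
    have "asum cAl cW id ((j # js) @ rest) ?U = asum cAl cW id (js @ rest) (insert j ?U)"
    proof -
      have "{c\<in>cAl j. id c \<notin> ?U} = {j}" using True j by (auto simp: cAl_def)
      then show ?thesis by (simp add: cW_def)
    qed
    also have "insert j ?U = {c. c < n \<and> a \<le> B c} - B' - {c\<in>set js. B c = a}"
      using True j Cons.prems(3) by auto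
    also have "asum cAl cW id (js @ rest) \<dots> = cc (qq ^ (a - r)) (WW (f B') (g js) [0..<n]) * ?R"
      unfolding f_def g_def
    proof (rule Cons.IH)
      show "card {j\<in>set js. B j \<noteq> a} = card B'"
      proof -
        have "{i\<in>set (j # js). B i \<noteq> a} = {i\<in>set js. B i \<noteq> a}" using True by auto
        then show ?thesis using Cons.prems(4) by simp
      qed
    qed (use Cons.prems in auto)
    also have "g js = g (j # js)" using True by (auto simp: g_def)
    finally show ?thesis unfolding f_def g_def .
  next
    case False
    have jB: "j \<notin> B'" using Cons.prems(3) False by auto
    have ch: "{c\<in>cAl j. id c \<notin> ?U} = B'"
      using False j Cons.prems(2,3) by (auto simp: cAl_def)
    \<comment> \<open>The balls free for the current strand, those in \<open>B'\<close> and those of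
      smaller label, are the columns whose letter is not \<open>LO\<close>.\<close>
    have F: "cF j ?U = {c. c < n \<and> f B' c \<noteq> LO}"
      using j Cons.prems(2,3) a1 unfolding cF_def f_def by (auto split: if_splits)
    have k: "w = cc Q (WW ((f B')(k := LO)) ((g (j # js))(j := LO)) [0..<n]) * ?R"
      if k: "k \<in> B'" and w: "w = asum cAl cW id (js @ rest) (insert k ?U)" for k w
    proof -
      have "insert k ?U = {c. c < n \<and> a \<le> B c} - (B' - {k}) - {c\<in>set js. B c = a}"
        using k False Cons.prems(2,3) by auto
      then have "w = asum cAl cW id (js @ rest) ({c. c < n \<and> a \<le> B c} - (B' - {k}) - {c\<in>set js. B c = a})"
        using w by simp
      also have "\<dots> = cc (qq ^ (a - r)) (WW (f (B' - {k})) (g js) [0..<n]) * ?R"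
        unfolding f_def g_def
      proof (rule Cons.IH)
        have "{i\<in>set (j # js). B i \<noteq> a} = insert j {i\<in>set js. B i \<noteq> a}" using False by auto
        then have "Suc (card {i\<in>set js. B i \<noteq> a}) = card B'" using Cons.prems(4) j by simp
        then show "card {j\<in>set js. B j \<noteq> a} = card (B' - {k})" using k fin by simp
      qed (use Cons.prems in auto)
      also have "f (B' - {k}) = (f B')(k := LO)" using k Cons.prems(3) by (auto simp: f_def fun_eq_iff)
      also have "g js = (g (j # js))(j := LO)" using j by (auto simp: g_def fun_eq_iff)
      finally show ?thesis unfolding Q_def .
    qed
    have KB: "{k. k < n \<and> f B' k = LB} = B'" using Cons.prems(3) by (auto simp: f_def split: if_splits)
    have KA: "{c. c < n \<and> g (j # js) c = LA} = {i\<in>set (j # js). B i \<noteq> a}"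
      using Cons.prems(2) by (auto simp: g_def split: if_splits)
    have gj: "g (j # js) j = LA" using False by (simp add: g_def)
    have bal: "card B' = card {c. c < n \<and> g (j # js) c = LA}" unfolding KA Cons.prems(4) ..
    define N where "N = card {c. c < n \<and> f B' c \<noteq> LO}"
    have rec: "(1 - Q * tt ^ N) * tr Q (WW (f B') (g (j # js)) [0..<n])
      = (\<Sum>k\<in>B'. (1 - tt) * tt ^ card ({c. c < n \<and> f B' c \<noteq> LO} \<inter> cyc_between n j k)
          * (if k \<le> j then Q else 1) * tr Q (WW ((f B')(k := LO)) ((g (j # js))(j := LO)) [0..<n]))"
      unfolding N_def
      by (rule tr_strand_rec[where n = n and f = "f B'" and g = "g (j # js)", unfolded KB, OF Q _ j(1) gj bal])
        (auto simp: f_def g_def)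
    \<comment> \<open>Removing a strand does not touch the letters \<open>LD\<close>, so the
      normalisation is the same before and after.\<close>
    have nd: "nd (WW ((f B')(k := LO)) ((g (j # js))(j := LO)) [0..<n]) = nd (WW (f B') (g (j # js)) [0..<n])"
      if "k \<in> B'" for k
    proof -
      have "{c. c < n \<and> ((f B')(k := LO)) c = LD} = {c. c < n \<and> f B' c = LD}" using that by (auto simp: f_def)
      moreover have "{c. c < n \<and> ((g (j # js))(j := LO)) c = LD} = {c. c < n \<and> g (j # js) c = LD}" by (auto simp: g_def)
      ultimately show ?thesis by (simp only: count_WW count_map_upt)
    qed
    define D where "D = nd (WW (f B') (g (j # js)) [0..<n])"
    have "asum cAl cW id ((j # js) @ rest) ?U = (\<Sum>k\<in>B'. cW j k ?U * asum cAl cW id (js @ rest) (insert k ?U))"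
      using ch by simp
    also have "\<dots> = (\<Sum>k\<in>B'. (1 - Q * tt ^ D) / (1 - Q * tt ^ N) * ?R
       * ((1 - tt) * tt ^ card ({c. c < n \<and> f B' c \<noteq> LO} \<inter> cyc_between n j k)
          * (if k \<le> j then Q else 1) * tr Q (WW ((f B')(k := LO)) ((g (j # js))(j := LO)) [0..<n])))"
    proof (rule sum.cong)
      fix k assume kB: "k \<in> B'"
      then have kj: "k \<noteq> j" using jB by auto
      have "asum cAl cW id (js @ rest) (insert k ?U)
          = (1 - Q * tt ^ D) * tr Q (WW ((f B')(k := LO)) ((g (j # js))(j := LO)) [0..<n]) * ?R"
        using k[OF kB refl] nd[OF kB] unfolding cc_def D_def by simp
      moreover have "cW j k ?U = (1 - tt) * tt ^ card ({c. c < n \<and> f B' c \<noteq> LO} \<inter> cyc_between n j k)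
          / (1 - Q * tt ^ N) * (if k \<le> j then Q else 1)"
        unfolding cW_def F N_def using kj j by (simp add: Q_def le_less)
      ultimately show "cW j k ?U * asum cAl cW id (js @ rest) (insert k ?U) = (1 - Q * tt ^ D) / (1 - Q * tt ^ N) * ?R
       * ((1 - tt) * tt ^ card ({c. c < n \<and> f B' c \<noteq> LO} \<inter> cyc_between n j k)
          * (if k \<le> j then Q else 1) * tr Q (WW ((f B')(k := LO)) ((g (j # js))(j := LO)) [0..<n]))"
        by simp
    qed simp
    also have "\<dots> = (1 - Q * tt ^ D) / (1 - Q * tt ^ N) * ?R * ((1 - Q * tt ^ N) * tr Q (WW (f B') (g (j # js)) [0..<n]))"
      unfolding rec sum_distrib_left ..
    also have "\<dots> = cc Q (WW (f B') (g (j # js)) [0..<n]) * ?R"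
      using Q[of N] by (simp add: cc_def D_def)
    finally show ?thesis unfolding f_def g_def Q_def .
  qed
qed

text \<open>Once all labels above \<open>a\<close> are placed, the occupied positions are exactly
  the lower balls of label above \<open>a\<close>, whatever the pairing was. Therefore the labels
  decouple into a product.\<close>

lemma cl_asum:
  assumes "r \<le> a" "a \<le> L"
  shows "asum cAl cW id (jl K n a) {c. c < n \<and> a < B c}
    = (\<Prod>a'\<in>{r+1..a}. cc (qq ^ (a' - r)) (cword a' (map K [0..<n]) (map B [0..<n])))"
  using assms
proof (induction a rule: dec_induct)
  case base
  have "set (jl K n r) = {}" unfolding set_jl using K by fastforce
  then show ?case by simp
next
  case (step a)
  let ?blk = "rev (filter (\<lambda>j. K j = Suc a) [0..<n])"
  let ?B' = "{c. c < n \<and> B c = Suc a \<and> K c \<noteq> Suc a}"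
  have aL: "Suc a \<in> {r+1..L}" using step by auto
  have sb: "set ?blk = {j. j < n \<and> K j = Suc a}" by auto
  have U: "{c. c < n \<and> Suc a < B c} = {c. c < n \<and> Suc a \<le> B c} - ?B' - {c\<in>set ?blk. B c = Suc a}"
    unfolding sb by auto
  have card: "card {j\<in>set ?blk. B j \<noteq> Suc a} = card ?B'"
  proof -
    let ?T = "{j. j < n \<and> K j = Suc a \<and> B j = Suc a}"
    have e1: "{j. j < n \<and> K j = Suc a} = {j\<in>set ?blk. B j \<noteq> Suc a} \<union> ?T" unfolding sb by auto
    have c1: "card {j. j < n \<and> K j = Suc a} = card {j\<in>set ?blk. B j \<noteq> Suc a} + card ?T"
      unfolding e1 by (rule card_Un_disjoint) auto
    have e2: "{j. j < n \<and> B j = Suc a} = ?B' \<union> ?T" by auto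
    have c2: "card {j. j < n \<and> B j = Suc a} = card ?B' + card ?T"
      unfolding e2 by (rule card_Un_disjoint) auto
    show ?thesis using c1 c2 cnt[OF aL] by linarith
  qed
  have word: "WW (\<lambda>c. if c \<in> ?B' then LB else if 0 < B c \<and> B c < Suc a then LD else LO)
        (\<lambda>c. if c \<in> set ?blk \<and> B c \<noteq> Suc a then LA else LO) [0..<n] = cword (Suc a) (map K [0..<n]) (map B [0..<n])"
    unfolding cword_map WW_def
  proof (intro arg_cong[where f = concat] map_cong refl)
    fix c assume "c \<in> set [0..<n]"
    then have "c < n" by simp
    from ok[OF this] this show "[if c \<in> ?B' then LB else if 0 < B c \<and> B c < Suc a then LD else LO,
       if c \<in> set ?blk \<and> B c \<noteq> Suc a then LA else LO] = ccol (Suc a) (K c) (B c)"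
      by (auto simp: ccol_def ok_def cA_def cB_def cD_def cO_def)
  qed
  have "asum cAl cW id (jl K n (Suc a)) {c. c < n \<and> Suc a < B c}
      = cc (qq ^ (Suc a - r)) (cword (Suc a) (map K [0..<n]) (map B [0..<n])) * asum cAl cW id (jl K n a) {c. c < n \<and> Suc a \<le> B c}"
    unfolding jl.simps U word[symmetric] by (rule cl_block[OF aL _ _ _ card]) auto
  also have "{c. c < n \<and> Suc a \<le> B c} = {c. c < n \<and> a < B c}" by auto
  also have "asum cAl cW id (jl K n a) \<dots> = (\<Prod>a'\<in>{r+1..a}. cc (qq ^ (a' - r)) (cword a' (map K [0..<n]) (map B [0..<n])))"
    by (rule step.IH) (use step in auto)
  also have "cc (qq ^ (Suc a - r)) (cword (Suc a) (map K [0..<n]) (map B [0..<n])) * \<dots>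
      = (\<Prod>a'\<in>{r+1..Suc a}. cc (qq ^ (a' - r)) (cword a' (map K [0..<n]) (map B [0..<n])))"
    using step by (simp add: prod.nat_ivl_Suc' mult.commute)
  finally show ?case .
qed

lemma cl_pair_asg: "cl_pair n K B = asg cAl id 0 (jl K n L) {}"
proof -
  have s: "set (jl K n L) = {j. j < n \<and> K j \<noteq> 0}" unfolding set_jl using K by fastforce
  show ?thesis
  proof (intro set_eqI iffI)
    fix p assume p: "p \<in> cl_pair n K B"
    have "p j \<in> cAl j" if j: "j < n" "K j \<noteq> 0" for j
    proof (cases "B j = K j")
      case True
      then show ?thesis using p j by (auto simp: cl_pair_def cAl_def)
    next
      case False
      \<comment> \<open>A target with the same label above it would be taken by the trivial pairing
        of that ball, against injectivity.\<close>
      have "K (p j) \<noteq> K j"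
      proof
        assume e: "K (p j) = K j"
        have pj: "p j < n" "B (p j) = K j" using p j by (auto simp: cl_pair_def)
        then have "p (p j) = p j" using p e j by (auto simp: cl_pair_def)
        then have "p j = j" using p pj j e by (auto simp: cl_pair_def inj_on_def)
        then show False using False pj by simp
      qed
      then show ?thesis using p j False by (auto simp: cl_pair_def cAl_def)
    qed
    then show "p \<in> asg cAl id 0 (jl K n L) {}"
      using p unfolding asg_def s by (auto simp: cl_pair_def)
  next
    fix p assume p: "p \<in> asg cAl id 0 (jl K n L) {}"
    have "p j < n \<and> B (p j) = K j \<and> (B j = K j \<longrightarrow> p j = j)" if j: "j < n" "K j \<noteq> 0" for j
      using p j unfolding asg_def s by (auto simp: cAl_def split: if_splits)
    then show "p \<in> cl_pair n K B"
      using p ok unfolding asg_def s cl_pair_def ok_def by auto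
  qed
qed

lemma cl_sum_ok:
  assumes "r \<le> L"
  shows "(\<Sum>p\<in>cl_pair n K B. \<Prod>j\<in>{j. j < n \<and> K j \<noteq> 0}. cl_wt n r K B p j)
    = CC r L (map K [0..<n]) (map B [0..<n])"
proof -
  have s: "set (jl K n L) = {j. j < n \<and> K j \<noteq> 0}" unfolding set_jl using K by fastforce
  have wt: "cl_wt n r K B p j = cW j (p j) ({} \<union> (\<lambda>j. id (p j)) ` {c\<in>set (jl K n L). prec K c j})"
    if p: "p \<in> cl_pair n K B" and j: "j < n" "K j \<noteq> 0" for p j
  proof -
    have "cl_free n K B p j = cF j ({} \<union> (\<lambda>j. id (p j)) ` {c\<in>set (jl K n L). prec K c j})"
      using p j unfolding cl_free_def cF_def s by (auto simp: cl_pair_def)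
    then show ?thesis by (simp only: cl_wt_def cW_def)
  qed
  have "(\<Sum>p\<in>cl_pair n K B. \<Prod>j\<in>{j. j < n \<and> K j \<noteq> 0}. cl_wt n r K B p j)
      = (\<Sum>p\<in>asg cAl id 0 (jl K n L) {}. \<Prod>j\<in>set (jl K n L). cW j (p j) ({} \<union> (\<lambda>j. id (p j)) ` {c\<in>set (jl K n L). prec K c j}))"
    unfolding cl_pair_asg[symmetric] s[symmetric] by (intro sum.cong prod.cong refl wt) (auto simp: s)
  also have "\<dots> = asum cAl cW id (jl K n L) {}"
    by (rule asum_eq[OF distinct_jl sorted_jl prec_asym]) (auto simp: cAl_def)
  also have "{} = {c. c < n \<and> L < B c}" using B by fastforce
  also have "asum cAl cW id (jl K n L) \<dots> = CC r L (map K [0..<n]) (map B [0..<n])"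
    unfolding cl_asum[OF assms order_refl] CC_def using ok by (auto simp: list_all2_conv_all_nth)
  finally show ?thesis .
qed

end

lemma cl_sum:
  assumes "r \<le> L" "\<And>j. j < n \<Longrightarrow> K j \<in> insert 0 {r+1..L}" "\<And>j. j < n \<Longrightarrow> B j \<in> insert 0 {r..L}"
    and "\<And>a. a \<in> {r+1..L} \<Longrightarrow> card {j. j < n \<and> K j = a} = card {j. j < n \<and> B j = a}"
  shows "(\<Sum>p\<in>cl_pair n K B. \<Prod>j\<in>{j. j < n \<and> K j \<noteq> 0}. cl_wt n r K B p j)
    = CC r L (map K [0..<n]) (map B [0..<n])"
proof (cases "\<forall>j<n. ok (K j) (B j)")
  case True
  then show ?thesis using cl_sum_ok[of n K r L B] assms by blast
next
  case False
  then obtain j where j: "j < n" "\<not> ok (K j) (B j)" by blast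
  then have "cl_pair n K B = {}" by (auto simp: cl_pair_def ok_def)
  moreover have "\<not> list_all2 ok (map K [0..<n]) (map B [0..<n])"
    using j by (auto simp: list_all2_conv_all_nth)
  ultimately show ?thesis by (simp add: CC_def)
qed

section \<open>Pairings of a signed layer\<close>

text \<open>Signs and pairing are chosen together, since the sign of a ball decides which strands it
  may have. \<open>M\<close> is row \<open>r\<close> and \<beta> holds the absolute values of row
  \<open>r'\<close>.\<close>

definition sg_pair :: "nat \<Rightarrow> (nat \<Rightarrow> nat) \<Rightarrow> (nat \<Rightarrow> nat) \<Rightarrow> ((nat \<Rightarrow> int) \<times> (nat \<Rightarrow> nat)) set" where
  "sg_pair n M \<beta> = {(\<alpha>, p). (\<forall>j. n \<le> j \<longrightarrow> \<alpha> j = 0) \<and> (\<forall>j<n. absl (\<alpha> j) = \<beta> j)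
     \<and> (\<forall>j. \<not> (j < n \<and> \<alpha> j \<noteq> 0) \<longrightarrow> p j = 0)
     \<and> (\<forall>j<n. \<alpha> j \<noteq> 0 \<longrightarrow> j \<le> p j \<and> p j < n \<and> M (p j) = absl (\<alpha> j))
     \<and> inj_on p {j. j < n \<and> \<alpha> j \<noteq> 0}
     \<and> (\<forall>j<n. 0 < \<alpha> j \<longrightarrow> absl (\<alpha> j) \<le> M j \<and> (M j = absl (\<alpha> j) \<longrightarrow> p j = j))
     \<and> (\<forall>j<n. \<alpha> j < 0 \<longrightarrow> M j = 0 \<or> M j \<le> absl (\<alpha> j))}"

definition sg_wt :: "nat \<Rightarrow> (nat \<Rightarrow> nat) \<Rightarrow> (nat \<Rightarrow> int) \<Rightarrow> (nat \<Rightarrow> nat) \<Rightarrow> nat \<Rightarrow> qt" where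
  "sg_wt n M \<alpha> p j = (if p j = j then 1 else (if 0 < \<alpha> j then 1 else -1) * (1 - tt)
     * tt ^ (card ({c. c < n \<and> M c \<noteq> 0 \<and> c \<notin> p ` {c'. c' < n \<and> \<alpha> c' \<noteq> 0 \<and> prec (\<lambda>x. absl (\<alpha> x)) c' j}} \<inter> {c. j < c \<and> c < p j})
        + card {c\<in>{c. j < c \<and> c < p j}. M c = 0}))"

lemma absl_eq_0 [simp]: "absl z = 0 \<longleftrightarrow> z = 0" "absl 0 = 0" "absl (int a) = a" "absl (- int a) = a"
  by (auto simp: absl_def)

lemma absl_eqD: "absl s = a \<Longrightarrow> s = int a \<or> s = - int a"
  by (auto simp: absl_def)

abbreviation ev1 :: "ltr list \<Rightarrow> qt" where "ev1 w \<equiv> poly (PP 1 w) 1"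

text \<open>Without wrapping, the trace is replaced by the value at initial state 0. The term in
  which the strand runs off to the right leaves a word with one lowering letter too many and
  vanishes.\<close>

lemma ev1_push:
  assumes fg: "\<And>c. j < c \<Longrightarrow> c < n \<Longrightarrow> f c \<in> {LB, LD, LO} \<and> g c = LO"
    and j: "j < n" "g j = LA"
    and bal: "nb (WW f g [0..<n]) = na (WW f g [0..<n])"
  shows "ev1 (WW f g [0..<n]) = (\<Sum>k\<in>{k\<in>{Suc j..<n}. f k = LB}.
      (1 - tt) * tt ^ card {c\<in>{Suc j..<k}. f c \<noteq> LO} * ev1 (WW (f(k := LO)) (g(j := LO)) [0..<n]))"
proof -
  define w0 where "w0 = WW f g [0..<j] @ [f j]"
  have split: "[0..<n] = [0..<j] @ j # [Suc j..<n]"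
    using j(1) upt_add_eq_append[of 0 j "n - j"] by (simp add: upt_conv_Cons)
  have w: "WW f g [0..<n] = w0 @ LA # WW f g [Suc j..<n] @ []"
    unfolding split w0_def by (simp add: j(2))
  have "PP 1 (WW f g [0..<n]) = PP 1 w0 * PP (stt 1 w0) (LA # WW f g [Suc j..<n] @ [])"
    unfolding w PP_append[of 1 w0] ..
  also have "PP (stt 1 w0) (LA # WW f g [Suc j..<n] @ [])
      = (\<Sum>k\<in>{k\<in>{Suc j..<n}. f k = LB}. smult ((1 - tt) * tt ^ card {c\<in>{Suc j..<k}. f c \<noteq> LO})
           (PP (stt 1 w0) (WW (f(k := LO)) g [Suc j..<n] @ [])))
        + smult (tt ^ card {c\<in>{Suc j..<n}. f c \<noteq> LO}) (PP (stt 1 w0) (WW f g [Suc j..<n] @ [LA]))"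
    by (rule PP_push) (use j fg in auto)
  also have "PP 1 w0 * \<dots> = (\<Sum>k\<in>{k\<in>{Suc j..<n}. f k = LB}. smult ((1 - tt) * tt ^ card {c\<in>{Suc j..<k}. f c \<noteq> LO})
           (PP 1 (w0 @ WW (f(k := LO)) g [Suc j..<n])))
        + smult (tt ^ card {c\<in>{Suc j..<n}. f c \<noteq> LO}) (PP 1 (w0 @ WW f g [Suc j..<n] @ [LA]))"
    by (simp only: PP_append[of 1 w0] distrib_left sum_distrib_left mult_smult_right append_Nil2)
  finally have 1: "ev1 (WW f g [0..<n]) = (\<Sum>k\<in>{k\<in>{Suc j..<n}. f k = LB}. (1 - tt) * tt ^ card {c\<in>{Suc j..<k}. f c \<noteq> LO}
           * ev1 (w0 @ WW (f(k := LO)) g [Suc j..<n]))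
        + tt ^ card {c\<in>{Suc j..<n}. f c \<noteq> LO} * ev1 (w0 @ WW f g [Suc j..<n] @ [LA])"
    by (simp only: poly_add poly_sum poly_smult)
  have "nb (w0 @ WW f g [Suc j..<n]) = Suc (na (w0 @ WW f g [Suc j..<n]))"
    using bal unfolding w by simp
  then have "ev1 (w0 @ WW f g [Suc j..<n]) = 0" using PP_negative_net[of 0 "w0 @ WW f g [Suc j..<n]"] by simp
  moreover have "PP 1 (w0 @ WW f g [Suc j..<n] @ [LA]) = PP 1 (w0 @ WW f g [Suc j..<n])"
    using PP_append[of 1 "w0 @ WW f g [Suc j..<n]" "[LA]"] by simp
  ultimately have 2: "ev1 (w0 @ WW f g [Suc j..<n] @ [LA]) = 0" by simp
  have 3: "ev1 (w0 @ WW (f(k := LO)) g [Suc j..<n]) = ev1 (WW (f(k := LO)) (g(j := LO)) [0..<n])"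
    if k: "k \<in> {k\<in>{Suc j..<n}. f k = LB}" for k
  proof -
    have "WW f g [0..<j] = WW (f(k := LO)) (g(j := LO)) [0..<j]"
      "WW (f(k := LO)) g [Suc j..<n] = WW (f(k := LO)) (g(j := LO)) [Suc j..<n]"
      using k by (auto intro!: WW_cong)
    moreover have "f j = (f(k := LO)) j" using k by auto
    ultimately have "WW (f(k := LO)) (g(j := LO)) [0..<n] = w0 @ LO # WW (f(k := LO)) g [Suc j..<n]"
      unfolding split w0_def by simp
    then show ?thesis by (simp only: PP_LO2)
  qed
  show ?thesis unfolding 1 2 using 3 by simp
qed

context
  fixes n L :: nat and M \<beta> :: "nat \<Rightarrow> nat" and x :: "nat \<Rightarrow> qt" and y :: qt
  assumes cnt: "\<And>a. 1 \<le> a \<Longrightarrow> card {j. j < n \<and> \<beta> j = a} = card {j. j < n \<and> M j = a}"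
begin

definition "sAl j = {(k, s). j \<le> k \<and> k < n \<and> M k = \<beta> j \<and> absl s = \<beta> j
    \<and> (0 < s \<longrightarrow> \<beta> j \<le> M j \<and> (M j = \<beta> j \<longrightarrow> k = j)) \<and> (s < 0 \<longrightarrow> M j \<le> \<beta> j)}"

definition "sE U j k = card ({c. c < n \<and> M c \<noteq> 0 \<and> c \<notin> U} \<inter> {c. j < c \<and> c < k}) + card {c\<in>{c. j < c \<and> c < k}. M c = 0}"

definition "sW j c U = (case c of (k, s) \<Rightarrow> (if 0 < (s::int) then x j else - y) * (if k = j then 1
    else (if 0 < s then 1 else -1) * (1 - tt) * tt ^ sE U j k))"

text \<open>When the labels differ the sign is forced: a positive ball gives \<open>x j\<close>, a
  negative one gives \<open>-y\<close> times the sign of its strand, hence \<open>y\<close>.\<close>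

definition "ssc j = (if \<beta> j < M j then x j else y)"

definition "sf a js B' = (\<lambda>c. if c \<in> set js \<and> M c = a then Lin (x c) (- y) else if c \<in> B' then LB else if M c < a then LD else LO)"
definition "sg a js = (\<lambda>c. if c \<in> set js \<and> M c \<noteq> a then LA else LO)"

lemma finite_sAl: "finite (sAl j)"
proof -
  have "sAl j \<subseteq> {..<n} \<times> {int (\<beta> j), - int (\<beta> j)}" by (auto simp: sAl_def dest: absl_eqD)
  then show ?thesis by (rule finite_subset) simp
qed

text \<open>As for a classic layer, \<open>B'\<close> collects the lower balls of the label still to
  be matched. The new feature is a column with equal labels, where both signs compete; summing over
  them gives the letter \<open>Lin (x c) (- y)\<close>.\<close>

lemma sg_block:
  assumes a: "1 \<le> a" and "sorted_wrt (\<lambda>x y. y < x) js" "\<And>j. j \<in> set js \<Longrightarrow> j < n \<and> \<beta> j = a"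
    and "B' \<subseteq> {c. c < n \<and> M c = a}" "\<And>c. c \<in> set js \<Longrightarrow> M c = a \<Longrightarrow> c \<in> B'" "length js = card B'"
  shows "asum sAl sW fst (js @ rest) ({c. c < n \<and> a \<le> M c} - B')
    = (\<Prod>j\<in>{j\<in>set js. M j \<noteq> a}. ssc j) * ev1 (WW (sf a js B') (sg a js) [0..<n])
      * asum sAl sW fst rest {c. c < n \<and> a \<le> M c}"
  using assms(2-)
proof (induction js arbitrary: B')
  case Nil
  have "finite B'" using Nil(3) by (rule finite_subset) simp
  then have B': "B' = {}" using Nil by simp
  have "ev1 w = 1" if "set w \<subseteq> {LD, LO}" for w
    using that by (induction w) (auto simp: lin_def)
  moreover have "set (WW (sf a [] B') (sg a []) [0..<n]) \<subseteq> {LD, LO}"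
    by (auto simp: WW_def B' sf_def sg_def)
  ultimately have "ev1 (WW (sf a [] B') (sg a []) [0..<n]) = 1" by blast
  then show ?case by (simp add: B')
next
  case (Cons j js)
  have j: "j < n" "\<beta> j = a" "j \<notin> set js" and lt: "\<And>i. i \<in> set js \<Longrightarrow> i < j"
    using Cons.prems(1,2) by auto
  have srt: "sorted_wrt (\<lambda>x y. y < x) js" using Cons.prems(1) by simp
  have fin: "finite B'" using Cons.prems(3) by (rule finite_subset) simp
  have "distinct is" if "sorted_wrt (\<lambda>x y. y < x) is" for "is" :: "nat list"
    using that by (induction "is") auto
  then have dist: "distinct (j # js)" using Cons.prems(1) by blast
  let ?R = "asum sAl sW fst rest {c. c < n \<and> a \<le> M c}"
  let ?U = "{c. c < n \<and> a \<le> M c} - B'"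
  define P where "P js = (\<Prod>j\<in>{j\<in>set js. M j \<noteq> a}. ssc j)" for js
  define V where "V js B' = ev1 (WW (sf a js B') (sg a js) [0..<n])" for js B'
  have IH: "asum sAl sW fst (js @ rest) (insert k ?U) = P js * V js (B' - {k}) * ?R"
    if k: "k \<in> B'" "j \<le> k" for k
  proof -
    have "insert k ?U = {c. c < n \<and> a \<le> M c} - (B' - {k})" using k Cons.prems(3) by auto
    moreover have "asum sAl sW fst (js @ rest) ({c. c < n \<and> a \<le> M c} - (B' - {k})) = P js * V js (B' - {k}) * ?R"
      unfolding P_def V_def
    proof (rule Cons.IH[OF srt])
      show "c \<in> B' - {k}" if "c \<in> set js" "M c = a" for c
        using Cons.prems(4)[of c] that lt[of c] k by auto
      show "length js = card (B' - {k})" using Cons.prems(5) k fin by simp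
    qed (use Cons.prems in auto)
    ultimately show ?thesis by simp
  qed
  have fge: "sf a (j # js) B' c \<in> {LB, LD, LO} \<and> sg a (j # js) c = LO" if "j < c" "c < n" for c
    using that lt[of c] by (auto simp: sf_def sg_def)
  have E: "sE ?U j k = card {c\<in>{Suc j..<k}. sf a (j # js) B' c \<noteq> LO}" if "k < n" for k
  proof -
    have key: "sf a (j # js) B' c \<noteq> LO \<longleftrightarrow> c \<in> B' \<or> M c < a" if "j < c" for c
    proof -
      have "c \<notin> set (j # js)" using lt[of c] that by auto
      then show ?thesis by (simp add: sf_def)
    qed
    have "{c\<in>{Suc j..<k}. sf a (j # js) B' c \<noteq> LO} = {c\<in>{Suc j..<k}. c \<in> B' \<or> M c < a}"
      by (rule Collect_cong) (simp add: key Suc_le_eq cong: conj_cong)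
    also have "\<dots> = ({c. c < n \<and> M c \<noteq> 0 \<and> c \<notin> ?U} \<inter> {c. j < c \<and> c < k}) \<union> {c\<in>{c. j < c \<and> c < k}. M c = 0}"
    proof (rule set_eqI)
      fix c
      have "c \<in> B' \<Longrightarrow> M c = a" using Cons.prems(3) by auto
      then show "c \<in> {c\<in>{Suc j..<k}. c \<in> B' \<or> M c < a} \<longleftrightarrow>
        c \<in> ({c. c < n \<and> M c \<noteq> 0 \<and> c \<notin> ?U} \<inter> {c. j < c \<and> c < k}) \<union> {c\<in>{c. j < c \<and> c < k}. M c = 0}"
        using a that by (simp add: Suc_le_eq) linarith
    qed
    finally have SE: "{c\<in>{Suc j..<k}. sf a (j # js) B' c \<noteq> LO}
        = ({c. c < n \<and> M c \<noteq> 0 \<and> c \<notin> ?U} \<inter> {c. j < c \<and> c < k}) \<union> {c\<in>{c. j < c \<and> c < k}. M c = 0}" .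
    show ?thesis unfolding sE_def SE by (rule card_Un_disjoint[symmetric]) auto
  qed
  have keyB: "sf a (j # js) B' c = LB \<longleftrightarrow> c \<in> B'" if "j < c" for c
  proof -
    have "c \<notin> set (j # js)" using lt[of c] that by auto
    then show ?thesis by (simp add: sf_def)
  qed
  have cnts: "nb (WW (sf a js B') (sg a js) [0..<n]) = card {c\<in>B'. c \<notin> set js \<or> M c \<noteq> a}"
    "na (WW (sf a js B') (sg a js) [0..<n]) = card {c\<in>set js. M c \<noteq> a}"
    if "B' \<subseteq> {c. c < n \<and> M c = a}" "\<And>j. j \<in> set js \<Longrightarrow> j < n" for js B'
  proof -
    have "{c. c < n \<and> sf a js B' c = LB} = {c\<in>B'. c \<notin> set js \<or> M c \<noteq> a}" "{c. c < n \<and> sg a js c = LB} = {}"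
      "{c. c < n \<and> sf a js B' c = LA} = {}" "{c. c < n \<and> sg a js c = LA} = {c\<in>set js. M c \<noteq> a}"
      using that by (auto simp: sf_def sg_def split: if_splits)
    then show "nb (WW (sf a js B') (sg a js) [0..<n]) = card {c\<in>B'. c \<notin> set js \<or> M c \<noteq> a}"
      "na (WW (sf a js B') (sg a js) [0..<n]) = card {c\<in>set js. M c \<noteq> a}"
      unfolding count_WW count_map_upt by (simp_all only: card.empty add_0_right add_0_left)
  qed
  have bal: "card {c\<in>B'. c \<notin> set (j # js) \<or> M c \<noteq> a} = card {c\<in>set (j # js). M c \<noteq> a}"
  proof -
    let ?T = "{c\<in>set (j # js). M c = a}"
    have e1: "B' = {c\<in>B'. c \<notin> set (j # js) \<or> M c \<noteq> a} \<union> ?T" using Cons.prems(4) by auto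
    have "card B' = card {c\<in>B'. c \<notin> set (j # js) \<or> M c \<noteq> a} + card ?T"
      by (subst e1, rule card_Un_disjoint) (use fin in auto)
    moreover have "card (set (j # js)) = card {c\<in>set (j # js). M c \<noteq> a} + card ?T"
    proof -
      have "set (j # js) = {c\<in>set (j # js). M c \<noteq> a} \<union> ?T" by blast
      then have "card (set (j # js)) = card ({c\<in>set (j # js). M c \<noteq> a} \<union> ?T)" by (rule arg_cong)
      also have "\<dots> = card {c\<in>set (j # js). M c \<noteq> a} + card ?T" by (rule card_Un_disjoint) auto
      finally show ?thesis .
    qed
    moreover have "card (set (j # js)) = card B'" using distinct_card[OF dist] Cons.prems(5) by simp
    ultimately show ?thesis by linarith
  qed
  have cj: "i < n" if "i \<in> set (j # js)" for i using Cons.prems(2) that by blast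
  have b0: "nb (WW (sf a (j # js) B') (sg a (j # js)) [0..<n]) = na (WW (sf a (j # js) B') (sg a (j # js)) [0..<n])"
    by (simp only: cnts[OF Cons.prems(3) cj] bal)
  show ?case
  proof (cases "M j = a")
    case False
    define \<epsilon> :: int where "\<epsilon> = (if a < M j then 1 else -1)"
    have ch: "{c\<in>sAl j. fst c \<notin> ?U} = (\<lambda>k. (k, \<epsilon> * int a)) ` {k\<in>B'. j < k}"
    proof (intro set_eqI iffI)
      fix c assume c: "c \<in> {c\<in>sAl j. fst c \<notin> ?U}"
      obtain k s where ks: "c = (k, s)" by (cases c)
      have k: "j \<le> k" "k < n" "M k = a" "absl s = a" "k \<notin> ?U" "0 < s \<longrightarrow> a \<le> M j" "s < 0 \<longrightarrow> M j \<le> a"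
        using c ks j by (auto simp: sAl_def)
      have "k \<noteq> j" using k False by auto
      moreover have "s = \<epsilon> * int a" using absl_eqD[OF k(4)] k(6,7) False a by (auto simp: \<epsilon>_def)
      ultimately show "c \<in> (\<lambda>k. (k, \<epsilon> * int a)) ` {k\<in>B'. j < k}" using k ks by auto
    next
      fix c assume "c \<in> (\<lambda>k. (k, \<epsilon> * int a)) ` {k\<in>B'. j < k}"
      then obtain k where "c = (k, \<epsilon> * int a)" "k \<in> B'" "j < k" by auto
      then show "c \<in> {c\<in>sAl j. fst c \<notin> ?U}"
        using Cons.prems(3) False j a by (auto simp: sAl_def \<epsilon>_def)
    qed
    have w: "sW j (k, \<epsilon> * int a) ?U = ssc j * ((1 - tt) * tt ^ sE ?U j k)" if "j < k" for k
      using that False j a by (auto simp: sW_def ssc_def \<epsilon>_def)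
    have Bk: "{k\<in>{Suc j..<n}. sf a (j # js) B' k = LB} = {k\<in>B'. j < k}"
      using Cons.prems(3) keyB by auto
    have gj: "sg a (j # js) j = LA" using False by (simp add: sg_def)
    have push: "V (j # js) B' = (\<Sum>k\<in>{k\<in>B'. j < k}. (1 - tt) * tt ^ sE ?U j k * V js (B' - {k}))"
    proof -
      have "V (j # js) B' = (\<Sum>k\<in>{k\<in>B'. j < k}. (1 - tt) * tt ^ card {c\<in>{Suc j..<k}. sf a (j # js) B' c \<noteq> LO}
          * ev1 (WW ((sf a (j # js) B')(k := LO)) ((sg a (j # js))(j := LO)) [0..<n]))"
        unfolding V_def
        unfolding Bk[symmetric]
        by (rule ev1_push[where f = "sf a (j # js) B'" and g = "sg a (j # js)", OF fge j(1) gj b0])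
      also have "\<dots> = (\<Sum>k\<in>{k\<in>B'. j < k}. (1 - tt) * tt ^ sE ?U j k * V js (B' - {k}))"
      proof (rule sum.cong)
        fix k assume k: "k \<in> {k\<in>B'. j < k}"
        have kk: "k \<notin> set js" "M k = a" "k \<noteq> j" using k lt[of k] Cons.prems(3) by auto
        have "(sf a (j # js) B')(k := LO) = sf a js (B' - {k})"
          using kk False j(3) by (intro ext) (auto simp: sf_def)
        moreover have "(sg a (j # js))(j := LO) = sg a js"
          using j(3) by (intro ext) (auto simp: sg_def)
        ultimately show "(1 - tt) * tt ^ card {c\<in>{Suc j..<k}. sf a (j # js) B' c \<noteq> LO}
          * ev1 (WW ((sf a (j # js) B')(k := LO)) ((sg a (j # js))(j := LO)) [0..<n])
          = (1 - tt) * tt ^ sE ?U j k * V js (B' - {k})"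
          using E[of k] k Cons.prems(3) by (auto simp: V_def)
      qed simp
      finally show ?thesis .
    qed
    have "asum sAl sW fst ((j # js) @ rest) ?U
        = (\<Sum>c\<in>(\<lambda>k. (k, \<epsilon> * int a)) ` {k\<in>B'. j < k}. sW j c ?U * asum sAl sW fst (js @ rest) (insert (fst c) ?U))"
      unfolding ch[symmetric] by simp
    also have "\<dots> = (\<Sum>k\<in>{k\<in>B'. j < k}. sW j (k, \<epsilon> * int a) ?U * asum sAl sW fst (js @ rest) (insert k ?U))"
      by (subst sum.reindex) (auto simp: inj_on_def)
    also have "\<dots> = (\<Sum>k\<in>{k\<in>B'. j < k}. ssc j * P js * ?R * ((1 - tt) * tt ^ sE ?U j k * V js (B' - {k})))"
      by (rule sum.cong) (auto simp: w IH)
    also have "\<dots> = ssc j * P js * V (j # js) B' * ?R"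
      unfolding push by (simp add: sum_distrib_left mult_ac)
    also have "ssc j * P js = P (j # js)"
    proof -
      have "{i\<in>set (j # js). M i \<noteq> a} = insert j {i\<in>set js. M i \<noteq> a}" using False by auto
      then show ?thesis unfolding P_def using j by simp
    qed
    finally show ?thesis unfolding P_def V_def .
  next
    case True
    have jB: "j \<in> B'" using Cons.prems(4) True by simp
    have ch: "{c\<in>sAl j. fst c \<notin> ?U} = {(j, int a), (j, - int a)} \<union> (\<lambda>k. (k, - int a)) ` {k\<in>B'. j < k}"
    proof (intro set_eqI iffI)
      fix c assume c: "c \<in> {c\<in>sAl j. fst c \<notin> ?U}"
      obtain k s where ks: "c = (k, s)" by (cases c)
      have k: "j \<le> k" "k < n" "M k = a" "absl s = a" "k \<notin> ?U" "0 < s \<longrightarrow> k = j"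
        using c ks j True by (auto simp: sAl_def)
      then show "c \<in> {(j, int a), (j, - int a)} \<union> (\<lambda>k. (k, - int a)) ` {k\<in>B'. j < k}"
        using absl_eqD[OF k(4)] ks a by auto
    next
      fix c assume "c \<in> {(j, int a), (j, - int a)} \<union> (\<lambda>k. (k, - int a)) ` {k\<in>B'. j < k}"
      then show "c \<in> {c\<in>sAl j. fst c \<notin> ?U}"
        using Cons.prems(3) jB True j a by (auto simp: sAl_def)
    qed
    define f1 g1 where "f1 = (sf a (j # js) B')(j := LB)" and "g1 = (sg a (j # js))(j := LA)"
    \<comment> \<open>\<open>x - y s = (x - y) + y (1 - s)\<close>: either the ball drops straight
      down with one of the two signs, or a negative ball sends its strand on and leaves the lower
      ball to a strand from the left.\<close>
    have split: "V (j # js) B' = (x j - y) * V js (B' - {j}) + y * ev1 (WW f1 g1 [0..<n])"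
    proof -
      let ?u = "WW (sf a js B') (sg a js) [0..<j]" and ?v = "WW (sf a js B') (sg a js) [Suc j..<n]"
      have sp: "[0..<n] = [0..<j] @ j # [Suc j..<n]"
        using j(1) upt_add_eq_append[of 0 j "n - j"] by (simp add: upt_conv_Cons)
      have e1: "WW (sf a (j # js) B') (sg a (j # js)) [0..<n] = ?u @ Lin (x j) (- y) # LO # ?v"
        unfolding sp using True by (auto simp: sf_def sg_def intro!: WW_cong arg_cong2[where f = append])
      have e2: "WW f1 g1 [0..<n] = ?u @ LB # LA # ?v"
        unfolding sp f1_def g1_def using True by (auto simp: sf_def sg_def intro!: WW_cong arg_cong2[where f = append])
      have e3: "WW (sf a js (B' - {j})) (sg a js) [0..<n] = ?u @ LO # LO # ?v"
        unfolding sp using True j by (auto simp: sf_def sg_def intro!: WW_cong arg_cong2[where f = append])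
      show ?thesis unfolding V_def e1 e2 e3 by (simp add: PP_append[of 1 ?u] algebra_simps)
    qed
    have Bk: "{k\<in>{Suc j..<n}. f1 k = LB} = {k\<in>B'. j < k}"
      using Cons.prems(3) keyB by (auto simp: f1_def)
    have push: "ev1 (WW f1 g1 [0..<n]) = (\<Sum>k\<in>{k\<in>B'. j < k}. (1 - tt) * tt ^ sE ?U j k * V js (B' - {k}))"
    proof -
      have "nb (WW f1 g1 [0..<n]) = Suc (nb (WW (sf a (j # js) B') (sg a (j # js)) [0..<n]))"
        "na (WW f1 g1 [0..<n]) = Suc (na (WW (sf a (j # js) B') (sg a (j # js)) [0..<n]))"
      proof -
        have sp: "[0..<n] = [0..<j] @ j # [Suc j..<n]"
          using j(1) upt_add_eq_append[of 0 j "n - j"] by (simp add: upt_conv_Cons)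
        have m: "map f1 [0..<j] = map (sf a (j # js) B') [0..<j]" "map f1 [Suc j..<n] = map (sf a (j # js) B') [Suc j..<n]"
          "map g1 [0..<j] = map (sg a (j # js)) [0..<j]" "map g1 [Suc j..<n] = map (sg a (j # js)) [Suc j..<n]"
          by (auto simp: f1_def g1_def)
        show "nb (WW f1 g1 [0..<n]) = Suc (nb (WW (sf a (j # js) B') (sg a (j # js)) [0..<n]))"
          "na (WW f1 g1 [0..<n]) = Suc (na (WW (sf a (j # js) B') (sg a (j # js)) [0..<n]))"
          unfolding count_WW sp map_append list.map m using True by (auto simp: f1_def g1_def sf_def sg_def)
      qed
      then have b1: "nb (WW f1 g1 [0..<n]) = na (WW f1 g1 [0..<n])"
        using b0 by simp
      have "ev1 (WW f1 g1 [0..<n]) = (\<Sum>k\<in>{k\<in>B'. j < k}. (1 - tt) * tt ^ card {c\<in>{Suc j..<k}. f1 c \<noteq> LO}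
          * ev1 (WW (f1(k := LO)) (g1(j := LO)) [0..<n]))"
        unfolding Bk[symmetric]
        by (rule ev1_push[where f = f1 and g = g1, OF _ j(1) _ b1]) (use fge in \<open>simp_all add: f1_def g1_def\<close>)
      also have "\<dots> = (\<Sum>k\<in>{k\<in>B'. j < k}. (1 - tt) * tt ^ sE ?U j k * V js (B' - {k}))"
      proof (rule sum.cong)
        fix k assume k: "k \<in> {k\<in>B'. j < k}"
        have kk: "k \<notin> set js" "M k = a" "k \<noteq> j" using k lt[of k] Cons.prems(3) by auto
        have "f1(k := LO) = sf a js (B' - {k})"
          using kk True j(3) jB by (intro ext) (auto simp: f1_def sf_def)
        moreover have "g1(j := LO) = sg a js"
          using j(3) True by (intro ext) (auto simp: g1_def sg_def)
        moreover have "{c\<in>{Suc j..<k}. f1 c \<noteq> LO} = {c\<in>{Suc j..<k}. sf a (j # js) B' c \<noteq> LO}" by (auto simp: f1_def)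
        ultimately show "(1 - tt) * tt ^ card {c\<in>{Suc j..<k}. f1 c \<noteq> LO} * ev1 (WW (f1(k := LO)) (g1(j := LO)) [0..<n])
          = (1 - tt) * tt ^ sE ?U j k * V js (B' - {k})"
          using E[of k] k Cons.prems(3) by (auto simp: V_def)
      qed simp
      finally show ?thesis .
    qed
    define S where "S c = sW j c ?U * asum sAl sW fst (js @ rest) (insert (fst c) ?U)" for c
    have "asum sAl sW fst ((j # js) @ rest) ?U = sum S ({(j, int a), (j, - int a)} \<union> (\<lambda>k. (k, - int a)) ` {k\<in>B'. j < k})"
      unfolding ch[symmetric] S_def by simp
    also have "\<dots> = sum S {(j, int a), (j, - int a)} + sum S ((\<lambda>k. (k, - int a)) ` {k\<in>B'. j < k})"
      by (rule sum.union_disjoint) (use fin in auto)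
    also have "sum S {(j, int a), (j, - int a)} = (x j - y) * (P js * V js (B' - {j}) * ?R)"
      using a IH[OF jB] by (simp add: S_def sW_def algebra_simps)
    also have "sum S ((\<lambda>k. (k, - int a)) ` {k\<in>B'. j < k}) = (\<Sum>k\<in>{k\<in>B'. j < k}. S (k, - int a))"
      by (subst sum.reindex) (auto simp: inj_on_def)
    also have "\<dots> = (\<Sum>k\<in>{k\<in>B'. j < k}. y * P js * ?R * ((1 - tt) * tt ^ sE ?U j k * V js (B' - {k})))"
      by (rule sum.cong) (use a in \<open>auto simp: S_def sW_def IH algebra_simps\<close>)
    also have "\<dots> = y * P js * ?R * ev1 (WW f1 g1 [0..<n])" unfolding push by (simp add: sum_distrib_left)
    also have "(x j - y) * (P js * V js (B' - {j}) * ?R) + \<dots> = P js * V (j # js) B' * ?R"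
      unfolding split by (simp add: algebra_simps)
    also have "P js = P (j # js)"
    proof -
      have "{i\<in>set (j # js). M i \<noteq> a} = {i\<in>set js. M i \<noteq> a}" using True by auto
      then show ?thesis unfolding P_def by simp
    qed
    finally show ?thesis unfolding P_def V_def .
  qed
qed

definition "sF a = (\<lambda>c. if \<beta> c = a \<and> M c = a then Lin (x c) (- y) else if M c = a then LB else if M c < a then LD else LO)"
definition "sG a = (\<lambda>c. if \<beta> c = a \<and> M c \<noteq> a then LA else LO)"

lemma sg_asum:
  "asum sAl sW fst (jl \<beta> n a) {c. c < n \<and> a < M c}
    = (\<Prod>a'\<in>{1..a}. (\<Prod>j\<in>{j\<in>{0..<n}. \<beta> j = a' \<and> M j \<noteq> a'}. ssc j) * ev1 (WW (sF a') (sG a') [0..<n]))"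
proof (induction a)
  case (Suc a)
  let ?blk = "rev (filter (\<lambda>j. \<beta> j = Suc a) [0..<n])"
  let ?B' = "{c. c < n \<and> M c = Suc a}"
  have U: "{c. c < n \<and> Suc a < M c} = {c. c < n \<and> Suc a \<le> M c} - ?B'" by auto
  have sb: "set ?blk = {j. j < n \<and> \<beta> j = Suc a}" by auto
  have "distinct ?blk" by simp
  from distinct_card[OF this] have len: "length ?blk = card ?B'"
    using cnt[of "Suc a"] unfolding sb by simp
  have word: "WW (sf (Suc a) ?blk ?B') (sg (Suc a) ?blk) [0..<n] = WW (sF (Suc a)) (sG (Suc a)) [0..<n]"
    by (rule WW_cong) (auto simp: sf_def sg_def sF_def sG_def)
  have sc: "{j\<in>set ?blk. M j \<noteq> Suc a} = {j\<in>{0..<n}. \<beta> j = Suc a \<and> M j \<noteq> Suc a}" unfolding sb by auto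
  have "asum sAl sW fst (jl \<beta> n (Suc a)) {c. c < n \<and> Suc a < M c}
      = (\<Prod>j\<in>{j\<in>{0..<n}. \<beta> j = Suc a \<and> M j \<noteq> Suc a}. ssc j) * ev1 (WW (sF (Suc a)) (sG (Suc a)) [0..<n])
        * asum sAl sW fst (jl \<beta> n a) {c. c < n \<and> Suc a \<le> M c}"
    unfolding jl.simps U word[symmetric] sc[symmetric]
    by (rule sg_block[OF _ sorted_desc_filter _ _ _ len]) auto
  also have "{c. c < n \<and> Suc a \<le> M c} = {c. c < n \<and> a < M c}" by auto
  finally show ?case unfolding Suc by (simp add: prod.nat_ivl_Suc' mult_ac)
qed simp

lemma sg_pair_sum:
  assumes bd: "\<And>j. j < n \<Longrightarrow> \<beta> j \<le> L \<and> M j \<le> L"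
  shows "(\<Sum>(\<alpha>, p)\<in>sg_pair n M \<beta>. (\<Prod>j<n. if 0 < \<alpha> j then x j else if \<alpha> j < 0 then - y else 1)
      * (\<Prod>j\<in>{j. j < n \<and> \<alpha> j \<noteq> 0}. sg_wt n M \<alpha> p j)) = asum sAl sW fst (jl \<beta> n L) {}"
proof -
  have s: "set (jl \<beta> n L) = {j. j < n \<and> \<beta> j \<noteq> 0}" unfolding set_jl using bd by fastforce
  have z: "\<alpha> j \<noteq> 0 \<longleftrightarrow> \<beta> j \<noteq> 0" "absl (\<alpha> j) = \<beta> j" if "(\<alpha>, p) \<in> sg_pair n M \<beta>" "j < n" for \<alpha> p j
  proof -
    show "absl (\<alpha> j) = \<beta> j" using that by (simp add: sg_pair_def)
    then show "\<alpha> j \<noteq> 0 \<longleftrightarrow> \<beta> j \<noteq> 0" using absl_eq_0(1)[of "\<alpha> j"] by metis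
  qed
  have "asum sAl sW fst (jl \<beta> n L) {} = (\<Sum>q\<in>asg sAl fst (0, 0) (jl \<beta> n L) {}.
      \<Prod>j\<in>set (jl \<beta> n L). sW j (q j) ({} \<union> (\<lambda>j. fst (q j)) ` {c\<in>set (jl \<beta> n L). prec \<beta> c j}))"
    by (rule asum_eq[OF distinct_jl sorted_jl prec_asym, symmetric]) (auto simp: finite_sAl)
  also have "\<dots> = (\<Sum>(\<alpha>, p)\<in>sg_pair n M \<beta>. (\<Prod>j<n. if 0 < \<alpha> j then x j else if \<alpha> j < 0 then - y else 1)
      * (\<Prod>j\<in>{j. j < n \<and> \<alpha> j \<noteq> 0}. sg_wt n M \<alpha> p j))"
  proof (rule sum.reindex_bij_witness[of _ "\<lambda>(\<alpha>, p) j. (p j, \<alpha> j)" "\<lambda>q. (snd \<circ> q, fst \<circ> q)"])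
    fix q assume q: "q \<in> asg sAl fst (0, 0) (jl \<beta> n L) {}"
    show "(case (snd \<circ> q, fst \<circ> q) of (\<alpha>, p) \<Rightarrow> \<lambda>j. (p j, \<alpha> j)) = q" by auto
    have out: "q j = (0, 0)" if "\<not> (j < n \<and> \<beta> j \<noteq> 0)" for j using q that unfolding asg_def s by auto
    have inn: "q j \<in> sAl j" if "j < n" "\<beta> j \<noteq> 0" for j using q that unfolding asg_def s by auto
    have ab: "absl (snd (q j)) = \<beta> j" if "j < n" for j
      using inn[of j] out[of j] that by (cases "\<beta> j = 0") (auto simp: sAl_def)
    have nz: "snd (q j) \<noteq> 0 \<longleftrightarrow> j < n \<and> \<beta> j \<noteq> 0" for j
      using ab[of j] out[of j] by (cases "j < n \<and> \<beta> j \<noteq> 0") auto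
    have inj: "inj_on (\<lambda>j. fst (q j)) {j. j < n \<and> \<beta> j \<noteq> 0}" using q unfolding asg_def s by auto
    show mem: "(snd \<circ> q, fst \<circ> q) \<in> sg_pair n M \<beta>"
      unfolding sg_pair_def mem_Collect_eq case_prod_conv comp_def
    proof (intro conjI allI impI)
      fix j assume "n \<le> j" then show "snd (q j) = 0" using out by simp
    next
      fix j assume "j < n" then show "absl (snd (q j)) = \<beta> j" by (rule ab)
    next
      fix j assume "\<not> (j < n \<and> snd (q j) \<noteq> 0)" then show "fst (q j) = 0" using out[of j] nz[of j] by auto
    next
      fix j assume "j < n" "snd (q j) \<noteq> 0"
      then have i: "q j \<in> sAl j" "absl (snd (q j)) = \<beta> j" using inn[of j] ab[of j] nz[of j] by auto
      then show "j \<le> fst (q j)" "fst (q j) < n" "M (fst (q j)) = absl (snd (q j))"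
        by (auto simp: sAl_def)
    next
      have "{j. j < n \<and> snd (q j) \<noteq> 0} = {j. j < n \<and> \<beta> j \<noteq> 0}" using nz by auto
      then show "inj_on (\<lambda>j. fst (q j)) {j. j < n \<and> snd (q j) \<noteq> 0}" using inj by simp
    next
      fix j assume "j < n" and s: "0 < snd (q j)"
      then have i: "q j \<in> sAl j" "absl (snd (q j)) = \<beta> j" using inn[of j] ab[of j] nz[of j] by auto
      then show "absl (snd (q j)) \<le> M j" using s by (auto simp: sAl_def)
      assume "M j = absl (snd (q j))"
      then show "fst (q j) = j" using i s by (auto simp: sAl_def)
    next
      fix j assume "j < n" and s: "snd (q j) < 0"
      then have i: "q j \<in> sAl j" "absl (snd (q j)) = \<beta> j" using inn[of j] ab[of j] nz[of j] by auto
      then show "M j = 0 \<or> M j \<le> absl (snd (q j))" using s by (auto simp: sAl_def)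
    qed
    let ?\<alpha> = "snd \<circ> q" and ?p = "fst \<circ> q"
    have "(\<Prod>j<n. if 0 < ?\<alpha> j then x j else if ?\<alpha> j < 0 then - y else 1)
        = (\<Prod>j\<in>{j. j < n \<and> \<beta> j \<noteq> 0}. if 0 < ?\<alpha> j then x j else - y)"
    proof -
      have "(\<Prod>j\<in>{j. j < n \<and> \<beta> j \<noteq> 0}. if 0 < ?\<alpha> j then x j else - y)
          = (\<Prod>j\<in>{j. j < n \<and> \<beta> j \<noteq> 0}. if 0 < ?\<alpha> j then x j else if ?\<alpha> j < 0 then - y else 1)"
        by (rule prod.cong) (use nz in \<open>auto simp: not_less le_less\<close>)
      also have "\<dots> = (\<Prod>j<n. if 0 < ?\<alpha> j then x j else if ?\<alpha> j < 0 then - y else 1)"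
        by (rule prod.mono_neutral_left) (use nz in fastforce)+
      finally show ?thesis by simp
    qed
    moreover have "{j. j < n \<and> ?\<alpha> j \<noteq> 0} = {j. j < n \<and> \<beta> j \<noteq> 0}" using nz by auto
    moreover have "sW j (q j) ({} \<union> (\<lambda>j. fst (q j)) ` {c\<in>set (jl \<beta> n L). prec \<beta> c j})
        = (if 0 < ?\<alpha> j then x j else - y) * sg_wt n M ?\<alpha> ?p j" if j: "j \<in> {j. j < n \<and> \<beta> j \<noteq> 0}" for j
    proof -
      have "{c\<in>set (jl \<beta> n L). prec \<beta> c j} = {c'. c' < n \<and> ?\<alpha> c' \<noteq> 0 \<and> prec (\<lambda>x. absl (?\<alpha> x)) c' j}"
        unfolding s using nz ab j by (auto simp: prec_def)
      then show ?thesis by (simp add: sW_def sg_wt_def sE_def split_beta comp_def)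
    qed
    ultimately show "(case (snd \<circ> q, fst \<circ> q) of (\<alpha>, p) \<Rightarrow>
        (\<Prod>j<n. if 0 < \<alpha> j then x j else if \<alpha> j < 0 then - y else 1) * (\<Prod>j\<in>{j. j < n \<and> \<alpha> j \<noteq> 0}. sg_wt n M \<alpha> p j))
      = (\<Prod>j\<in>set (jl \<beta> n L). sW j (q j) ({} \<union> (\<lambda>j. fst (q j)) ` {c\<in>set (jl \<beta> n L). prec \<beta> c j}))"
      unfolding s by (simp add: prod.distrib del: Un_empty_left)
  next
    fix ap assume ap: "ap \<in> sg_pair n M \<beta>"
    obtain \<alpha> p where e: "ap = (\<alpha>, p)" by (cases ap)
    show "(snd \<circ> (case ap of (\<alpha>, p) \<Rightarrow> \<lambda>j. (p j, \<alpha> j)), fst \<circ> (case ap of (\<alpha>, p) \<Rightarrow> \<lambda>j. (p j, \<alpha> j))) = ap"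
      using e by (simp add: comp_def)
    have nz: "j < n \<Longrightarrow> \<alpha> j \<noteq> 0 \<longleftrightarrow> \<beta> j \<noteq> 0" "j < n \<Longrightarrow> absl (\<alpha> j) = \<beta> j" for j
      using z[of \<alpha> p j] ap e by auto
    have inj: "inj_on p {j. j < n \<and> \<beta> j \<noteq> 0}"
    proof -
      have "{j. j < n \<and> \<alpha> j \<noteq> 0} = {j. j < n \<and> \<beta> j \<noteq> 0}" using nz by auto
      then show ?thesis using ap e by (auto simp: sg_pair_def)
    qed
    have "\<alpha> j = 0 \<and> p j = 0" if "\<not> (j < n \<and> \<beta> j \<noteq> 0)" for j
      using ap e that nz[of j] by (cases "j < n") (auto simp: sg_pair_def)
    moreover have "(p j, \<alpha> j) \<in> sAl j" if "j < n" "\<beta> j \<noteq> 0" for j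
      using ap e that nz[of j] by (auto simp: sg_pair_def sAl_def)
    ultimately show "(case ap of (\<alpha>, p) \<Rightarrow> \<lambda>j. (p j, \<alpha> j)) \<in> asg sAl fst (0, 0) (jl \<beta> n L) {}"
      unfolding asg_def s e using inj by auto
  qed
  finally show ?thesis by simp
qed

lemma sg_col_prod:
  assumes "b \<le> L" "m \<le> L"
  shows "(\<Prod>a\<in>{1..L}. (if b = a \<and> m \<noteq> a then (if b < m then xx else y) else 1)
      * (if b = a \<and> m = a then xx - y * z a else if m = a then 1 - z a else if m < a then z a else 1))
    = cw L y xx z b m"
proof -
  have 1: "(\<Prod>a\<in>{1..L}. if b = a \<and> m \<noteq> a then (if b < m then xx else y) else 1)
      = (if b \<noteq> m \<and> b \<noteq> 0 then (if b < m then xx else y) else 1)"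
  proof (cases "b \<noteq> m \<and> b \<noteq> 0")
    case True
    then have "(\<Prod>a\<in>{1..L}. if b = a \<and> m \<noteq> a then (if b < m then xx else y) else 1)
      = (\<Prod>a\<in>{1..L}. if b = a then (if b < m then xx else y) else 1)" by (intro prod.cong) auto
    then show ?thesis using True assms by (simp add: prod.delta')
  next
    case False
    then show ?thesis by (intro trans[OF prod.neutral]) auto
  qed
  have 2: "(\<Prod>a\<in>{1..L}. if b = a \<and> m = a then xx - y * z a else if m = a then 1 - z a else if m < a then z a else 1)
      = (if m = 0 then 1 else if b = m then xx - y * z m else 1 - z m) * MP L m z"
  proof -
    have "(\<Prod>a\<in>{1..L}. if b = a \<and> m = a then xx - y * z a else if m = a then 1 - z a else if m < a then z a else 1)
        = (\<Prod>a\<in>{1..L}. (if a = m then if b = m then xx - y * z m else 1 - z m else 1) * (if m < a then z a else 1))"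
      by (rule prod.cong) auto
    also have "\<dots> = (\<Prod>a\<in>{1..L}. if a = m then if b = m then xx - y * z m else 1 - z m else 1)
        * (\<Prod>a\<in>{1..L}. if m < a then z a else 1)" by (rule prod.distrib)
    also have "(\<Prod>a\<in>{1..L}. if m < a then z a else 1) = MP L m z"
      unfolding MP_def by (subst prod.inter_filter[symmetric]) (auto intro: prod.cong)
    finally show ?thesis using assms by (simp add: prod.delta)
  qed
  show ?thesis unfolding prod.distrib 1 2 by (auto simp: cw_def cwp_def cwq_def algebra_simps)
qed

text \<open>The word of a label is a product over columns once its state is known, and the state on
  entering a column is \<open>z a\<close>. Interchanging the products over labels and over columns
  yields the column weights.\<close>

lemma wl_prod:
  assumes x: "x = co v" and bd: "\<And>j. j < n \<Longrightarrow> \<beta> j \<le> L \<and> M j \<le> L" and "i \<le> n"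
  shows "(\<Prod>a\<in>{1..L}. (\<Prod>j\<in>{j\<in>{i..<n}. \<beta> j = a \<and> M j \<noteq> a}. ssc j) * poly (PP (z a) (WW (sF a) (sG a) [i..<n])) 1)
    = wl L y i z (map \<beta> [i..<n]) (map M [i..<n]) v"
  using assms(3)
proof (induction i arbitrary: z rule: inc_induct)
  case base
  then show ?case by simp
next
  case (step i)
  have up: "[i..<n] = i # [Suc i..<n]" using step.hyps by (simp add: upt_conv_Cons)
  have st: "stt (z a) [sF a i, sG a i] = cz z (\<beta> i) (M i) a" for a
    by (auto simp: sF_def sG_def cz_def)
  have "(\<Prod>j\<in>{j\<in>{i..<n}. \<beta> j = a \<and> M j \<noteq> a}. ssc j) * poly (PP (z a) (WW (sF a) (sG a) [i..<n])) 1
      = ((if \<beta> i = a \<and> M i \<noteq> a then (if \<beta> i < M i then x i else y) else 1)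
        * (if \<beta> i = a \<and> M i = a then x i - y * z a else if M i = a then 1 - z a else if M i < a then z a else 1))
       * ((\<Prod>j\<in>{j\<in>{Suc i..<n}. \<beta> j = a \<and> M j \<noteq> a}. ssc j) * poly (PP (cz z (\<beta> i) (M i) a) (WW (sF a) (sG a) [Suc i..<n])) 1)"
    for a
  proof -
    have s: "{j\<in>{i..<n}. \<beta> j = a \<and> M j \<noteq> a}
        = (if \<beta> i = a \<and> M i \<noteq> a then {i} else {}) \<union> {j\<in>{Suc i..<n}. \<beta> j = a \<and> M j \<noteq> a}"
      using step.hyps by (auto simp: le_less Suc_le_eq)
    have "(\<Prod>j\<in>{j\<in>{i..<n}. \<beta> j = a \<and> M j \<noteq> a}. ssc j)
        = (if \<beta> i = a \<and> M i \<noteq> a then ssc i else 1) * (\<Prod>j\<in>{j\<in>{Suc i..<n}. \<beta> j = a \<and> M j \<noteq> a}. ssc j)"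
      unfolding s by (subst prod.union_disjoint) auto
    moreover have "PP (z a) (WW (sF a) (sG a) [i..<n])
        = PP (z a) [sF a i, sG a i] * PP (cz z (\<beta> i) (M i) a) (WW (sF a) (sG a) [Suc i..<n])"
      unfolding up st[symmetric] PP_append[symmetric] by simp
    moreover have "poly (PP (z a) [sF a i, sG a i]) 1
        = (if \<beta> i = a \<and> M i = a then x i - y * z a else if M i = a then 1 - z a else if M i < a then z a else 1)"
      by (auto simp: sF_def sG_def)
    ultimately show ?thesis by (simp add: ssc_def)
  qed
  then have "(\<Prod>a\<in>{1..L}. (\<Prod>j\<in>{j\<in>{i..<n}. \<beta> j = a \<and> M j \<noteq> a}. ssc j) * poly (PP (z a) (WW (sF a) (sG a) [i..<n])) 1)
    = cw L y (x i) z (\<beta> i) (M i) * wl L y (Suc i) (cz z (\<beta> i) (M i)) (map \<beta> [Suc i..<n]) (map M [Suc i..<n]) v"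
    unfolding step.IH[symmetric] using sg_col_prod[of "\<beta> i" "M i" "x i" z] bd[of i] step.hyps
    by (simp only: prod.distrib)
  then show ?case unfolding up x by simp
qed

lemma sg_sum:
  assumes x: "x = co v" and bd: "\<And>j. j < n \<Longrightarrow> \<beta> j \<le> L \<and> M j \<le> L"
  shows "(\<Sum>(\<alpha>, p)\<in>sg_pair n M \<beta>. (\<Prod>j<n. if 0 < \<alpha> j then co v j else if \<alpha> j < 0 then - y else 1)
      * (\<Prod>j\<in>{j. j < n \<and> \<alpha> j \<noteq> 0}. sg_wt n M \<alpha> p j))
    = wl L y 0 (\<lambda>_. 1) (map \<beta> [0..<n]) (map M [0..<n]) v"
proof -
  have U: "{c. c < n \<and> L < M c} = {}" using bd by fastforce
  have "asum sAl sW fst (jl \<beta> n L) {} = wl L y 0 (\<lambda>_. 1) (map \<beta> [0..<n]) (map M [0..<n]) v"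
    using sg_asum[of L] wl_prod[OF x bd, of 0 "\<lambda>_. 1"] unfolding U by simp
  then show ?thesis unfolding x[symmetric] by (intro trans[OF sg_pair_sum[OF bd]])
qed

end

section \<open>Splitting a queue into its lowest row and the rest\<close>

definition rowf :: "nat \<Rightarrow> nat list \<Rightarrow> nat \<Rightarrow> nat" where
  "rowf n ks j = (if j < n then ks ! j else 0)"

lemma map_rowf: "length ks = n \<Longrightarrow> map (rowf n ks) [0..<n] = ks"
  by (auto intro!: nth_equalityI simp: rowf_def)

lemma rowf_map: "(\<And>j. n \<le> j \<Longrightarrow> f j = 0) \<Longrightarrow> rowf n (map f [0..<n]) = f"
  by (auto simp: rowf_def fun_eq_iff)

lemma card_rowf: "length ks = n \<Longrightarrow> card {j. j < n \<and> rowf n ks j = a} = count (mset ks) a"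
  using count_map_upt[of "rowf n ks" n a] by (simp add: map_rowf count_list_mset)

definition Mr :: "nat list \<Rightarrow> nat \<Rightarrow> nat multiset" where
  "Mr lam r = mset (lam_r lam r)"

lemma size_Mr [simp]: "size (Mr lam r) = length lam" by (simp add: Mr_def lam_r_def)

lemma Lmax_ge: "a \<in> set lam \<Longrightarrow> a \<le> Lmax lam" by (simp add: Lmax_def)

lemma set_Mr: "set_mset (Mr lam r) \<subseteq> insert 0 {r..Lmax lam}"
  by (auto simp: Mr_def lam_r_def Lmax_ge)

lemma count_Mr: "a \<in> {r+1..L} \<Longrightarrow> count (Mr lam (r+1)) a = count (Mr lam r) a"
  unfolding Mr_def lam_r_def by (induction lam) auto

text \<open>The rows of a queue from \<open>r\<close> on, with all fields below set to 0. The
  pairing \<open>pc\<close> of row \<open>r\<close> leads down to row \<open>r - 1\<close> and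
  therefore does not belong to this part.\<close>

definition part :: "nat list \<Rightarrow> nat \<Rightarrow> nat list \<Rightarrow> smlq \<Rightarrow> bool" where
  "part lam r mu Q \<longleftrightarrow> (let n = length lam; L = Lmax lam in
     (\<forall>r'. r' < r \<or> L < r' \<longrightarrow> reg Q r' = (\<lambda>_. 0) \<and> sgn Q r' = (\<lambda>_. 0) \<and> ps Q r' = (\<lambda>_. 0))
   \<and> (\<forall>r'. r' \<le> r \<or> L < r' \<longrightarrow> pc Q r' = (\<lambda>_. 0))
   \<and> (\<forall>r'\<in>{r..L}. (\<forall>j. n \<le> j \<longrightarrow> reg Q r' j = 0) \<and> mset (map (reg Q r') [0..<n]) = Mr lam r'
        \<and> mset (map (\<lambda>j. absl (sgn Q r' j)) [0..<n]) = Mr lam r'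
        \<and> (sgn Q r', ps Q r') \<in> sg_pair n (reg Q r') (\<lambda>j. absl (sgn Q r' j)))
   \<and> (\<forall>r'\<in>{r+1..L}. pc Q r' \<in> cl_pair n (reg Q r') (\<lambda>j. absl (sgn Q (r' - 1) j)))
   \<and> (\<forall>j<n. reg Q r j = mu ! j))"

definition bwt :: "nat \<Rightarrow> nat \<Rightarrow> (nat \<Rightarrow> int) \<Rightarrow> fn" where
  "bwt n r \<alpha> v = (\<Prod>j<n. if 0 < \<alpha> j then co v j else if \<alpha> j < 0 then - (qq ^ (r - 1) / tt ^ (n - 1)) else 1)"

definition clw :: "nat \<Rightarrow> smlq \<Rightarrow> nat \<Rightarrow> qt" where
  "clw n Q r = (\<Prod>j\<in>{j. j < n \<and> reg Q r j \<noteq> 0}. cl_wt n (r - 1) (reg Q r) (\<lambda>j. absl (sgn Q (r - 1) j)) (pc Q r) j)"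

definition sgw :: "nat \<Rightarrow> smlq \<Rightarrow> nat \<Rightarrow> qt" where
  "sgw n Q r = (\<Prod>j\<in>{j. j < n \<and> sgn Q r j \<noteq> 0}. sg_wt n (reg Q r) (sgn Q r) (ps Q r) j)"

definition wtr :: "nat list \<Rightarrow> nat \<Rightarrow> smlq \<Rightarrow> fn" where
  "wtr lam r Q v = (let n = length lam; L = Lmax lam in
     (\<Prod>r'\<in>{r..L}. bwt n r' (sgn Q r') v * sgw n Q r') * (\<Prod>r'\<in>{r+1..L}. clw n Q r'))"

definition GG :: "nat list \<Rightarrow> nat \<Rightarrow> nat list \<Rightarrow> fn" where
  "GG lam r mu v = (\<Sum>Q | part lam r mu Q. wtr lam r Q v)"

lemma is_smlq_part: "is_smlq lam mu Q \<longleftrightarrow> part lam 1 mu Q"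
proof -
  let ?n = "length lam" and ?L = "Lmax lam"
  have f0: "f = (\<lambda>_. 0) \<longleftrightarrow> (\<forall>j. f j = 0)" for f :: "nat \<Rightarrow> 'b::zero" by auto
  show ?thesis
  proof
    assume "is_smlq lam mu Q"
    then have *: "\<forall>r j. (r < 1 \<or> ?L < r \<or> ?n \<le> j) \<longrightarrow> reg Q r j = 0 \<and> sgn Q r j = 0"
      "\<forall>r j. \<not> (2 \<le> r \<and> r \<le> ?L \<and> j < ?n \<and> reg Q r j \<noteq> 0) \<longrightarrow> pc Q r j = 0"
      "\<forall>r j. \<not> (1 \<le> r \<and> r \<le> ?L \<and> j < ?n \<and> sgn Q r j \<noteq> 0) \<longrightarrow> ps Q r j = 0"
      "\<forall>r\<in>{1..?L}. mset (map (reg Q r) [0..<?n]) = mset (lam_r lam r)"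
      "\<forall>r\<in>{1..?L}. mset (map (\<lambda>j. absl (sgn Q r j)) [0..<?n]) = mset (lam_r lam r)"
      "\<forall>j<?n. reg Q 1 j = mu ! j"
      and c: "\<forall>r\<in>{2..?L}. (\<forall>j<?n. reg Q r j \<noteq> 0 \<longrightarrow> pc Q r j < ?n \<and> absl (sgn Q (r - 1) (pc Q r j)) = reg Q r j)
        \<and> inj_on (pc Q r) {j. j < ?n \<and> reg Q r j \<noteq> 0}
        \<and> (\<forall>j<?n. reg Q r j \<noteq> 0 \<longrightarrow> (sgn Q (r - 1) j = 0 \<or> reg Q r j \<le> absl (sgn Q (r - 1) j))
          \<and> (absl (sgn Q (r - 1) j) = reg Q r j \<longrightarrow> pc Q r j = j))"
      and s: "\<forall>r\<in>{1..?L}. (\<forall>j<?n. sgn Q r j \<noteq> 0 \<longrightarrow> j \<le> ps Q r j \<and> ps Q r j < ?n \<and> reg Q r (ps Q r j) = absl (sgn Q r j))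
        \<and> inj_on (ps Q r) {j. j < ?n \<and> sgn Q r j \<noteq> 0}
        \<and> (\<forall>j<?n. 0 < sgn Q r j \<longrightarrow> absl (sgn Q r j) \<le> reg Q r j \<and> (reg Q r j = absl (sgn Q r j) \<longrightarrow> ps Q r j = j))
        \<and> (\<forall>j<?n. sgn Q r j < 0 \<longrightarrow> reg Q r j = 0 \<or> reg Q r j \<le> absl (sgn Q r j))"
      unfolding is_smlq_def Let_def by - (elim conjE; assumption)+
    have "(sgn Q r, ps Q r) \<in> sg_pair ?n (reg Q r) (\<lambda>j. absl (sgn Q r j))" if "r \<in> {1..?L}" for r
      using s that *(1,3) unfolding sg_pair_def by simp
    moreover have "pc Q r \<in> cl_pair ?n (reg Q r) (\<lambda>j. absl (sgn Q (r - 1) j))" if "r \<in> {1+1..?L}" for r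
    proof -
      have "r \<in> {2..?L}" using that by auto
      then show ?thesis using c *(2) unfolding cl_pair_def by simp
    qed
    moreover have "pc Q r = (\<lambda>_. 0)" if "r \<le> 1 \<or> ?L < r" for r
    proof -
      have "\<not> (2 \<le> r \<and> r \<le> ?L)" using that by auto
      then show ?thesis using *(2) unfolding f0 by blast
    qed
    ultimately show "part lam 1 mu Q"
      using * unfolding part_def Let_def Mr_def f0 by (simp add: not_less)
  next
    assume "part lam 1 mu Q"
    then have *: "\<forall>r'. r' < 1 \<or> ?L < r' \<longrightarrow> reg Q r' = (\<lambda>_. 0) \<and> sgn Q r' = (\<lambda>_. 0) \<and> ps Q r' = (\<lambda>_. 0)"
      "\<forall>r'. r' \<le> 1 \<or> ?L < r' \<longrightarrow> pc Q r' = (\<lambda>_. 0)"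
      and s: "\<forall>r'\<in>{1..?L}. (\<forall>j. ?n \<le> j \<longrightarrow> reg Q r' j = 0) \<and> mset (map (reg Q r') [0..<?n]) = Mr lam r'
        \<and> mset (map (\<lambda>j. absl (sgn Q r' j)) [0..<?n]) = Mr lam r'
        \<and> (sgn Q r', ps Q r') \<in> sg_pair ?n (reg Q r') (\<lambda>j. absl (sgn Q r' j))"
      and c: "\<forall>r'\<in>{1+1..?L}. pc Q r' \<in> cl_pair ?n (reg Q r') (\<lambda>j. absl (sgn Q (r' - 1) j))"
      and m: "\<forall>j<?n. reg Q 1 j = mu ! j"
      unfolding part_def Let_def by - (elim conjE; assumption)+
    have in1: "r \<in> {1..?L}" if "\<not> (r < 1 \<or> ?L < r)" for r using that by auto
    have in2: "r \<in> {1+1..?L}" if "\<not> (r \<le> 1 \<or> ?L < r)" for r using that by auto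
    have sp: "\<forall>j. ?n \<le> j \<longrightarrow> sgn Q r j = 0" "\<forall>j. \<not> (j < ?n \<and> sgn Q r j \<noteq> 0) \<longrightarrow> ps Q r j = 0"
      "\<forall>j<?n. sgn Q r j \<noteq> 0 \<longrightarrow> j \<le> ps Q r j \<and> ps Q r j < ?n \<and> reg Q r (ps Q r j) = absl (sgn Q r j)"
      "inj_on (ps Q r) {j. j < ?n \<and> sgn Q r j \<noteq> 0}"
      "\<forall>j<?n. 0 < sgn Q r j \<longrightarrow> absl (sgn Q r j) \<le> reg Q r j \<and> (reg Q r j = absl (sgn Q r j) \<longrightarrow> ps Q r j = j)"
      "\<forall>j<?n. sgn Q r j < 0 \<longrightarrow> reg Q r j = 0 \<or> reg Q r j \<le> absl (sgn Q r j)" if "r \<in> {1..?L}" for r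
      using s that unfolding sg_pair_def by simp_all
    have cp: "\<forall>j. \<not> (j < ?n \<and> reg Q r j \<noteq> 0) \<longrightarrow> pc Q r j = 0"
      "\<forall>j<?n. reg Q r j \<noteq> 0 \<longrightarrow> pc Q r j < ?n \<and> absl (sgn Q (r - 1) (pc Q r j)) = reg Q r j"
      "inj_on (pc Q r) {j. j < ?n \<and> reg Q r j \<noteq> 0}"
      "\<forall>j<?n. reg Q r j \<noteq> 0 \<longrightarrow> (sgn Q (r - 1) j = 0 \<or> reg Q r j \<le> absl (sgn Q (r - 1) j))
          \<and> (absl (sgn Q (r - 1) j) = reg Q r j \<longrightarrow> pc Q r j = j)" if "r \<in> {1+1..?L}" for r
      using c that unfolding cl_pair_def by simp_all
    have 1: "reg Q r j = 0 \<and> sgn Q r j = 0" if "r < 1 \<or> ?L < r \<or> ?n \<le> j" for r j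
    proof (cases "r < 1 \<or> ?L < r")
      case True
      then show ?thesis using *(1)[rule_format, OF True] by simp
    next
      case False
      then show ?thesis using that s in1[OF False] sp(1)[OF in1[OF False]] by auto
    qed
    have 2: "pc Q r j = 0" if "\<not> (2 \<le> r \<and> r \<le> ?L \<and> j < ?n \<and> reg Q r j \<noteq> 0)" for r j
    proof (cases "r \<le> 1 \<or> ?L < r")
      case True
      then show ?thesis using *(2)[rule_format, OF True] by simp
    next
      case False
      then show ?thesis using that cp(1)[OF in2[OF False]] by auto
    qed
    have 3: "ps Q r j = 0" if "\<not> (1 \<le> r \<and> r \<le> ?L \<and> j < ?n \<and> sgn Q r j \<noteq> 0)" for r j
    proof (cases "r < 1 \<or> ?L < r")
      case True
      then show ?thesis using *(1)[rule_format, OF True] by simp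
    next
      case False
      then show ?thesis using that sp(2)[OF in1[OF False]] by auto
    qed
    have 4: "(\<forall>j<?n. reg Q r j \<noteq> 0 \<longrightarrow> pc Q r j < ?n \<and> absl (sgn Q (r - 1) (pc Q r j)) = reg Q r j)
        \<and> inj_on (pc Q r) {j. j < ?n \<and> reg Q r j \<noteq> 0}
        \<and> (\<forall>j<?n. reg Q r j \<noteq> 0 \<longrightarrow> (sgn Q (r - 1) j = 0 \<or> reg Q r j \<le> absl (sgn Q (r - 1) j))
          \<and> (absl (sgn Q (r - 1) j) = reg Q r j \<longrightarrow> pc Q r j = j))" if "r \<in> {2..?L}" for r
      using cp(2-4)[of r] that by auto
    have ms: "mset (map (reg Q r) [0..<?n]) = mset (lam_r lam r)"
      "mset (map (\<lambda>j. absl (sgn Q r j)) [0..<?n]) = mset (lam_r lam r)" if "r \<in> {1..?L}" for r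
      using s that unfolding Mr_def by blast+
    have 5: "(\<forall>j<?n. sgn Q r j \<noteq> 0 \<longrightarrow> j \<le> ps Q r j \<and> ps Q r j < ?n \<and> reg Q r (ps Q r j) = absl (sgn Q r j))
        \<and> inj_on (ps Q r) {j. j < ?n \<and> sgn Q r j \<noteq> 0}
        \<and> (\<forall>j<?n. 0 < sgn Q r j \<longrightarrow> absl (sgn Q r j) \<le> reg Q r j \<and> (reg Q r j = absl (sgn Q r j) \<longrightarrow> ps Q r j = j))
        \<and> (\<forall>j<?n. sgn Q r j < 0 \<longrightarrow> reg Q r j = 0 \<or> reg Q r j \<le> absl (sgn Q r j))" if "r \<in> {1..?L}" for r
      by (intro conjI) (rule sp[OF that])+
    show "is_smlq lam mu Q"
      unfolding is_smlq_def Let_def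
    proof (intro conjI)
      show "\<forall>r j. r < 1 \<or> ?L < r \<or> ?n \<le> j \<longrightarrow> reg Q r j = 0 \<and> sgn Q r j = 0" using 1 by (intro allI impI)
      show "\<forall>r j. \<not> (2 \<le> r \<and> r \<le> ?L \<and> j < ?n \<and> reg Q r j \<noteq> 0) \<longrightarrow> pc Q r j = 0" using 2 by (intro allI impI)
      show "\<forall>r j. \<not> (1 \<le> r \<and> r \<le> ?L \<and> j < ?n \<and> sgn Q r j \<noteq> 0) \<longrightarrow> ps Q r j = 0" using 3 by (intro allI impI)
    qed (rule m | (rule ballI, rule ms 4 5, assumption))+
  qed
qed

lemma finite_sg_pair: "finite (sg_pair n M \<beta>)"
proof -
  let ?A = "{\<alpha> :: nat \<Rightarrow> int. \<forall>j. (j \<in> {..<n} \<longrightarrow> \<alpha> j \<in> (\<lambda>j. int (\<beta> j)) ` {..<n} \<union> (\<lambda>j. - int (\<beta> j)) ` {..<n}) \<and> (j \<notin> {..<n} \<longrightarrow> \<alpha> j = 0)}"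
  let ?P = "{p :: nat \<Rightarrow> nat. \<forall>j. (j \<in> {..<n} \<longrightarrow> p j \<in> {..n}) \<and> (j \<notin> {..<n} \<longrightarrow> p j = 0)}"
  have "finite (?A \<times> ?P)" by (intro finite_cartesian_product finite_set_of_finite_funs) auto
  moreover have "sg_pair n M \<beta> \<subseteq> ?A \<times> ?P"
  proof
    fix x assume "x \<in> sg_pair n M \<beta>"
    then obtain \<alpha> p where x: "x = (\<alpha>, p)" and ap: "(\<alpha>, p) \<in> sg_pair n M \<beta>" by (cases x) auto
    have "\<alpha> j \<in> (\<lambda>j. int (\<beta> j)) ` {..<n} \<union> (\<lambda>j. - int (\<beta> j)) ` {..<n}" if "j < n" for j
    proof -
      have "absl (\<alpha> j) = \<beta> j" using ap that by (simp add: sg_pair_def)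
      from absl_eqD[OF this] show ?thesis using that by auto
    qed
    moreover have "p j \<le> n" if "j < n" for j
    proof (cases "\<alpha> j = 0")
      case True then show ?thesis using ap by (simp add: sg_pair_def)
    next
      case False then show ?thesis using ap that by (simp add: sg_pair_def less_imp_le)
    qed
    moreover have "\<alpha> j = 0" "p j = 0" if "\<not> j < n" for j using ap that by (simp_all add: sg_pair_def)
    ultimately show "x \<in> ?A \<times> ?P" unfolding x by auto
  qed
  ultimately show ?thesis by (rule rev_finite_subset)
qed

lemma finite_cl_pair: "finite (cl_pair n K B)"
proof -
  have "finite {p :: nat \<Rightarrow> nat. \<forall>j. (j \<in> {..<n} \<longrightarrow> p j \<in> {..n}) \<and> (j \<notin> {..<n} \<longrightarrow> p j = 0)}"
    by (intro finite_set_of_finite_funs) auto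
  moreover have "(p j \<le> n) \<and> (\<not> j < n \<longrightarrow> p j = 0)" if p: "p \<in> cl_pair n K B" for p j
    by (cases "j < n \<and> K j \<noteq> 0") (use p in \<open>auto simp: cl_pair_def less_imp_le\<close>)
  ultimately show ?thesis by (elim rev_finite_subset) auto
qed

text \<open>The data gained on going down from row \<open>r + 1\<close> to row \<open>r\<close>:
  absolute values of row \<open>r'\<close>, its signs and pairing, the word of row
  \<open>r + 1\<close> and its pairing, and the upper part. Above the topmost row that word consists
  of zeros.\<close>

definition split_set :: "nat list \<Rightarrow> nat \<Rightarrow> nat list \<Rightarrow> _ set" where
  "split_set lam r mu = (let n = length lam in
     Sigma (arr (Mr lam r)) (\<lambda>\<beta>. sg_pair n (rowf n mu) (rowf n \<beta>)
       \<times> Sigma (arr (Mr lam (r+1))) (\<lambda>\<kappa>. cl_pair n (rowf n \<kappa>) (rowf n \<beta>) \<times> {Q. part lam (r+1) \<kappa> Q})))"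

definition join :: "nat \<Rightarrow> nat \<Rightarrow> nat list \<Rightarrow> nat list \<times> ((nat \<Rightarrow> int) \<times> (nat \<Rightarrow> nat)) \<times> nat list \<times> (nat \<Rightarrow> nat) \<times> smlq \<Rightarrow> smlq" where
  "join n r mu = (\<lambda>(\<beta>, (\<alpha>, p), \<kappa>, p2, Q). \<lparr>reg = (reg Q)(r := rowf n mu), sgn = (sgn Q)(r := \<alpha>),
     pc = (pc Q)(r+1 := p2), ps = (ps Q)(r := p)\<rparr>)"

lemma join_part:
  assumes mu: "mu \<in> arr (Mr lam r)" and r: "r \<le> Lmax lam"
    and x: "x \<in> split_set lam r mu"
  shows "part lam r mu (join (length lam) r mu x)"
proof -
  let ?n = "length lam" and ?L = "Lmax lam"
  obtain \<beta> \<alpha> p \<kappa> p2 Q where X: "x = (\<beta>, (\<alpha>, p), \<kappa>, p2, Q)" by (cases x) auto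
  have b: "\<beta> \<in> arr (Mr lam r)" "(\<alpha>, p) \<in> sg_pair ?n (rowf ?n mu) (rowf ?n \<beta>)" "\<kappa> \<in> arr (Mr lam (r+1))"
    "p2 \<in> cl_pair ?n (rowf ?n \<kappa>) (rowf ?n \<beta>)" "part lam (r+1) \<kappa> Q"
    using x unfolding X split_set_def Let_def by auto
  have len: "length mu = ?n" "length \<beta> = ?n" "length \<kappa> = ?n" using mu b arr_length by fastforce+
  have ab: "(\<lambda>j. absl (\<alpha> j)) = rowf ?n \<beta>"
    using b(2) unfolding sg_pair_def by (auto simp: rowf_def fun_eq_iff)
  define Q' where "Q' = join ?n r mu x"
  have q: "reg Q' r = rowf ?n mu" "sgn Q' r = \<alpha>" "ps Q' r = p" "pc Q' (r+1) = p2"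
    "r' \<noteq> r \<Longrightarrow> reg Q' r' = reg Q r'" "r' \<noteq> r \<Longrightarrow> sgn Q' r' = sgn Q r'" "r' \<noteq> r \<Longrightarrow> ps Q' r' = ps Q r'"
    "r' \<noteq> r+1 \<Longrightarrow> pc Q' r' = pc Q r'" for r'
    unfolding Q'_def X join_def by auto
  have P: "\<forall>r'. r' < r+1 \<or> ?L < r' \<longrightarrow> reg Q r' = (\<lambda>_. 0) \<and> sgn Q r' = (\<lambda>_. 0) \<and> ps Q r' = (\<lambda>_. 0)"
    "\<forall>r'. r' \<le> r+1 \<or> ?L < r' \<longrightarrow> pc Q r' = (\<lambda>_. 0)"
    "\<forall>r'\<in>{r+1..?L}. (\<forall>j. ?n \<le> j \<longrightarrow> reg Q r' j = 0) \<and> mset (map (reg Q r') [0..<?n]) = Mr lam r'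
        \<and> mset (map (\<lambda>j. absl (sgn Q r' j)) [0..<?n]) = Mr lam r'
        \<and> (sgn Q r', ps Q r') \<in> sg_pair ?n (reg Q r') (\<lambda>j. absl (sgn Q r' j))"
    "\<forall>r'\<in>{r+1+1..?L}. pc Q r' \<in> cl_pair ?n (reg Q r') (\<lambda>j. absl (sgn Q (r' - 1) j))"
    "\<forall>j<?n. reg Q (r+1) j = \<kappa> ! j"
    using b(5) unfolding part_def Let_def by - (elim conjE; assumption)+
  have regr1: "reg Q (r+1) = rowf ?n \<kappa>"
  proof (cases "r+1 \<le> ?L")
    case True
    then show ?thesis using P(3) P(5) by (auto simp: rowf_def fun_eq_iff)
  next
    case False
    then have "reg Q (r+1) = (\<lambda>_. 0)" using P(1) by auto
    then show ?thesis using P(5) by (auto simp: rowf_def fun_eq_iff)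
  qed
  have p2z: "p2 = (\<lambda>_. 0)" if "?L < r+1"
  proof -
    have "rowf ?n \<kappa> = (\<lambda>_. 0)" using P(1) that regr1 by auto
    then show ?thesis using b(4) by (auto simp: cl_pair_def)
  qed
  have "part lam r mu Q'"
    unfolding part_def Let_def
  proof (intro conjI allI ballI impI)
    fix r' assume a: "r' < r \<or> ?L < r'"
    then have "r' \<noteq> r" using r by auto
    then show "reg Q' r' = (\<lambda>_. 0)" "sgn Q' r' = (\<lambda>_. 0)" "ps Q' r' = (\<lambda>_. 0)"
      using q P(1) a by auto
  next
    fix r' assume a: "r' \<le> r \<or> ?L < r'"
    show "pc Q' r' = (\<lambda>_. 0)"
      using q(4) q(8)[of r'] P(2) a p2z by (cases "r' = r+1") auto
  next
    fix r' assume a: "r' \<in> {r..?L}"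
    show "reg Q' r' j = 0" if "?n \<le> j" for j
      using q(1) q(5)[of r'] P(3) a that by (cases "r' = r") (auto simp: rowf_def)
    show "mset (map (reg Q' r') [0..<?n]) = Mr lam r'"
      using q(1) q(5)[of r'] P(3) a mu len by (cases "r' = r") (auto simp: map_rowf arr_def)
    show "mset (map (\<lambda>j. absl (sgn Q' r' j)) [0..<?n]) = Mr lam r'"
    proof (cases "r' = r")
      case True
      then have "(\<lambda>j. absl (sgn Q' r' j)) = rowf ?n \<beta>" using q(2) ab by simp
      then show ?thesis using b(1) len True by (simp add: map_rowf arr_def)
    next
      case False
      then show ?thesis using q(6)[of r'] P(3) a by auto
    qed
    show "(sgn Q' r', ps Q' r') \<in> sg_pair ?n (reg Q' r') (\<lambda>j. absl (sgn Q' r' j))"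
    proof (cases "r' = r")
      case True
      then show ?thesis using q(1-3) ab b(2) by simp
    next
      case False
      then show ?thesis using q(5-7)[of r'] P(3) a by auto
    qed
  next
    fix r' assume a: "r' \<in> {r+1..?L}"
    show "pc Q' r' \<in> cl_pair ?n (reg Q' r') (\<lambda>j. absl (sgn Q' (r' - 1) j))"
    proof (cases "r' = r+1")
      case True
      then show ?thesis using q(2,4) q(5)[of "r+1"] regr1 ab b(4) by simp
    next
      case False
      then have "r' - 1 \<noteq> r" "r' \<in> {r+1+1..?L}" using a by auto
      then show ?thesis using q(5)[of r'] q(6)[of "r' - 1"] q(8)[of r'] False a P(4) by auto
    qed
  next
    fix j assume "j < ?n" then show "reg Q' r j = mu ! j" using q(1) by (simp add: rowf_def)
  qed
  then show ?thesis unfolding Q'_def .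
qed

definition unjoin :: "nat \<Rightarrow> nat \<Rightarrow> smlq \<Rightarrow> nat list \<times> ((nat \<Rightarrow> int) \<times> (nat \<Rightarrow> nat)) \<times> nat list \<times> (nat \<Rightarrow> nat) \<times> smlq" where
  "unjoin n r Q = (map (\<lambda>j. absl (sgn Q r j)) [0..<n], (sgn Q r, ps Q r), map (reg Q (r+1)) [0..<n], pc Q (r+1),
     \<lparr>reg = (reg Q)(r := (\<lambda>_. 0)), sgn = (sgn Q)(r := (\<lambda>_. 0)), pc = (pc Q)(r+1 := (\<lambda>_. 0)), ps = (ps Q)(r := (\<lambda>_. 0))\<rparr>)"

lemma split_setD:
  assumes "(\<beta>, (\<alpha>, p), \<kappa>, p2, Q) \<in> split_set lam r mu"
  shows "(\<lambda>j. absl (\<alpha> j)) = rowf (length lam) \<beta>" "reg Q (r+1) = rowf (length lam) \<kappa>"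
    "length \<beta> = length lam" "length \<kappa> = length lam"
    "reg Q r = (\<lambda>_. 0)" "sgn Q r = (\<lambda>_. 0)" "ps Q r = (\<lambda>_. 0)" "pc Q (r+1) = (\<lambda>_. 0)"
    "\<beta> \<in> arr (Mr lam r)" "(\<alpha>, p) \<in> sg_pair (length lam) (rowf (length lam) mu) (rowf (length lam) \<beta>)"
    "\<kappa> \<in> arr (Mr lam (r+1))" "p2 \<in> cl_pair (length lam) (rowf (length lam) \<kappa>) (rowf (length lam) \<beta>)"
    "part lam (r+1) \<kappa> Q"
proof -
  let ?n = "length lam"
  show b: "\<beta> \<in> arr (Mr lam r)" "(\<alpha>, p) \<in> sg_pair ?n (rowf ?n mu) (rowf ?n \<beta>)" "\<kappa> \<in> arr (Mr lam (r+1))"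
    "p2 \<in> cl_pair ?n (rowf ?n \<kappa>) (rowf ?n \<beta>)" "part lam (r+1) \<kappa> Q"
    using assms unfolding split_set_def Let_def by auto
  show "length \<beta> = ?n" "length \<kappa> = ?n" using b arr_length by fastforce+
  show "(\<lambda>j. absl (\<alpha> j)) = rowf ?n \<beta>"
    using b(2) unfolding sg_pair_def by (auto simp: rowf_def fun_eq_iff)
  have P: "\<forall>r'. r' < r+1 \<or> Lmax lam < r' \<longrightarrow> reg Q r' = (\<lambda>_. 0) \<and> sgn Q r' = (\<lambda>_. 0) \<and> ps Q r' = (\<lambda>_. 0)"
    "\<forall>r'. r' \<le> r+1 \<or> Lmax lam < r' \<longrightarrow> pc Q r' = (\<lambda>_. 0)"
    "\<forall>r'\<in>{r+1..Lmax lam}. (\<forall>j. ?n \<le> j \<longrightarrow> reg Q r' j = 0) \<and> mset (map (reg Q r') [0..<?n]) = Mr lam r'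
        \<and> mset (map (\<lambda>j. absl (sgn Q r' j)) [0..<?n]) = Mr lam r'
        \<and> (sgn Q r', ps Q r') \<in> sg_pair ?n (reg Q r') (\<lambda>j. absl (sgn Q r' j))"
    "\<forall>j<?n. reg Q (r+1) j = \<kappa> ! j"
    using b(5) unfolding part_def Let_def by - (elim conjE; assumption)+
  show "reg Q r = (\<lambda>_. 0)" "sgn Q r = (\<lambda>_. 0)" "ps Q r = (\<lambda>_. 0)" "pc Q (r+1) = (\<lambda>_. 0)"
    using P(1,2) by auto
  show "reg Q (r+1) = rowf ?n \<kappa>"
  proof (cases "r+1 \<le> Lmax lam")
    case True
    then show ?thesis using P(3,4) by (auto simp: rowf_def fun_eq_iff)
  next
    case False
    then have "reg Q (r+1) = (\<lambda>_. 0)" using P(1) by auto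
    then show ?thesis using P(4) by (auto simp: rowf_def fun_eq_iff)
  qed
qed

lemma unjoin_join:
  assumes "x \<in> split_set lam r mu"
  shows "unjoin (length lam) r (join (length lam) r mu x) = x"
proof -
  obtain \<beta> \<alpha> p \<kappa> p2 Q where X: "x = (\<beta>, (\<alpha>, p), \<kappa>, p2, Q)" by (cases x) auto
  note d = split_setD[OF assms[unfolded X]]
  have "(reg Q)(r := (\<lambda>_. 0)) = reg Q" "(sgn Q)(r := (\<lambda>_. 0)) = sgn Q" "(ps Q)(r := (\<lambda>_. 0)) = ps Q"
    "(pc Q)(r+1 := (\<lambda>_. 0)) = pc Q"
    using d(5-8) by (auto simp: fun_eq_iff)
  then show ?thesis using d(1-4) unfolding X join_def unjoin_def by (simp add: map_rowf)
qed

lemma Mr_top: "Lmax lam < r \<Longrightarrow> Mr lam r = mset (map (\<lambda>_. 0) [0..<length lam])"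
proof -
  assume "Lmax lam < r"
  then have "lam_r lam r = map (\<lambda>_. 0) lam" using Lmax_ge[of _ lam] by (fastforce simp: lam_r_def)
  then show ?thesis unfolding Mr_def by (simp add: map_replicate_const)
qed

lemma part_unjoin:
  assumes r: "r \<le> Lmax lam" and Q: "part lam r mu Q"
  shows "unjoin (length lam) r Q \<in> split_set lam r mu" "join (length lam) r mu (unjoin (length lam) r Q) = Q"
proof -
  let ?n = "length lam" and ?L = "Lmax lam"
  have P: "\<forall>r'. r' < r \<or> ?L < r' \<longrightarrow> reg Q r' = (\<lambda>_. 0) \<and> sgn Q r' = (\<lambda>_. 0) \<and> ps Q r' = (\<lambda>_. 0)"
    "\<forall>r'. r' \<le> r \<or> ?L < r' \<longrightarrow> pc Q r' = (\<lambda>_. 0)"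
    "\<forall>r'\<in>{r..?L}. (\<forall>j. ?n \<le> j \<longrightarrow> reg Q r' j = 0) \<and> mset (map (reg Q r') [0..<?n]) = Mr lam r'
        \<and> mset (map (\<lambda>j. absl (sgn Q r' j)) [0..<?n]) = Mr lam r'
        \<and> (sgn Q r', ps Q r') \<in> sg_pair ?n (reg Q r') (\<lambda>j. absl (sgn Q r' j))"
    "\<forall>r'\<in>{r+1..?L}. pc Q r' \<in> cl_pair ?n (reg Q r') (\<lambda>j. absl (sgn Q (r' - 1) j))"
    "\<forall>j<?n. reg Q r j = mu ! j"
    using Q unfolding part_def Let_def by - (elim conjE; assumption)+
  have rr: "r \<in> {r..?L}" using r by simp
  have regr: "reg Q r = rowf ?n mu" using P(3)[rule_format, OF rr] P(5) by (auto simp: rowf_def fun_eq_iff)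
  show "join ?n r mu (unjoin ?n r Q) = Q"
    unfolding join_def unjoin_def by (simp add: regr[symmetric])
  have sgr: "(sgn Q r, ps Q r) \<in> sg_pair ?n (reg Q r) (\<lambda>j. absl (sgn Q r j))" using P(3) rr by blast
  have rb: "rowf ?n (map (\<lambda>j. absl (sgn Q r j)) [0..<?n]) = (\<lambda>j. absl (sgn Q r j))"
    by (rule rowf_map) (use sgr in \<open>simp add: sg_pair_def\<close>)
  have top: "reg Q (r+1) = (\<lambda>_. 0)" "pc Q (r+1) = (\<lambda>_. 0)" if "\<not> r+1 \<le> ?L" using P(1,2) that by auto
  have rk: "rowf ?n (map (reg Q (r+1)) [0..<?n]) = reg Q (r+1)"
    by (rule rowf_map) (use P(3) top in \<open>cases "r+1 \<le> ?L"; auto\<close>)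
  have "map (\<lambda>j. absl (sgn Q r j)) [0..<?n] \<in> arr (Mr lam r)" using P(3)[rule_format, OF rr] by (simp add: arr_def)
  moreover have "map (reg Q (r+1)) [0..<?n] \<in> arr (Mr lam (r+1))"
  proof (cases "r+1 \<le> ?L")
    case True
    then have "r+1 \<in> {r..?L}" by auto
    from P(3)[rule_format, OF this] show ?thesis unfolding arr_def by blast
  next
    case False
    then show ?thesis using Mr_top[of lam "r+1"] top(1) by (simp add: arr_def)
  qed
  moreover have "pc Q (r+1) \<in> cl_pair ?n (reg Q (r+1)) (\<lambda>j. absl (sgn Q r j))"
  proof (cases "r+1 \<le> ?L")
    case True
    then have "r+1 \<in> {r+1..?L}" by auto
    from P(4)[rule_format, OF this] show ?thesis by simp
  next
    case False
    then show ?thesis using top by (simp add: cl_pair_def)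
  qed
  moreover have "part lam (r+1) (map (reg Q (r+1)) [0..<?n])
      \<lparr>reg = (reg Q)(r := (\<lambda>_. 0)), sgn = (sgn Q)(r := (\<lambda>_. 0)), pc = (pc Q)(r+1 := (\<lambda>_. 0)), ps = (ps Q)(r := (\<lambda>_. 0))\<rparr>"
    (is "part _ _ _ ?Q'")
    unfolding part_def Let_def
  proof (intro conjI allI ballI impI)
    fix r' assume a: "r' < r+1 \<or> ?L < r'"
    show "reg ?Q' r' = (\<lambda>_. 0)" "sgn ?Q' r' = (\<lambda>_. 0)" "ps ?Q' r' = (\<lambda>_. 0)"
      using P(1)[rule_format, of r'] a by (cases "r' = r"; auto)+
  next
    fix r' assume a: "r' \<le> r+1 \<or> ?L < r'"
    show "pc ?Q' r' = (\<lambda>_. 0)" using P(2)[rule_format, of r'] a by (cases "r' = r+1") auto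
  next
    fix r' assume a: "r' \<in> {r+1..?L}"
    then have a': "r' \<in> {r..?L}" "r' \<noteq> r" by auto
    note P3 = P(3)[rule_format, OF a'(1)]
    show "reg ?Q' r' j = 0" if "?n \<le> j" for j using P3 a' that by simp
    show "mset (map (reg ?Q' r') [0..<?n]) = Mr lam r'" using P3 a' by simp
    show "mset (map (\<lambda>j. absl (sgn ?Q' r' j)) [0..<?n]) = Mr lam r'" using P3 a' by simp
    show "(sgn ?Q' r', ps ?Q' r') \<in> sg_pair ?n (reg ?Q' r') (\<lambda>j. absl (sgn ?Q' r' j))" using P3 a' by simp
  next
    fix r' assume a: "r' \<in> {r+1+1..?L}"
    then have a': "r' \<in> {r+1..?L}" "r' \<noteq> r" "r' \<noteq> r+1" "r' - 1 \<noteq> r" by auto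
    show "pc ?Q' r' \<in> cl_pair ?n (reg ?Q' r') (\<lambda>j. absl (sgn ?Q' (r' - 1) j))"
      using P(4)[rule_format, OF a'(1)] a' by simp
  next
    fix j assume "j < ?n" then show "reg ?Q' (r+1) j = map (reg Q (r+1)) [0..<?n] ! j" by simp
  qed
  ultimately show "unjoin ?n r Q \<in> split_set lam r mu"
    unfolding unjoin_def split_set_def Let_def using sgr rb rk regr by simp
qed

lemma wtr_join:
  assumes x: "(\<beta>, (\<alpha>, p), \<kappa>, p2, Q) \<in> split_set lam r mu" and r: "1 \<le> r" "r \<le> Lmax lam"
  defines "n \<equiv> length lam"
  shows "wtr lam r (join n r mu (\<beta>, (\<alpha>, p), \<kappa>, p2, Q)) v
    = (bwt n r \<alpha> v * (\<Prod>j\<in>{j. j < n \<and> \<alpha> j \<noteq> 0}. sg_wt n (rowf n mu) \<alpha> p j))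
      * ((\<Prod>j\<in>{j. j < n \<and> rowf n \<kappa> j \<noteq> 0}. cl_wt n r (rowf n \<kappa>) (rowf n \<beta>) p2 j) * wtr lam (r+1) Q v)"
proof -
  let ?L = "Lmax lam"
  define Q' where "Q' = join n r mu (\<beta>, (\<alpha>, p), \<kappa>, p2, Q)"
  note d = split_setD[OF x, folded n_def]
  have q: "reg Q' r = rowf n mu" "sgn Q' r = \<alpha>" "ps Q' r = p" "pc Q' (r+1) = p2"
    "r' \<noteq> r \<Longrightarrow> reg Q' r' = reg Q r'" "r' \<noteq> r \<Longrightarrow> sgn Q' r' = sgn Q r'" "r' \<noteq> r \<Longrightarrow> ps Q' r' = ps Q r'"
    "r' \<noteq> r+1 \<Longrightarrow> pc Q' r' = pc Q r'" for r'
    unfolding Q'_def join_def by auto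
  have 1: "(\<Prod>r'\<in>{r..?L}. bwt n r' (sgn Q' r') v * sgw n Q' r')
      = (bwt n r \<alpha> v * (\<Prod>j\<in>{j. j < n \<and> \<alpha> j \<noteq> 0}. sg_wt n (rowf n mu) \<alpha> p j))
        * (\<Prod>r'\<in>{r+1..?L}. bwt n r' (sgn Q r') v * sgw n Q r')"
  proof -
    have "(\<Prod>r'\<in>{r..?L}. bwt n r' (sgn Q' r') v * sgw n Q' r')
      = (bwt n r (sgn Q' r) v * sgw n Q' r) * (\<Prod>r'\<in>{r+1..?L}. bwt n r' (sgn Q' r') v * sgw n Q' r')"
      using r by (simp add: prod.atLeast_Suc_atMost)
    also have "(\<Prod>r'\<in>{r+1..?L}. bwt n r' (sgn Q' r') v * sgw n Q' r') = (\<Prod>r'\<in>{r+1..?L}. bwt n r' (sgn Q r') v * sgw n Q r')"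
      by (rule prod.cong) (auto simp: sgw_def q)
    finally show ?thesis by (simp add: sgw_def q)
  qed
  have 2: "(\<Prod>r'\<in>{r+1..?L}. clw n Q' r')
      = (\<Prod>j\<in>{j. j < n \<and> rowf n \<kappa> j \<noteq> 0}. cl_wt n r (rowf n \<kappa>) (rowf n \<beta>) p2 j) * (\<Prod>r'\<in>{r+1+1..?L}. clw n Q r')"
  proof (cases "r+1 \<le> ?L")
    case True
    have "(\<Prod>r'\<in>{r+1..?L}. clw n Q' r') = clw n Q' (r+1) * (\<Prod>r'\<in>{r+1+1..?L}. clw n Q' r')"
      using True by (simp add: prod.atLeast_Suc_atMost)
    also have "(\<Prod>r'\<in>{r+1+1..?L}. clw n Q' r') = (\<Prod>r'\<in>{r+1+1..?L}. clw n Q r')"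
    proof (rule prod.cong)
      fix r' assume a: "r' \<in> {r+1+1..?L}"
      then have "r' \<noteq> r" "r' \<noteq> r+1" "r' - 1 \<noteq> r" by auto
      then show "clw n Q' r' = clw n Q r'" unfolding clw_def by (simp only: q if_False simp_thms)
    qed simp
    also have "clw n Q' (r+1) = (\<Prod>j\<in>{j. j < n \<and> rowf n \<kappa> j \<noteq> 0}. cl_wt n r (rowf n \<kappa>) (rowf n \<beta>) p2 j)"
    proof -
      have "reg Q' (r+1) = rowf n \<kappa>" "(\<lambda>j. absl (sgn Q' (r+1-1) j)) = rowf n \<beta>"
        using q(5)[of "r+1"] q(2) d(1,2) by simp_all
      then show ?thesis unfolding clw_def q(4) by (simp only: diff_add_inverse2)
    qed
    finally show ?thesis .
  next
    \<comment> \<open>In the topmost step row \<open>r + 1\<close> is empty and contributes an empty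
      product.\<close>
    case False
    have "rowf n \<kappa> = (\<lambda>_. 0)"
    proof -
      have "\<kappa> \<in> arr (mset (map (\<lambda>_. 0) [0..<n]))" using d(11) Mr_top[of lam "r+1"] False unfolding n_def by simp
      then have "set \<kappa> \<subseteq> {0}" unfolding arr_def mem_Collect_eq by (metis (no_types, lifting) ex_map_conv set_mset_mset singleton_iff subsetI)
      then have "\<kappa> ! j = 0" if "j < n" for j using d(4) that by (metis nth_mem singletonD subsetD)
      then show ?thesis by (auto simp: rowf_def fun_eq_iff)
    qed
    then show ?thesis using False by simp
  qed
  show ?thesis unfolding Q'_def[symmetric] unfolding wtr_def Let_def n_def[symmetric] 1 2 by (simp only: mult_ac)
qed

lemma part_top:
  assumes p: "part lam (Suc (Lmax lam)) mu Q"
  shows "Q = \<lparr>reg = (\<lambda>_ _. 0), sgn = (\<lambda>_ _. 0), pc = (\<lambda>_ _. 0), ps = (\<lambda>_ _. 0)\<rparr>"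
proof -
  have "reg Q r' = (\<lambda>_. 0)" "sgn Q r' = (\<lambda>_. 0)" "ps Q r' = (\<lambda>_. 0)" "pc Q r' = (\<lambda>_. 0)" for r'
    using p by (cases "r' < Suc (Lmax lam)"; simp add: part_def Let_def)+
  then have "reg Q = (\<lambda>_ _. 0)" "sgn Q = (\<lambda>_ _. 0)" "ps Q = (\<lambda>_ _. 0)" "pc Q = (\<lambda>_ _. 0)" by auto
  then show ?thesis by (cases Q) simp
qed

lemma finite_part:
  assumes "1 \<le> r" "r \<le> Suc (Lmax lam)"
  shows "finite {Q. part lam r mu Q}"
  using assms(2,1)
proof (induction r arbitrary: mu rule: inc_induct)
  case base
  have "{Q. part lam (Suc (Lmax lam)) mu Q} \<subseteq> {\<lparr>reg = (\<lambda>_ _. 0), sgn = (\<lambda>_ _. 0), pc = (\<lambda>_ _. 0), ps = (\<lambda>_ _. 0)\<rparr>}"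
    using part_top by blast
  then show ?case by (rule finite_subset) simp
next
  case (step r)
  have "finite (split_set lam r mu)"
    unfolding split_set_def Let_def using step
    by (intro finite_SigmaI finite_cartesian_product finite_arr finite_sg_pair finite_cl_pair) auto
  moreover have "{Q. part lam r mu Q} \<subseteq> join (length lam) r mu ` split_set lam r mu"
  proof
    fix Q assume "Q \<in> {Q. part lam r mu Q}"
    then have "join (length lam) r mu (unjoin (length lam) r Q) = Q" "unjoin (length lam) r Q \<in> split_set lam r mu"
      using part_unjoin[of r lam mu Q] step by auto
    then show "Q \<in> join (length lam) r mu ` split_set lam r mu" by (metis image_eqI)
  qed
  ultimately show ?case by (meson finite_imageI finite_subset)
qed

text \<open>The combinatorial sum becomes a composition of two linear maps: \<open>hh\<close> for
  the classic layer, then summation against \<open>wl\<close> for the signed one.\<close>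

lemma GG_rec:
  assumes mu: "mu \<in> arr (Mr lam r)" and r: "1 \<le> r" "r \<le> Lmax lam"
  defines "n \<equiv> length lam"
  shows "GG lam r mu v = (\<Sum>\<beta>\<in>arr (Mr lam r). wl (Lmax lam) (qq ^ (r - 1) / tt ^ (n - 1)) 0 (\<lambda>_. 1) \<beta> mu v
      * hh r (Lmax lam) (Mr lam (r+1)) (GG lam (r+1)) \<beta> v)"
proof -
  let ?L = "Lmax lam" and ?M = "Mr lam r" and ?M1 = "Mr lam (r+1)" and ?y = "qq ^ (r - 1) / tt ^ (n - 1)"
  define S where "S \<beta> = sg_pair n (rowf n mu) (rowf n \<beta>)" for \<beta>
  define C where "C \<beta> \<kappa> = cl_pair n (rowf n \<kappa>) (rowf n \<beta>)" for \<beta> \<kappa>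
  define fs where "fs = (\<lambda>(\<alpha>, p). bwt n r \<alpha> v * (\<Prod>j\<in>{j. j < n \<and> \<alpha> j \<noteq> 0}. sg_wt n (rowf n mu) \<alpha> p j))"
  define fc where "fc \<beta> \<kappa> p2 = (\<Prod>j\<in>{j. j < n \<and> rowf n \<kappa> j \<noteq> 0}. cl_wt n r (rowf n \<kappa>) (rowf n \<beta>) p2 j)" for \<beta> \<kappa> p2
  have fin: "finite (S \<beta>)" "finite (C \<beta> \<kappa>)" "finite {Q. part lam (r+1) \<kappa> Q}" for \<beta> \<kappa>
    unfolding S_def C_def using finite_part[of "r+1" lam] r by (auto simp: finite_sg_pair finite_cl_pair)
  have "GG lam r mu v = (\<Sum>(\<beta>, ap, \<kappa>, p2, Q)\<in>split_set lam r mu. fs ap * (fc \<beta> \<kappa> p2 * wtr lam (r+1) Q v))"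
    unfolding GG_def
  proof (rule sum.reindex_bij_witness[of _ "join n r mu" "unjoin n r"])
    fix Q assume "Q \<in> {Q. part lam r mu Q}"
    then show "join n r mu (unjoin n r Q) = Q" and mem: "unjoin n r Q \<in> split_set lam r mu"
      using part_unjoin[OF r(2)] unfolding n_def by auto
    obtain \<beta> \<alpha> p \<kappa> p2 Q' where X: "unjoin n r Q = (\<beta>, (\<alpha>, p), \<kappa>, p2, Q')" by (cases "unjoin n r Q") auto
    have "wtr lam r Q v = wtr lam r (join n r mu (unjoin n r Q)) v"
      using part_unjoin[OF r(2)] \<open>Q \<in> _\<close> unfolding n_def by auto
    then show "(case unjoin n r Q of (\<beta>, ap, \<kappa>, p2, Q) \<Rightarrow> fs ap * (fc \<beta> \<kappa> p2 * wtr lam (r+1) Q v)) = wtr lam r Q v"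
      using wtr_join[OF mem[unfolded X] r, of v] unfolding X n_def[symmetric] by (simp add: fs_def fc_def)
  next
    fix x assume x: "x \<in> split_set lam r mu"
    show "unjoin n r (join n r mu x) = x" using unjoin_join[OF x] unfolding n_def .
    show "join n r mu x \<in> {Q. part lam r mu Q}" using join_part[OF mu r(2) x] unfolding n_def by simp
  qed
  also have "\<dots> = (\<Sum>\<beta>\<in>arr ?M. \<Sum>(ap, \<kappa>, p2, Q)\<in>S \<beta> \<times> Sigma (arr ?M1) (\<lambda>\<kappa>. C \<beta> \<kappa> \<times> {Q. part lam (r+1) \<kappa> Q}).
      fs ap * (fc \<beta> \<kappa> p2 * wtr lam (r+1) Q v))"
    unfolding split_set_def Let_def S_def C_def n_def[symmetric]
    by (subst sum.Sigma) (use fin in \<open>auto simp: finite_arr S_def C_def n_def[symmetric]\<close>)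
  also have "\<dots> = (\<Sum>\<beta>\<in>arr ?M. (\<Sum>ap\<in>S \<beta>. fs ap) * (\<Sum>\<kappa>\<in>arr ?M1. (\<Sum>p2\<in>C \<beta> \<kappa>. fc \<beta> \<kappa> p2) * GG lam (r+1) \<kappa> v))"
  proof (rule sum.cong)
    fix \<beta> assume "\<beta> \<in> arr ?M"
    have "(\<Sum>(ap, \<kappa>, p2, Q)\<in>S \<beta> \<times> Sigma (arr ?M1) (\<lambda>\<kappa>. C \<beta> \<kappa> \<times> {Q. part lam (r+1) \<kappa> Q}). fs ap * (fc \<beta> \<kappa> p2 * wtr lam (r+1) Q v))
      = (\<Sum>ap\<in>S \<beta>. fs ap) * (\<Sum>(\<kappa>, p2, Q)\<in>Sigma (arr ?M1) (\<lambda>\<kappa>. C \<beta> \<kappa> \<times> {Q. part lam (r+1) \<kappa> Q}). fc \<beta> \<kappa> p2 * wtr lam (r+1) Q v)"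
      by (simp add: sum_product sum.cartesian_product split_def)
    also have "(\<Sum>(\<kappa>, p2, Q)\<in>Sigma (arr ?M1) (\<lambda>\<kappa>. C \<beta> \<kappa> \<times> {Q. part lam (r+1) \<kappa> Q}). fc \<beta> \<kappa> p2 * wtr lam (r+1) Q v)
      = (\<Sum>\<kappa>\<in>arr ?M1. \<Sum>(p2, Q)\<in>C \<beta> \<kappa> \<times> {Q. part lam (r+1) \<kappa> Q}. fc \<beta> \<kappa> p2 * wtr lam (r+1) Q v)"
      by (subst sum.Sigma) (use fin in \<open>auto simp: finite_arr\<close>)
    also have "\<dots> = (\<Sum>\<kappa>\<in>arr ?M1. (\<Sum>p2\<in>C \<beta> \<kappa>. fc \<beta> \<kappa> p2) * GG lam (r+1) \<kappa> v)"
      by (simp add: GG_def sum_product sum.cartesian_product split_def)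
    finally show "(\<Sum>(ap, \<kappa>, p2, Q)\<in>S \<beta> \<times> Sigma (arr ?M1) (\<lambda>\<kappa>. C \<beta> \<kappa> \<times> {Q. part lam (r+1) \<kappa> Q}). fs ap * (fc \<beta> \<kappa> p2 * wtr lam (r+1) Q v))
      = (\<Sum>ap\<in>S \<beta>. fs ap) * (\<Sum>\<kappa>\<in>arr ?M1. (\<Sum>p2\<in>C \<beta> \<kappa>. fc \<beta> \<kappa> p2) * GG lam (r+1) \<kappa> v)" .
  qed simp
  also have "\<dots> = (\<Sum>\<beta>\<in>arr ?M. wl ?L ?y 0 (\<lambda>_. 1) \<beta> mu v * hh r ?L ?M1 (GG lam (r+1)) \<beta> v)"
  proof (rule sum.cong)
    fix \<beta> assume b: "\<beta> \<in> arr ?M"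
    have len: "length \<beta> = n" "length mu = n" using b mu arr_length unfolding n_def by fastforce+
    have rng: "rowf n xs j \<in> insert 0 {s..?L}" if "xs \<in> arr (Mr lam s)" "j < n" for xs s j
    proof -
      have "xs ! j \<in> set_mset (Mr lam s)" using that arr_length[OF that(1)] unfolding n_def arr_def
        by (metis (mono_tags, lifting) mem_Collect_eq nth_mem set_mset_mset size_Mr)
      then show ?thesis using set_Mr[of lam s] that by (auto simp: rowf_def)
    qed
    have bd: "rowf n \<beta> j \<le> ?L \<and> rowf n mu j \<le> ?L" if "j < n" for j
      using rng[OF b that] rng[OF mu that] by auto
    have cs: "card {j. j < n \<and> rowf n \<beta> j = a} = card {j. j < n \<and> rowf n mu j = a}" for a
      using b mu unfolding card_rowf[OF len(1)] card_rowf[OF len(2)] by (simp add: arr_def)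
    have "(\<Sum>ap\<in>S \<beta>. fs ap) = wl ?L ?y 0 (\<lambda>_. 1) (map (rowf n \<beta>) [0..<n]) (map (rowf n mu) [0..<n]) v"
      using sg_sum[OF cs, of "co v" v ?L ?y] bd unfolding S_def fs_def bwt_def by auto
    moreover have "(\<Sum>p2\<in>C \<beta> \<kappa>. fc \<beta> \<kappa> p2) = CC r ?L \<kappa> \<beta>" if k: "\<kappa> \<in> arr ?M1" for \<kappa>
    proof -
      have lk: "length \<kappa> = n" using k arr_length unfolding n_def by fastforce
      have "card {j. j < n \<and> rowf n \<kappa> j = a} = card {j. j < n \<and> rowf n \<beta> j = a}" if "a \<in> {r+1..?L}" for a
        using k b count_Mr[OF that] unfolding card_rowf[OF len(1)] card_rowf[OF lk] by (simp add: arr_def)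
      then show ?thesis
        using cl_sum[OF r(2), of n "rowf n \<kappa>" "rowf n \<beta>"] rng[OF k] rng[OF b] unfolding C_def fc_def
        by (simp only: map_rowf[OF lk] map_rowf[OF len(1)])
    qed
    ultimately show "(\<Sum>ap\<in>S \<beta>. fs ap) * (\<Sum>\<kappa>\<in>arr ?M1. (\<Sum>p2\<in>C \<beta> \<kappa>. fc \<beta> \<kappa> p2) * GG lam (r+1) \<kappa> v)
      = wl ?L ?y 0 (\<lambda>_. 1) \<beta> mu v * hh r ?L ?M1 (GG lam (r+1)) \<beta> v"
      unfolding hh_def by (simp add: map_rowf len cong: sum.cong_simp)
  qed simp
  finally show ?thesis .
qed

section \<open>Downward induction over the rows\<close>

lemma arr_Mr_top: "arr (Mr lam (Suc (Lmax lam))) = {replicate (length lam) 0}"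
proof -
  have "lam_r lam (Suc (Lmax lam)) = replicate (length lam) 0"
    unfolding lam_r_def by (rule replicate_eqI) (auto simp: Suc_le_eq dest!: Lmax_ge)
  moreover have "xs = replicate (length lam) 0" if "mset xs = mset (replicate (length lam) (0::nat))" for xs
    using mset_eq_length[OF that] mset_eq_setD[OF that] by (intro replicate_eqI) auto
  ultimately show ?thesis by (auto simp: arr_def Mr_def)
qed

lemma GG_top: "mu \<in> arr (Mr lam (Suc (Lmax lam))) \<Longrightarrow> GG lam (Suc (Lmax lam)) mu = (\<lambda>_. 1)"
proof -
  assume "mu \<in> arr (Mr lam (Suc (Lmax lam)))"
  then have mu: "mu = replicate (length lam) 0" by (simp add: arr_Mr_top)
  let ?Z = "\<lparr>reg = (\<lambda>_ _. 0), sgn = (\<lambda>_ _. 0), pc = (\<lambda>_ _. 0), ps = (\<lambda>_ _. 0)\<rparr>"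
  have "{Q. part lam (Suc (Lmax lam)) mu Q} = {?Z}"
  proof -
    have "part lam (Suc (Lmax lam)) mu ?Z" by (auto simp: part_def Let_def mu)
    then show ?thesis using part_top by blast
  qed
  then show ?thesis unfolding GG_def wtr_def by simp
qed

lemma GG_families:
  assumes "1 \<le> r" "r \<le> Suc (Lmax lam)" and n: "1 \<le> length lam"
  shows "hecke_fam (length lam) (arr (Mr lam r)) th1 th2 (GG lam r)
    \<and> rot_fam (length lam) (qq ^ (r - 1)) (\<lambda>a. a - (r - 1)) (arr (Mr lam r)) (GG lam r)"
  using assms(2,1)
proof (induction r rule: inc_induct)
  case base
  let ?n = "length lam" and ?R = "Suc (Lmax lam)"
  \<comment> \<open>Above the top row everything is empty and the family is the constant 1. It
    satisfies the rotation equation because each inverse operator divides constants by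
    \<open>t\<close>.\<close>
  have G: "GG lam ?R xs = (\<lambda>_. 1)" if "xs \<in> arr (Mr lam ?R)" for xs using that by (rule GG_top)
  have rep: "xs \<in> arr (Mr lam ?R) \<longleftrightarrow> xs = replicate ?n 0" for xs by (simp add: arr_Mr_top)
  have "hecke_fam ?n (arr (Mr lam ?R)) th1 th2 (GG lam ?R)"
    unfolding hecke_fam_def by (auto simp: G TT_const rep th1_def th2_def)
  moreover have "rot_fam ?n (qq ^ (?R - 1)) (\<lambda>a. a - (?R - 1)) (arr (Mr lam ?R)) (GG lam ?R)"
    unfolding rot_fam_def
  proof (intro allI impI)
    fix ys a v assume m: "ys @ [a] \<in> arr (Mr lam ?R)"
    then have "mset (a # ys) = Mr lam ?R" by (simp add: arr_def)
    then have m': "a # ys \<in> arr (Mr lam ?R)" by (simp add: arr_def)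
    have a: "a = 0" using m' n unfolding rep by (cases ?n) auto
    have J: "JJ 0 (?n - 1) (\<lambda>_. 1) = (\<lambda>_. 1 / tt ^ (?n - 1))"
      unfolding JJ_def by (subst foldr_TI_eigen) (auto simp: TT_const)
    show "co v 0 * GG lam ?R (a # ys) v = qq ^ (a - (?R - 1)) * ((co v 0 - qq ^ (?R - 1) / tt ^ (?n - 1)) * RR ?n (GG lam ?R (ys @ [a])) v
      + qq ^ (?R - 1) * JJ 0 (?n - 1) (GG lam ?R (ys @ [a])) v)"
      unfolding G[OF m] G[OF m'] J by (simp add: RR_def a)
  qed
  ultimately show ?case by blast
next
  case (step r)
  let ?n = "length lam" and ?L = "Lmax lam"
  have r: "1 \<le> r" "r \<le> ?L" using step by auto
  define h where "h = hh r ?L (Mr lam (r+1)) (GG lam (r+1))"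
  have IH: "hecke_fam ?n (arr (Mr lam (r+1))) th1 th2 (GG lam (r+1))"
    "rot_fam ?n (qq ^ r) (\<lambda>a. a - r) (arr (Mr lam (r+1))) (GG lam (r+1))"
    using step by auto
  have s: "set_mset (Mr lam (r+1)) \<subseteq> insert 0 {r+1..?L}" "set_mset (Mr lam r) \<subseteq> insert 0 {r..?L}" using set_Mr by blast+
  interpret signed_layer ?n ?L r "Mr lam r" h "qq ^ (r - 1) / tt ^ (?n - 1)"
  proof
    show "hecke_fam ?n (arr (Mr lam r)) tz1 tz2 h"
      unfolding h_def by (rule hh_hecke[OF IH(1)]) (use r s in auto)
    show "rot_fam ?n (qq ^ r) (\<lambda>a. a - r) (arr (Mr lam r)) h"
      unfolding h_def by (rule hh_rot[OF IH(2)]) (use r s n count_Mr in auto)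
  qed (use r s n in auto)
  have GF: "GG lam r xs = F xs" if "xs \<in> arr (Mr lam r)" for xs
    using GG_rec[OF that r] unfolding F_def h_def[symmetric] by (intro ext)
  have "hecke_fam ?n (arr (Mr lam r)) th1 th2 (GG lam r)"
    using F_hecke unfolding hecke_fam_def by (auto simp: GF sp_arr)
  moreover have "rot_fam ?n (qq ^ (r - 1)) (\<lambda>a. a - (r - 1)) (arr (Mr lam r)) (GG lam r)"
    unfolding rot_fam_def
  proof (intro allI impI)
    fix ys a v assume m: "ys @ [a] \<in> arr (Mr lam r)"
    then have m': "a # ys \<in> arr (Mr lam r)" by (simp add: arr_def)
    show "co v 0 * GG lam r (a # ys) v = qq ^ (a - (r - 1)) * ((co v 0 - qq ^ (r - 1) / tt ^ (?n - 1)) * RR ?n (GG lam r (ys @ [a])) v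
      + qq ^ (r - 1) * JJ 0 (?n - 1) (GG lam r (ys @ [a])) v)"
      unfolding GF[OF m] GF[OF m'] using F_rot m unfolding rot_fam_def by blast
  qed
  ultimately show ?case by blast
qed

section \<open>Evaluation of polynomials; generic points detect them\<close>

definition mon :: "(nat \<Rightarrow>\<^sub>0 nat) \<Rightarrow> (nat \<Rightarrow> qt) \<Rightarrow> qt" where
  "mon m v = (\<Prod>i\<in>Poly_Mapping.keys m. v i ^ Poly_Mapping.lookup m i)"

lemma mon_superset:
  assumes "finite A" "Poly_Mapping.keys m \<subseteq> A"
  shows "mon m v = (\<Prod>i\<in>A. v i ^ Poly_Mapping.lookup m i)"
  unfolding mon_def by (rule prod.mono_neutral_left) (use assms in \<open>auto simp: in_keys_iff\<close>)

lemma mon_add: "mon (m + m') v = mon m v * mon m' v"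
proof -
  let ?A = "Poly_Mapping.keys m \<union> Poly_Mapping.keys m'"
  have "Poly_Mapping.keys (m + m') \<subseteq> ?A" by (rule Poly_Mapping.keys_add)
  then show ?thesis
    using mon_superset[of ?A m v] mon_superset[of ?A m' v] mon_superset[of ?A "m + m'" v]
    by (simp add: lookup_add power_add prod.distrib)
qed

lemma mon_single [simp]: "mon (Poly_Mapping.single i k) v = v i ^ k"
  using mon_superset[of "{i}" "Poly_Mapping.single i k" v] by (simp add: keys_single)

lemma mon_zero [simp]: "mon 0 v = 1" by (simp add: mon_def)

lemma mon_sum: "mon (sum f A) v = (\<Prod>x\<in>A. mon (f x) v)"
  by (induction A rule: infinite_finite_induct) (auto simp: mon_add)

lemma peval_superset:
  assumes "finite A" "Poly_Mapping.keys p \<subseteq> A"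
  shows "peval p v = (\<Sum>m\<in>A. Poly_Mapping.lookup p m * mon m v)"
  unfolding peval_def mon_def[symmetric]
  by (rule sum.mono_neutral_left) (use assms in \<open>auto simp: in_keys_iff\<close>)

lemma peval_add: "peval (p + q) v = peval p v + peval q v"
proof -
  let ?A = "Poly_Mapping.keys p \<union> Poly_Mapping.keys q"
  have "Poly_Mapping.keys (p + q) \<subseteq> ?A" by (rule Poly_Mapping.keys_add)
  then show ?thesis
    using peval_superset[of ?A p v] peval_superset[of ?A q v] peval_superset[of ?A "p + q" v]
    by (simp add: lookup_add distrib_right sum.distrib)
qed

lemma peval_zero [simp]: "peval 0 v = 0" by (simp add: peval_def)

lemma peval_diff: "peval (p - q) v = peval p v - peval q v"
  using peval_add[of "p - q" q v] by simp

lemma peval_single: "peval (Poly_Mapping.single m c) v = c * mon m v"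
  using peval_superset[of "{m}" "Poly_Mapping.single m c" v] by (simp add: keys_single)

lemma peval_sum: "peval (sum f A) v = (\<Sum>x\<in>A. peval (f x) v)"
  by (induction A rule: infinite_finite_induct) (auto simp: peval_add)

lemma poly_mapping_expand:
  "p = (\<Sum>m\<in>Poly_Mapping.keys p. Poly_Mapping.single m (Poly_Mapping.lookup p m))"
  by (rule poly_mapping_eqI) (auto simp: lookup_sum lookup_single when_def in_keys_iff sum.delta)

lemma peval_mult: "peval (p * q) v = peval p v * peval q v"
proof -
  let ?s = "\<lambda>p m. Poly_Mapping.single m (Poly_Mapping.lookup p m) :: mpoly"
  have "p * q = (\<Sum>m\<in>Poly_Mapping.keys p. ?s p m) * (\<Sum>m\<in>Poly_Mapping.keys q. ?s q m)"
    using poly_mapping_expand[of p] poly_mapping_expand[of q] by simp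
  also have "\<dots> = (\<Sum>m\<in>Poly_Mapping.keys p. \<Sum>m'\<in>Poly_Mapping.keys q.
      Poly_Mapping.single (m + m') (Poly_Mapping.lookup p m * Poly_Mapping.lookup q m'))"
    by (simp add: sum_product mult_single)
  finally show ?thesis
    unfolding peval_def[of p] peval_def[of q] mon_def[symmetric]
    by (simp add: peval_sum peval_single mon_add sum_product mult_ac)
qed

lemma peval_Xv [simp]: "peval (Xv i) v = v i" by (simp add: Xv_def peval_single)

lemma peval_Cst [simp]: "peval (Cst c) v = c" by (simp add: Cst_def peval_single)

lemma peval_one [simp]: "peval 1 v = 1" using peval_Cst[of 1 v] by (simp add: Cst_def)

lemma peval_prod: "peval (prod f A) v = (\<Prod>x\<in>A. peval (f x) v)"
  by (induction A rule: infinite_finite_induct) (auto simp: peval_mult)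

lemma peval_rename: "peval (rename \<sigma> p) v = peval p (\<lambda>i. v (\<sigma> i))"
  unfolding rename_def peval_sum peval_single mon_sum mon_single by (simp add: peval_def)

text \<open>A supply of generic points with integer coordinates, large enough to contain infinitely
  many points of a Kronecker curve.\<close>

lemma gpt_nat:
  assumes "inj e" "\<And>i. 2 \<le> e i"
  shows "\<exists>w. co w = (\<lambda>i. of_nat (e i))"
proof -
  have 1: "qq ^ k * of_nat (e i) \<noteq> qq ^ l * of_nat (e j)" if "i \<noteq> j" for i j k l
  proof
    assume "qq ^ k * of_nat (e i) = qq ^ l * of_nat (e j)"
    then have "of_nat (e i) * qq ^ k * tt ^ 0 = of_nat (e j) * qq ^ l * tt ^ 0"
      by (simp only: mult.commute power_0 mult_1_right)
    from qt_monomial_eqD(1)[OF this] assms(2)[of i] have "e i = e j" by simp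
    then show False using injD[OF assms(1)] that by blast
  qed
  have 2: "of_nat (e i) * tt ^ k \<noteq> qq ^ l" for i k l
  proof
    assume "of_nat (e i) * tt ^ k = qq ^ l"
    then have "of_nat (e i) * qq ^ 0 * tt ^ k = of_nat 1 * qq ^ l * tt ^ 0"
      by (simp only: power_0 mult_1_right mult_1_left of_nat_1)
    from qt_monomial_eqD(1)[OF this] assms(2)[of i] show False by simp
  qed
  have 3: "(of_nat (e i) :: qt) \<noteq> 0" for i using assms(2)[of i] unfolding of_nat_eq_0_iff by simp
  have "(\<lambda>i. of_nat (e i)) \<in> {v :: nat \<Rightarrow> qt. (\<forall>i j k l. i \<noteq> j \<longrightarrow> qq ^ k * v i \<noteq> qq ^ l * v j)
    \<and> (\<forall>i k l. v i * tt ^ k \<noteq> qq ^ l) \<and> (\<forall>i. v i \<noteq> 0)}" using 1 2 3 by blast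
  from Gpt_inverse[OF this] show ?thesis by blast
qed

lemma base_expansion_inj:
  fixes f g :: "nat \<Rightarrow> nat"
  assumes "\<And>i. i < K \<Longrightarrow> f i < N \<and> g i < N" "(\<Sum>i<K. f i * N ^ i) = (\<Sum>i<K. g i * N ^ i)" "i < K"
  shows "f i = g i"
  using assms
proof (induction K arbitrary: f g i)
  case (Suc K)
  have e: "(\<Sum>i<Suc K. h i * N ^ i) = h 0 + N * (\<Sum>i<K. h (Suc i) * N ^ i)" for h :: "nat \<Rightarrow> nat"
    unfolding sum.lessThan_Suc_shift by (simp add: sum_distrib_left mult_ac)
  have eq: "f 0 + N * (\<Sum>i<K. f (Suc i) * N ^ i) = g 0 + N * (\<Sum>i<K. g (Suc i) * N ^ i)"
    using Suc.prems(2) unfolding e .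
  have b: "f 0 < N" "g 0 < N" using Suc.prems(1)[of 0] by auto
  have 0: "f 0 = g 0" using arg_cong[OF eq, of "\<lambda>x. x mod N"] b by simp
  have "(\<Sum>i<K. f (Suc i) * N ^ i) = (\<Sum>i<K. g (Suc i) * N ^ i)"
    using arg_cong[OF eq, of "\<lambda>x. x div N"] b by simp
  then have "f (Suc i) = g (Suc i)" if "i < K" for i
    using Suc.IH[of "\<lambda>i. f (Suc i)" "\<lambda>i. g (Suc i)" i] Suc.prems(1) that by auto
  then show ?case using 0 Suc.prems(3) by (cases i) auto
qed simp

text \<open>Kronecker substitution \<open>x\<^sub>i = z ^ (N ^ i)\<close> reduces this to polynomials in one variable.\<close>

lemma mpoly_generic_zero:
  assumes 0: "\<And>w. peval p (co w) = 0"
  shows "p = 0"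
proof -
  let ?keys = "Poly_Mapping.keys" and ?lk = "Poly_Mapping.lookup"
  have "finite (\<Union>m\<in>?keys p. ?keys m)" by simp
  then obtain K where "(\<Union>m\<in>?keys p. ?keys m) \<subseteq> {..<K}" by (meson finite_nat_iff_bounded)
  then have K: "?keys m \<subseteq> {..<K}" if "m \<in> ?keys p" for m using that by auto
  have "finite (\<Union>m\<in>?keys p. ?lk m ` ?keys m)" by simp
  then obtain N0 where N0: "(\<Union>m\<in>?keys p. ?lk m ` ?keys m) \<subseteq> {..<N0}" by (meson finite_nat_iff_bounded)
  define N where "N = N0 + 2"
  have N: "?lk m i < N" if "m \<in> ?keys p" for m i
  proof (cases "i \<in> ?keys m")
    case True
    then have "?lk m i \<in> {..<N0}" using N0 that by blast
    then show ?thesis by (simp add: N_def)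
  qed (simp add: N_def in_keys_iff)
  define \<phi> where "\<phi> m = (\<Sum>i<K. ?lk m i * N ^ i)" for m
  have inj: "m = m'" if "m \<in> ?keys p" "m' \<in> ?keys p" "\<phi> m = \<phi> m'" for m m'
  proof (rule poly_mapping_eqI)
    fix i
    show "?lk m i = ?lk m' i"
    proof (cases "i < K")
      case True
      show ?thesis by (rule base_expansion_inj[of K _ N]) (use N that True in \<open>auto simp: \<phi>_def\<close>)
    next
      case False
      then have "i \<notin> ?keys m" "i \<notin> ?keys m'" using K that by auto
      then show ?thesis by (simp add: in_keys_iff)
    qed
  qed
  define U where "U = (\<Sum>m\<in>?keys p. Polynomial.monom (?lk p m) (\<phi> m))"
  have "poly U (of_nat z) = 0" if z: "2 \<le> z" for z
  proof -
    have "inj (\<lambda>i. z ^ N ^ i)" using z by (auto intro!: injI simp: N_def)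
    moreover have "2 \<le> z ^ N ^ i" for i
      using z self_le_power[of z "N ^ i"] by (simp add: N_def)
    ultimately obtain w where w: "co w = (\<lambda>i. of_nat (z ^ N ^ i))" using gpt_nat by blast
    have "mon m (co w) = of_nat z ^ \<phi> m" if "m \<in> ?keys p" for m
      using mon_superset[OF _ K[OF that], of "co w"]
      by (simp add: w \<phi>_def power_sum power_mult[symmetric] mult.commute)
    then have "poly U (of_nat z) = peval p (co w)"
      unfolding U_def peval_def mon_def[symmetric] by (simp add: poly_sum poly_monom)
    then show ?thesis by (simp add: 0)
  qed
  then have sub: "of_nat ` {2..} \<subseteq> {x. poly U x = 0}" by auto
  have "inj_on (of_nat :: nat \<Rightarrow> qt) {2..}"
    using qt_monomial_eqD(1)[of _ 0 0 _ 0 0] by (intro inj_onI) auto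
  then have "infinite ((of_nat :: nat \<Rightarrow> qt) ` {2..})"
    using infinite_Ici[of "2::nat"] finite_imageD by blast
  then have "U = 0" using sub poly_roots_finite[of U] finite_subset by blast
  have "?lk p m = 0" if m: "m \<in> ?keys p" for m
  proof -
    have "coeff U (\<phi> m) = (\<Sum>m'\<in>?keys p. if m' = m then ?lk p m' else 0)"
      unfolding U_def coeff_sum coeff_monom using inj m by (intro sum.cong) auto
    then show ?thesis using m \<open>U = 0\<close> by simp
  qed
  then show ?thesis by (intro poly_mapping_eqI) (auto simp: in_keys_iff)
qed

lemma mpoly_generic_eq: "(\<And>w. peval p (co w) = peval q (co w)) \<Longrightarrow> p = q"
  using mpoly_generic_zero[of "p - q"] by (simp add: peval_diff)

section \<open>Interpolation\<close>

text \<open>Polynomial functions of degree at most \<open>d\<close> in the first \<open>n\<close>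
  variables. The inductive form suits specialisation, rotation and division by a linear factor, none
  of which needs coefficients.\<close>

inductive PF :: "nat \<Rightarrow> nat \<Rightarrow> ((nat \<Rightarrow> qt) \<Rightarrow> qt) \<Rightarrow> bool" for n where
  const: "PF n d (\<lambda>_. c)"
| add: "PF n d f \<Longrightarrow> PF n d g \<Longrightarrow> PF n d (\<lambda>v. f v + g v)"
| var: "PF n d f \<Longrightarrow> i < n \<Longrightarrow> PF n (Suc d) (\<lambda>v. v i * f v)"

lemma PF_cmult: "PF n d f \<Longrightarrow> PF n d (\<lambda>v. c * f v)"
proof (induction rule: PF.induct)
  case (var d f i)
  then show ?case using PF.var[OF var.IH] by (simp add: mult.left_commute)
qed (auto simp: distrib_left intro: PF.intros)

lemma PF_Suc: "PF n d f \<Longrightarrow> PF n (Suc d) f"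
  by (induction rule: PF.induct) (auto intro: PF.intros)

lemma PF_mono: "PF n d f \<Longrightarrow> d \<le> e \<Longrightarrow> PF n e f"
  by (induction e) (auto simp: le_Suc_eq intro: PF_Suc)

lemma PF_sum: "finite A \<Longrightarrow> (\<And>x. x \<in> A \<Longrightarrow> PF n d (f x)) \<Longrightarrow> PF n d (\<lambda>v. \<Sum>x\<in>A. f x v)"
  by (induction A rule: finite_induct) (auto intro: PF.intros)

lemma PF_power: "PF n d f \<Longrightarrow> i < n \<Longrightarrow> PF n (k + d) (\<lambda>v. v i ^ k * f v)"
proof (induction k)
  case (Suc k)
  then show ?case using PF.var[OF Suc.IH] by (simp add: mult.assoc)
qed simp

lemma PF_mon:
  assumes "Poly_Mapping.keys m \<subseteq> {..<n}"
  shows "PF n (mdeg m) (mon m)"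
proof -
  have "PF n (\<Sum>i\<in>A. Poly_Mapping.lookup m i) (\<lambda>v. \<Prod>i\<in>A. v i ^ Poly_Mapping.lookup m i)"
    if "finite A" "A \<subseteq> {..<n}" for A
    using that by (induction A rule: finite_induct) (auto intro: PF.const PF_power)
  then show ?thesis using assms unfolding mon_def mdeg_def by simp
qed

lemma PF_peval:
  assumes "vars_in n p" "deg_le p d"
  shows "PF n d (peval p)"
  using assms unfolding peval_def mon_def[symmetric] vars_in_def deg_le_def
  by (intro PF_sum PF_cmult) (auto intro: PF_mono[OF PF_mon])

lemma PF_cong: "PF n d f \<Longrightarrow> (\<And>i. i < n \<Longrightarrow> v i = w i) \<Longrightarrow> f v = f w"
  by (induction rule: PF.induct) auto

lemma PF_specialize: "PF (Suc n) d f \<Longrightarrow> PF n d (\<lambda>w. f (case_nat u w))"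
proof (induction rule: PF.induct)
  case (var d f i)
  then show ?case by (cases i) (auto intro: PF.var PF_Suc PF_cmult)
qed (auto intro: PF.intros)

lemma PF_rotate: "PF (Suc n) d f \<Longrightarrow> PF (Suc n) d (\<lambda>y. f (case_nat (c * y n) y))"
proof (induction rule: PF.induct)
  case (var d f i)
  show ?case
  proof (cases i)
    case 0
    show ?thesis using PF_cmult[OF PF.var[OF var.IH, of n], of c] 0 by (simp add: mult.assoc)
  qed (use var in \<open>auto intro: PF.var\<close>)
qed (auto intro: PF.intros)

lemma PF_divide:
  "PF (Suc n) d f \<Longrightarrow> \<exists>g. (\<forall>v. f v = f (v(0 := u)) + (v 0 - u) * g v)
     \<and> (case d of 0 \<Rightarrow> g = (\<lambda>_. 0) | Suc e \<Rightarrow> PF (Suc n) e g)"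
proof (induction rule: PF.induct)
  case (const d c)
  show ?case by (rule exI[of _ "\<lambda>_. 0"]) (auto split: nat.split intro: PF.const)
next
  case (add d f g)
  then obtain f' g' where *: "\<forall>v. f v = f (v(0 := u)) + (v 0 - u) * f' v" "\<forall>v. g v = g (v(0 := u)) + (v 0 - u) * g' v"
    "case d of 0 \<Rightarrow> f' = (\<lambda>_. 0) | Suc e \<Rightarrow> PF (Suc n) e f'" "case d of 0 \<Rightarrow> g' = (\<lambda>_. 0) | Suc e \<Rightarrow> PF (Suc n) e g'"
    by blast
  have E: "f v + g v = f (v(0 := u)) + g (v(0 := u)) + (v 0 - u) * (f' v + g' v)" for v
    using *(1,2)[rule_format, of v] by (simp add: algebra_simps)
  have D: "case d of 0 \<Rightarrow> (\<lambda>v. f' v + g' v) = (\<lambda>_. 0) | Suc e \<Rightarrow> PF (Suc n) e (\<lambda>v. f' v + g' v)"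
    using *(3,4) by (cases d) (auto intro: PF.add)
  show ?case by (rule exI[of _ "\<lambda>v. f' v + g' v"], rule conjI, rule allI, rule E, rule D)
next
  case (var d f i)
  then obtain g where *: "\<forall>v. f v = f (v(0 := u)) + (v 0 - u) * g v" "case d of 0 \<Rightarrow> g = (\<lambda>_. 0) | Suc e \<Rightarrow> PF (Suc n) e g"
    by blast
  have alg1: "a = b + (x - u) * c \<Longrightarrow> x * a = u * b + (x - u) * (a + u * c)" for a b c x :: qt by algebra
  have alg2: "a = b + (x - u) * c \<Longrightarrow> y * a = y * b + (x - u) * (y * c)" for a b c x y :: qt by algebra
  have g: "PF (Suc n) d g" using *(2) by (cases d) (auto intro: PF.const PF_Suc)
  show ?case
  proof (cases "i = 0")
    case True
    have E: "v i * f v = (v(0 := u)) i * f (v(0 := u)) + (v 0 - u) * (f v + u * g v)" for v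
      using alg1[OF *(1)[rule_format, of v]] True by simp
    have D: "PF (Suc n) d (\<lambda>v. f v + u * g v)" using g var by (intro PF.add PF_cmult)
    show ?thesis by (rule exI[of _ "\<lambda>v. f v + u * g v"], rule conjI, rule allI, rule E) (simp add: D)
  next
    case False
    have E: "v i * f v = (v(0 := u)) i * f (v(0 := u)) + (v 0 - u) * (v i * g v)" for v
      using alg2[OF *(1)[rule_format, of v]] False by simp
    have D: "PF (Suc n) d (\<lambda>v. v i * g v)"
      using *(2) var(2) PF.const[of "Suc n" 0 0] by (cases d) (auto intro: PF.var)
    show ?thesis by (rule exI[of _ "\<lambda>v. v i * g v"], rule conjI, rule allI, rule E) (simp add: D)
  qed
qed

lemma kstat_sum:
  assumes "i < length mu"
  shows "kstat mu i = (\<Sum>j<length mu. if j < i \<and> mu ! i < mu ! j \<or> i < j \<and> mu ! i \<le> mu ! j then 1 else 0)"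
proof -
  have "kstat mu i = card ({j. j < i \<and> mu ! j > mu ! i} \<union> {j. i < j \<and> j < length mu \<and> mu ! j \<ge> mu ! i})"
    unfolding kstat_def by (rule card_Un_disjoint[symmetric]) auto
  also have "{j. j < i \<and> mu ! j > mu ! i} \<union> {j. i < j \<and> j < length mu \<and> mu ! j \<ge> mu ! i}
      = {j\<in>{..<length mu}. j < i \<and> mu ! i < mu ! j \<or> i < j \<and> mu ! i \<le> mu ! j}" using assms by auto
  also have "card \<dots> = (\<Sum>j<length mu. if j < i \<and> mu ! i < mu ! j \<or> i < j \<and> mu ! i \<le> mu ! j then 1 else 0)"
    by (simp add: sum.If_cases Int_def)
  finally show ?thesis .
qed

lemma tilde_zero: "tilde (0 # ys) 0 = 1 / tt ^ length ys" "i < length ys \<Longrightarrow> tilde (0 # ys) (Suc i) = tilde ys i"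
proof -
  have "kstat (0 # ys) 0 = length ys"
    by (subst kstat_sum) (simp_all add: sum.lessThan_Suc_shift del: sum.lessThan_Suc)
  then show "tilde (0 # ys) 0 = 1 / tt ^ length ys" by (simp add: tilde_def divide_inverse)
  assume "i < length ys"
  then have "kstat (0 # ys) (Suc i) = kstat ys i"
    by (subst (1 2) kstat_sum) (simp_all add: sum.lessThan_Suc_shift del: sum.lessThan_Suc)
  then show "tilde (0 # ys) (Suc i) = tilde ys i" by (simp add: tilde_def)
qed

text \<open>\<open>Suc a > b\<close> is \<open>a \<ge> b\<close>. That \<open>kstat\<close> counts
  strictly to the left and weakly to the right is exactly what makes raising the first part
  compatible with rotation.\<close>

lemma tilde_rotate:
  "tilde (Suc a # ys) 0 = qq * tilde (ys @ [a]) (length ys)"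
  "i < length ys \<Longrightarrow> tilde (Suc a # ys) (Suc i) = tilde (ys @ [a]) i"
proof -
  have "kstat (Suc a # ys) 0 = kstat (ys @ [a]) (length ys)"
  proof -
    have "kstat (Suc a # ys) 0 = (\<Sum>j<length ys. if a < ys ! j then 1 else 0)"
      by (subst kstat_sum) (simp_all add: sum.lessThan_Suc_shift Suc_le_eq del: sum.lessThan_Suc)
    moreover have "kstat (ys @ [a]) (length ys) = (\<Sum>j<length ys. if a < ys ! j then 1 else 0)"
      by (subst kstat_sum) (simp_all add: nth_append cong: sum.cong_simp)
    ultimately show ?thesis by simp
  qed
  then show "tilde (Suc a # ys) 0 = qq * tilde (ys @ [a]) (length ys)" by (simp add: tilde_def nth_append)
  assume i: "i < length ys"
  have "kstat (Suc a # ys) (Suc i) = (if ys ! i \<le> a then 1 else 0) + (\<Sum>j<length ys. if j < i \<and> ys ! i < ys ! j \<or> i < j \<and> ys ! i \<le> ys ! j then 1 else 0)"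
    using i by (subst kstat_sum) (simp_all add: sum.lessThan_Suc_shift less_Suc_eq_le Suc_le_eq del: sum.lessThan_Suc)
  moreover have "kstat (ys @ [a]) i = (\<Sum>j<length ys. if j < i \<and> ys ! i < ys ! j \<or> i < j \<and> ys ! i \<le> ys ! j then 1 else 0) + (if ys ! i \<le> a then 1 else 0)"
    using i by (subst kstat_sum) (simp_all add: nth_append cong: sum.cong_simp)
  ultimately show "tilde (Suc a # ys) (Suc i) = tilde (ys @ [a]) i" using i by (simp add: tilde_def nth_append)
qed

text \<open>Induction on the number of variables plus the degree. Points with first part 0 lie on
  the hyperplane \<open>x_0 = t^(1-n)\<close> and give divisibility by its equation. At the
  remaining points the quotient vanishes, and the inverse rotation turns them into all points of
  degree at most \<open>d - 1\<close>.\<close>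

lemma interpolation_unique:
  assumes "PF n d f" "\<And>nu. length nu = n \<Longrightarrow> sum_list nu \<le> d \<Longrightarrow> f (tilde nu) = 0"
  shows "f v = 0"
  using assms
proof (induction "n + d" arbitrary: n d f v rule: less_induct)
  case less
  show ?case
  proof (cases n)
    case 0
    have "f v = f (tilde [])" by (rule PF_cong[OF less.prems(1)]) (simp add: 0)
    then show ?thesis using less.prems(2)[of "[]"] 0 by simp
  next
    case (Suc m)
    let ?u = "1 / tt ^ m"
    have P: "PF (Suc m) d f" using less.prems(1) Suc by simp
    have spec: "f (case_nat ?u w) = 0" for w
    proof (rule less.hyps[of m d "\<lambda>w. f (case_nat ?u w)"])
      show "PF m d (\<lambda>w. f (case_nat ?u w))" using P by (rule PF_specialize)
      fix nu :: "nat list" assume nu: "length nu = m" "sum_list nu \<le> d"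
      have "f (case_nat ?u (tilde nu)) = f (tilde (0 # nu))"
        by (rule PF_cong[OF P]) (use nu in \<open>auto simp: tilde_zero split: nat.split\<close>)
      then show "f (case_nat ?u (tilde nu)) = 0" using less.prems(2)[of "0 # nu"] nu Suc by simp
    qed (use Suc in simp)
    have z: "f (v(0 := ?u)) = 0" for v
    proof -
      have "v(0 := ?u) = case_nat ?u (\<lambda>i. v (Suc i))" by (auto split: nat.split)
      then show ?thesis using spec by simp
    qed
    obtain g where g: "\<And>v. f v = (v 0 - ?u) * g v" and gd: "case d of 0 \<Rightarrow> g = (\<lambda>_. 0) | Suc e \<Rightarrow> PF (Suc m) e g"
      using PF_divide[OF P, of ?u] z by auto
    show ?thesis
    proof (cases d)
      case 0
      then show ?thesis using g gd by simp
    next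
      case (Suc e)
      have Pg: "PF (Suc m) e g" using gd Suc by simp
      have rot: "g (case_nat (qq * y m) y) = 0" for y
      proof (rule less.hyps[of n e "\<lambda>y. g (case_nat (qq * y m) y)"])
        show "PF n e (\<lambda>y. g (case_nat (qq * y m) y))" using PF_rotate[OF Pg] \<open>n = Suc m\<close> by simp
        fix nu :: "nat list" assume nu: "length nu = n" "sum_list nu \<le> e"
        then obtain ys a where ya: "nu = ys @ [a]" "length ys = m" using \<open>n = Suc m\<close>
          by (cases nu rule: rev_cases) auto
        have "g (case_nat (qq * tilde nu m) (tilde nu)) = g (tilde (Suc a # ys))"
          by (rule PF_cong[OF Pg]) (use ya tilde_rotate in \<open>auto split: nat.split\<close>)
        moreover have "f (tilde (Suc a # ys)) = 0" using less.prems(2) ya nu \<open>n = Suc m\<close> Suc by simp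
        \<comment> \<open>A positive power of \<open>q\<close> in the first coordinate keeps these
          points off the hyperplane.\<close>
        moreover have "tilde (Suc a # ys) 0 \<noteq> ?u"
        proof
          assume "tilde (Suc a # ys) 0 = ?u"
          then have "qq ^ Suc a * tt ^ m = qq ^ 0 * tt ^ kstat (Suc a # ys) 0"
            by (simp add: tilde_def divide_simps)
          from qq_tt_power_eqD(1)[OF this] show False by simp
        qed
        ultimately show "g (case_nat (qq * tilde nu m) (tilde nu)) = 0" using g[of "tilde (Suc a # ys)"] by simp
      qed (use Suc in simp)
      have "g v = g (case_nat (qq * rotv n v m) (rotv n v))"
        by (rule PF_cong[OF Pg]) (auto simp: rotv_def \<open>n = Suc m\<close> split: nat.split)
      then show ?thesis using rot g by simp
    qed
  qed
qed

section \<open>From functions of generic points back to polynomials\<close>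

lemma Mr_1: "Mr lam 1 = mset lam"
proof -
  have "lam_r lam 1 = lam" unfolding lam_r_def by (induction lam) auto
  then show ?thesis by (simp add: Mr_def)
qed

definition ev :: "mpoly \<Rightarrow> fn" where "ev p w = peval p (co w)"

lemma ev_smlq_wt: "ev (smlq_wt lam Q) w = wtr lam 1 Q w"
proof -
  let ?n = "length lam" and ?L = "Lmax lam"
  have b: "(\<Prod>j<?n. peval (if 0 < sgn Q r j then Xv j else if sgn Q r j < 0 then Cst (- (qq ^ (r - 1)) / tt ^ (?n - 1)) else 1) (co w))
      = bwt ?n r (sgn Q r) w" for r
    unfolding bwt_def by (rule prod.cong) auto
  have c: "classic_wt ?n Q r j = cl_wt ?n (r - 1) (reg Q r) (\<lambda>j. absl (sgn Q (r - 1) j)) (pc Q r) j" if "2 \<le> r" for r j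
  proof -
    have "classic_free ?n Q r j = cl_free ?n (reg Q r) (\<lambda>j. absl (sgn Q (r - 1) j)) (pc Q r) j"
      unfolding classic_free_def cl_free_def Let_def by simp
    moreover have "reg Q r j + 1 - r = reg Q r j - (r - 1)" using that by simp
    ultimately show ?thesis unfolding classic_wt_def cl_wt_def Let_def by (simp only:)
  qed
  have s: "signed_wt ?n Q r j = sg_wt ?n (reg Q r) (sgn Q r) (ps Q r) j" for r j
    unfolding signed_wt_def sg_wt_def signed_free_def Let_def by simp
  have "ev (smlq_wt lam Q) w = (\<Prod>r\<in>{1..?L}. bwt ?n r (sgn Q r) w)
      * (\<Prod>r\<in>{2..?L}. clw ?n Q r) * (\<Prod>r\<in>{1..?L}. sgw ?n Q r)"
    unfolding ev_def smlq_wt_def Let_def ball_wt_def peval_mult peval_prod b peval_Cst sgw_def s clw_def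
    by (simp add: c cong: prod.cong_simp)
  also have "\<dots> = wtr lam 1 Q w" unfolding wtr_def Let_def prod.distrib by (simp add: numeral_2_eq_2)
  finally show ?thesis .
qed

lemma ev_Fstar: "ev (Fstar lam mu) = GG lam 1 mu"
proof
  fix w
  have "ev (Fstar lam mu) w = (\<Sum>Q\<in>{Q. is_smlq lam mu Q}. ev (smlq_wt lam Q) w)"
    unfolding ev_def Fstar_def peval_sum ..
  then show "ev (Fstar lam mu) w = GG lam 1 mu w"
    unfolding GG_def by (simp add: ev_smlq_wt is_smlq_part)
qed

lemma ev_linear: "ev (p + q) = (\<lambda>w. ev p w + ev q w)" "ev (Cst c * p) = (\<lambda>w. c * ev p w)"
  by (simp_all add: ev_def peval_add peval_mult fun_eq_iff)

text \<open>The Hecke operator at arbitrary points. It is needed at \<open>tilde nu\<close>, which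
  is not generic but has distinct neighbouring coordinates, so the division is genuine
  there.\<close>

definition TV :: "nat \<Rightarrow> ((nat \<Rightarrow> qt) \<Rightarrow> qt) \<Rightarrow> (nat \<Rightarrow> qt) \<Rightarrow> qt" where
  "TV i f v = tt * f v - (tt * v i - v (Suc i)) / (v i - v (Suc i)) * (f v - f (\<lambda>j. v (transp i j)))"

lemma co_sw_fun: "co (sw i w) = (\<lambda>j. co w (transp i j))" by auto

text \<open>Cleared of its denominator, an identity at generic points becomes one between
  polynomials. As such it determines \<open>Hecke\<close> and may be evaluated at spectral
  points.\<close>

lemma divided_difference_poly:
  assumes "TT i (ev p) = ev p'"
  shows "(Xv i - Xv (Suc i)) * p' = Cst tt * (Xv i - Xv (Suc i)) * p
    - (Cst tt * Xv i - Xv (Suc i)) * (p - rename (transp i) p)"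
proof (rule mpoly_generic_eq)
  fix w
  have "TT i (ev p) w = ev p' w" using assms by simp
  moreover have "co w i - co w (Suc i) \<noteq> 0" by simp
  ultimately have "(co w i - co w (Suc i)) * ev p' w
     = tt * (co w i - co w (Suc i)) * ev p w - (tt * co w i - co w (Suc i)) * (ev p w - ev p (sw i w))"
    unfolding TT_def by (auto simp: field_simps)
  then show "peval ((Xv i - Xv (Suc i)) * p') (co w) = peval (Cst tt * (Xv i - Xv (Suc i)) * p
    - (Cst tt * Xv i - Xv (Suc i)) * (p - rename (transp i) p)) (co w)"
    by (simp add: peval_mult peval_diff peval_rename ev_def co_sw_fun)
qed

lemma Hecke_eq:
  assumes "TT i (ev p) = ev p'"
  shows "Hecke i p = p'"
  unfolding Hecke_def
proof (rule the_equality)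
  fix g assume "(Xv i - Xv (Suc i)) * g = Cst tt * (Xv i - Xv (Suc i)) * p
    - (Cst tt * Xv i - Xv (Suc i)) * (p - rename (transp i) p)"
  then have e: "(Xv i - Xv (Suc i)) * g = (Xv i - Xv (Suc i)) * p'"
    using divided_difference_poly[OF assms] by simp
  show "g = p'"
  proof (rule mpoly_generic_eq)
    fix w
    show "peval g (co w) = peval p' (co w)"
      using arg_cong[OF e, of "\<lambda>p. peval p (co w)"] by (simp add: peval_mult peval_diff)
  qed
qed (rule divided_difference_poly[OF assms])

lemma TV_eq:
  assumes "TT i (ev p) = ev p'" "v i \<noteq> v (Suc i)"
  shows "TV i (peval p) v = peval p' v"
proof -
  have "(v i - v (Suc i)) * peval p' v = tt * (v i - v (Suc i)) * peval p v
    - (tt * v i - v (Suc i)) * (peval p v - peval p (\<lambda>j. v (transp i j)))"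
    using arg_cong[OF divided_difference_poly[OF assms(1)], of "\<lambda>p. peval p v"]
    by (simp add: peval_mult peval_diff peval_rename)
  then show ?thesis using assms(2) unfolding TV_def by (simp add: divide_simps) (simp add: algebra_simps)
qed

lemma rotv_poly: "\<exists>p'. \<forall>v. peval p' v = peval p (rotv n v)"
proof -
  define R where "R i = (if Suc i < n then Xv (Suc i) else if Suc i = n then Cst (1 / qq) * Xv 0 else Xv i)" for i
  have R: "peval (R i) v = rotv n v i" for i v unfolding R_def rotv_def by (simp add: peval_mult)
  have pow: "peval (P ^ k) v = peval P v ^ k" for P k v by (induction k) (simp_all add: peval_mult)
  show ?thesis
    by (rule exI[of _ "\<Sum>m\<in>Poly_Mapping.keys p. Cst (Poly_Mapping.lookup p m) * (\<Prod>i\<in>Poly_Mapping.keys m. R i ^ Poly_Mapping.lookup m i)"])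
      (simp add: peval_sum peval_mult peval_prod pow R peval_def[of p])
qed

section \<open>Spectral points\<close>

lemma tilde_out: "length nu \<le> i \<Longrightarrow> tilde nu i = 0" by (simp add: tilde_def)

lemma tilde_swap:
  assumes "Suc i < length nu" "nu ! i \<noteq> nu ! Suc i"
  shows "tilde (sp i nu) = (\<lambda>j. tilde nu (transp i j))"
proof
  fix j
  let ?n = "length nu"
  have len: "length (sp i nu) = ?n" by (simp add: sp_def)
  have nth: "sp i nu ! k = nu ! transp i k" if "k < ?n" for k
    using that assms(1) by (cases "k = i"; cases "k = Suc i") (auto simp: sp_def)
  have tl: "transp i k < ?n \<longleftrightarrow> k < ?n" for k
    using assms(1) by (cases "k = i"; cases "k = Suc i") auto
  have ord: "k < j \<longleftrightarrow> transp i k < transp i j" if "\<not> (k \<in> {i, Suc i} \<and> j \<in> {i, Suc i})" for k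
    using that by (cases "k = i"; cases "k = Suc i"; cases "j = i"; cases "j = Suc i") auto
  have ord': "j < k \<longleftrightarrow> transp i j < transp i k" if "\<not> (k \<in> {i, Suc i} \<and> j \<in> {i, Suc i})" for k
    using that by (cases "k = i"; cases "k = Suc i"; cases "j = i"; cases "j = Suc i") auto
  show "tilde (sp i nu) j = tilde nu (transp i j)"
  proof (cases "j < ?n")
    case True
    let ?P = "\<lambda>mu j k. if k < j \<and> mu ! j < mu ! k \<or> j < k \<and> mu ! j \<le> mu ! k then 1 else (0::nat)"
    have "kstat (sp i nu) j = (\<Sum>k<?n. ?P (sp i nu) j k)" using kstat_sum[of j "sp i nu"] True len by simp
    also have "\<dots> = (\<Sum>k<?n. ?P nu (transp i j) (transp i k))"
    proof (rule sum.cong)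
      fix k assume "k \<in> {..<?n}"
      then have k: "k < ?n" by simp
      show "?P (sp i nu) j k = ?P nu (transp i j) (transp i k)"
      proof (cases "k \<in> {i, Suc i} \<and> j \<in> {i, Suc i}")
        case True
        then show ?thesis using assms nth[OF k] nth[OF \<open>j < ?n\<close>] by auto
      next
        case False
        then show ?thesis using ord[of k] ord'[of k] nth[OF k] nth[OF \<open>j < ?n\<close>] by simp
      qed
    qed simp
    also have "\<dots> = (\<Sum>k<?n. ?P nu (transp i j) k)"
      by (rule sum.reindex_bij_witness[of _ "transp i" "transp i"]) (auto simp: tl)
    also have "\<dots> = kstat nu (transp i j)" using kstat_sum[of "transp i j" nu] True tl by simp
    finally show ?thesis using True len tl nth by (simp add: tilde_def)
  next
    case False
    then show ?thesis using len tl by (simp add: tilde_def)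
  qed
qed

lemma tilde_equal:
  assumes "Suc i < length nu" "nu ! i = nu ! Suc i"
  shows "tilde nu (Suc i) = tt * tilde nu i"
proof -
  have A: "{j. j < Suc i \<and> nu ! Suc i < nu ! j} = {j. j < i \<and> nu ! i < nu ! j}"
    using assms by (auto simp: less_Suc_eq)
  have B: "{j. i < j \<and> j < length nu \<and> nu ! i \<le> nu ! j}
      = insert (Suc i) {j. Suc i < j \<and> j < length nu \<and> nu ! Suc i \<le> nu ! j}" using assms by auto
  have "kstat nu i = Suc (kstat nu (Suc i))"
    unfolding kstat_def A B by (subst card_insert_disjoint) auto
  then show ?thesis using assms by (simp add: tilde_def)
qed

lemma tilde_eqD:
  assumes "tilde nu i = tilde mu i" "i < length nu" "i < length mu"
  shows "nu ! i = mu ! i"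
proof -
  have "qq ^ (nu ! i) * tt ^ kstat mu i = qq ^ (mu ! i) * tt ^ kstat nu i"
    using assms by (simp add: tilde_def divide_simps)
  then show ?thesis by (rule qq_tt_power_eqD)
qed

lemma tilde_neq_Suc: "Suc i < length nu \<Longrightarrow> tilde nu i \<noteq> tilde nu (Suc i)"
proof
  assume i: "Suc i < length nu" and e: "tilde nu i = tilde nu (Suc i)"
  have e2: "qq ^ (nu ! i) * tt ^ kstat nu (Suc i) = qq ^ (nu ! Suc i) * tt ^ kstat nu i"
    using e i by (simp add: tilde_def divide_simps)
  from qq_tt_power_eqD(1)[OF e2] have "nu ! i = nu ! Suc i" .
  from tilde_equal[OF i this] have "tilde nu i = tt * tilde nu i" using e by simp
  then show False using i by (simp add: tilde_def)
qed

definition swap_closed :: "nat \<Rightarrow> nat list set \<Rightarrow> bool" where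
  "swap_closed n C \<longleftrightarrow> (\<forall>nu\<in>C. length nu = n \<and> (\<forall>i. Suc i < n \<longrightarrow> sp i nu \<in> C))"

definition eqv :: "nat list set \<Rightarrow> ((nat \<Rightarrow> qt) \<Rightarrow> qt) \<Rightarrow> ((nat \<Rightarrow> qt) \<Rightarrow> qt) \<Rightarrow> bool" where
  "eqv C f g \<longleftrightarrow> (\<forall>nu\<in>C. f (tilde nu) = g (tilde nu))"

lemma eqv_trans: "eqv C f g \<Longrightarrow> eqv C g h \<Longrightarrow> eqv C f h" and eqv_sym: "eqv C f g \<Longrightarrow> eqv C g f"
  by (auto simp: eqv_def)

text \<open>For \<open>\<nu>\<^sub>i = \<nu>\<^sub>i\<^sub>+\<^sub>1\<close> the swapped point is not of the form \<open>tilde \<nu>'\<close>, but then its coefficient vanishes.\<close>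

lemma eqv_TV:
  assumes C: "swap_closed n C" and i: "Suc i < n" and fg: "eqv C f g"
  shows "eqv C (TV i f) (TV i g)"
  unfolding eqv_def
proof
  fix nu assume nu: "nu \<in> C"
  then have len: "length nu = n" and s: "sp i nu \<in> C" using C i by (auto simp: swap_closed_def)
  have f: "f (tilde nu) = g (tilde nu)" using fg nu by (simp add: eqv_def)
  show "TV i f (tilde nu) = TV i g (tilde nu)"
  proof (cases "nu ! i = nu ! Suc i")
    case True
    then show ?thesis using tilde_equal[of i nu] f len i by (simp add: TV_def)
  next
    case False
    have "f (tilde (sp i nu)) = g (tilde (sp i nu))" using fg s by (simp add: eqv_def)
    then show ?thesis using tilde_swap[of i nu] False f len i by (simp add: TV_def)
  qed
qed

lemma TV_x:
  assumes "v i \<noteq> v (Suc i)"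
  shows "TV i (\<lambda>v. v i * TV i f v) v = tt * v (Suc i) * f v"
proof -
  have ne: "v i - v (Suc i) \<noteq> 0" "v (Suc i) - v i \<noteq> 0" using assms by auto
  show ?thesis unfolding TV_def using ne by (simp add: divide_simps) (simp add: algebra_simps)
qed

lemma TV_cmult: "TV i (\<lambda>v. c * f v) = (\<lambda>v. c * TV i f v)"
  by (auto simp: TV_def fun_eq_iff algebra_simps)

text \<open>The counterpart at arbitrary points of the inverse of \<open>JJ 0 i\<close>.\<close>

primrec TVs :: "nat \<Rightarrow> ((nat \<Rightarrow> qt) \<Rightarrow> qt) \<Rightarrow> (nat \<Rightarrow> qt) \<Rightarrow> qt" where
  "TVs 0 f = f"
| "TVs (Suc i) f = TV i (TVs i f)"

lemma eqv_TVs: "swap_closed n C \<Longrightarrow> i < n \<Longrightarrow> eqv C f g \<Longrightarrow> eqv C (TVs i f) (TVs i g)"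
  by (induction i) (auto intro: eqv_TV)

lemma TVs_cmult: "TVs i (\<lambda>v. c * f v) = (\<lambda>v. c * TVs i f v)"
  by (induction i) (simp_all add: TV_cmult)

context
  fixes lam :: "nat list"
begin

abbreviation (input) FF :: "nat list \<Rightarrow> mpoly" where "FF \<equiv> Fstar lam"
abbreviation (input) AA :: "nat list set" where "AA \<equiv> arr (mset lam)"

lemma FF_hecke:
  assumes "xs \<in> AA" "Suc i < length lam"
  shows "TT i (ev (FF xs)) = (\<lambda>v. th1 (xs ! i) (xs ! Suc i) * ev (FF xs) v + th2 (xs ! i) (xs ! Suc i) * ev (FF (sp i xs)) v)"
  using GG_families[of 1 lam] assms unfolding ev_Fstar hecke_fam_def Mr_1 by simp

lemma FF_rot:
  assumes "ys @ [a] \<in> AA" "1 \<le> length lam"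
  shows "co v 0 * ev (FF (a # ys)) v = qq ^ a * ((co v 0 - 1 / tt ^ (length lam - 1)) * RR (length lam) (ev (FF (ys @ [a]))) v
     + JJ 0 (length lam - 1) (ev (FF (ys @ [a]))) v)"
  using GG_families[of 1 lam] assms unfolding ev_Fstar rot_fam_def Mr_1 by simp

lemma FF_desc:
  assumes "xs \<in> AA" "Suc i < length lam" "xs ! Suc i < xs ! i"
  shows "TT i (ev (FF xs)) = ev (FF (sp i xs))"
  using FF_hecke[OF assms(1,2)] assms(3) by (simp add: th1_def th2_def)

lemma FF_same:
  assumes "xs \<in> AA" "Suc i < length lam" "xs ! Suc i = xs ! i"
  shows "TT i (ev (FF xs)) = ev (Cst tt * FF xs)"
  using FF_hecke[OF assms(1,2)] assms(3) by (simp add: th1_def th2_def ev_linear)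

text \<open>The span of the family. It is stable under inverse Hecke operators, so functions built
  with them remain evaluations of polynomials and make sense at spectral points.\<close>

inductive Sp :: "mpoly \<Rightarrow> bool" where
  gen: "mu \<in> AA \<Longrightarrow> Sp (FF mu)"
| add: "Sp p \<Longrightarrow> Sp q \<Longrightarrow> Sp (p + q)"
| scale: "Sp p \<Longrightarrow> Sp (Cst c * p)"

lemma Sp_TI:
  assumes "Sp p" "Suc i < length lam"
  shows "\<exists>p'. Sp p' \<and> TI i (ev p) = ev p'"
  using assms(1)
proof (induction rule: Sp.induct)
  case (gen mu)
  let ?a = "th1 (mu ! i) (mu ! Suc i)" and ?b = "th2 (mu ! i) (mu ! Suc i)"
  have "sp i mu \<in> AA" using gen assms(2) by (intro sp_arr) auto
  then have "Sp (Cst ((?a - (tt - 1)) / tt) * FF mu + Cst (?b / tt) * FF (sp i mu))" using gen by (intro Sp.intros)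
  moreover have "TI i (ev (FF mu)) = ev (Cst ((?a - (tt - 1)) / tt) * FF mu + Cst (?b / tt) * FF (sp i mu))"
    unfolding ev_linear TI_def FF_hecke[OF gen assms(2)] by (auto simp: fun_eq_iff field_simps)
  ultimately show ?case by blast
next
  case (add p q)
  then obtain p' q' where "Sp p'" "TI i (ev p) = ev p'" "Sp q'" "TI i (ev q) = ev q'" by blast
  then show ?case by (intro exI[of _ "p' + q'"]) (simp add: Sp.add ev_linear TI_add)
next
  case (scale p c)
  then obtain p' where "Sp p'" "TI i (ev p) = ev p'" by blast
  then show ?case by (intro exI[of _ "Cst c * p'"]) (simp add: Sp.scale ev_linear TI_cmult)
qed

lemma eqv_TV_peval:
  assumes "swap_closed n C" "Suc i < n" "TT i (ev p) = ev p'"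
  shows "eqv C (TV i (peval p)) (peval p')"
  unfolding eqv_def using assms by (auto intro!: TV_eq tilde_neq_Suc simp: swap_closed_def)

text \<open>Inverse operators are avoided at spectral points: they yield a polynomial
  \<open>g\<close> generically, and at spectral points only the operators leading from
  \<open>g\<close> back to \<open>p\<close> are used.\<close>

lemma JJ_chain:
  assumes C: "swap_closed (length lam) C" and "Sp p" "i < length lam"
  shows "\<exists>g. JJ 0 i (ev p) = ev g \<and> eqv C (TVs i (peval g)) (peval p)"
  using assms(2,3)
proof (induction i arbitrary: p)
  case 0
  then show ?case by (auto simp: eqv_def)
next
  case (Suc i)
  obtain p' where p': "Sp p'" "TI i (ev p) = ev p'" using Sp_TI[OF Suc.prems] by blast
  obtain g where g: "JJ 0 i (ev p') = ev g" "eqv C (TVs i (peval g)) (peval p')"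
    using Suc.IH[OF p'(1)] Suc.prems by auto
  have "TT i (ev p') = ev p" unfolding p'(2)[symmetric] by simp
  then have "eqv C (TV i (peval p')) (peval p)" using eqv_TV_peval[OF C] Suc.prems by blast
  then have "eqv C (TVs (Suc i) (peval g)) (peval p)"
    using eqv_trans[OF eqv_TV[OF C _ g(2), of i]] Suc.prems by simp
  then show ?case using g(1) p'(2) by (auto simp: JJ_Suc)
qed

lemma JJ_move:
  assumes "u @ zs @ [a] \<in> AA" "\<And>z. z \<in> set zs \<Longrightarrow> z \<le> a"
  shows "JJ (length u) (length u + length zs) (ev (FF (u @ zs @ [a])))
    = (\<lambda>v. 1 / tt ^ count_list zs a * ev (FF (u @ a # zs)) v)"
  using assms
proof (induction zs arbitrary: u)
  case (Cons z zs)
  have IH: "JJ (Suc (length u)) (Suc (length u) + length zs) (ev (FF (u @ z # zs @ [a])))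
    = (\<lambda>v. 1 / tt ^ count_list zs a * ev (FF (u @ z # a # zs)) v)"
    using Cons.IH[of "u @ [z]"] Cons.prems by simp
  have m: "u @ a # z # zs \<in> AA" using Cons.prems(1) by (auto simp: arr_def add_mset_commute)
  have len: "Suc (length u) < length lam" using arr_length[OF m] by simp
  have T: "TI (length u) (ev (FF (u @ z # a # zs))) = (\<lambda>v. (if z = a then 1 / tt else 1) * ev (FF (u @ a # z # zs)) v)"
  proof (cases "z = a")
    case True
    have "TT (length u) (ev (FF (u @ a # a # zs))) = ev (Cst tt * FF (u @ a # a # zs))"
      using FF_same[OF _ len, of "u @ a # a # zs"] m True by (simp add: nth_append)
    then have "TI (length u) (ev (Cst tt * FF (u @ a # a # zs))) = ev (FF (u @ a # a # zs))" by (rule TI_eqI)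
    then show ?thesis using True unfolding ev_linear TI_cmult by (auto simp: fun_eq_iff field_simps)
  next
    case False
    then have "z < a" using Cons.prems(2)[of z] by simp
    then have "TT (length u) (ev (FF (u @ a # z # zs))) = ev (FF (u @ z # a # zs))"
      using FF_desc[OF m len] by (simp add: nth_append)
    then show ?thesis using False by (simp add: TI_eqI)
  qed
  have "JJ (length u) (length u + length (z # zs)) (ev (FF (u @ (z # zs) @ [a])))
      = TI (length u) (\<lambda>v. 1 / tt ^ count_list zs a * ev (FF (u @ z # a # zs)) v)"
    using IH by (simp add: JJ_Cons)
  also have "\<dots> = (\<lambda>v. 1 / tt ^ count_list (z # zs) a * ev (FF (u @ a # z # zs)) v)"
    unfolding TI_cmult T by (auto simp: fun_eq_iff)
  finally show ?case .
qed (simp add: fun_eq_iff)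

context
  fixes d :: nat
  assumes srt: "sorted_wrt (\<ge>) lam"
    and low: "\<And>mu nu. mu \<in> AA \<Longrightarrow> length nu = length lam \<Longrightarrow> sum_list nu < d \<Longrightarrow> peval (FF mu) (tilde nu) = 0"
begin

abbreviation (input) LV where "LV \<equiv> {nu :: nat list. length nu = length lam \<and> sum_list nu = d}"

lemma LV_closed: "swap_closed (length lam) LV"
proof -
  have "sum_list (sp i nu) = sum_list nu" if "Suc i < length nu" for i and nu :: "nat list"
    using split_pair[OF that] by (metis (no_types, lifting) add.commute add.left_commute sp_append sum_list.Cons sum_list_append)
  then show ?thesis by (auto simp: swap_closed_def sp_def)
qed

text \<open>At a spectral point of degree \<open>d\<close> the rotation term disappears for one of
  two reasons: the first part is 0 and \<open>x_0 - t^(1-n)\<close> is zero, or the rotated point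
  has degree \<open>d - 1\<close>, where the whole family vanishes.\<close>

lemma eigen_front:
  assumes m: "a # u @ zs \<in> AA" and zs: "\<And>z. z \<in> set zs \<Longrightarrow> z \<le> a"
  shows "eqv LV (TVs (length u) (\<lambda>v. v 0 * peval (FF (a # u @ zs)) v))
    (\<lambda>v. qq ^ a / tt ^ count_list zs a * peval (FF (u @ a # zs)) v)"
proof -
  let ?n = "length lam" and ?c = "1 / tt ^ count_list zs a"
  have m1: "(u @ zs) @ [a] \<in> AA" and m2: "u @ a # zs \<in> AA" using m by (auto simp: arr_def)
  have len: "?n = Suc (length u + length zs)" using arr_length[OF m] by simp
  obtain g where g: "JJ 0 (length u) (ev (FF (u @ a # zs))) = ev g" "eqv LV (TVs (length u) (peval g)) (peval (FF (u @ a # zs)))"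
    using JJ_chain[OF LV_closed Sp.gen[OF m2], of "length u"] len by auto
  have J: "JJ 0 (?n - 1) (ev (FF (u @ zs @ [a]))) = (\<lambda>v. ?c * ev g v)"
    using JJ_move[of u zs a] m1 zs JJ_split[of 0 "length u" "length u + length zs"] len
    by (simp add: JJ_cmult[of _ _ ?c, simplified] JJ_cdiv g(1))
  obtain R where R: "\<And>v. peval R v = peval (FF (u @ zs @ [a])) (rotv ?n v)" using rotv_poly by blast
  have X: "Xv 0 * FF (a # u @ zs) = Cst (qq ^ a) * ((Xv 0 - Cst (1 / tt ^ (?n - 1))) * R + Cst ?c * g)"
  proof (rule mpoly_generic_eq)
    fix w
    show "peval (Xv 0 * FF (a # u @ zs)) (co w) = peval (Cst (qq ^ a) * ((Xv 0 - Cst (1 / tt ^ (?n - 1))) * R + Cst ?c * g)) (co w)"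
      using FF_rot[OF m1, of w] J len by (simp add: peval_mult peval_add peval_diff R ev_def RR_def)
  qed
  have id: "v 0 * peval (FF (a # u @ zs)) v = qq ^ a * ((v 0 - 1 / tt ^ (?n - 1)) * peval (FF (u @ zs @ [a])) (rotv ?n v) + ?c * peval g v)" for v
    using arg_cong[OF X, of "\<lambda>p. peval p v"] by (simp only: peval_mult peval_add peval_diff peval_Xv peval_Cst R)
  have "eqv LV (\<lambda>v. v 0 * peval (FF (a # u @ zs)) v) (\<lambda>v. (qq ^ a * ?c) * peval g v)"
    unfolding eqv_def
  proof
    fix nu assume "nu \<in> LV"
    then have nu: "length nu = ?n" "sum_list nu = d" by auto
    then obtain b ys where ys: "nu = b # ys" "length ys = ?n - 1" using len by (cases nu) auto
    have "(tilde nu 0 - 1 / tt ^ (?n - 1)) * peval (FF (u @ zs @ [a])) (rotv ?n (tilde nu)) = 0"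
    proof (cases b)
      case 0
      then show ?thesis using tilde_zero(1)[of ys] ys by simp
    next
      case (Suc b')
      have "rotv ?n (tilde nu) = tilde (ys @ [b'])"
      proof
        fix i
        show "rotv ?n (tilde nu) i = tilde (ys @ [b']) i"
          using tilde_rotate(1)[of b' ys] tilde_rotate(2)[of i ys b'] ys Suc len tilde_out[of nu i] tilde_out[of "ys @ [b']" i]
          by (cases "Suc i < ?n"; cases "Suc i = ?n") (auto simp: rotv_def)
      qed
      then show ?thesis using low[of "u @ zs @ [a]" "ys @ [b']"] m1 ys nu Suc len by simp
    qed
    then show "tilde nu 0 * peval (FF (a # u @ zs)) (tilde nu) = (qq ^ a * ?c) * peval g (tilde nu)"
      unfolding id by (simp only: add_0 mult.assoc)
  qed
  then have "eqv LV (TVs (length u) (\<lambda>v. v 0 * peval (FF (a # u @ zs)) v)) (TVs (length u) (\<lambda>v. (qq ^ a * ?c) * peval g v))"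
    using eqv_TVs[OF LV_closed] len by simp
  moreover have "eqv LV (TVs (length u) (\<lambda>v. (qq ^ a * ?c) * peval g v)) (\<lambda>v. (qq ^ a * ?c) * peval (FF (u @ a # zs)) v)"
    using g(2) unfolding TVs_cmult eqv_def by simp
  ultimately show ?thesis by (auto dest: eqv_trans)
qed

text \<open>Repeated use of \<open>T_i x_i T_i = t x_{i+1}\<close>: the variable follows the part
  \<open>a\<close> as it is carried to the right across larger parts.\<close>

lemma x_intertwine:
  assumes m: "a # u1 @ u2 \<in> AA" and u: "\<And>z. z \<in> set u1 \<Longrightarrow> a < z"
  shows "eqv LV (TVs (length u1) (\<lambda>v. v 0 * peval (FF (a # u1 @ u2)) v))
    (\<lambda>v. tt ^ length u1 * (v (length u1) * peval (FF (u1 @ a # u2)) v))"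
  using assms
proof (induction u1 arbitrary: u2 rule: rev_induct)
  case (snoc z u1)
  let ?k = "length u1"
  have m': "u1 @ z # a # u2 \<in> AA" using snoc.prems(1) by (auto simp: arr_def add_mset_commute)
  have len: "Suc ?k < length lam" using arr_length[OF m'] by simp
  have IH: "eqv LV (TVs ?k (\<lambda>v. v 0 * peval (FF (a # u1 @ z # u2)) v)) (\<lambda>v. tt ^ ?k * (v ?k * peval (FF (u1 @ a # z # u2)) v))"
    using snoc.IH[of "z # u2"] snoc.prems by simp
  have "a < z" using snoc.prems(2) by simp
  then have "TT ?k (ev (FF (u1 @ z # a # u2))) = ev (FF (u1 @ a # z # u2))"
    using FF_desc[OF m' len] by (simp add: nth_append)
  then have "eqv LV (TV ?k (peval (FF (u1 @ z # a # u2)))) (peval (FF (u1 @ a # z # u2)))"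
    using eqv_TV_peval[OF LV_closed len] by blast
  then have "eqv LV (\<lambda>v. tt ^ ?k * (v ?k * peval (FF (u1 @ a # z # u2)) v)) (\<lambda>v. tt ^ ?k * (v ?k * TV ?k (peval (FF (u1 @ z # a # u2))) v))"
    by (simp add: eqv_def)
  from eqv_TV[OF LV_closed len eqv_trans[OF IH this]]
  have "eqv LV (TVs (Suc ?k) (\<lambda>v. v 0 * peval (FF (a # u1 @ z # u2)) v)) (\<lambda>v. tt ^ ?k * TV ?k (\<lambda>v. v ?k * TV ?k (peval (FF (u1 @ z # a # u2))) v) v)"
    by (simp add: TV_cmult)
  moreover have "eqv LV (\<lambda>v. tt ^ ?k * TV ?k (\<lambda>v. v ?k * TV ?k (peval (FF (u1 @ z # a # u2))) v) v)
     (\<lambda>v. tt ^ Suc ?k * (v (Suc ?k) * peval (FF (u1 @ z # a # u2)) v))"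
    unfolding eqv_def using len by (auto simp: TV_x tilde_neq_Suc)
  ultimately show ?case by (auto dest: eqv_trans)
qed (simp add: eqv_def)

lemma eigen:
  assumes "i < length lam"
  shows "eqv LV (\<lambda>v. v i * peval (FF lam) v) (\<lambda>v. tilde lam i * peval (FF lam) v)"
  using assms
proof (induction i)
  let ?F = "peval (FF lam)"
  \<comment> \<open>For the first entry of a block of equal parts, all parts in front are larger and
    none behind is; both preceding facts apply. The powers of \<open>t\<close> count the larger
    parts before it and the equal ones after it, which is \<open>kstat\<close>.\<close>
  have strict: "eqv LV (\<lambda>v. v i * ?F v) (\<lambda>v. tilde lam i * ?F v)"
    if i: "i < length lam" and gt: "\<And>j. j < i \<Longrightarrow> lam ! i < lam ! j" for i
  proof -
    define u zs a where "u = take i lam" and "zs = drop (Suc i) lam" and "a = lam ! i"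
    have L: "lam = u @ a # zs" "length u = i" using i by (auto simp: u_def zs_def a_def id_take_nth_drop)
    have m: "a # u @ zs \<in> AA" by (subst L(1)) (simp add: arr_def)
    have z: "z \<le> a" if "z \<in> set zs" for z using srt that by (subst (asm) L(1)) (simp add: sorted_wrt_append)
    have uu: "a < x" if "x \<in> set u" for x using gt that unfolding u_def a_def by (auto simp: in_set_conv_nth)
    have "eqv LV (\<lambda>v. tt ^ i * (v i * ?F v)) (\<lambda>v. qq ^ a / tt ^ count_list zs a * ?F v)"
      using eqv_trans[OF eqv_sym[OF x_intertwine[OF m uu]] eigen_front[OF m z]] L by simp
    moreover have "kstat lam i = i + count_list zs a"
    proof -
      have "{j. j < i \<and> lam ! i < lam ! j} = {..<i}" using gt by auto
      moreover have "card {j. i < j \<and> j < length lam \<and> lam ! i \<le> lam ! j} = count_list zs a"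
      proof -
        have "{j. i < j \<and> j < length lam \<and> lam ! i \<le> lam ! j} = (\<lambda>k. Suc i + k) ` {k. k < length zs \<and> zs ! k = a}"
        proof (intro equalityI subsetI)
          fix j assume j: "j \<in> {j. i < j \<and> j < length lam \<and> lam ! i \<le> lam ! j}"
          then have "lam ! j = zs ! (j - Suc i)" "j - Suc i < length zs" by (auto simp: zs_def)
          moreover from this have "lam ! j \<le> a" using z by simp
          ultimately have "j - Suc i \<in> {k. k < length zs \<and> zs ! k = a}" using j by (auto simp: a_def)
          moreover have "j = Suc i + (j - Suc i)" using j by auto
          ultimately show "j \<in> (\<lambda>k. Suc i + k) ` {k. k < length zs \<and> zs ! k = a}" by blast
        next
          fix j assume "j \<in> (\<lambda>k. Suc i + k) ` {k. k < length zs \<and> zs ! k = a}"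
          then show "j \<in> {j. i < j \<and> j < length lam \<and> lam ! i \<le> lam ! j}" by (auto simp: zs_def a_def)
        qed
        then have "card {j. i < j \<and> j < length lam \<and> lam ! i \<le> lam ! j} = card {k. k < length zs \<and> zs ! k = a}"
          by (simp only:) (rule card_image, simp add: inj_on_def)
        then show ?thesis by (simp add: count_list_eq_length_filter length_filter_conv_card eq_commute)
      qed
      ultimately show ?thesis unfolding kstat_def by simp
    qed
    ultimately show ?thesis using i unfolding eqv_def a_def
      by (auto simp: tilde_def[of lam] power_add divide_simps mult_ac)
  qed
  { case 0 then show ?case using strict[of 0] by simp }
  case (Suc i)
  show ?case
  proof (cases "lam ! Suc i < lam ! i")
    case True
    have "lam ! Suc i < lam ! j" if "j < Suc i" for j
    proof (cases "j = i")
      case False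
      then have "lam ! i \<le> lam ! j" using srt Suc.prems that by (auto simp: sorted_wrt_iff_nth_less)
      then show ?thesis using True by simp
    qed (use True in simp)
    then show ?thesis using strict[of "Suc i"] Suc.prems by simp
  next
    case False
    have "lam ! Suc i \<le> lam ! i" using srt Suc.prems by (auto simp: sorted_wrt_iff_nth_less)
    then have e: "lam ! Suc i = lam ! i" using False by simp
    have mem: "lam \<in> AA" by (simp add: arr_def)
    \<comment> \<open>Inside a block \<open>T_i\<close> acts as \<open>t\<close>, so
      \<open>T_i x_i T_i = t x_{i+1}\<close> multiplies the eigenvalue by \<open>t\<close> from one
      entry to the next, as \<open>tilde lam\<close> does.\<close>
    have a: "eqv LV (TV i ?F) (\<lambda>v. tt * ?F v)"
      using eqv_TV_peval[OF LV_closed Suc.prems FF_same[OF mem Suc.prems e]] by (simp add: peval_mult eqv_def)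
    have "eqv LV (\<lambda>v. v i * TV i ?F v) (\<lambda>v. (tt * tilde lam i) * ?F v)"
      using a Suc.IH Suc.prems by (simp add: eqv_def)
    from eqv_TV[OF LV_closed Suc.prems this]
    have "eqv LV (TV i (\<lambda>v. v i * TV i ?F v)) (\<lambda>v. (tt * tilde lam i) * TV i ?F v)" by (simp add: TV_cmult)
    then have "eqv LV (\<lambda>v. tt * v (Suc i) * ?F v) (\<lambda>v. (tt * tilde lam i) * (tt * ?F v))"
      using a Suc.prems unfolding eqv_def by (simp add: TV_x tilde_neq_Suc)
    then show ?thesis using tilde_equal[OF Suc.prems e[symmetric]] unfolding eqv_def by (simp add: mult.commute)
  qed
qed

text \<open>Distinct compositions have distinct spectral vectors, so two different eigenvalues
  compete for the same value.\<close>

lemma vanish_step: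
  assumes "length nu = length lam" "sum_list nu = d" "nu \<noteq> lam"
  shows "peval (FF lam) (tilde nu) = 0"
proof -
  obtain i where i: "i < length lam" "nu ! i \<noteq> lam ! i" using assms by (metis nth_equalityI)
  then have "tilde nu i \<noteq> tilde lam i" using tilde_eqD assms(1) by metis
  moreover have "tilde nu i * peval (FF lam) (tilde nu) = tilde lam i * peval (FF lam) (tilde nu)"
    using eigen[OF i(1)] assms by (simp add: eqv_def)
  ultimately show ?thesis by simp
qed

end

text \<open>For two distinct parts \<open>th2\<close> is nonzero, so the member at the exchanged row
  is a combination of the old member and its image under \<open>T_i\<close>; both vanish on a set
  closed under swaps.\<close>

lemma vanish_class:
  assumes C: "swap_closed (length lam) C" and 0: "eqv C (peval (FF lam)) (\<lambda>_. 0)" and mu: "mu \<in> AA"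
  shows "eqv C (peval (FF mu)) (\<lambda>_. 0)"
proof -
  define P where "P xs \<longleftrightarrow> xs \<in> AA \<and> eqv C (peval (FF xs)) (\<lambda>_. 0)" for xs
  have "P mu"
  proof (rule adjacent_swap_induct[of P])
    show "mset lam = mset mu" using mu by (simp add: arr_def)
    show "P lam" using 0 by (simp add: P_def arr_def)
    fix u a b v assume "P (u @ a # b # v)"
    then have m: "u @ a # b # v \<in> AA" and z: "eqv C (peval (FF (u @ a # b # v))) (\<lambda>_. 0)" by (auto simp: P_def)
    have m': "u @ b # a # v \<in> AA" using m by (auto simp: arr_def add_mset_commute)
    have len: "Suc (length u) < length lam" using arr_length[OF m] by simp
    let ?p = "FF (u @ a # b # v)" and ?q = "FF (u @ b # a # v)"
    show "P (u @ b # a # v)"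
    proof (cases "a = b")
      case False
      have "TT (length u) (ev ?p) = ev (Cst (th1 a b) * ?p + Cst (th2 a b) * ?q)"
        unfolding ev_linear using FF_hecke[OF m len] by (simp add: nth_append)
      from eqv_TV_peval[OF C len this]
      have "eqv C (TV (length u) (peval ?p)) (\<lambda>v. th1 a b * peval ?p v + th2 a b * peval ?q v)"
        by (simp add: peval_add peval_mult eqv_def)
      moreover have "eqv C (TV (length u) (peval ?p)) (\<lambda>_. 0)"
        using eqv_TV[OF C len z] by (simp add: TV_def eqv_def)
      moreover have "th2 a b \<noteq> 0" using False by (simp add: th2_def)
      ultimately have "eqv C (peval ?q) (\<lambda>_. 0)" using z by (auto simp: eqv_def)
      then show ?thesis using m' by (simp add: P_def)
    qed (use m' z in \<open>simp add: P_def\<close>)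
  qed
  then show ?thesis by (simp add: P_def)
qed

text \<open>Induction on the degree of the point supplies the vanishing at smaller degrees that the
  eigenvalue argument assumes. Rearrangements of \<open>lam\<close> are excluded for general
  \<open>mu\<close>, since the argument for \<open>lam\<close> says nothing at \<open>lam\<close>
  itself.\<close>

lemma vanish_all:
  assumes "sorted_wrt (\<ge>) lam" "sum_list nu \<le> sum_list lam" "length nu = length lam"
  shows "mu \<in> AA \<Longrightarrow> mset nu \<noteq> mset lam \<Longrightarrow> peval (FF mu) (tilde nu) = 0"
    and "nu \<noteq> lam \<Longrightarrow> peval (FF lam) (tilde nu) = 0"
proof -
  have sum: "sum_list xs = sum_list ys" if "mset xs = mset ys" for xs ys :: "nat list"
    using that by (metis sum_mset_sum_list)
  have main: "(\<forall>mu\<in>AA. mset nu \<noteq> mset lam \<longrightarrow> peval (FF mu) (tilde nu) = 0) \<and> (nu \<noteq> lam \<longrightarrow> peval (FF lam) (tilde nu) = 0)"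
    if "length nu = length lam" "sum_list nu = d" "d \<le> sum_list lam" for nu d
    using that
  proof (induction d arbitrary: nu rule: less_induct)
    case (less d)
    have low: "peval (FF mu) (tilde nu) = 0" if "mu \<in> AA" "length nu = length lam" "sum_list nu < d" for mu nu
      using less.IH[OF that(3) that(2) refl] less.prems(3) that sum[of nu lam] by fastforce
    have v: "peval (FF lam) (tilde nu) = 0" if "length nu = length lam" "sum_list nu = d" "nu \<noteq> lam" for nu
      by (rule vanish_step[OF assms(1) low that]) auto
    let ?C = "{nu. length nu = length lam \<and> sum_list nu = d \<and> mset nu \<noteq> mset lam}"
    have C: "swap_closed (length lam) ?C"
    proof -
      have "sp i nu \<in> ?C" if "nu \<in> ?C" "Suc i < length lam" for i nu
      proof -
        have m: "mset (sp i nu) = mset nu" using that by (intro mset_sp) simp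
        show ?thesis using that m sum[OF m] mset_eq_length[OF m] by simp
      qed
      then show ?thesis unfolding swap_closed_def by blast
    qed
    have "eqv ?C (peval (FF lam)) (\<lambda>_. 0)" using v by (auto simp: eqv_def)
    then have "peval (FF mu) (tilde nu) = 0" if "mu \<in> AA" "mset nu \<noteq> mset lam" for mu
      using vanish_class[OF C _ that(1)] less.prems that by (auto simp: eqv_def)
    then show ?case using v less.prems by blast
  qed
  show "mu \<in> AA \<Longrightarrow> mset nu \<noteq> mset lam \<Longrightarrow> peval (FF mu) (tilde nu) = 0" "nu \<noteq> lam \<Longrightarrow> peval (FF lam) (tilde nu) = 0"
    using main[OF assms(3) refl assms(2)] by auto
qed

end

section \<open>The leading coefficient\<close>

lemma prod_single: "(\<Prod>x\<in>A. Poly_Mapping.single (e x) (f x)) = (Poly_Mapping.single (\<Sum>x\<in>A. e x) (\<Prod>x\<in>A. f x) :: mpoly)"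
  by (induction A rule: infinite_finite_induct) (auto simp: mult_single)

definition wexp :: "nat list \<Rightarrow> smlq \<Rightarrow> (nat \<Rightarrow>\<^sub>0 nat)" where
  "wexp lam Q = (\<Sum>r\<in>{1..Lmax lam}. \<Sum>j<length lam. if 0 < sgn Q r j then Poly_Mapping.single j 1 else 0)"

definition wcf :: "nat list \<Rightarrow> smlq \<Rightarrow> qt" where
  "wcf lam Q = (let n = length lam; L = Lmax lam in
     (\<Prod>r\<in>{1..L}. \<Prod>j<n. if sgn Q r j < 0 then - (qq ^ (r - 1)) / tt ^ (n - 1) else 1)
     * (\<Prod>r\<in>{2..L}. \<Prod>j\<in>{j. j < n \<and> reg Q r j \<noteq> 0}. classic_wt n Q r j)
     * (\<Prod>r\<in>{1..L}. \<Prod>j\<in>{j. j < n \<and> sgn Q r j \<noteq> 0}. signed_wt n Q r j))"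

lemma smlq_wt_single: "smlq_wt lam Q = Poly_Mapping.single (wexp lam Q) (wcf lam Q)"
proof -
  have b: "(if 0 < sgn Q r j then Xv j else if sgn Q r j < 0 then Cst c else 1)
    = Poly_Mapping.single (if 0 < sgn Q r j then Poly_Mapping.single j 1 else 0) (if sgn Q r j < 0 then c else 1)" for r j c
    by (auto simp: Xv_def Cst_def)
  show ?thesis
    unfolding smlq_wt_def Let_def ball_wt_def b
    unfolding wexp_def wcf_def Let_def Cst_def prod_single mult_single by simp
qed

lemma lookup_wexp: "Poly_Mapping.lookup (wexp lam Q) j = (if j < length lam then card {r\<in>{1..Lmax lam}. 0 < sgn Q r j} else 0)"
proof -
  have "Poly_Mapping.lookup (wexp lam Q) j = (\<Sum>r\<in>{1..Lmax lam}. \<Sum>i<length lam. if i = j then (if 0 < sgn Q r j then 1 else 0) else 0)"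
    unfolding wexp_def lookup_sum by (intro sum.cong refl) (auto simp: lookup_single when_def)
  also have "\<dots> = (\<Sum>r\<in>{1..Lmax lam}. if j < length lam \<and> 0 < sgn Q r j then 1 else 0)"
    by (intro sum.cong refl) (simp add: sum.delta)
  also have "\<dots> = (if j < length lam then card {r\<in>{1..Lmax lam}. 0 < sgn Q r j} else 0)"
    by (simp add: sum.If_cases Int_def)
  finally show ?thesis .
qed

lemma keys_wexp: "Poly_Mapping.keys (wexp lam Q) \<subseteq> {..<length lam}"
  by (auto simp: in_keys_iff lookup_wexp split: if_splits)

lemma card_filter_mset: "card {j. j < n \<and> P (f j)} = size (filter_mset P (mset (map f [0..<n])))"
proof (induction n)
  case (Suc n)
  have "{j. j < Suc n \<and> P (f j)} = {j. j < n \<and> P (f j)} \<union> (if P (f n) then {n} else {})" by (auto simp: less_Suc_eq)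
  then show ?case using Suc by auto
qed simp

lemma lam_r_map: "lam_r lam r = map (\<lambda>j. if r \<le> lam ! j then lam ! j else 0) [0..<length lam]"
  by (rule nth_equalityI) (auto simp: lam_r_def)

lemma sum_card_swap:
  "finite A \<Longrightarrow> (\<Sum>r\<in>A. f r * card {j. j < (n::nat) \<and> P r j}) = (\<Sum>j<n. \<Sum>r | r \<in> A \<and> P r j. (f r :: nat))"
proof -
  assume A: "finite A"
  have "(\<Sum>r\<in>A. f r * card {j. j < n \<and> P r j}) = (\<Sum>r\<in>A. \<Sum>j<n. if P r j then f r else 0)"
    by (simp add: sum.If_cases Int_def mult.commute)
  also have "\<dots> = (\<Sum>j<n. \<Sum>r\<in>A. if P r j then f r else 0)" by (rule sum.swap)
  also have "\<dots> = (\<Sum>j<n. \<Sum>r | r \<in> A \<and> P r j. f r)" using A by (simp add: sum.If_cases Int_def)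
  finally show ?thesis .
qed

lemma row_count:
  assumes "is_smlq lam mu Q" "r \<in> {1..Lmax lam}"
  shows "card {j. j < length lam \<and> sgn Q r j \<noteq> 0} = card {j. j < length lam \<and> r \<le> lam ! j}"
proof -
  let ?n = "length lam"
  have m: "mset (map (\<lambda>j. absl (sgn Q r j)) [0..<?n]) = mset (map (\<lambda>j. if r \<le> lam ! j then lam ! j else 0) [0..<?n])"
    using assms unfolding is_smlq_def Let_def lam_r_map by blast
  have "card {j. j < ?n \<and> absl (sgn Q r j) \<noteq> 0} = card {j. j < ?n \<and> (if r \<le> lam ! j then lam ! j else 0) \<noteq> 0}"
    unfolding card_filter_mset[of ?n "\<lambda>x. x \<noteq> 0"] m ..
  moreover have "{j. j < ?n \<and> (if r \<le> lam ! j then lam ! j else 0) \<noteq> 0} = {j. j < ?n \<and> r \<le> lam ! j}" using assms(2) by auto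
  ultimately show ?thesis by simp
qed

lemma sum_rows:
  "(\<Sum>r\<in>{1..Lmax lam}. f r * card {j. j < length lam \<and> r \<le> lam ! j}) = (\<Sum>j<length lam. \<Sum>r\<in>{1..lam ! j}. (f r :: nat))"
proof -
  have "{r. r \<in> {1..Lmax lam} \<and> r \<le> lam ! j} = {1..lam ! j}" if "j < length lam" for j
    using Lmax_ge[of "lam ! j" lam] that by auto
  then show ?thesis by (subst sum_card_swap) auto
qed

lemma sum_rows_one: "(\<Sum>r\<in>{1..Lmax lam}. card {j. j < length lam \<and> r \<le> lam ! j}) = sum_list lam"
  using sum_rows[of "\<lambda>_. 1" lam] by (simp add: sum_list_sum_nth atLeast0LessThan)

lemma wexp_total: "(\<Sum>j<length lam. Poly_Mapping.lookup (wexp lam Q) j) = (\<Sum>r\<in>{1..Lmax lam}. card {j. j < length lam \<and> 0 < sgn Q r j})"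
  using sum_card_swap[of "{1..Lmax lam}" "\<lambda>_. 1" "length lam" "\<lambda>r j. 0 < sgn Q r j"] by (simp add: lookup_wexp)

lemma pos_row_le:
  assumes "is_smlq lam mu Q" "r \<in> {1..Lmax lam}"
  shows "card {j. j < length lam \<and> 0 < sgn Q r j} \<le> card {j. j < length lam \<and> r \<le> lam ! j}"
  unfolding row_count[OF assms, symmetric] by (rule card_mono) auto

lemma mdeg_wexp:
  assumes "is_smlq lam mu Q"
  shows "mdeg (wexp lam Q) \<le> sum_list lam"
proof -
  have "mdeg (wexp lam Q) = (\<Sum>j<length lam. Poly_Mapping.lookup (wexp lam Q) j)"
    unfolding mdeg_def by (rule sum.mono_neutral_left) (use keys_wexp in \<open>auto simp: in_keys_iff\<close>)
  also have "\<dots> \<le> (\<Sum>r\<in>{1..Lmax lam}. card {j. j < length lam \<and> r \<le> lam ! j})"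
    unfolding wexp_total using pos_row_le[OF assms] by (intro sum_mono) auto
  finally show ?thesis unfolding sum_rows_one .
qed

lemma Fstar_single: "Fstar lam mu = (\<Sum>Q\<in>{Q. is_smlq lam mu Q}. Poly_Mapping.single (wexp lam Q) (wcf lam Q))"
  by (simp add: Fstar_def smlq_wt_single)

lemma keys_Fstar: "m \<in> Poly_Mapping.keys (Fstar lam mu) \<Longrightarrow> \<exists>Q. is_smlq lam mu Q \<and> m = wexp lam Q"
proof -
  assume "m \<in> Poly_Mapping.keys (Fstar lam mu)"
  then have "(\<Sum>Q\<in>{Q. is_smlq lam mu Q}. Poly_Mapping.lookup (Poly_Mapping.single (wexp lam Q) (wcf lam Q)) m) \<noteq> 0"
    unfolding in_keys_iff Fstar_single lookup_sum .
  then obtain Q where "is_smlq lam mu Q" "Poly_Mapping.lookup (Poly_Mapping.single (wexp lam Q) (wcf lam Q)) m \<noteq> 0"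
    by (metis (mono_tags, lifting) mem_Collect_eq sum.neutral)
  then show ?thesis by (auto simp: lookup_single when_def split: if_splits)
qed

lemma Fstar_vars: "vars_in (length lam) (Fstar lam mu)"
  unfolding vars_in_def using keys_Fstar keys_wexp by blast

lemma Fstar_deg: "deg_le (Fstar lam mu) (sum_list lam)"
  unfolding deg_le_def using keys_Fstar mdeg_wexp by blast

text \<open>Equality forces \<open>S = {1..card S}\<close>.\<close>

lemma sum_initial_segment_le:
  fixes S :: "nat set"
  assumes "finite S" "0 \<notin> S"
  shows "\<Sum>{1..card S} + card (S - {1..card S}) \<le> \<Sum>S"
proof -
  let ?I = "{1..card S}"
  have c: "card (S - ?I) = card (?I - S)"
    using card_Diff_subset_Int[of S ?I] card_Diff_subset_Int[of ?I S] assms(1) by (simp add: Int_commute)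
  have "\<Sum>(?I - S) \<le> card (?I - S) * card S" using sum_bounded_above[of "?I - S" "\<lambda>x. x" "card S"] by simp
  moreover have "card (S - ?I) * Suc (card S) \<le> \<Sum>(S - ?I)"
  proof -
    have "Suc (card S) \<le> x" if "x \<in> S - ?I" for x using that assms(2) by (cases x) auto
    then show ?thesis using sum_bounded_below[of "S - ?I" "Suc (card S)" "\<lambda>x. x"] by simp
  qed
  ultimately have "\<Sum>(?I - S) + card (S - ?I) \<le> \<Sum>(S - ?I)" unfolding c by simp
  moreover have "\<Sum>?I = \<Sum>(S \<inter> ?I) + \<Sum>(?I - S)" using sum.Int_Diff[of ?I "\<lambda>x. x" S] by (simp add: Int_commute)
  moreover have "\<Sum>S = \<Sum>(S \<inter> ?I) + \<Sum>(S - ?I)" using sum.Int_Diff[of S "\<lambda>x. x" ?I] assms(1) by simp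
  ultimately show ?thesis by linarith
qed

text \<open>The queue that produces the leading monomial: column \<open>j\<close> is filled up to
  height \<open>lam ! j\<close>, all signed balls are positive and all strands go straight
  down.\<close>

definition diagq :: "nat list \<Rightarrow> smlq" where
  "diagq lam = (let B = (\<lambda>r j. 1 \<le> r \<and> r \<le> Lmax lam \<and> j < length lam \<and> r \<le> lam ! j) in
     \<lparr>reg = (\<lambda>r j. if B r j then lam ! j else 0), sgn = (\<lambda>r j. if B r j then int (lam ! j) else 0),
      pc = (\<lambda>r j. if 2 \<le> r \<and> B r j then j else 0), ps = (\<lambda>r j. if B r j then j else 0)\<rparr>)"

lemma diagq_smlq: "is_smlq lam lam (diagq lam)"
proof -
  let ?n = "length lam" and ?L = "Lmax lam" and ?Q = "diagq lam"
  define B where "B r j \<longleftrightarrow> 1 \<le> r \<and> r \<le> ?L \<and> j < ?n \<and> r \<le> lam ! j" for r j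
  have Q: "reg ?Q r j = (if B r j then lam ! j else 0)" "sgn ?Q r j = (if B r j then int (lam ! j) else 0)"
    "pc ?Q r j = (if 2 \<le> r \<and> B r j then j else 0)" "ps ?Q r j = (if B r j then j else 0)" for r j
    by (simp_all add: diagq_def B_def)
  have BD: "B r j \<Longrightarrow> 1 \<le> r \<and> r \<le> ?L \<and> j < ?n \<and> lam ! j \<noteq> 0" for r j by (auto simp: B_def)
  have B1: "B r j \<Longrightarrow> 2 \<le> r \<Longrightarrow> B (r - 1) j" for r j by (auto simp: B_def)
  have abs: "absl (if b then int x else 0) = (if b then x else 0)" for b x by simp
  have m: "map (\<lambda>j. if B r j then lam ! j else 0) [0..<?n] = lam_r lam r" if "r \<in> {1..?L}" for r
    using that unfolding lam_r_map by (auto simp: B_def)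
  have F1: "\<forall>r j. (r < 1 \<or> ?L < r \<or> ?n \<le> j) \<longrightarrow> reg ?Q r j = 0 \<and> sgn ?Q r j = 0"
    unfolding Q B_def by auto
  have F2: "\<forall>r j. \<not> (2 \<le> r \<and> r \<le> ?L \<and> j < ?n \<and> reg ?Q r j \<noteq> 0) \<longrightarrow> pc ?Q r j = 0"
    unfolding Q B_def by auto
  have F3: "\<forall>r j. \<not> (1 \<le> r \<and> r \<le> ?L \<and> j < ?n \<and> sgn ?Q r j \<noteq> 0) \<longrightarrow> ps ?Q r j = 0"
    unfolding Q B_def by auto
  have F4: "\<forall>r\<in>{1..?L}. mset (map (reg ?Q r) [0..<?n]) = mset (lam_r lam r)"
  proof
    fix r assume r: "r \<in> {1..?L}"
    have "reg ?Q r = (\<lambda>j. if B r j then lam ! j else 0)" using Q by auto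
    then show "mset (map (reg ?Q r) [0..<?n]) = mset (lam_r lam r)" using m[OF r] by simp
  qed
  have F5: "\<forall>r\<in>{1..?L}. mset (map (\<lambda>j. absl (sgn ?Q r j)) [0..<?n]) = mset (lam_r lam r)"
    unfolding Q abs using m by simp
  have F6: "\<forall>j<?n. reg ?Q 1 j = lam ! j"
  proof (intro allI impI)
    fix j assume "j < ?n"
    then show "reg ?Q 1 j = lam ! j" unfolding Q B_def using Lmax_ge[of "lam ! j" lam] by auto
  qed
  have F7: "\<forall>r\<in>{2..?L}.
        (\<forall>j<?n. reg ?Q r j \<noteq> 0 \<longrightarrow> pc ?Q r j < ?n \<and> absl (sgn ?Q (r - 1) (pc ?Q r j)) = reg ?Q r j)
      \<and> inj_on (pc ?Q r) {j. j < ?n \<and> reg ?Q r j \<noteq> 0}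
      \<and> (\<forall>j<?n. reg ?Q r j \<noteq> 0 \<longrightarrow>
            (sgn ?Q (r - 1) j = 0 \<or> reg ?Q r j \<le> absl (sgn ?Q (r - 1) j))
          \<and> (absl (sgn ?Q (r - 1) j) = reg ?Q r j \<longrightarrow> pc ?Q r j = j))"
  proof
    fix r assume "r \<in> {2..?L}"
    then have r: "2 \<le> r" by simp
    have "reg ?Q r j \<noteq> 0 \<longleftrightarrow> B r j" for j unfolding Q using BD[of r j] by auto
    moreover have "B r j \<Longrightarrow> reg ?Q r j = lam ! j \<and> absl (sgn ?Q (r - 1) j) = lam ! j \<and> pc ?Q r j = j" for j
      unfolding Q using B1[of r j] r by simp
    ultimately show "(\<forall>j<?n. reg ?Q r j \<noteq> 0 \<longrightarrow> pc ?Q r j < ?n \<and> absl (sgn ?Q (r - 1) (pc ?Q r j)) = reg ?Q r j)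
      \<and> inj_on (pc ?Q r) {j. j < ?n \<and> reg ?Q r j \<noteq> 0}
      \<and> (\<forall>j<?n. reg ?Q r j \<noteq> 0 \<longrightarrow>
            (sgn ?Q (r - 1) j = 0 \<or> reg ?Q r j \<le> absl (sgn ?Q (r - 1) j))
          \<and> (absl (sgn ?Q (r - 1) j) = reg ?Q r j \<longrightarrow> pc ?Q r j = j))"
      by (simp add: inj_on_def)
  qed
  have F8: "\<forall>r\<in>{1..?L}.
        (\<forall>j<?n. sgn ?Q r j \<noteq> 0 \<longrightarrow> j \<le> ps ?Q r j \<and> ps ?Q r j < ?n \<and> reg ?Q r (ps ?Q r j) = absl (sgn ?Q r j))
      \<and> inj_on (ps ?Q r) {j. j < ?n \<and> sgn ?Q r j \<noteq> 0}
      \<and> (\<forall>j<?n. 0 < sgn ?Q r j \<longrightarrow> absl (sgn ?Q r j) \<le> reg ?Q r j \<and> (reg ?Q r j = absl (sgn ?Q r j) \<longrightarrow> ps ?Q r j = j))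
      \<and> (\<forall>j<?n. sgn ?Q r j < 0 \<longrightarrow> reg ?Q r j = 0 \<or> reg ?Q r j \<le> absl (sgn ?Q r j))"
    unfolding Q B_def by (auto simp: inj_on_def)
  show ?thesis unfolding is_smlq_def Let_def by (intro conjI F1 F2 F3 F4 F5 F6 F7 F8)
qed

lemma diagq_wt: "wexp lam (diagq lam) = mono lam" "wcf lam (diagq lam) = 1"
proof -
  have s: "0 < sgn (diagq lam) r j \<longleftrightarrow> 1 \<le> r \<and> r \<le> Lmax lam \<and> j < length lam \<and> r \<le> lam ! j" for r j
    by (auto simp: diagq_def Let_def)
  have "card {r\<in>{1..Lmax lam}. 0 < sgn (diagq lam) r j} = lam ! j" if "j < length lam" for j
  proof -
    have "{r\<in>{1..Lmax lam}. 0 < sgn (diagq lam) r j} = {1..lam ! j}"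
      unfolding s using that Lmax_ge[of "lam ! j" lam] by auto
    then show ?thesis by simp
  qed
  then show "wexp lam (diagq lam) = mono lam"
    by (intro poly_mapping_eqI) (simp add: lookup_wexp mono_def nth_default_def)
  have n: "\<not> sgn (diagq lam) r j < 0" for r j by (auto simp: diagq_def Let_def)
  have c: "classic_wt (length lam) (diagq lam) r j = 1" if "reg (diagq lam) r j \<noteq> 0" "2 \<le> r" for r j
    using that by (auto simp: classic_wt_def diagq_def Let_def split: if_splits)
  have g: "signed_wt (length lam) (diagq lam) r j = 1" if "sgn (diagq lam) r j \<noteq> 0" for r j
    using that by (auto simp: signed_wt_def diagq_def Let_def split: if_splits)
  show "wcf lam (diagq lam) = 1"
    unfolding wcf_def Let_def by (simp add: n c g)
qed

text \<open>Column \<open>j\<close> holds \<open>lam ! j\<close> positive balls, and row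
  \<open>r\<close> at most as many as there are parts of size at least \<open>r\<close>. Equal
  totals make every signed ball positive, and equal sums of heights push the balls of each column to
  the bottom. A positive ball has a label at most the one below it, so equal row sums make rows
  \<open>r'\<close> and \<open>r\<close> agree.\<close>

lemma leading_queue:
  assumes Q: "is_smlq lam mu Q" and E: "wexp lam Q = mono lam" and len: "length mu = length lam"
  shows "mu = lam" "Q = diagq lam"
proof -
  let ?n = "length lam" and ?L = "Lmax lam"
  note Q' = Q[unfolded is_smlq_def Let_def]
  note Z = Q'[THEN conjunct1]
    and ZC = Q'[THEN conjunct2, THEN conjunct1]
    and ZS = Q'[THEN conjunct2, THEN conjunct2, THEN conjunct1]
    and R = Q'[THEN conjunct2, THEN conjunct2, THEN conjunct2, THEN conjunct1]
    and Q4 = Q'[THEN conjunct2, THEN conjunct2, THEN conjunct2, THEN conjunct2]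
  note S = Q4[THEN conjunct1]
    and M = Q4[THEN conjunct2, THEN conjunct1]
    and C7 = Q4[THEN conjunct2, THEN conjunct2, THEN conjunct1]
    and C8 = Q4[THEN conjunct2, THEN conjunct2, THEN conjunct2]
  have Cl: "\<forall>r\<in>{2..?L}. \<forall>j<?n. reg Q r j \<noteq> 0 \<longrightarrow> (sgn Q (r - 1) j = 0 \<or> reg Q r j \<le> absl (sgn Q (r - 1) j))
          \<and> (absl (sgn Q (r - 1) j) = reg Q r j \<longrightarrow> pc Q r j = j)"
    by (rule ballI, drule bspec[OF C7]) (elim conjE, assumption)
  have Sg: "\<forall>r\<in>{1..?L}. \<forall>j<?n. 0 < sgn Q r j \<longrightarrow> absl (sgn Q r j) \<le> reg Q r j \<and> (reg Q r j = absl (sgn Q r j) \<longrightarrow> ps Q r j = j)"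
    by (rule ballI, drule bspec[OF C8]) (elim conjE, assumption)
  have col: "card {r\<in>{1..?L}. 0 < sgn Q r j} = lam ! j" if "j < ?n" for j
    using arg_cong[OF E, of "\<lambda>m. Poly_Mapping.lookup m j"] that by (simp add: lookup_wexp mono_def nth_default_def)
  have row: "card {j. j < ?n \<and> 0 < sgn Q r j} = card {j. j < ?n \<and> r \<le> lam ! j}" if r: "r \<in> {1..?L}" for r
  proof (rule sum_mono_inv[of "\<lambda>r. card {j. j < ?n \<and> 0 < sgn Q r j}" "{1..?L}" "\<lambda>r. card {j. j < ?n \<and> r \<le> lam ! j}"])
    show "(\<Sum>r\<in>{1..?L}. card {j. j < ?n \<and> 0 < sgn Q r j}) = (\<Sum>r\<in>{1..?L}. card {j. j < ?n \<and> r \<le> lam ! j})"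
      unfolding wexp_total[symmetric] sum_rows_one E by (simp add: mono_def nth_default_def sum_list_sum_nth atLeast0LessThan)
  qed (use pos_row_le[OF Q] r in auto)
  have pos: "0 < sgn Q r j \<longleftrightarrow> sgn Q r j \<noteq> 0" if r: "r \<in> {1..?L}" and j: "j < ?n" for r j
  proof -
    have "{j. j < ?n \<and> 0 < sgn Q r j} = {j. j < ?n \<and> sgn Q r j \<noteq> 0}"
      by (rule card_subset_eq) (use row[OF r] row_count[OF Q r] in auto)
    then show ?thesis using j by auto
  qed
  have seg: "{r\<in>{1..?L}. 0 < sgn Q r j} = {1..lam ! j}" if j: "j < ?n" for j
  proof -
    define T where "T j = {r\<in>{1..?L}. 0 < sgn Q r j}" for j
    have fT: "finite (T j)" "0 \<notin> T j" for j unfolding T_def by auto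
    have cT: "card (T j) = lam ! j" if "j < ?n" for j using col[OF that] by (simp add: T_def)
    \<comment> \<open>Summed by rows, the heights of all positive balls already attain the least
      total that the column counts permit.\<close>
    have tot: "(\<Sum>j<?n. \<Sum>(T j)) = (\<Sum>j<?n. \<Sum>{1..lam ! j})"
    proof -
      have "(\<Sum>j<?n. \<Sum>(T j)) = (\<Sum>r\<in>{1..?L}. r * card {j. j < ?n \<and> 0 < sgn Q r j})"
        by (subst sum_card_swap) (simp_all add: T_def)
      also have "\<dots> = (\<Sum>r\<in>{1..?L}. r * card {j. j < ?n \<and> r \<le> lam ! j})" using row by (intro sum.cong) auto
      finally show ?thesis unfolding sum_rows .
    qed
    have "\<Sum>{1..lam ! j} = \<Sum>(T j)"
    proof (rule sum_mono_inv[of "\<lambda>j. \<Sum>{1..lam ! j}" "{..<?n}" "\<lambda>j. \<Sum>(T j)"])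
      fix k assume "k \<in> {..<?n}"
      then show "\<Sum>{1..lam ! k} \<le> \<Sum>(T k)" using sum_initial_segment_le[OF fT, of k] cT[of k] by simp
    qed (use tot j in auto)
    then have "card (T j - {1..lam ! j}) = 0" using sum_initial_segment_le[OF fT, of j] cT[OF j] by simp
    then have "T j \<subseteq> {1..lam ! j}" using fT by auto
    then have "T j = {1..lam ! j}" using cT[OF j] by (intro card_subset_eq) auto
    then show ?thesis by (simp add: T_def)
  qed
  have supp: "0 < sgn Q r j \<longleftrightarrow> r \<le> lam ! j" if "r \<in> {1..?L}" "j < ?n" for r j
    using seg[OF that(2)] that(1) by (metis (mono_tags, lifting) atLeastAtMost_iff mem_Collect_eq)
  have sums: "sum f {..<?n} = sum g {..<?n}" if "mset (map f [0..<?n]) = mset (map g [0..<?n])" for f g :: "nat \<Rightarrow> nat"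
    using arg_cong[OF that, of sum_mset] unfolding sum_mset_sum_list by (simp add: interv_sum_list_conv_sum_set_nat atLeast0LessThan)
  have reg_abs: "reg Q r j = absl (sgn Q r j)" if r: "r \<in> {1..?L}" and j: "j < ?n" for r j
  proof (rule sym, rule sum_mono_inv[of "\<lambda>j. absl (sgn Q r j)" "{..<?n}" "reg Q r"])
    show "(\<Sum>j<?n. absl (sgn Q r j)) = sum (reg Q r) {..<?n}" using R S r by (intro sums) simp
    fix k assume "k \<in> {..<?n}"
    then show "absl (sgn Q r k) \<le> reg Q r k" using bspec[OF Sg r] pos[OF r, of k] by (cases "sgn Q r k = 0") auto
  qed (use j in auto)
  have reg0: "reg Q r j = 0 \<longleftrightarrow> \<not> r \<le> lam ! j" if "r \<in> {1..?L}" "j < ?n" for r j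
    using reg_abs[OF that] pos[OF that] supp[OF that] by auto
  have lower: "r \<le> reg Q r j" if r: "r \<in> {1..?L}" and j: "j < ?n" "reg Q r j \<noteq> 0" for r j
  proof -
    have "reg Q r j \<in> set (lam_r lam r)" using R r j mset_eq_setD[of "map (reg Q r) [0..<?n]" "lam_r lam r"] by auto
    then show ?thesis using j(2) by (auto simp: lam_r_def split: if_splits)
  qed
  \<comment> \<open>From the top row downward: the classic condition bounds each label from below by
    the one above it, and the row sum leaves no slack.\<close>
  have reg: "\<forall>j<?n. reg Q r j = (if r \<le> lam ! j then lam ! j else 0)" if "1 \<le> r" "r \<le> ?L" for r
    using that(2,1)
  proof (induction r rule: inc_induct)
    case base
    show ?case
    proof (intro allI impI)
      fix j assume j: "j < ?n"
      have L: "?L \<in> {1..?L}" using base by simp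
      have "reg Q ?L j \<in> set (lam_r lam ?L)" using R L j mset_eq_setD[of "map (reg Q ?L) [0..<?n]" "lam_r lam ?L"] by auto
      then have "reg Q ?L j \<le> ?L" by (auto simp: lam_r_def dest: Lmax_ge)
      then show "reg Q ?L j = (if ?L \<le> lam ! j then lam ! j else 0)"
        using reg0[OF L j] lower[OF L j] Lmax_ge[of "lam ! j" lam] j by auto
    qed
  next
    case (step r)
    then have r: "r \<in> {1..?L}" "Suc r \<in> {2..?L}" and IH: "\<forall>j<?n. reg Q (Suc r) j = (if Suc r \<le> lam ! j then lam ! j else 0)" by auto
    have ge: "(if r \<le> lam ! k then lam ! k else 0) \<le> reg Q r k" if k: "k < ?n" for k
    proof (cases "Suc r \<le> lam ! k")
      case True
      then have "reg Q (Suc r) k \<noteq> 0" using IH k by auto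
      then have "sgn Q r k = 0 \<or> reg Q (Suc r) k \<le> absl (sgn Q r k)" using bspec[OF Cl r(2)] k by simp
      then show ?thesis using supp[OF r(1) k] reg_abs[OF r(1) k] IH k True by auto
    next
      case False
      then show ?thesis using lower[OF r(1) k] reg0[OF r(1) k] by auto
    qed
    have "(if r \<le> lam ! j then lam ! j else 0) = reg Q r j" if j: "j < ?n" for j
    proof (rule sum_mono_inv[of "\<lambda>j. if r \<le> lam ! j then lam ! j else 0" "{..<?n}" "reg Q r"])
      show "(\<Sum>j<?n. if r \<le> lam ! j then lam ! j else 0) = sum (reg Q r) {..<?n}"
        using R r(1) by (intro sums) (simp add: lam_r_map)
    qed (use ge j in auto)
    then show ?case by simp
  qed
  have rq: "reg Q r j = (if 1 \<le> r \<and> r \<le> ?L \<and> j < ?n \<and> r \<le> lam ! j then lam ! j else 0)" for r j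
  proof (cases "1 \<le> r \<and> r \<le> ?L \<and> j < ?n")
    case False
    then have "r < 1 \<or> ?L < r \<or> ?n \<le> j" by auto
    then show ?thesis using Z False by auto
  qed (use reg[of r] in simp)
  have sq: "sgn Q r j = (if 1 \<le> r \<and> r \<le> ?L \<and> j < ?n \<and> r \<le> lam ! j then int (lam ! j) else 0)" for r j
  proof (cases "1 \<le> r \<and> r \<le> ?L \<and> j < ?n")
    case True
    then have r: "r \<in> {1..?L}" and j: "j < ?n" by auto
    show ?thesis using reg_abs[OF r j] pos[OF r j] supp[OF r j] reg[of r] True by (auto simp: absl_def)
  next
    case False
    then have "r < 1 \<or> ?L < r \<or> ?n \<le> j" by auto
    then show ?thesis using Z False by auto
  qed
  have pq: "ps Q r j = (if 1 \<le> r \<and> r \<le> ?L \<and> j < ?n \<and> r \<le> lam ! j then j else 0)" for r j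
  proof (cases "1 \<le> r \<and> r \<le> ?L \<and> j < ?n \<and> r \<le> lam ! j")
    case True
    then have r: "r \<in> {1..?L}" and j: "j < ?n" by auto
    show ?thesis using bspec[OF Sg r] j reg_abs[OF r j] supp[OF r j] True by simp
  next
    case False
    then have "\<not> (1 \<le> r \<and> r \<le> ?L \<and> j < ?n \<and> sgn Q r j \<noteq> 0)" using sq[of r j] by auto
    then have "ps Q r j = 0" using ZS by blast
    then show ?thesis by (simp only: False if_False)
  qed
  have cq: "pc Q r j = (if 2 \<le> r \<and> 1 \<le> r \<and> r \<le> ?L \<and> j < ?n \<and> r \<le> lam ! j then j else 0)" for r j
  proof (cases "2 \<le> r \<and> 1 \<le> r \<and> r \<le> ?L \<and> j < ?n \<and> r \<le> lam ! j")
    case True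
    then have "reg Q r j = lam ! j" "sgn Q (r - 1) j = int (lam ! j)" "lam ! j \<noteq> 0" using rq[of r j] sq[of "r - 1" j] by auto
    then show ?thesis using bspec[OF Cl, of r] True by simp
  next
    case False
    then have "\<not> (2 \<le> r \<and> r \<le> ?L \<and> j < ?n \<and> reg Q r j \<noteq> 0)" using rq[of r j] by auto
    then have "pc Q r j = 0" using ZC by blast
    then show ?thesis by (simp only: False if_False)
  qed
  have "reg Q = reg (diagq lam)" "sgn Q = sgn (diagq lam)" "pc Q = pc (diagq lam)" "ps Q = ps (diagq lam)"
    unfolding diagq_def Let_def smlq.simps by (intro ext rq sq pq cq)+
  then show "Q = diagq lam" by (intro smlq.equality) auto
  show "mu = lam"
  proof (rule nth_equalityI)
    fix j assume "j < length mu"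
    then have j: "j < ?n" using len by simp
    then have "mu ! j = reg Q 1 j" using M by simp
    then show "mu ! j = lam ! j" using rq[of 1 j] j Lmax_ge[of "lam ! j" lam] by (auto split: if_splits)
  qed (rule len)
qed

lemma Fstar_leading:
  assumes "length mu = length lam"
  shows "Poly_Mapping.lookup (Fstar lam mu) (mono lam) = (if mu = lam then 1 else 0)"
proof -
  have fin: "finite {Q. is_smlq lam mu Q}" using finite_part[of 1 lam mu] by (simp add: is_smlq_part)
  have "Poly_Mapping.lookup (Fstar lam mu) (mono lam)
      = (\<Sum>Q\<in>{Q. is_smlq lam mu Q}. if Q = diagq lam then (if mu = lam then 1 else 0) else 0)"
    unfolding Fstar_single lookup_sum
  proof (rule sum.cong)
    fix Q assume "Q \<in> {Q. is_smlq lam mu Q}"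
    then have Q: "is_smlq lam mu Q" by simp
    show "Poly_Mapping.lookup (Poly_Mapping.single (wexp lam Q) (wcf lam Q)) (mono lam) = (if Q = diagq lam then if mu = lam then 1 else 0 else 0)"
    proof (cases "wexp lam Q = mono lam")
      case True
      have "mu = lam" "Q = diagq lam" using leading_queue[OF Q True assms] by auto
      then show ?thesis by (simp add: diagq_wt)
    next
      case False
      then have "Q \<noteq> diagq lam" using diagq_wt(1) by blast
      then show ?thesis using False by (simp add: lookup_single)
    qed
  qed simp
  then show ?thesis using fin diagq_smlq[of lam] by (simp add: sum.delta)
qed

section \<open>Uniqueness of interpolation polynomials\<close>

lemma lookup_Cst_mult: "Poly_Mapping.lookup (Cst k * p) m = k * Poly_Mapping.lookup p m"
proof -
  have "Cst k * p = Poly_Mapping.map ((*) k) p" by (simp add: Cst_def mult_map_scale_conv_mult)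
  then show ?thesis by (simp add: Poly_Mapping.map.rep_eq when_def)
qed

text \<open>\<open>Z\<close> cannot vanish on \<open>K\<close> as well, so \<open>p\<close> is a
  multiple of \<open>Z\<close>, and the leading coefficient fixes the ratio. \<open>K\<close> is one
  composition for the nonsymmetric polynomial and a whole orbit for the symmetric one.\<close>

lemma interpolation_leading_unique:
  assumes Z: "vars_in n Z" "deg_le Z d" "Poly_Mapping.lookup Z m = 1"
    and p: "vars_in n p" "deg_le p d" "Poly_Mapping.lookup p m = 1"
    and off: "\<And>nu. length nu = n \<Longrightarrow> sum_list nu \<le> d \<Longrightarrow> nu \<notin> K \<Longrightarrow> peval Z (tilde nu) = 0 \<and> peval p (tilde nu) = 0"
    and on: "\<And>nu. nu \<in> K \<Longrightarrow> peval Z (tilde nu) = z \<and> peval p (tilde nu) = c"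
  shows "p = Z"
proof -
  have "z \<noteq> 0"
  proof
    assume "z = 0"
    then have "peval Z (tilde nu) = 0" if "length nu = n" "sum_list nu \<le> d" for nu
      using off[OF that] on[of nu] by (cases "nu \<in> K") auto
    then have "peval Z v = 0" for v by (rule interpolation_unique[OF PF_peval[OF Z(1,2)]])
    then have "Z = 0" by (intro mpoly_generic_zero)
    then show False using Z(3) by simp
  qed
  have "peval p v + (- (c / z)) * peval Z v = 0" for v
  proof (rule interpolation_unique[of n d "\<lambda>v. peval p v + (- (c / z)) * peval Z v"])
    show "PF n d (\<lambda>v. peval p v + (- (c / z)) * peval Z v)"
      using Z p by (intro PF.add PF_cmult PF_peval)
    fix nu :: "nat list" assume nu: "length nu = n" "sum_list nu \<le> d"
    show "peval p (tilde nu) + (- (c / z)) * peval Z (tilde nu) = 0"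
      using off[OF nu] on[of nu] \<open>z \<noteq> 0\<close> by (cases "nu \<in> K") auto
  qed
  then have "peval p v = peval (Cst (c / z) * Z) v" for v by (simp add: peval_mult add_eq_0_iff2)
  then have e: "p = Cst (c / z) * Z" by (intro mpoly_generic_eq) simp
  then have "c / z = 1" using Z(3) p(3) by (simp add: lookup_Cst_mult)
  then show ?thesis using e by (simp add: Cst_def)
qed

lemma Estar_eq_Fstar:
  assumes "sorted_wrt (\<ge>) lam"
  shows "Estar lam = Fstar lam lam"
  unfolding Estar_def
proof (rule the_equality)
  show F: "vars_in (length lam) (Fstar lam lam) \<and> deg_le (Fstar lam lam) (sum_list lam)
      \<and> Poly_Mapping.lookup (Fstar lam lam) (mono lam) = 1
      \<and> (\<forall>nu. length nu = length lam \<and> sum_list nu \<le> sum_list lam \<and> nu \<noteq> lam \<longrightarrow> peval (Fstar lam lam) (tilde nu) = 0)"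
    using Fstar_vars Fstar_deg Fstar_leading vanish_all(2)[OF assms] by simp
  fix p assume p: "vars_in (length lam) p \<and> deg_le p (sum_list lam) \<and> Poly_Mapping.lookup p (mono lam) = 1
      \<and> (\<forall>nu. length nu = length lam \<and> sum_list nu \<le> sum_list lam \<and> nu \<noteq> lam \<longrightarrow> peval p (tilde nu) = 0)"
  show "p = Fstar lam lam"
    by (rule interpolation_leading_unique[of "length lam" _ "sum_list lam" "mono lam" _ "{lam}"]) (use F p in auto)
qed

section \<open>Words and inversions\<close>

text \<open>Inversions relative to decreasing order, so that a partition has none.\<close>

fun ninv :: "nat list \<Rightarrow> nat" where
  "ninv [] = 0"
| "ninv (x # xs) = length (filter (\<lambda>y. x < y) xs) + ninv xs"

lemma ninv_swap: "b < a \<Longrightarrow> ninv (u @ b # a # v) = Suc (ninv (u @ a # b # v))"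
  by (induction u) auto

lemma ninv_sp:
  assumes "Suc i < length xs"
  shows "xs ! Suc i < xs ! i \<Longrightarrow> ninv (sp i xs) = Suc (ninv xs)"
    and "xs ! i < xs ! Suc i \<Longrightarrow> ninv xs = Suc (ninv (sp i xs))"
proof -
  obtain u a b v where x: "xs = u @ a # b # v" "length u = i" using split_pair[OF assms] .
  have s: "sp i xs = u @ b # a # v" using x by auto
  have n: "xs ! i = a" "xs ! Suc i = b" using x by (auto simp: nth_append)
  show "xs ! Suc i < xs ! i \<Longrightarrow> ninv (sp i xs) = Suc (ninv xs)"
    and "xs ! i < xs ! Suc i \<Longrightarrow> ninv xs = Suc (ninv (sp i xs))"
    unfolding n s by (auto simp: x(1) ninv_swap)
qed

lemma ninv_sp_le:
  assumes "Suc i < length xs"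
  shows "ninv (sp i xs) \<le> Suc (ninv xs)"
proof (cases "xs ! i" "xs ! Suc i" rule: linorder_cases)
  case less
  show ?thesis unfolding ninv_sp(2)[OF assms less] by simp
next
  case equal
  show ?thesis unfolding sp_eq[OF equal] by simp
next
  case greater
  show ?thesis unfolding ninv_sp(1)[OF assms greater] by simp
qed

lemma ninv_sorted: "sorted_wrt (\<ge>) xs \<Longrightarrow> ninv xs = 0"
  by (induction xs) (auto simp: filter_empty_conv not_less)

lemma length_foldr_sp [simp]: "length (foldr sp w xs) = length xs" by (induction w) auto

lemma nth_sp_transp: "Suc i < length xs \<Longrightarrow> k < length xs \<Longrightarrow> sp i xs ! transp i k = xs ! k"
  by (cases "k = i"; cases "k = Suc i") (auto simp: sp_def)

lemma transp_permutes: "Suc i < n \<Longrightarrow> transp i permutes {..<n}"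
  unfolding transp_def by (rule permutes_swap_id) auto

lemma word_perm_Cons [simp]: "word_perm (i # w) = transp i \<circ> word_perm w" and word_perm_Nil [simp]: "word_perm [] = id"
  by (simp_all add: word_perm_def)

lemma word_perm_permutes: "set w \<subseteq> {..<n - 1} \<Longrightarrow> word_perm w permutes {..<n}"
proof (induction w)
  case (Cons i w)
  then have "Suc i < n" by auto
  then show ?case using Cons transp_permutes unfolding word_perm_Cons by (intro permutes_compose) auto
qed (simp add: permutes_id id_def[symmetric])

lemma foldr_sp_nth: "set w \<subseteq> {..<length xs - 1} \<Longrightarrow> k < length xs \<Longrightarrow> foldr sp w xs ! word_perm w k = xs ! k"
proof (induction w)
  case (Cons i w)
  have "word_perm w k < length xs"
    using permutes_in_image[OF word_perm_permutes[of w "length xs"], of k] Cons.prems by auto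
  moreover have "Suc i < length xs" using Cons.prems by auto
  ultimately show ?case using Cons by (simp add: nth_sp_transp)
qed simp

lemma act_nth: "\<sigma> permutes {..<length xs} \<Longrightarrow> k < length xs \<Longrightarrow> act \<sigma> xs ! \<sigma> k = xs ! k"
  using permutes_in_image[of \<sigma> "{..<length xs}" k] by (simp add: act_def permutes_inverses)

lemma length_act [simp]: "length (act \<sigma> xs) = length xs" by (simp add: act_def)

lemma act_unique:
  assumes "\<sigma> permutes {..<length xs}" "length ys = length xs" "\<And>k. k < length xs \<Longrightarrow> ys ! \<sigma> k = xs ! k"
  shows "act \<sigma> xs = ys"
proof (rule nth_equalityI)
  fix j assume "j < length (act \<sigma> xs)"
  then have j: "j < length xs" by simp
  then have k: "inv \<sigma> j < length xs" using permutes_in_image[OF permutes_inv[OF assms(1)], of j] by simp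
  have "\<sigma> (inv \<sigma> j) = j" using permutes_inverses[OF assms(1)] by simp
  then show "act \<sigma> xs ! j = ys ! j" using act_nth[OF assms(1) k] assms(3)[OF k] by simp
qed (use assms in simp)

lemma act_word_perm: "set w \<subseteq> {..<length xs - 1} \<Longrightarrow> act (word_perm w) xs = foldr sp w xs"
  by (intro act_unique word_perm_permutes foldr_sp_nth) auto

lemma ninv_word: "sorted_wrt (\<ge>) lam \<Longrightarrow> set w \<subseteq> {..<length lam - 1} \<Longrightarrow> ninv (foldr sp w lam) \<le> length w"
proof (induction w)
  case (Cons i w)
  have "ninv (sp i (foldr sp w lam)) \<le> Suc (ninv (foldr sp w lam))" using Cons.prems by (intro ninv_sp_le) auto
  then show ?case using Cons by simp
qed (simp add: ninv_sorted)

lemma mset_foldr_sp: "set w \<subseteq> {..<length xs - 1} \<Longrightarrow> mset (foldr sp w xs) = mset xs"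
  by (induction w) (auto simp: mset_sp)

text \<open>Along a word of minimal length every swap creates an inversion, so each Hecke operator acts by
  exchanging labels, and equal parts are never exchanged.\<close>

lemma minimal_word:
  assumes srt: "sorted_wrt (\<ge>) lam" and "set w \<subseteq> {..<length lam - 1}" "ninv (foldr sp w lam) = length w"
  shows "Hecke_word w (Fstar lam lam) = Fstar lam (foldr sp w lam)
    \<and> (\<forall>a b. a < b \<longrightarrow> b < length lam \<longrightarrow> lam ! a = lam ! b \<longrightarrow> word_perm w a < word_perm w b)"
  using assms(2,3)
proof (induction w)
  case Nil
  then show ?case by (simp add: Hecke_word_def)
next
  case (Cons i w)
  let ?x = "foldr sp w lam" and ?s = "word_perm w"
  have w: "set w \<subseteq> {..<length lam - 1}" and i: "Suc i < length lam" using Cons.prems by auto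
  have le: "ninv ?x \<le> length w" using ninv_word[OF srt w] .
  have eq: "ninv (sp i ?x) = Suc (length w)" using Cons.prems(2) by simp
  have desc: "?x ! Suc i < ?x ! i"
  proof (rule ccontr)
    assume "\<not> ?x ! Suc i < ?x ! i"
    then have "ninv (sp i ?x) \<le> ninv ?x"
      using ninv_sp(2)[of i ?x] sp_eq[of ?x i] i by (cases "?x ! i" "?x ! Suc i" rule: linorder_cases) auto
    then show False using le eq by simp
  qed
  have "ninv ?x = length w" using ninv_sp(1)[of i ?x] desc i eq by simp
  then have IH: "Hecke_word w (Fstar lam lam) = Fstar lam ?x"
    "\<And>a b. a < b \<Longrightarrow> b < length lam \<Longrightarrow> lam ! a = lam ! b \<Longrightarrow> ?s a < ?s b" using Cons.IH[OF w] by auto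
  have "?x \<in> arr (mset lam)" using mset_foldr_sp[OF w] by (simp add: arr_def)
  then have "Hecke i (Fstar lam ?x) = Fstar lam (sp i ?x)" using FF_desc[OF _ i desc] by (intro Hecke_eq)
  then have "Hecke_word (i # w) (Fstar lam lam) = Fstar lam (foldr sp (i # w) lam)"
    using IH(1) by (simp add: Hecke_word_def)
  moreover have "word_perm (i # w) a < word_perm (i # w) b" if ab: "a < b" "b < length lam" "lam ! a = lam ! b" for a b
  proof -
    have "?x ! ?s a = ?x ! ?s b" using foldr_sp_nth[OF w] ab by simp
    then have "\<not> (?s a = i \<and> ?s b = Suc i)" using desc by auto
    then show ?thesis using IH(2)[OF ab]
      by (cases "?s a = i"; cases "?s a = Suc i"; cases "?s b = i"; cases "?s b = Suc i") auto
  qed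
  ultimately show ?case by blast
qed

lemma sorted_desc_unique:
  fixes xs ys :: "nat list"
  assumes "sorted_wrt (\<ge>) xs" "sorted_wrt (\<ge>) ys" "mset xs = mset ys"
  shows "xs = ys"
proof -
  have "sorted (rev xs)" "sorted (rev ys)" using assms(1,2) by (simp_all add: sorted_wrt_rev)
  then have "rev xs = rev ys" using assms(3) by (metis mset_rev properties_for_sort)
  then show ?thesis by simp
qed

text \<open>Bubble sort from \<open>x\<close> back to \<open>lam\<close>, which removes one
  inversion per swap.\<close>

lemma minimal_word_exists:
  assumes srt: "sorted_wrt (\<ge>) lam" and "mset x = mset lam"
  shows "\<exists>w. set w \<subseteq> {..<length lam - 1} \<and> length w = ninv x \<and> foldr sp w lam = x"
  using assms(2)
proof (induction "ninv x" arbitrary: x rule: less_induct)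
  case less
  have len: "length x = length lam" using mset_eq_length[OF less.prems] .
  show ?case
  proof (cases "sorted_wrt (\<ge>) x")
    case True
    then have "x = lam" using sorted_desc_unique[OF _ srt less.prems] by simp
    then show ?thesis using ninv_sorted[OF srt] by (intro exI[of _ "[]"]) simp
  next
    case False
    then obtain i where i: "Suc i < length x" "x ! i < x ! Suc i"
      using sorted_wrt_iff_nth_Suc_transp[of "(\<ge>) :: nat \<Rightarrow> nat \<Rightarrow> bool" x] by (auto simp: not_le)
    have n: "ninv x = Suc (ninv (sp i x))" using ninv_sp(2)[OF i] .
    have "mset (sp i x) = mset lam" using mset_sp[OF i(1)] less.prems by simp
    then obtain w where w: "set w \<subseteq> {..<length lam - 1}" "length w = ninv (sp i x)" "foldr sp w lam = sp i x"
      using less.hyps[of "sp i x"] n by auto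
    then show ?thesis using i len n sp_sp[OF i(1)] by (intro exI[of _ "i # w"]) auto
  qed
qed

lemma permutation_word:
  assumes "\<sigma> permutes {..<n}"
  shows "\<exists>w. set w \<subseteq> {..<n - 1} \<and> word_perm w = \<sigma>"
proof -
  \<comment> \<open>A permutation is determined by its action on a word with distinct entries, so
    sorting such a word produces a word for the permutation.\<close>
  define \<delta> where "\<delta> = rev [0..<n]"
  have d: "sorted_wrt (\<ge>) \<delta>" "length \<delta> = n" "distinct \<delta>" by (auto simp: \<delta>_def sorted_wrt_rev)
  define x where "x = act \<sigma> \<delta>"
  have p: "\<sigma> permutes {..<length \<delta>}" using assms d by simp
  have inj: "inv \<sigma> j < n \<and> (inv \<sigma> j = inv \<sigma> k \<longleftrightarrow> j = k)" if "j < n" for j k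
    using permutes_in_image[OF permutes_inv[OF assms], of j] permutes_inverses(1)[OF assms] that
    by (metis lessThan_iff)
  have dx: "distinct x" unfolding x_def act_def distinct_map inj_on_def using d inj by (auto simp: nth_eq_iff_index_eq)
  have "set x \<subseteq> set \<delta>" unfolding x_def act_def using d inj by auto
  then have "set x = set \<delta>" using dx d distinct_card[of x] distinct_card[of \<delta>] by (intro card_subset_eq) (auto simp: x_def)
  then have "mset x = mset \<delta>" using dx d by (simp add: set_eq_iff_mset_eq_distinct)
  then obtain w where w: "set w \<subseteq> {..<n - 1}" "foldr sp w \<delta> = x" using minimal_word_exists[OF d(1)] d by auto
  have wp: "word_perm w permutes {..<n}" using word_perm_permutes[OF w(1)] .
  have "word_perm w k = \<sigma> k" for k
  proof (cases "k < n")
    case True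
    have "x ! word_perm w k = x ! \<sigma> k"
      using foldr_sp_nth[of w \<delta> k] w act_nth[OF p] d True by (simp add: x_def)
    moreover have "word_perm w k < length x" "\<sigma> k < length x"
      using permutes_in_image[OF wp, of k] permutes_in_image[OF assms, of k] True d by (auto simp: x_def)
    ultimately show ?thesis using dx by (simp add: nth_eq_iff_index_eq)
  next
    case False
    then show ?thesis using permutes_not_in[OF wp, of k] permutes_not_in[OF assms, of k] by simp
  qed
  then show ?thesis using w by blast
qed

text \<open>At the first position where the maps differ, the smaller of the two values is, under the
  other map, the image of a later equal part, against monotonicity.\<close>

lemma order_preserving_unique:
  assumes p: "\<sigma> permutes {..<length lam}" "\<tau> permutes {..<length lam}" and e: "act \<sigma> lam = act \<tau> lam"
    and o: "\<And>a b. a < b \<Longrightarrow> b < length lam \<Longrightarrow> lam ! a = lam ! b \<Longrightarrow> \<sigma> a < \<sigma> b"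
      "\<And>a b. a < b \<Longrightarrow> b < length lam \<Longrightarrow> lam ! a = lam ! b \<Longrightarrow> \<tau> a < \<tau> b"
  shows "\<sigma> = \<tau>"
proof
  fix k
  have main: "\<not> s k < t k"
    if P: "s permutes {..<length lam}" "t permutes {..<length lam}" and E: "act s lam = act t lam"
      and o': "\<And>a b. a < b \<Longrightarrow> b < length lam \<Longrightarrow> lam ! a = lam ! b \<Longrightarrow> t a < t b"
      and k: "k < length lam" and IH: "\<And>j. j < k \<Longrightarrow> s j = t j" for s t k
  proof
    assume lt: "s k < t k"
    define b where "b = inv t (s k)"
    have sk: "s k < length lam" using permutes_in_image[OF P(1), of k] k by simp
    have b: "t b = s k" "b < length lam"
      using permutes_inverses(1)[OF P(2)] permutes_in_image[OF permutes_inv[OF P(2)], of "s k"] sk by (auto simp: b_def)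
    have "lam ! b = lam ! k" using act_nth[OF P(1) k] act_nth[OF P(2) b(2)] E b by simp
    then show False
      using o'[of k b] b lt IH[of b] permutes_inj[OF P(1)] by (cases b k rule: linorder_cases) (auto simp: inj_eq)
  qed
  have "k < length lam \<Longrightarrow> \<sigma> k = \<tau> k" for k
  proof (induction k rule: less_induct)
    case (less k)
    then have "\<And>j. j < k \<Longrightarrow> \<sigma> j = \<tau> j" by simp
    then show ?case using main[OF p e o(2) less.prems] main[OF p(2,1) e[symmetric] o(1) less.prems]
      by (metis linorder_neqE_nat)
  qed
  then show "\<sigma> k = \<tau> k" using permutes_not_in[OF p(1), of k] permutes_not_in[OF p(2), of k] by (cases "k < length lam") auto
qed

text \<open>Both choices in the definition are harmless. The shortest permutation is unique because
  shortest words preserve the order of equal parts, and any reduced word will do because its length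
  equals the number of inversions.\<close>

lemma fstar_eq_Fstar:
  assumes srt: "sorted_wrt (\<ge>) lam" and mu: "mset mu = mset lam"
  shows "fstar lam mu = Fstar lam mu"
proof -
  let ?n = "length lam"
  obtain w where w: "set w \<subseteq> {..<?n - 1}" "length w = ninv mu" "foldr sp w lam = mu"
    using minimal_word_exists[OF assms] by blast
  define \<sigma> where "\<sigma> = word_perm w"
  have short: "\<exists>v. length v = cox_len ?n \<tau> \<and> set v \<subseteq> {..<?n - 1} \<and> word_perm v = \<tau>" if "\<tau> permutes {..<?n}" for \<tau>
    using permutation_word[OF that] unfolding cox_len_def by (rule_tac LeastI_ex) blast
  have lower: "ninv mu \<le> cox_len ?n \<tau>" if t: "\<tau> permutes {..<?n}" "act \<tau> lam = mu" for \<tau>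
    using short[OF t(1)] ninv_word[OF srt] act_word_perm t(2) by metis
  have s: "\<sigma> permutes {..<?n}" "act \<sigma> lam = mu"
    using word_perm_permutes[OF w(1)] act_word_perm[OF w(1)] w(3) by (auto simp: \<sigma>_def)
  have cs: "cox_len ?n \<sigma> = ninv mu"
  proof (rule antisym)
    show "cox_len ?n \<sigma> \<le> ninv mu" unfolding cox_len_def by (rule Least_le) (use w in \<open>auto simp: \<sigma>_def\<close>)
  qed (rule lower[OF s])
  have "sigma_of lam mu = \<sigma>"
    unfolding sigma_of_def
  proof (rule the_equality)
    show "\<sigma> permutes {..<?n} \<and> act \<sigma> lam = mu \<and> (\<forall>\<tau>. \<tau> permutes {..<?n} \<and> act \<tau> lam = mu \<longrightarrow> cox_len ?n \<sigma> \<le> cox_len ?n \<tau>)"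
      using s lower cs by simp
    fix \<tau> assume "\<tau> permutes {..<?n} \<and> act \<tau> lam = mu \<and> (\<forall>\<tau>'. \<tau>' permutes {..<?n} \<and> act \<tau>' lam = mu \<longrightarrow> cox_len ?n \<tau> \<le> cox_len ?n \<tau>')"
    then have t: "\<tau> permutes {..<?n}" "act \<tau> lam = mu" "cox_len ?n \<tau> \<le> ninv mu" using s cs by auto
    obtain v where v: "length v = cox_len ?n \<tau>" "set v \<subseteq> {..<?n - 1}" "word_perm v = \<tau>" using short[OF t(1)] by blast
    have vm: "foldr sp v lam = mu" using act_word_perm[OF v(2)] v(3) t(2) by simp
    have "length v = ninv mu" using lower[OF t(1,2)] t(3) v(1) by simp
    then have "\<And>a b. a < b \<Longrightarrow> b < ?n \<Longrightarrow> lam ! a = lam ! b \<Longrightarrow> \<tau> a < \<tau> b"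
      using minimal_word[OF srt v(2)] vm v(3) by simp
    moreover have "\<And>a b. a < b \<Longrightarrow> b < ?n \<Longrightarrow> lam ! a = lam ! b \<Longrightarrow> \<sigma> a < \<sigma> b"
      using minimal_word[OF srt w(1)] w by (simp add: \<sigma>_def)
    ultimately show "\<tau> = \<sigma>" using order_preserving_unique[OF t(1) s(1)] t(2) s(2) by simp
  qed
  moreover have "reduced_word ?n \<sigma> w" using w cs by (simp add: reduced_word_def \<sigma>_def)
  then have red: "reduced_word ?n \<sigma> (SOME w. reduced_word ?n \<sigma> w)" by (rule someI)
  define v where "v = (SOME w. reduced_word ?n \<sigma> w)"
  have v: "set v \<subseteq> {..<?n - 1}" "word_perm v = \<sigma>" "length v = ninv mu"
    using red cs unfolding v_def[symmetric] by (auto simp: reduced_word_def)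
  have vm: "foldr sp v lam = mu" using act_word_perm[OF v(1)] v(2) s(2) by simp
  have "Hecke_word v (Fstar lam lam) = Fstar lam mu" using minimal_word[OF srt v(1)] vm v(3) by simp
  ultimately show ?thesis unfolding fstar_def Hecke_perm_def Estar_eq_Fstar[OF srt] by (simp add: v_def)
qed

section \<open>The symmetric case\<close>

lemma rename_comp: "rename (\<sigma> \<circ> \<tau>) p = rename \<sigma> (rename \<tau> p)"
  by (rule mpoly_generic_eq) (simp add: peval_rename)

lemma rename_id: "rename id p = p"
  by (rule mpoly_generic_eq) (simp add: peval_rename)

lemma symmetric_polyI:
  assumes "\<And>i. Suc i < n \<Longrightarrow> rename (transp i) p = p"
  shows "symmetric_poly n p"
  unfolding symmetric_poly_def
proof (intro allI impI)
  fix \<sigma> assume "\<sigma> permutes {..<n}"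
  then obtain w where w: "set w \<subseteq> {..<n - 1}" "word_perm w = \<sigma>" using permutation_word by blast
  have "rename (word_perm w) p = p" using w(1)
    by (induction w) (auto simp: rename_id rename_comp assms)
  then show "rename \<sigma> p = p" using w(2) by simp
qed

text \<open>Exchanging distinct neighbours of a composition exchanges coordinates of its spectral
  vector; equal neighbours leave nothing to do.\<close>

lemma symmetric_value:
  assumes sym: "symmetric_poly n p" and "length xs = n" "mset xs = mset ys"
  shows "peval p (tilde ys) = peval p (tilde xs)"
proof -
  define P where "P zs \<longleftrightarrow> length zs = n \<and> peval p (tilde zs) = peval p (tilde xs)" for zs
  have "P ys"
  proof (rule adjacent_swap_induct[of P])
    fix u a b v assume P: "P (u @ a # b # v)"
    let ?x = "u @ a # b # v"
    have len: "Suc (length u) < length ?x" by simp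
    show "P (u @ b # a # v)"
    proof (cases "a = b")
      case False
      have "tilde (sp (length u) ?x) = (\<lambda>j. tilde ?x (transp (length u) j))"
        using False by (intro tilde_swap) (auto simp: nth_append)
      then have "peval p (tilde (u @ b # a # v)) = peval (rename (transp (length u)) p) (tilde ?x)"
        by (simp add: peval_rename)
      moreover have "rename (transp (length u)) p = p"
        using sym P transp_permutes[of "length u" n] unfolding symmetric_poly_def P_def by simp
      ultimately show ?thesis using P by (simp add: P_def)
    qed (use P in simp)
  qed (use assms in \<open>auto simp: P_def\<close>)
  then show ?thesis by (simp add: P_def)
qed

text \<open>Each \<open>T_i\<close> has the sum as an eigenfunction with eigenvalue
  \<open>t\<close>. This says that \<open>(t x_i - x_{i+1})(1 - s_i)\<close> annihilates it, and the
  linear factor is not zero.\<close>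

lemma sum_Fstar_symmetric: "symmetric_poly (length lam) (\<Sum>nu\<in>arr (mset lam). Fstar lam nu)"
proof (rule symmetric_polyI)
  fix i assume i: "Suc i < length lam"
  let ?A = "arr (mset lam)" and ?Z = "\<Sum>nu\<in>arr (mset lam). Fstar lam nu"
  have evZ: "ev ?Z = (\<lambda>w. \<Sum>nu\<in>?A. ev (Fstar lam nu) w)" by (simp add: ev_def peval_sum fun_eq_iff)
  have "TT i (ev ?Z) w = tt * ev ?Z w" for w
  proof -
    have "TT i (ev ?Z) w = (\<Sum>nu\<in>?A. th1 (nu ! i) (nu ! Suc i) * ev (Fstar lam nu) w) + (\<Sum>nu\<in>?A. th2 (nu ! i) (nu ! Suc i) * ev (Fstar lam (sp i nu)) w)"
      unfolding evZ TT_sum[OF finite_arr] sum.distrib[symmetric] by (intro sum.cong) (auto simp: FF_hecke i)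
    also have "(\<Sum>nu\<in>?A. th2 (nu ! i) (nu ! Suc i) * ev (Fstar lam (sp i nu)) w) = (\<Sum>nu\<in>?A. th2 (nu ! Suc i) (nu ! i) * ev (Fstar lam nu) w)"
      by (rule sum.reindex_bij_witness[of _ "sp i" "sp i"]) (use i in \<open>auto simp: sp_arr sp_sp arr_length nth_sp\<close>)
    also have "(\<Sum>nu\<in>?A. th1 (nu ! i) (nu ! Suc i) * ev (Fstar lam nu) w) + \<dots> = (\<Sum>nu\<in>?A. tt * ev (Fstar lam nu) w)"
      unfolding sum.distrib[symmetric] by (intro sum.cong) (auto simp: th1_def th2_def algebra_simps)
    finally show ?thesis by (simp add: evZ sum_distrib_left)
  qed
  then have "TT i (ev ?Z) = ev (Cst tt * ?Z)" by (simp add: ev_linear fun_eq_iff)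
  from divided_difference_poly[OF this]
  have "(Cst tt * Xv i - Xv (Suc i)) * (?Z - rename (transp i) ?Z) = 0" by (simp add: mult_ac)
  moreover have "Cst tt * Xv i - Xv (Suc i) \<noteq> 0"
  proof
    assume "Cst tt * Xv i - Xv (Suc i) = 0"
    then have "peval (Cst tt * Xv i - Xv (Suc i)) (\<lambda>j. if j = i then 1 else 0) = 0" by simp
    then show False by (simp add: peval_diff peval_mult)
  qed
  ultimately show "rename (transp i) ?Z = ?Z" by simp
qed

lemma Pstar_eq:
  assumes srt: "sorted_wrt (\<ge>) lam"
  shows "Pstar lam = (\<Sum>nu\<in>arr (mset lam). Fstar lam nu)"
  unfolding Pstar_def
proof (rule the_equality)
  let ?n = "length lam" and ?d = "sum_list lam" and ?A = "arr (mset lam)" and ?Z = "\<Sum>nu\<in>arr (mset lam). Fstar lam nu"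
  have keys: "\<exists>nu. m \<in> Poly_Mapping.keys (Fstar lam nu)" if "m \<in> Poly_Mapping.keys ?Z" for m
  proof -
    have "(\<Sum>nu\<in>?A. Poly_Mapping.lookup (Fstar lam nu) m) \<noteq> 0" using that unfolding in_keys_iff lookup_sum .
    then show ?thesis unfolding in_keys_iff by (meson sum.neutral)
  qed
  have Z1: "vars_in ?n ?Z" using keys Fstar_vars unfolding vars_in_def by meson
  have Z2: "deg_le ?Z ?d" using keys Fstar_deg unfolding deg_le_def by meson
  have "Poly_Mapping.lookup ?Z (mono lam) = (\<Sum>nu\<in>?A. if nu = lam then 1 else 0)"
    unfolding lookup_sum by (intro sum.cong refl Fstar_leading) (auto dest: arr_length)
  moreover have "lam \<in> ?A" by (simp add: arr_def)
  ultimately have Z3: "Poly_Mapping.lookup ?Z (mono lam) = 1" by (simp add: finite_arr sum.delta)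
  have off: "peval ?Z (tilde nu) = 0" if "length nu = ?n" "sum_list nu \<le> ?d" "mset nu \<noteq> mset lam" for nu
    unfolding peval_sum using vanish_all(1)[OF srt that(2,1) _ that(3)] by (intro sum.neutral) blast
  have part: "mset nu \<noteq> mset lam" if "is_partition ?n nu" "nu \<noteq> lam" for nu
    using that sorted_desc_unique[OF _ srt] by (auto simp: is_partition_def)
  show "vars_in ?n ?Z \<and> symmetric_poly ?n ?Z \<and> deg_le ?Z ?d \<and> Poly_Mapping.lookup ?Z (mono lam) = 1
      \<and> (\<forall>nu. is_partition ?n nu \<and> sum_list nu \<le> ?d \<and> nu \<noteq> lam \<longrightarrow> peval ?Z (tilde nu) = 0)"
    using Z1 Z2 Z3 sum_Fstar_symmetric off part unfolding is_partition_def by blast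
  fix p assume p: "vars_in ?n p \<and> symmetric_poly ?n p \<and> deg_le p ?d \<and> Poly_Mapping.lookup p (mono lam) = 1
      \<and> (\<forall>nu. is_partition ?n nu \<and> sum_list nu \<le> ?d \<and> nu \<noteq> lam \<longrightarrow> peval p (tilde nu) = 0)"
  \<comment> \<open>The condition is imposed at partitions only; symmetry carries it to all
    compositions outside the orbit of \<open>lam\<close>.\<close>
  have sorted: "peval p (tilde nu) = 0" if nu: "length nu = ?n" "sum_list nu \<le> ?d" "mset nu \<noteq> mset lam" for nu
  proof -
    define rho where "rho = rev (sort nu)"
    have m: "mset rho = mset nu" by (simp add: rho_def)
    have "sum_list rho = sum_list nu" using arg_cong[OF m, of sum_mset] by (simp only: sum_mset_sum_list)
    then have r: "length rho = ?n" "sorted_wrt (\<ge>) rho" "sum_list rho = sum_list nu"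
      using nu mset_eq_length[OF m] by (simp_all add: rho_def sorted_wrt_rev)
    have "rho \<noteq> lam" using m nu(3) by auto
    then have "peval p (tilde rho) = 0" using p r nu(2) by (simp add: is_partition_def)
    then show ?thesis using symmetric_value[of ?n p rho nu] p r(1) m by simp
  qed
  show "p = ?Z"
  proof (rule interpolation_leading_unique[of ?n _ ?d "mono lam" _ ?A])
    fix nu assume "nu \<in> ?A"
    then have "mset lam = mset nu" by (simp add: arr_def)
    then show "peval ?Z (tilde nu) = peval ?Z (tilde lam) \<and> peval p (tilde nu) = peval p (tilde lam)"
      using symmetric_value[OF sum_Fstar_symmetric, of lam lam nu] symmetric_value[of ?n p lam nu] p by simp
  qed (use Z1 Z2 Z3 p off sorted in \<open>auto simp: arr_def\<close>)
qed

theorem theorem1p15: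
  fixes lam mu :: "nat list"
  assumes "sorted_wrt (\<ge>) lam"
    and "mset mu = mset lam"
  shows "fstar lam mu = Fstar lam mu
       \<and> Pstar lam = (\<Sum>nu\<in>{nu. mset nu = mset lam}. Fstar lam nu)"
  using fstar_eq_Fstar[OF assms] Pstar_eq[OF assms(1)] by (simp add: arr_def)

end
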